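(* Let a group $G$ act without inversion on a CAT(0) cube complex $X$, and suppose $g\in G$ is hyperbolic. Then the cube complex $M^{\mathrm{ess}}_g$ is CAT(0).
   Context: A cube complex is CAT(0) if it is simply connected and all vertex links are flag complexes. A half-space $H$ of $X$ is the closure of a component of the complement of a hyperplane, $\overline H$ the complementary half-space, and $\mathcal H(X)$ is ordered by inclusion. An action is without inversion if $gH\neq\overline H$ for all $g\in G$, $H\in\mathcal H(X)$. Distances between vertices are combinatorial. $g$ is hyperbolic if $\ell_g=\min_x d(x,gx)>0$ ($x$ ranging over vertices); then it has combinatorial axes (bi-infinite combinatorial geodesics preserved by $g$, on which $g$ translates by $\ell_g$, oriented forward). $A_g^+$ is the set of half-spaces dual to positively oriented edges of a combinatorial axis (independent of the axis; the half-space dual to an oriented edge $(x,y)$ contains $y$ but not $x$), and $A_g=A_g^+\sqcup\{\overline H:H\in A_g^+\}$. For a set $\mathcal A$ of half-spaces closed under $H\mapsto\overline H$, $X(\mathcal A)$ denotes the Sageev construction: vertices are subsets of $\mathcal A$ containing exactly one of each pair $\{H,\overline H\}$, no two elements disjoint, satisfying the descending chain condition; vertices differing on exactly one pair span an edge; cubes are attached whenever their $1$-skeleta are present. The essential characteristic set is $X^{\mathrm{ess}}_g=X(A_g)$, a CAT(0) cube complex whose half-spaces are identified with $A_g$. $M_g$ is the full subcomplex of $X$ spanned by the vertices realizing $\ell_g$, and $X_g$ is its convex hull. Let $T_g$ be the set of half-spaces not in $A_g$ whose bounding hyperplane separates two combinatorial axes of $g$, and $X^{\mathrm{ell}}_g=X(T_g)$.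 There is a $\langle g\rangle$-equivariant isomorphism $X_g\cong X^{\mathrm{ess}}_g\times X^{\mathrm{ell}}_g$ (send a vertex $v$, regarded as the set of half-spaces containing it, to its intersections with $A_g$ and $T_g$). The essential minimal set $M^{\mathrm{ess}}_g\subseteq X^{\mathrm{ess}}_g$ is the image of $M_g$ under projection to the first factor (in general it is not a convex subcomplex). *)

theory Defs
  imports "HOL-Analysis.Analysis" "HOL-Algebra.Group_Action"
begin

section \<open>Cube complexes\<close>

text \<open>
  Cube complexes are understood in the sense of Bridson and Haefliger (cubical complexes): closed
  cubes are embedded, and two cubes are disjoint or meet in a common face.  A cube is thus
  determined by its vertex set, and a complex is encoded as the family \<open>K\<close> of the vertex sets of
  its cubes, in the same way as an abstract simplicial complex.  The vertices are the elements of
  \<open>\<Union>K\<close>.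

  A chart identifies the vertices of a cube with those of \<open>[0,1]^n\<close>, a vertex of the latter being
  recorded as the set of coordinates equal to 1.  Faces of \<open>[0,1]^n\<close> then become intervals
  of \<open>Pow {..<n}\<close>.  The members of \<open>K\<close> contained in \<open>C\<close> have to be precisely the faces of \<open>C\<close>.
\<close>

definition cube_chart :: "'v set set \<Rightarrow> 'v set \<Rightarrow> nat \<Rightarrow> ('v \<Rightarrow> nat set) \<Rightarrow> bool" where
  "cube_chart K C n \<phi> \<longleftrightarrow>
     bij_betw \<phi> C (Pow {..<n}) \<and>
     (\<forall>D\<subseteq>C. D \<in> K \<longleftrightarrow> (\<exists>L U. L \<subseteq> U \<and> U \<subseteq> {..<n} \<and> \<phi> ` D = {A. L \<subseteq> A \<and> A \<subseteq> U}))"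

definition cube_complex :: "'v set set \<Rightarrow> bool" where
  "cube_complex K \<longleftrightarrow>
     (\<forall>C\<in>K. \<exists>n \<phi>. cube_chart K C n \<phi>) \<and>
     (\<forall>C\<in>K. \<forall>D\<in>K. C \<inter> D \<noteq> {} \<longrightarrow> C \<inter> D \<in> K)"

definition adjacent :: "'v set set \<Rightarrow> 'v \<Rightarrow> 'v \<Rightarrow> bool" where
  "adjacent K x y \<longleftrightarrow> x \<noteq> y \<and> {x, y} \<in> K"


subsection \<open>Geometric realization\<close>

text \<open>
  The point of the cube \<open>C\<close> with coordinates \<open>t \<in> [0,1]^n\<close> is represented by its multilinear
  coordinates: the weight function on vertices \<open>v\<close> of \<open>C\<close> that is the product of the \<open>t i\<close>
  for \<open>i \<in> \<phi> v\<close> and the \<open>1 - t i\<close> for \<open>i \<notin> \<phi> v\<close>.  This is injective in \<open>t\<close>, restricts correctly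
  to faces (weights vanish off the face), and so performs the gluing of the cubes along common
  faces.  The resulting \<open>cell\<close> does not depend on the chart.
\<close>

definition cube_point :: "'v set \<Rightarrow> nat \<Rightarrow> ('v \<Rightarrow> nat set) \<Rightarrow> (nat \<Rightarrow> real) \<Rightarrow> 'v \<Rightarrow> real" where
  "cube_point C n \<phi> t = (\<lambda>v. if v \<in> C then \<Prod>i<n. if i \<in> \<phi> v then t i else 1 - t i else 0)"

definition cell :: "'v set set \<Rightarrow> 'v set \<Rightarrow> ('v \<Rightarrow> real) set" where
  "cell K C = {cube_point C n \<phi> t | n \<phi> t. cube_chart K C n \<phi> \<and> (\<forall>i<n. t i \<in> {0..1})}"

definition vertex_point :: "'v \<Rightarrow> 'v \<Rightarrow> real" where
  "vertex_point v = (\<lambda>u. if u = v then 1 else 0)"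

text \<open>
  The realization carries the weak (CW) topology.  All points of a cell are supported on the
  finite set \<open>C\<close>, so the topology of pointwise convergence on a cell is the Euclidean one.
\<close>

definition realization :: "'v set set \<Rightarrow> ('v \<Rightarrow> real) topology" where
  "realization K = topology (\<lambda>U. U \<subseteq> (\<Union>C\<in>K. cell K C) \<and>
     (\<forall>C\<in>K. openin (top_of_set (cell K C)) (U \<inter> cell K C)))"

lemma openin_realization:
  "openin (realization K) U \<longleftrightarrow>
     U \<subseteq> (\<Union>C\<in>K. cell K C) \<and> (\<forall>C\<in>K. openin (top_of_set (cell K C)) (U \<inter> cell K C))"
proof -
  have "istopology (\<lambda>U. U \<subseteq> (\<Union>C\<in>K. cell K C) \<and>
     (\<forall>C\<in>K. openin (top_of_set (cell K C)) (U \<inter> cell K C)))"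
    unfolding istopology_def
  proof (intro conjI allI impI; (elim conjE)?)
    fix S T
    assume "\<forall>C\<in>K. openin (top_of_set (cell K C)) (S \<inter> cell K C)"
      "\<forall>C\<in>K. openin (top_of_set (cell K C)) (T \<inter> cell K C)"
    moreover have "S \<inter> T \<inter> cell K C = (S \<inter> cell K C) \<inter> (T \<inter> cell K C)" for C
      by auto
    ultimately show "\<forall>C\<in>K. openin (top_of_set (cell K C)) (S \<inter> T \<inter> cell K C)"
      by (metis openin_Int)
  next
    fix \<U>
    assume "\<forall>U\<in>\<U>. U \<subseteq> (\<Union>C\<in>K. cell K C) \<and>
      (\<forall>C\<in>K. openin (top_of_set (cell K C)) (U \<inter> cell K C))"
    then show "\<forall>C\<in>K. openin (top_of_set (cell K C)) (\<Union>\<U> \<inter> cell K C)"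
      unfolding Int_Union2 by blast
  qed blast+
  then show ?thesis
    unfolding realization_def by (simp add: topology_inverse')
qed

lemma topspace_realization: "topspace (realization K) = (\<Union>C\<in>K. cell K C)"
proof
  show "topspace (realization K) \<subseteq> (\<Union>C\<in>K. cell K C)"
    using openin_realization[of K "topspace (realization K)"] by simp
  have "(\<Union>D\<in>K. cell K D) \<inter> cell K C = cell K C" if "C \<in> K" for C
    using that by auto
  then have "openin (realization K) (\<Union>C\<in>K. cell K C)"
    by (simp add: openin_realization)
  then show "(\<Union>C\<in>K. cell K C) \<subseteq> topspace (realization K)"
    by (rule openin_subset)
qed


subsection \<open>CAT(0) cube complexes\<close>

text \<open>The counterpart of \<^const>\<open>simply_connected\<close> for abstract topological spaces: all loops
  are freely homotopic (in particular, the space is path-connected).\<close>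

definition simply_connected_space :: "'a topology \<Rightarrow> bool" where
  "simply_connected_space X \<longleftrightarrow>
     (\<forall>p q. pathin X p \<and> p 1 = p 0 \<and> pathin X q \<and> q 1 = q 0 \<longrightarrow>
        homotopic_with (\<lambda>r. r 1 = r 0) (top_of_set {0..1}) X p q)"

text \<open>The vertices of the link of \<open>v\<close> are represented by the neighbours of \<open>v\<close>.\<close>

definition vertex_link :: "'v set set \<Rightarrow> 'v \<Rightarrow> 'v set set" where
  "vertex_link K v = {{u \<in> C. adjacent K v u} | C. C \<in> K \<and> v \<in> C \<and> C \<noteq> {v}}"

definition flag :: "'v set set \<Rightarrow> bool" where
  "flag S \<longleftrightarrow>
     (\<forall>\<sigma>. finite \<sigma> \<and> \<sigma> \<noteq> {} \<and> \<sigma> \<subseteq> \<Union>S \<and> (\<forall>a\<in>\<sigma>. \<forall>b\<in>\<sigma>. a \<noteq> b \<longrightarrow> {a, b} \<in> S) \<longrightarrow> \<sigma> \<in> S)"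

definition cat0_cube_complex :: "'v set set \<Rightarrow> bool" where
  "cat0_cube_complex K \<longleftrightarrow>
     cube_complex K \<and> K \<noteq> {} \<and> simply_connected_space (realization K) \<and>
     (\<forall>v\<in>\<Union>K. flag (vertex_link K v))"


section \<open>Hyperplanes and half-spaces\<close>

text \<open>Two disjoint edges of a square are opposite.\<close>

definition opposite_edges :: "'v set set \<Rightarrow> 'v set \<Rightarrow> 'v set \<Rightarrow> bool" where
  "opposite_edges K e f \<longleftrightarrow>
     e \<in> K \<and> f \<in> K \<and> card e = 2 \<and> card f = 2 \<and> e \<inter> f = {} \<and> e \<union> f \<in> K"

definition midcube :: "'v set set \<Rightarrow> 'v set \<Rightarrow> 'v set \<Rightarrow> ('v \<Rightarrow> real) set" where
  "midcube K C e = {cube_point C n \<phi> t | n \<phi> t i x y.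
     cube_chart K C n \<phi> \<and> (\<forall>j<n. t j \<in> {0..1}) \<and>
     i < n \<and> e = {x, y} \<and> i \<notin> \<phi> x \<and> \<phi> y = insert i (\<phi> x) \<and> t i = 1/2}"

text \<open>The hyperplane dual to the edge \<open>e\<close>: the union of the midcubes dual to the edges that are
  equivalent to \<open>e\<close> under the equivalence relation generated by \<open>opposite_edges\<close>.\<close>

definition hyperplane :: "'v set set \<Rightarrow> 'v set \<Rightarrow> ('v \<Rightarrow> real) set" where
  "hyperplane K e = \<Union>{midcube K C f | C f. C \<in> K \<and> f \<subseteq> C \<and> (opposite_edges K)\<^sup>*\<^sup>* e f}"

definition halfspaces_of :: "'v set set \<Rightarrow> ('v \<Rightarrow> real) set \<Rightarrow> ('v \<Rightarrow> real) set set" where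
  "halfspaces_of K h =
     {realization K closure_of U | U.
        U \<in> connected_components_of (subtopology (realization K) (topspace (realization K) - h))}"

definition halfspaces :: "'v set set \<Rightarrow> ('v \<Rightarrow> real) set set" where
  "halfspaces K = \<Union>{halfspaces_of K (hyperplane K {x, y}) | x y. adjacent K x y}"

text \<open>A half-space contains its bounding hyperplane, so its set-theoretic complement is the
  component on the other side of the hyperplane.\<close>

definition opp :: "'v set set \<Rightarrow> ('v \<Rightarrow> real) set \<Rightarrow> ('v \<Rightarrow> real) set" where
  "opp K H = realization K closure_of (topspace (realization K) - H)"

definition halfspaces_dual :: "'v set set \<Rightarrow> 'v \<Rightarrow> 'v \<Rightarrow> ('v \<Rightarrow> real) set set" where
  "halfspaces_dual K x y =
     {H \<in> halfspaces_of K (hyperplane K {x, y}). vertex_point y \<in> H \<and> vertex_point x \<notin> H}"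


section \<open>Group actions and hyperbolic automorphisms\<close>

text \<open>The map on points of the realization induced by a map \<open>f\<close> on vertices pushes
  weights forward (they have finite support).\<close>

definition push_point :: "('v \<Rightarrow> 'v) \<Rightarrow> ('v \<Rightarrow> real) \<Rightarrow> 'v \<Rightarrow> real" where
  "push_point f w = (\<lambda>u. \<Sum>v | w v \<noteq> 0 \<and> f v = u. w v)"

definition cube_complex_action ::
    "('g, 'm) monoid_scheme \<Rightarrow> 'v set set \<Rightarrow> ('g \<Rightarrow> 'v \<Rightarrow> 'v) \<Rightarrow> bool" where
  "cube_complex_action G K act \<longleftrightarrow>
     group_action G (\<Union>K) act \<and> (\<forall>g\<in>carrier G. \<forall>C\<in>K. act g ` C \<in> K)"

definition without_inversion ::
    "('g, 'm) monoid_scheme \<Rightarrow> 'v set set \<Rightarrow> ('g \<Rightarrow> 'v \<Rightarrow> 'v) \<Rightarrow> bool" where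
  "without_inversion G K act \<longleftrightarrow>
     (\<forall>g\<in>carrier G. \<forall>H\<in>halfspaces K. push_point (act g) ` H \<noteq> opp K H)"

definition vdist :: "'v set set \<Rightarrow> 'v \<Rightarrow> 'v \<Rightarrow> nat" where
  "vdist K x y =
     (LEAST n. \<exists>p. p 0 = x \<and> p n = y \<and> (\<forall>i<n. adjacent K (p i) (p (Suc i))))"

text \<open>The infimum of a nonempty set of natural numbers is its minimum.  From here on
  \<open>f\<close> is the vertex map of a single automorphism.\<close>

definition translation_length :: "'v set set \<Rightarrow> ('v \<Rightarrow> 'v) \<Rightarrow> nat" where
  "translation_length K f = (INF x\<in>\<Union>K. vdist K x (f x))"

definition hyperbolic :: "'v set set \<Rightarrow> ('v \<Rightarrow> 'v) \<Rightarrow> bool" where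
  "hyperbolic K f \<longleftrightarrow> translation_length K f > 0"

definition combinatorial_axis :: "'v set set \<Rightarrow> ('v \<Rightarrow> 'v) \<Rightarrow> (int \<Rightarrow> 'v) \<Rightarrow> bool" where
  "combinatorial_axis K f \<gamma> \<longleftrightarrow>
     range \<gamma> \<subseteq> \<Union>K \<and>
     (\<forall>m n. int (vdist K (\<gamma> m) (\<gamma> n)) = \<bar>m - n\<bar>) \<and>
     (\<forall>m. f (\<gamma> m) = \<gamma> (m + int (translation_length K f)))"

text \<open>The sets \<open>A\<^sub>g\<^sup>+\<close> and \<open>A\<^sub>g\<close>.  The half-spaces dual to an axis do not depend on the axis, so
  the union over all axes is the set obtained from any one of them.\<close>

definition positive_char_set :: "'v set set \<Rightarrow> ('v \<Rightarrow> 'v) \<Rightarrow> ('v \<Rightarrow> real) set set" where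
  "positive_char_set K f =
     \<Union>{halfspaces_dual K (\<gamma> m) (\<gamma> (m + 1)) | \<gamma> m. combinatorial_axis K f \<gamma>}"

definition char_set :: "'v set set \<Rightarrow> ('v \<Rightarrow> 'v) \<Rightarrow> ('v \<Rightarrow> real) set set" where
  "char_set K f = positive_char_set K f \<union> opp K ` positive_char_set K f"


section \<open>The Sageev construction\<close>

definition sageev_vertices ::
    "'v set set \<Rightarrow> ('v \<Rightarrow> real) set set \<Rightarrow> ('v \<Rightarrow> real) set set set" where
  "sageev_vertices K \<A> = {\<sigma>. \<sigma> \<subseteq> \<A> \<and>
     (\<forall>H\<in>\<A>. H \<in> \<sigma> \<longleftrightarrow> opp K H \<notin> \<sigma>) \<and>
     (\<forall>H\<in>\<sigma>. \<forall>H'\<in>\<sigma>. H \<inter> H' \<noteq> {}) \<and>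
     \<not> (\<exists>h :: nat \<Rightarrow> ('v \<Rightarrow> real) set. \<forall>i. h i \<in> \<sigma> \<and> h (Suc i) \<subset> h i)}"

definition sageev_adjacent ::
    "'v set set \<Rightarrow> ('v \<Rightarrow> real) set set \<Rightarrow> ('v \<Rightarrow> real) set set \<Rightarrow> bool" where
  "sageev_adjacent K \<sigma> \<tau> \<longleftrightarrow> (\<exists>H. \<sigma> - \<tau> = {H} \<and> \<tau> - \<sigma> = {opp K H})"

text \<open>Vertices of \<open>[0,1]^n\<close> are again encoded as subsets of \<open>{..<n}\<close>; two of them span an edge
  iff their symmetric difference is a singleton.\<close>

definition sageev_complex ::
    "'v set set \<Rightarrow> ('v \<Rightarrow> real) set set \<Rightarrow> ('v \<Rightarrow> real) set set set set" where
  "sageev_complex K \<A> = {D. D \<subseteq> sageev_vertices K \<A> \<and>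
     (\<exists>n \<phi>. bij_betw \<phi> D (Pow {..<n::nat}) \<and>
        (\<forall>\<sigma>\<in>D. \<forall>\<tau>\<in>D. card ((\<phi> \<sigma> - \<phi> \<tau>) \<union> (\<phi> \<tau> - \<phi> \<sigma>)) = 1 \<longrightarrow> sageev_adjacent K \<sigma> \<tau>))}"


section \<open>The essential minimal set\<close>

definition min_set :: "'v set set \<Rightarrow> ('v \<Rightarrow> 'v) \<Rightarrow> 'v set set" where
  "min_set K f = {C \<in> K. \<forall>v\<in>C. vdist K v (f v) = translation_length K f}"

definition ess_char_complex :: "'v set set \<Rightarrow> ('v \<Rightarrow> 'v) \<Rightarrow> ('v \<Rightarrow> real) set set set set" where
  "ess_char_complex K f = sageev_complex K (char_set K f)"

text \<open>The first component of the isomorphism between the convex hull of the minimal set and the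
  product of the essential and the elliptic part.\<close>

definition ess_proj :: "'v set set \<Rightarrow> ('v \<Rightarrow> 'v) \<Rightarrow> 'v \<Rightarrow> ('v \<Rightarrow> real) set set" where
  "ess_proj K f v = {H \<in> halfspaces K. vertex_point v \<in> H} \<inter> char_set K f"

text \<open>The cubes of the essential characteristic set that are images of cubes of the minimal
  set.  (Every cube of the minimal set projects onto a cube of the essential characteristic
  set.)\<close>

definition ess_min_set :: "'v set set \<Rightarrow> ('v \<Rightarrow> 'v) \<Rightarrow> ('v \<Rightarrow> real) set set set set" where
  "ess_min_set K f = {D \<in> ess_char_complex K f. \<exists>C\<in>min_set K f. D = ess_proj K f ` C}"

end

theory Submission
  imports Defs
begin

text \<open>
  Reduced edge paths up to swaps across squares form a local system on a cube complex with flag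
  links, and simple connectivity makes its monodromy trivial. Hence a reduced path is determined by
  its endpoints up to swaps, which yields the quadrangle condition for the combinatorial distance,
  combinatorial half-spaces, and their agreement with the geometric ones.

  A combinatorial axis \<open>\<gamma>\<close> of \<open>g\<close> crosses half-spaces \<open>H m\<close>, indexed by the integers, and a vertex of
  the essential minimal set is determined by the set of those \<open>m\<close> for which \<open>H m\<close> contains it. The
  sets that occur are closed under union and intersection, any two of them differ by finitely many
  integers, and a smaller one can be enlarged to a bigger one by adding integers one at a time. The
  cubes of the essential minimal set are the finite Boolean intervals of this ring of sets. The
  links of such a cube complex are flag, and it is simply connected: a loop lies in a finite
  interval of the ring, where coordinates are functions into \<open>[0,1]\<close>, and it contracts when these
  coordinates are raised to 1 one after the other.
\<close>

section \<open>Combinatorics of cubes\<close>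

text \<open>The essential minimal set is in general not convex in the essential characteristic set,
  so it does not inherit the CAT(0) property from the Sageev construction. What replaces convexity
  is a one-sided condition: if a vertex of the minimal set lies in \<open>H m\<close>, it also lies
  in \<open>H (m - L)\<close>, where \<open>L\<close> is the translation length, and it lies with
  its image on the same side of every hyperplane off the axis. Such a condition is stable under
  union and intersection of index sets, and conversely every consistent index set that satisfies it
  and has the right ends comes from a vertex of the minimal set. Union extends from vertices to
  points of the realization as the maximum of coordinates, and this continuous operation performs
  the contraction.

  CAT(0) is given here by simple connectivity and flag links, so the usual theory of half-spaces has
  to be extracted from homotopies. Classes of reduced paths that end at \<open>v\<close> play the
  role of the vertices over \<open>v\<close> of the universal cover.\<close>

lemma sym_diff_image_interval:
  fixes L U S :: "'a set"
  assumes "L \<subseteq> U"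
  shows "(\<lambda>A. sym_diff A S) ` {L..U} = {sym_diff L S - (U - L)..sym_diff L S \<union> (U - L)}"
proof -
  have "sym_diff (sym_diff B S) S = B" for B by blast
  moreover have "sym_diff B S \<in> {L..U}"
    if "B \<in> {sym_diff L S - (U - L)..sym_diff L S \<union> (U - L)}" for B
    using that assms by auto
  moreover have "sym_diff B S \<in> {sym_diff L S - (U - L)..sym_diff L S \<union> (U - L)}"
    if "B \<in> {L..U}" for B
    using that assms by auto
  ultimately show ?thesis
    by (intro equalityI subsetI) (fastforce simp del: atLeastAtMost_iff intro: rev_image_eqI)+
qed

lemma interval_subset_Pow: "U \<subseteq> N \<Longrightarrow> {L..U} \<subseteq> Pow N"
  by (rule subsetI, rule PowI, rule order_trans[of _ U]) simp_all

lemma bij_betw_sym_diff: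
  assumes "S \<subseteq> N"
  shows "bij_betw (\<lambda>A. sym_diff A S) (Pow N) (Pow N)"
proof (rule bij_betw_byWitness[where f' = "\<lambda>A. sym_diff A S"])
  show "\<forall>a\<in>Pow N. sym_diff (sym_diff a S) S = a"
    by blast
  then show "\<forall>a\<in>Pow N. sym_diff (sym_diff a S) S = a" .
  show "(\<lambda>A. sym_diff A S) ` Pow N \<subseteq> Pow N"
    using assms by blast
  then show "(\<lambda>A. sym_diff A S) ` Pow N \<subseteq> Pow N" .
qed

lemma cube_chart_iff:
  "cube_chart K C n \<phi> \<longleftrightarrow>
     bij_betw \<phi> C (Pow {..<n}) \<and>
     (\<forall>D\<subseteq>C. D \<in> K \<longleftrightarrow> (\<exists>L U. L \<subseteq> U \<and> U \<subseteq> {..<n} \<and> \<phi> ` D = {L..U}))"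
proof -
  have "{A. L \<subseteq> A \<and> A \<subseteq> U} = {L..U}" for L U :: "nat set"
    by auto
  then show ?thesis
    by (simp add: cube_chart_def)
qed

text \<open>Symmetric difference with \<open>S\<close> is a reflection of the cube and sends
  intervals to intervals: the free coordinates of a face stay free, the fixed ones change by
  \<open>S\<close>. Any vertex of a cube can thus be made the origin of a chart.\<close>

lemma cube_chart_shift:
  assumes "cube_chart K C n \<phi>" "S \<subseteq> {..<n}"
  shows "cube_chart K C n (\<lambda>v. sym_diff (\<phi> v) S)"
proof -
  let ?s = "\<lambda>A. sym_diff A S"
  have "bij_betw (?s \<circ> \<phi>) C (Pow {..<n})"
    using assms bij_betw_sym_diff[OF assms(2)] by (auto simp: cube_chart_iff intro: bij_betw_trans)
  moreover have "(\<exists>L U. L \<subseteq> U \<and> U \<subseteq> {..<n} \<and> \<phi> ` D = {L..U}) \<longleftrightarrow>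
      (\<exists>L U. L \<subseteq> U \<and> U \<subseteq> {..<n} \<and> (?s \<circ> \<phi>) ` D = {L..U})" for D
  proof -
    have step: "\<exists>L U. L \<subseteq> U \<and> U \<subseteq> {..<n} \<and> ?s ` X = {L..U}"
      if "\<exists>L U. L \<subseteq> U \<and> U \<subseteq> {..<n} \<and> X = {L..U}" for X
    proof -
      from that obtain L U where "L \<subseteq> U" "U \<subseteq> {..<n}" "X = {L..U}"
        by blast
      then have "?s ` X = {sym_diff L S - (U - L)..sym_diff L S \<union> (U - L)}"
        using sym_diff_image_interval[of L U S] by simp
      moreover have "sym_diff L S \<union> (U - L) \<subseteq> {..<n}"
        using \<open>L \<subseteq> U\<close> \<open>U \<subseteq> {..<n}\<close> assms(2) by blast
      moreover have "sym_diff L S - (U - L) \<subseteq> sym_diff L S \<union> (U - L)"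
        by blast
      ultimately show ?thesis by blast
    qed
    have inv: "?s ` ?s ` X = X" for X
    proof -
      have "?s (?s A) = A" for A by blast
      then show ?thesis by (simp add: image_image)
    qed
    show ?thesis
      using step[of "\<phi> ` D"] step[of "?s ` \<phi> ` D"] unfolding inv by (auto simp: image_comp)
  qed
  ultimately show ?thesis
    using assms(1) unfolding cube_chart_iff by (simp add: o_def)
qed

text \<open>A chart read backwards: \<open>\<psi>\<close> names the vertices of \<open>C\<close> by
  sets of directions, with \<open>\<psi> {}\<close> as origin. Faces, edges and squares are then
  obtained as images of intervals.\<close>

definition cube_param :: "'v set set \<Rightarrow> 'v set \<Rightarrow> nat \<Rightarrow> (nat set \<Rightarrow> 'v) \<Rightarrow> bool" where
  "cube_param K C n \<psi> \<longleftrightarrow>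
     bij_betw \<psi> (Pow {..<n}) C \<and>
     (\<forall>L U. L \<subseteq> U \<longrightarrow> U \<subseteq> {..<n} \<longrightarrow> \<psi> ` {L..U} \<in> K) \<and>
     (\<forall>D\<subseteq>C. D \<in> K \<longrightarrow> (\<exists>L U. L \<subseteq> U \<and> U \<subseteq> {..<n} \<and> D = \<psi> ` {L..U}))"

lemma cube_param_chart:
  assumes "cube_chart K C n \<phi>"
  shows "cube_param K C n (the_inv_into C \<phi>)"
    and "\<And>v. v \<in> C \<Longrightarrow> the_inv_into C \<phi> (\<phi> v) = v"
    and "\<And>B. B \<subseteq> {..<n} \<Longrightarrow> \<phi> (the_inv_into C \<phi> B) = B"
    and "\<And>v. v \<in> C \<Longrightarrow> \<phi> v \<subseteq> {..<n}"
proof -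
  let ?\<psi> = "the_inv_into C \<phi>"
  have bij: "bij_betw \<phi> C (Pow {..<n})"
    and faces: "\<And>D. D \<subseteq> C \<Longrightarrow> D \<in> K \<longleftrightarrow> (\<exists>L U. L \<subseteq> U \<and> U \<subseteq> {..<n} \<and> \<phi> ` D = {L..U})"
    using assms by (auto simp: cube_chart_iff)
  have bij': "bij_betw ?\<psi> (Pow {..<n}) C"
    using bij by (rule bij_betw_the_inv_into)
  show l: "?\<psi> (\<phi> v) = v" if "v \<in> C" for v
    using bij that by (simp add: bij_betw_def the_inv_into_f_f)
  show r: "\<phi> (?\<psi> B) = B" if "B \<subseteq> {..<n}" for B
    using bij that by (simp add: bij_betw_def f_the_inv_into_f)
  show "\<phi> v \<subseteq> {..<n}" if "v \<in> C" for v
    using bij that by (auto simp: bij_betw_def)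
  have "?\<psi> ` {L..U} \<in> K" if "L \<subseteq> U" "U \<subseteq> {..<n}" for L U
  proof -
    have "{L..U} \<subseteq> Pow {..<n}"
      using that(2) by (rule interval_subset_Pow)
    then have "?\<psi> ` {L..U} \<subseteq> C"
      using bij' unfolding bij_betw_def by blast
    moreover have "\<phi> ` ?\<psi> ` {L..U} = (\<lambda>B. B) ` {L..U}"
      unfolding image_image using \<open>{L..U} \<subseteq> Pow {..<n}\<close> by (intro image_cong refl r) blast
    then have "\<phi> ` ?\<psi> ` {L..U} = {L..U}" by simp
    ultimately show ?thesis
      using that by (subst faces) auto
  qed
  moreover have "\<exists>L U. L \<subseteq> U \<and> U \<subseteq> {..<n} \<and> D = ?\<psi> ` {L..U}" if D: "D \<subseteq> C" "D \<in> K" for D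
  proof -
    obtain L U where LU: "L \<subseteq> U" "U \<subseteq> {..<n}" "\<phi> ` D = {L..U}"
      using faces[OF D(1)] D(2) by blast
    have "?\<psi> ` \<phi> ` D = (\<lambda>v. v) ` D"
      unfolding image_image using D(1) by (intro image_cong refl l) blast
    then show ?thesis
      using LU by auto
  qed
  ultimately show "cube_param K C n ?\<psi>"
    using bij' by (simp add: cube_param_def)
qed

text \<open>Opposite edges of a square flip the same element.\<close>

lemma hypercube_coordinates:
  fixes f :: "nat set \<Rightarrow> 'p set"
  assumes inj: "inj_on f (Pow {..<n})"
    and edge: "\<And>B i. B \<subseteq> {..<n} \<Longrightarrow> i < n \<Longrightarrow> i \<notin> B \<Longrightarrow> \<exists>a. sym_diff (f B) (f (insert i B)) = {a}"
  obtains \<pi> where "inj_on \<pi> {..<n}" "\<And>B. B \<subseteq> {..<n} \<Longrightarrow> f B = sym_diff (f {}) (\<pi> ` B)"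
proof -
  have "\<exists>a. sym_diff (f {}) (f {i}) = {a}" if "i < n" for i
    using edge[of "{}" i] that by simp
  then obtain \<pi> where \<pi>: "\<And>i. i < n \<Longrightarrow> sym_diff (f {}) (f {i}) = {\<pi> i}"
    by metis
  have \<pi>': "f {i} = sym_diff (f {}) {\<pi> i}" if "i < n" for i
    using \<pi>[OF that] by blast
  have inj\<pi>: "inj_on \<pi> {..<n}"
  proof (rule inj_onI)
    fix i j assume "i \<in> {..<n}" "j \<in> {..<n}" "\<pi> i = \<pi> j"
    then have "f {i} = f {j}"
      using \<pi>' by simp
    with inj have "{i} = {j}"
      by (rule inj_onD) (use \<open>i \<in> {..<n}\<close> \<open>j \<in> {..<n}\<close> in auto)
    then show "i = j" by simp
  qed
  have "f B = sym_diff (f {}) (\<pi> ` B)" if "B \<subseteq> {..<n}" for B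
    using that
  proof (induction "card B" arbitrary: B rule: less_induct)
    case less
    have fin: "finite B"
      using less.prems finite_subset by blast
    consider "B = {}" | i where "B = {i}" | i j R where "B = insert i (insert j R)" "i \<noteq> j" "i \<notin> R" "j \<notin> R"
    proof (cases "B = {} \<or> (\<exists>i. B = {i})")
      case False
      then obtain i j where ij: "i \<in> B" "j \<in> B" "i \<noteq> j" by blast
      show ?thesis
        by (rule that(3)[of i j "B - {i, j}"]) (use ij in auto)
    qed (use that in auto)
    then show ?case
    proof cases
      case 1
      then show ?thesis by simp
    next
      case (2 i)
      then show ?thesis
        using \<pi>'[of i] less.prems by auto
    next
      case (3 i j R)
      have sub: "R \<subseteq> {..<n}" "i < n" "j < n"
        using 3 less.prems by auto
      have R: "f R = sym_diff (f {}) (\<pi> ` R)"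
        and Ri: "f (insert i R) = sym_diff (f {}) (\<pi> ` insert i R)"
        and Rj: "f (insert j R) = sym_diff (f {}) (\<pi> ` insert j R)"
        using less.hyps[of R] less.hyps[of "insert i R"] less.hyps[of "insert j R"] fin 3 sub
        by auto
      have ne: "\<pi> i \<noteq> \<pi> j"
        using inj\<pi> 3 sub by (meson inj_onD lessThan_iff)
      have nR: "\<pi> i \<notin> \<pi> ` R" "\<pi> j \<notin> \<pi> ` R"
        using inj\<pi> 3 sub by (auto dest!: inj_onD)
      \<comment> \<open>\<open>B\<close> is reached from \<open>insert j R\<close> and from
        \<open>insert i R\<close>. Comparing the two flips leaves only \<open>\<pi> i\<close> and
        \<open>\<pi> j\<close> as candidates for \<open>a\<close>.\<close>
      obtain a where a: "sym_diff (f (insert j R)) (f (insert i (insert j R))) = {a}"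
        using edge[of "insert j R" i] 3 sub by auto
      obtain b where b: "sym_diff (f (insert i R)) (f (insert j (insert i R))) = {b}"
        using edge[of "insert i R" j] 3 sub by auto
      have fa: "f B = sym_diff (f (insert j R)) {a}"
        using a unfolding 3 by blast
      have "f B = sym_diff (f (insert i R)) {b}"
        using b unfolding 3 insert_commute[of i j] by blast
      with fa Ri Rj have "sym_diff (sym_diff (f {}) (\<pi> ` insert j R)) {a} = sym_diff (sym_diff (f {}) (\<pi> ` insert i R)) {b}"
        by metis
      then have "sym_diff {\<pi> j} {a} = sym_diff {\<pi> i} {b}"
        using nR by auto
      then have "a = \<pi> j \<or> a = \<pi> i"
        using ne by auto
      \<comment> \<open>Flipping \<open>\<pi> j\<close> would undo the step from \<open>R\<close> to
        \<open>insert j R\<close> and give \<open>f B = f R\<close>, against injectivity.\<close>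
      moreover have "a \<noteq> \<pi> j"
      proof
        have cancel: "sym_diff (sym_diff F (insert x S)) {x} = sym_diff F S" if "x \<notin> S"
          for F S :: "'p set" and x
          using that by auto
        assume "a = \<pi> j"
        then have "f B = f R"
          unfolding fa Rj R image_insert by (simp only: cancel[OF nR(2)])
        with inj have "B = R"
          by (rule inj_onD) (use less.prems sub in auto)
        with 3 show False by blast
      qed
      ultimately have "a = \<pi> i" by blast
      have cancel: "sym_diff (sym_diff F (insert y S)) {x} = sym_diff F (insert x (insert y S))"
        if "x \<notin> S" "x \<noteq> y" for F S :: "'p set" and x y
        using that by auto
      have "\<pi> ` B = insert (\<pi> i) (insert (\<pi> j) (\<pi> ` R))"
        using 3(1) by simp
      then show ?thesis
        using cancel[OF nR(1) ne, of "f {}"] by (simp only: fa Rj \<open>a = \<pi> i\<close> image_insert)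
    qed
  qed
  with inj\<pi> show ?thesis
    using that by blast
qed

section \<open>Squares, neighbours and the flag condition\<close>

definition square :: "'v set set \<Rightarrow> 'v \<Rightarrow> 'v \<Rightarrow> 'v \<Rightarrow> 'v \<Rightarrow> bool" where
  "square K a b c d \<longleftrightarrow> {a, b, c, d} \<in> K \<and> adjacent K a b \<and> adjacent K b c \<and> adjacent K c d \<and>
     adjacent K d a \<and> a \<noteq> c \<and> b \<noteq> d"

lemma adjacent_sym: "adjacent K x y \<longleftrightarrow> adjacent K y x"
  by (auto simp: adjacent_def insert_commute)

lemma adjacent_vertex:
  "adjacent K x y \<Longrightarrow> x \<in> \<Union>K" "adjacent K x y \<Longrightarrow> y \<in> \<Union>K"
  by (auto simp: adjacent_def)

lemma square_reflect: "square K a b c d \<Longrightarrow> square K a d c b"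
  unfolding square_def by (auto simp: insert_commute dest: adjacent_sym[THEN iffD1])

lemma square_rotate: "square K a b c d \<Longrightarrow> square K b c d a"
  unfolding square_def by (auto simp: insert_commute)

lemma squareD:
  assumes "square K a b c d"
  shows "adjacent K a b" "adjacent K b c" "adjacent K c d" "adjacent K d a" "a \<noteq> c" "b \<noteq> d"
    "adjacent K b a" "adjacent K c b" "adjacent K d c" "adjacent K a d"
  using assms by (auto simp: square_def dest: adjacent_sym[THEN iffD1])

lemma
  assumes "cube_param K C n \<psi>"
  shows cube_param_in: "B \<subseteq> {..<n} \<Longrightarrow> \<psi> B \<in> C"
    and cube_param_inj: "A \<subseteq> {..<n} \<Longrightarrow> B \<subseteq> {..<n} \<Longrightarrow> \<psi> A = \<psi> B \<longleftrightarrow> A = B"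
    and cube_param_image: "C = \<psi> ` Pow {..<n}"
    and cube_param_face: "L \<subseteq> U \<Longrightarrow> U \<subseteq> {..<n} \<Longrightarrow> \<psi> ` {L..U} \<in> K"
proof -
  have b: "bij_betw \<psi> (Pow {..<n}) C"
    using assms by (simp add: cube_param_def)
  show "B \<subseteq> {..<n} \<Longrightarrow> \<psi> B \<in> C" "C = \<psi> ` Pow {..<n}"
    using b by (auto simp: bij_betw_def)
  show "A \<subseteq> {..<n} \<Longrightarrow> B \<subseteq> {..<n} \<Longrightarrow> \<psi> A = \<psi> B \<longleftrightarrow> A = B"
    using b by (auto simp: bij_betw_def inj_on_def)
  show "L \<subseteq> U \<Longrightarrow> U \<subseteq> {..<n} \<Longrightarrow> \<psi> ` {L..U} \<in> K"
    using assms by (simp add: cube_param_def)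
qed

lemma cube_param_edge:
  assumes \<psi>: "cube_param K C n \<psi>" and "B \<subseteq> {..<n}" "i < n" "i \<notin> B"
  shows "adjacent K (\<psi> B) (\<psi> (insert i B))"
proof -
  have "{B..insert i B} = {B, insert i B}"
    by auto
  then show ?thesis
    using cube_param_face[OF \<psi>, of B "insert i B"] cube_param_inj[OF \<psi>, of B "insert i B"] assms
    by (auto simp: adjacent_def)
qed

lemma cube_param_square:
  assumes \<psi>: "cube_param K C n \<psi>" and "B \<subseteq> {..<n}" "i < n" "i \<notin> B" "j < n" "j \<notin> B" "i \<noteq> j"
  shows "square K (\<psi> B) (\<psi> (insert i B)) (\<psi> (insert i (insert j B))) (\<psi> (insert j B))"
proof -
  have "{B..insert i (insert j B)} = {B, insert i B, insert i (insert j B), insert j B}"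
    using assms by auto
  then have "{\<psi> B, \<psi> (insert i B), \<psi> (insert i (insert j B)), \<psi> (insert j B)} \<in> K"
    using cube_param_face[OF \<psi>, of B "insert i (insert j B)"] assms by auto
  moreover have "adjacent K (\<psi> B) (\<psi> (insert i B))" "adjacent K (\<psi> B) (\<psi> (insert j B))"
     "adjacent K (\<psi> (insert j B)) (\<psi> (insert i (insert j B)))"
    using cube_param_edge[OF \<psi>] assms by auto
  moreover have "adjacent K (\<psi> (insert i B)) (\<psi> (insert i (insert j B)))"
    using cube_param_edge[OF \<psi>, of "insert i B" j] assms by (auto simp: insert_commute)
  moreover have "\<psi> B \<noteq> \<psi> (insert i (insert j B))" "\<psi> (insert i B) \<noteq> \<psi> (insert j B)"
    using cube_param_inj[OF \<psi>, of B] cube_param_inj[OF \<psi>, of "insert i B"] assms by auto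
  ultimately show ?thesis
    by (simp add: square_def adjacent_sym[of K "\<psi> (insert j B)"])
qed

text \<open>An edge at the origin is an interval with two elements that contains \<open>{}\<close>,
  so its upper end is a singleton. This identifies the vertices of the link inside \<open>C\<close>
  with the directions of the cube.\<close>

lemma cube_param_neighbours:
  assumes \<psi>: "cube_param K C n \<psi>"
  shows "{u \<in> C. adjacent K (\<psi> {}) u} = (\<lambda>i. \<psi> {i}) ` {..<n}"
proof (intro equalityI subsetI)
  fix u assume "u \<in> (\<lambda>i. \<psi> {i}) ` {..<n}"
  then show "u \<in> {u \<in> C. adjacent K (\<psi> {}) u}"
    using cube_param_edge[OF \<psi>, of "{}"] cube_param_in[OF \<psi>] by auto
next
  fix u assume "u \<in> {u \<in> C. adjacent K (\<psi> {}) u}"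
  then have u: "u \<in> C" "\<psi> {} \<noteq> u" "{\<psi> {}, u} \<in> K" "{\<psi> {}, u} \<subseteq> C"
    using cube_param_in[OF \<psi>, of "{}"] by (auto simp: adjacent_def)
  then obtain A where A: "A \<subseteq> {..<n}" "u = \<psi> A"
    using cube_param_image[OF \<psi>] by blast
  obtain L U where LU: "L \<subseteq> U" "U \<subseteq> {..<n}" "{\<psi> {}, u} = \<psi> ` {L..U}"
    using \<psi> u by (meson cube_param_def)
  have "inj_on \<psi> (Pow {..<n})"
    using \<psi> by (simp add: cube_param_def bij_betw_def)
  moreover have sub: "{L..U} \<subseteq> Pow {..<n}"
    using LU(2) by (rule interval_subset_Pow)
  moreover have "\<psi> ` {L..U} = \<psi> ` {{}, A}"
    using LU A by simp
  ultimately have eq: "{L..U} = {{}, A}"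
    using inj_on_image_eq_iff[of \<psi> "Pow {..<n}" "{L..U}" "{{}, A}"] sub A(1) by simp
  have "{} \<in> {L..U}" "A \<in> {L..U}"
    unfolding eq by simp_all
  then have "L = {}" "A \<subseteq> U"
    by simp_all
  moreover have "U = A"
  proof -
    have "U \<in> {L..U}" using LU(1) by simp
    then have "U \<in> {{}, A}" unfolding eq .
    with \<open>A \<subseteq> U\<close> show ?thesis by auto
  qed
  moreover have "A \<noteq> {}" using u A by auto
  ultimately obtain i where i: "i \<in> A" by blast
  then have "{i} \<in> {L..U}"
    using \<open>U = A\<close> \<open>L = {}\<close> by simp
  then have "{i} \<in> {{}, A}"
    unfolding eq .
  then show "u \<in> (\<lambda>i. \<psi> {i}) ` {..<n}"
    using A by auto
qed

locale cubical =
  fixes K :: "'v set set"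
  assumes cx: "cube_complex K"
begin

lemma chart_exists:
  assumes "C \<in> K" obtains n \<phi> where "cube_chart K C n \<phi>"
  using cx assms by (auto simp: cube_complex_def)

lemma rooted_chart:
  assumes "C \<in> K" "v \<in> C"
  obtains n \<phi> where "cube_chart K C n \<phi>" "\<phi> v = {}"
proof -
  obtain n \<phi> where \<phi>: "cube_chart K C n \<phi>"
    using assms chart_exists by blast
  then have "cube_chart K C n (\<lambda>u. sym_diff (\<phi> u) (\<phi> v))"
    by (rule cube_chart_shift) (rule cube_param_chart(4)[OF \<phi> assms(2)])
  then show ?thesis
    by (rule that) simp
qed

lemma rooted_param:
  assumes "C \<in> K" "v \<in> C"
  obtains n \<psi> where "cube_param K C n \<psi>" "\<psi> {} = v"
proof -
  obtain n \<phi> where "cube_chart K C n \<phi>" "\<phi> v = {}"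
    using rooted_chart[OF assms] .
  then show ?thesis
    using cube_param_chart[of K C n \<phi>] assms that by metis
qed

lemma cube_nonempty: "C \<in> K \<Longrightarrow> C \<noteq> {}"
  by (metis Pow_not_empty bij_betw_empty1 cube_chart_def chart_exists)

lemma finite_cube: "C \<in> K \<Longrightarrow> finite C"
  by (metis bij_betw_finite chart_exists cube_chart_def finite_Pow_iff finite_lessThan)

lemma card_cube: "C \<in> K \<Longrightarrow> \<exists>n. card C = 2 ^ n"
  by (metis bij_betw_same_card card_Pow card_lessThan chart_exists cube_chart_def finite_lessThan)

lemma vertex_cube: "v \<in> \<Union>K \<Longrightarrow> {v} \<in> K"
proof -
  assume "v \<in> \<Union>K"
  then obtain C where "C \<in> K" "v \<in> C" by blast
  then obtain n \<psi> where "cube_param K C n \<psi>" "\<psi> {} = v"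
    using rooted_param by metis
  then show ?thesis
    using cube_param_face[of K C n \<psi> "{}" "{}"] by simp
qed

lemma inter_cube: "C \<in> K \<Longrightarrow> D \<in> K \<Longrightarrow> v \<in> C \<Longrightarrow> v \<in> D \<Longrightarrow> C \<inter> D \<in> K"
  using cx by (auto simp: cube_complex_def)

text \<open>Two different squares with three common corners would meet in exactly these three
  vertices, whereas the number of vertices of a cube is a power of two.\<close>

lemma square_unique:
  assumes "square K a b c d" "square K a b c' d"
  shows "c = c'"
proof (rule ccontr)
  assume "c \<noteq> c'"
  then have "{a, b, c, d} \<inter> {a, b, c', d} = {a, b, d}"
    using assms by (auto simp: square_def adjacent_def)
  then have "{a, b, d} \<in> K"
    using assms inter_cube[of "{a, b, c, d}" "{a, b, c', d}" a] by (simp add: square_def)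
  moreover have "card {a, b, d} = 3"
    using assms by (auto simp: square_def adjacent_def)
  ultimately obtain n where "(3::nat) = 2 ^ n"
    using card_cube by metis
  then show False
    by (cases n) (auto, presburger)
qed

text \<open>Four vertices force dimension two, so \<open>v\<close> has just two neighbours inside
  the square, and the simplex cut out in the link is exactly \<open>{a, b}\<close>.\<close>

lemma square_link:
  assumes "square K v a d b"
  shows "{a, b} \<in> vertex_link K v"
proof -
  let ?C = "{v, a, d, b}"
  have C: "?C \<in> K" "v \<in> ?C"
    using assms by (auto simp: square_def)
  obtain n \<psi> where \<psi>: "cube_param K ?C n \<psi>" "\<psi> {} = v"
    using rooted_param[OF C] .
  have "card ?C = 4"
    using assms by (auto simp: square_def adjacent_def)
  moreover have "card ?C = 2 ^ n"
    using \<psi>(1) bij_betw_same_card[of \<psi> "Pow {..<n}" ?C] by (simp add: cube_param_def card_Pow)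
  ultimately have "2 ^ n = (2::nat) ^ 2"
    by simp
  then have "n = 2"
    by (rule power_inject_exp[THEN iffD1, rotated]) simp
  have fin: "finite {u \<in> ?C. adjacent K v u}"
    by simp
  have "{u \<in> ?C. adjacent K v u} = (\<lambda>i. \<psi> {i}) ` {..<n}"
    using cube_param_neighbours[OF \<psi>(1)] \<psi>(2) by simp
  then have "card {u \<in> ?C. adjacent K v u} \<le> 2"
    using \<open>n = 2\<close> by (metis card_image_le card_lessThan finite_lessThan)
  moreover have "{a, b} \<subseteq> {u \<in> ?C. adjacent K v u}" "card {a, b} = 2"
    using squareD[OF assms] by auto
  ultimately have "{a, b} = {u \<in> ?C. adjacent K v u}"
    using fin by (metis card_seteq)
  moreover have "?C \<noteq> {v}"
    using squareD[OF assms] by (auto simp: adjacent_def)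
  ultimately show ?thesis
    using C unfolding vertex_link_def by blast
qed

lemma neighbour_link:
  assumes "adjacent K v u"
  shows "{u} \<in> vertex_link K v"
proof -
  have "{w \<in> {v, u}. adjacent K v w} = {u}"
    using assms by (auto simp: adjacent_def)
  moreover have "{v, u} \<in> K" "{v, u} \<noteq> {v}"
    using assms by (auto simp: adjacent_def)
  ultimately show ?thesis
    unfolding vertex_link_def by blast
qed

text \<open>Pairwise squares at \<open>v\<close> make \<open>S\<close> a clique of the link. The
  flag condition turns the clique into a simplex, which is the trace at \<open>v\<close> of a
  cube.\<close>

lemma flag_cube:
  assumes "flag (vertex_link K v)" "finite S" "S \<noteq> {}"
    and "\<And>a. a \<in> S \<Longrightarrow> adjacent K v a"
    and "\<And>a b. a \<in> S \<Longrightarrow> b \<in> S \<Longrightarrow> a \<noteq> b \<Longrightarrow> \<exists>d. square K v a d b"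
  obtains C where "C \<in> K" "v \<in> C" "{u \<in> C. adjacent K v u} = S"
proof -
  have "S \<subseteq> \<Union>(vertex_link K v)"
    using neighbour_link assms(4) by blast
  moreover have "\<forall>a\<in>S. \<forall>b\<in>S. a \<noteq> b \<longrightarrow> {a, b} \<in> vertex_link K v"
    using square_link assms(5) by metis
  ultimately have "finite S \<and> S \<noteq> {} \<and> S \<subseteq> \<Union>(vertex_link K v) \<and>
      (\<forall>a\<in>S. \<forall>b\<in>S. a \<noteq> b \<longrightarrow> {a, b} \<in> vertex_link K v)"
    using assms(2,3) by (intro conjI)
  then have "S \<in> vertex_link K v"
    by (rule mp[OF spec[OF assms(1)[unfolded flag_def], of S]])
  then show ?thesis
    using that by (auto simp: vertex_link_def)
qed

text \<open>The three neighbours of \<open>y\<close> span a cube by the flag condition, and by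
  \<open>square_unique\<close> the fourth corners of the given squares are vertices of that cube.
  The vertex \<open>t\<close> is its corner opposite to \<open>y\<close>.\<close>

lemma flag_cube3:
  assumes fl: "flag (vertex_link K y)"
    and sq: "square K y a b12 b" "square K y b b23 c" "square K y a b13 c"
  obtains t where "square K a b12 t b13" "square K b b12 t b23" "square K c b13 t b23"
proof -
  have ne: "a \<noteq> b" "b \<noteq> c" "a \<noteq> c"
    using sq by (auto simp: square_def)
  obtain C where C: "C \<in> K" "y \<in> C" "{u \<in> C. adjacent K y u} = {a, b, c}"
  proof (rule flag_cube[OF fl, of "{a, b, c}"])
    have "\<exists>d. square K y a d b" "\<exists>d. square K y b d c" "\<exists>d. square K y a d c"
        "\<exists>d. square K y b d a" "\<exists>d. square K y c d b" "\<exists>d. square K y c d a"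
      using sq sq[THEN square_reflect] by blast+
    then show "\<exists>d. square K y u d w" if "u \<in> {a, b, c}" "w \<in> {a, b, c}" "u \<noteq> w" for u w
      using that by (elim insertE emptyE) simp_all
    have "adjacent K y a" "adjacent K y b" "adjacent K y c"
      using sq[THEN squareD(1)] sq(3)[THEN squareD(10)] by simp_all
    then show "adjacent K y u" if "u \<in> {a, b, c}" for u
      using that by (elim insertE emptyE) simp_all
  qed auto
  obtain n \<psi> where \<psi>: "cube_param K C n \<psi>" "\<psi> {} = y"
    using rooted_param[OF C(1,2)] .
  have nb: "(\<lambda>i. \<psi> {i}) ` {..<n} = {a, b, c}"
    using cube_param_neighbours[OF \<psi>(1)] \<psi>(2) C(3) by simp
  then have "a \<in> (\<lambda>i. \<psi> {i}) ` {..<n}" "b \<in> (\<lambda>i. \<psi> {i}) ` {..<n}" "c \<in> (\<lambda>i. \<psi> {i}) ` {..<n}"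
    by blast+
  then obtain i j k where ijk: "i < n" "j < n" "k < n" "a = \<psi> {i}" "b = \<psi> {j}" "c = \<psi> {k}"
    by auto
  have d: "i \<noteq> j" "j \<noteq> k" "i \<noteq> k"
    using ijk ne by auto
  have s: "square K y (\<psi> {i}) (\<psi> {i, j}) (\<psi> {j})" if "i < n" "j < n" "i \<noteq> j" for i j
    using cube_param_square[OF \<psi>(1), of "{}" i j] \<psi>(2) that by simp
  have b: "b12 = \<psi> {i, j}" "b23 = \<psi> {j, k}" "b13 = \<psi> {i, k}"
    using square_unique[of y a b12 b] square_unique[of y b b23 c] square_unique[of y a b13 c] sq
       s[of i j] s[of j k] s[of i k] ijk d by auto
  have e: "{j, i} = {i, j}" "{k, j} = {j, k}" "{k, i} = {i, k}"
    "{j, k, i} = {i, j, k}" "{i, k, j} = {i, j, k}" "{k, i, j} = {i, j, k}" "{j, i, k} = {i, j, k}"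
    by auto
  show ?thesis
  proof (rule that[of "\<psi> {i, j, k}"])
    show "square K a b12 (\<psi> {i, j, k}) b13"
      using cube_param_square[OF \<psi>(1), of "{i}" j k] ijk d b e by simp
    show "square K b b12 (\<psi> {i, j, k}) b23"
      using cube_param_square[OF \<psi>(1), of "{j}" i k] ijk d b e by simp
    show "square K c b13 (\<psi> {i, j, k}) b23"
      using cube_param_square[OF \<psi>(1), of "{k}" i j] ijk d b e by simp
  qed
qed

end

section \<open>Topology of the realization\<close>

lemma sum_Pow_prod:
  fixes y :: "'a \<Rightarrow> real"
  assumes "finite N"
  shows "(\<Sum>A\<in>Pow N. \<Prod>j\<in>N. if j \<in> A then y j else 1 - y j) = 1"
proof -
  have "(\<Prod>j\<in>N. if j \<in> A then y j else 1 - y j) = prod y A * prod (\<lambda>j. 1 - y j) (N - A)"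
    if "A \<in> Pow N" for A
  proof -
    have "N = A \<union> (N - A)" "finite A" using that assms finite_subset by auto
    then have "(\<Prod>j\<in>N. if j \<in> A then y j else 1 - y j) =
      (\<Prod>j\<in>A. if j \<in> A then y j else 1 - y j) * (\<Prod>j\<in>N - A. if j \<in> A then y j else 1 - y j)"
      using assms by (subst \<open>N = A \<union> (N - A)\<close>, subst prod.union_disjoint) auto
    then show ?thesis by simp
  qed
  then have "(\<Sum>A\<in>Pow N. \<Prod>j\<in>N. if j \<in> A then y j else 1 - y j) =
      (\<Sum>A\<in>Pow N. prod y A * prod (\<lambda>j. 1 - y j) (N - A))"
    by (rule sum.cong[OF refl])
  also have "\<dots> = (\<Prod>j\<in>N. y j + (1 - y j))"
    by (rule prod_add[OF assms, symmetric])
  finally show ?thesis by simp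
qed

text \<open>If each \<open>j\<close> is picked independently with probability \<open>y j\<close>,
  the summands are the probabilities of the outcomes \<open>A\<close>, and the sum is a marginal. In
  this way a coordinate of a point of a cube is recovered from the weights of the vertices.\<close>

lemma sum_Pow_prod_mem:
  fixes y :: "'a \<Rightarrow> real"
  assumes "finite N" "i \<in> N"
  shows "(\<Sum>A | A \<subseteq> N \<and> i \<in> A. \<Prod>j\<in>N. if j \<in> A then y j else 1 - y j) = y i"
proof -
  let ?M = "N - {i}"
  have eq: "{A. A \<subseteq> N \<and> i \<in> A} = insert i ` Pow ?M"
  proof (intro equalityI subsetI)
    fix A assume "A \<in> {A. A \<subseteq> N \<and> i \<in> A}"
    then have "A = insert i (A - {i})" "A - {i} \<in> Pow ?M" by auto
    then show "A \<in> insert i ` Pow ?M" by (rule image_eqI)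
  qed (use assms in auto)
  have inj: "inj_on (insert i) (Pow ?M)"
    by (rule inj_onI) (auto dest: insert_ident[THEN iffD1, rotated 2])
  have "(\<Sum>A | A \<subseteq> N \<and> i \<in> A. \<Prod>j\<in>N. if j \<in> A then y j else 1 - y j) =
      (\<Sum>A\<in>Pow ?M. \<Prod>j\<in>N. if j \<in> insert i A then y j else 1 - y j)"
    unfolding eq by (subst sum.reindex[OF inj]) simp
  also have "\<dots> = (\<Sum>A\<in>Pow ?M. y i * (\<Prod>j\<in>?M. if j \<in> A then y j else 1 - y j))"
  proof (rule sum.cong[OF refl])
    fix A assume "A \<in> Pow ?M"
    have "(\<Prod>j\<in>N. if j \<in> insert i A then y j else 1 - y j) =
        (if i \<in> insert i A then y i else 1 - y i) * (\<Prod>j\<in>?M. if j \<in> insert i A then y j else 1 - y j)"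
      by (rule prod.remove[OF assms])
    also have "(\<Prod>j\<in>?M. if j \<in> insert i A then y j else 1 - y j) = (\<Prod>j\<in>?M. if j \<in> A then y j else 1 - y j)"
      by (rule prod.cong) auto
    finally show "(\<Prod>j\<in>N. if j \<in> insert i A then y j else 1 - y j) = y i * (\<Prod>j\<in>?M. if j \<in> A then y j else 1 - y j)"
      by simp
  qed
  also have "\<dots> = y i"
    using assms by (simp add: sum_distrib_left[symmetric] sum_Pow_prod)
  finally show ?thesis .
qed

lemma sum_Pow_prod_not_mem:
  fixes y :: "'a \<Rightarrow> real"
  assumes "finite N" "i \<in> N"
  shows "(\<Sum>A | A \<subseteq> N \<and> i \<notin> A. \<Prod>j\<in>N. if j \<in> A then y j else 1 - y j) = 1 - y i"
proof -
  have "{A. A \<subseteq> N \<and> i \<notin> A} = Pow N - {A. A \<subseteq> N \<and> i \<in> A}"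
    by auto
  moreover have "{A. A \<subseteq> N \<and> i \<in> A} \<subseteq> Pow N"
    by auto
  ultimately show ?thesis
    using sum_Pow_prod[OF assms(1), of y] sum_Pow_prod_mem[OF assms, of y] assms(1)
    by (simp add: sum_diff del: Pow_iff)
qed

lemma cube_point_sum:
  assumes "cube_chart K C n \<phi>"
  shows "(\<Sum>v | v \<in> C \<and> P (\<phi> v). cube_point C n \<phi> t v) =
    (\<Sum>A | A \<subseteq> {..<n} \<and> P A. \<Prod>i<n. if i \<in> A then t i else 1 - t i)"
proof -
  have bij: "bij_betw \<phi> C (Pow {..<n})"
    using assms by (simp add: cube_chart_iff)
  then have im: "\<phi> ` C = Pow {..<n}"
    by (simp add: bij_betw_def)
  have "\<phi> ` {v. v \<in> C \<and> P (\<phi> v)} = {A \<in> \<phi> ` C. P A}"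
    by blast
  then have "\<phi> ` {v. v \<in> C \<and> P (\<phi> v)} = {A. A \<subseteq> {..<n} \<and> P A}"
    unfolding im by simp
  then have "bij_betw \<phi> {v. v \<in> C \<and> P (\<phi> v)} {A. A \<subseteq> {..<n} \<and> P A}"
    by (rule bij_betw_subset[OF bij, rotated]) auto
  then have "(\<Sum>v | v \<in> C \<and> P (\<phi> v). \<Prod>i<n. if i \<in> \<phi> v then t i else 1 - t i) =
      (\<Sum>A | A \<subseteq> {..<n} \<and> P A. \<Prod>i<n. if i \<in> A then t i else 1 - t i)"
    by (rule sum.reindex_bij_betw)
  moreover have "(\<Sum>v | v \<in> C \<and> P (\<phi> v). cube_point C n \<phi> t v) =
      (\<Sum>v | v \<in> C \<and> P (\<phi> v). \<Prod>i<n. if i \<in> \<phi> v then t i else 1 - t i)"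
    by (rule sum.cong) (auto simp: cube_point_def)
  ultimately show ?thesis by simp
qed

lemma cellE:
  assumes "w \<in> cell K C"
  obtains n \<phi> t where "cube_chart K C n \<phi>" "\<forall>i<n. 0 \<le> t i \<and> t i \<le> 1" "w = cube_point C n \<phi> t"
  using assms by (auto simp: cell_def)

lemma cellI:
  assumes "cube_chart K C n \<phi>" "\<And>i. i < n \<Longrightarrow> 0 \<le> t i" "\<And>i. i < n \<Longrightarrow> t i \<le> 1"
  shows "cube_point C n \<phi> t \<in> cell K C"
  unfolding cell_def mem_Collect_eq
  by (intro exI conjI refl allI impI) (use assms in auto)

lemma cell_nonneg: "w \<in> cell K C \<Longrightarrow> 0 \<le> w v"
  by (auto elim!: cellE simp: cube_point_def intro!: prod_nonneg)

lemma cell_outside: "w \<in> cell K C \<Longrightarrow> v \<notin> C \<Longrightarrow> w v = 0"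
  by (auto elim!: cellE simp: cube_point_def)

lemma cell_sum: "w \<in> cell K C \<Longrightarrow> sum w C = 1"
proof (erule cellE)
  fix n \<phi> t assume \<phi>: "cube_chart K C n \<phi>" and w: "w = cube_point C n \<phi> t"
  show "sum w C = 1"
    using cube_point_sum[OF \<phi>, where P = "\<lambda>_. True" and t = t] sum_Pow_prod[of "{..<n}" t] by (simp add: w Pow_def)
qed

lemma cell_positive: "w \<in> cell K C \<Longrightarrow> \<exists>v\<in>C. 0 < w v"
proof (rule ccontr)
  assume w: "w \<in> cell K C" and "\<not> (\<exists>v\<in>C. 0 < w v)"
  then have "w v = 0" if "v \<in> C" for v
    using cell_nonneg[OF w, of v] that by force
  then show False
    using cell_sum[OF w] by simp
qed

lemma vertex_point_cell:
  assumes "cubical K" "C \<in> K" "v \<in> C"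
  shows "vertex_point v \<in> cell K C"
proof -
  interpret cubical K by fact
  obtain n \<phi> where \<phi>: "cube_chart K C n \<phi>" "\<phi> v = {}"
    using rooted_chart assms by metis
  have bij: "bij_betw \<phi> C (Pow {..<n})"
    using \<phi>(1) by (simp add: cube_chart_iff)
  have "cube_point C n \<phi> (\<lambda>_. 0) = vertex_point v"
  proof
    fix u
    show "cube_point C n \<phi> (\<lambda>_. 0) u = vertex_point v u"
    proof (cases "u \<in> C")
      case True
      have "\<phi> u \<subseteq> {..<n}"
        using True bij by (auto simp: bij_betw_def)
      have "(\<Prod>i<n. if i \<in> \<phi> u then 0 else 1 - 0 :: real) = (if \<phi> u = {} then 1 else 0)"
        using \<open>\<phi> u \<subseteq> {..<n}\<close> by (auto simp: prod_zero_iff subset_iff)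
      moreover have "\<phi> u = {} \<longleftrightarrow> u = v"
        using bij True assms \<phi>(2) by (metis bij_betw_def inj_on_eq_iff)
      ultimately show ?thesis
        using True by (simp add: cube_point_def vertex_point_def)
    qed (use assms in \<open>auto simp: cube_point_def vertex_point_def\<close>)
  qed
  then show ?thesis
    using cellI[OF \<phi>(1), of "\<lambda>_. 0"] by simp
qed

lemma edge_point_cell:
  assumes "cubical K" "adjacent K x y" "0 \<le> s" "s \<le> 1"
  shows "(\<lambda>u. (1 - s) * vertex_point x u + s * vertex_point y u) \<in> cell K {x, y}"
proof -
  interpret cubical K by fact
  have e: "{x, y} \<in> K" "x \<noteq> y"
    using assms by (auto simp: adjacent_def)
  then obtain n \<phi> where \<phi>: "cube_chart K {x, y} n \<phi>" "\<phi> x = {}"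
    using rooted_chart by (metis insertI1)
  have bij: "bij_betw \<phi> {x, y} (Pow {..<n})"
    using \<phi>(1) by (simp add: cube_chart_iff)
  then have "card (Pow {..<n}) = 2"
    using bij_betw_same_card e by fastforce
  then have "2 ^ n = (2::nat) ^ 1"
    by (simp add: card_Pow)
  then have n: "n = 1"
    by (rule power_inject_exp[THEN iffD1, rotated]) simp
  have "\<phi> y \<subseteq> {..<n}" "\<phi> y \<noteq> \<phi> x"
    using bij e by (auto simp: bij_betw_def)
  then have "\<phi> y = {0}"
    using n \<phi>(2) by auto
  then have "cube_point {x, y} n \<phi> (\<lambda>_. s) = (\<lambda>u. (1 - s) * vertex_point x u + s * vertex_point y u)"
    using n \<phi>(2) e by (auto simp: cube_point_def vertex_point_def fun_eq_iff)
  then show ?thesis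
    using cellI[OF \<phi>(1), of "\<lambda>_. s"] assms by simp
qed

lemma Hausdorff_space_fun: "Hausdorff_space (euclidean :: ('a \<Rightarrow> real) topology)"
  by (simp flip: euclidean_product_topology add: Hausdorff_space_product_topology Hausdorff_space_euclidean)

lemma continuous_on_fun_iff:
  fixes f :: "'a::topological_space \<Rightarrow> 'i \<Rightarrow> real"
  shows "continuous_on S f \<longleftrightarrow> (\<forall>i. continuous_on S (\<lambda>x. f x i))"
  using continuous_on_coordinatewise_then_product[of S f]
    continuous_on_product_then_coordinatewise[of S f] by blast

lemma continuous_on_coordinate: "continuous_on S (\<lambda>w::'i \<Rightarrow> real. w v)"
  by (rule continuous_on_subset[OF continuous_on_product_coordinates]) simp

section \<open>Compact cells and the weak topology\<close>

context cubical
begin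

lemma chart_dim:
  assumes "cube_chart K C n \<phi>" "cube_chart K C m \<psi>" shows "n = m"
proof -
  have "bij_betw \<phi> C (Pow {..<n})" "bij_betw \<psi> C (Pow {..<m})"
    using assms by (simp_all add: cube_chart_def)
  then have "2 ^ n = (2::nat) ^ m"
    by (auto dest!: bij_betw_same_card simp: card_Pow)
  then show ?thesis
    by (rule power_inject_exp[THEN iffD1, rotated]) simp
qed

text \<open>\<open>cell\<close> ranges over all charts of \<open>C\<close>. Charts that agree on
  \<open>C\<close> give the same points, so those with value \<open>{}\<close> off \<open>C\<close>
  suffice. They are finite in number, and each contributes a continuous image of a product of
  intervals.\<close>

lemma compact_cell:
  assumes "C \<in> K" shows "compact (cell K C)"
proof -
  obtain n \<phi>0 where \<phi>0: "cube_chart K C n \<phi>0"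
    using chart_exists[OF assms] .
  \<comment> \<open>Coordinates from \<open>n\<close> on do not enter \<open>cube_point\<close> and
    are set to 0.\<close>
  define T :: "(nat \<Rightarrow> real) set" where "T = PiE UNIV (\<lambda>i. if i < n then {0..1} else {0})"
  have "compactin euclidean T"
    unfolding T_def euclidean_product_topology[symmetric] by (subst compactin_PiE) auto
  then have T: "compact T" by simp
  define \<Phi> where "\<Phi> = {\<phi>. cube_chart K C n \<phi> \<and> (\<forall>v. v \<notin> C \<longrightarrow> \<phi> v = {})}"
  have "\<Phi> \<subseteq> {\<phi>. (\<forall>v\<in>C. \<phi> v \<in> Pow {..<n}) \<and> (\<forall>v. v \<notin> C \<longrightarrow> \<phi> v = {})}"
    by (auto simp: \<Phi>_def dest: cube_param_chart(4))
  moreover have "finite {\<phi>. (\<forall>v\<in>C. \<phi> v \<in> Pow {..<n}) \<and> (\<forall>v. v \<notin> C \<longrightarrow> \<phi> v = {})}"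
    using finite_set_of_finite_funs[of C "Pow {..<n}" "{}"] finite_cube[OF assms]
    by (rule_tac finite_subset[rotated]) auto
  ultimately have fin: "finite \<Phi>"
    by (rule finite_subset)
  have "cell K C = (\<Union>\<phi>\<in>\<Phi>. cube_point C n \<phi> ` T)"
  proof (intro equalityI subsetI)
    fix w assume "w \<in> cell K C"
    then obtain m \<phi> t where w: "cube_chart K C m \<phi>" "\<forall>i<m. 0 \<le> t i \<and> t i \<le> 1"
      "w = cube_point C m \<phi> t" by (rule cellE)
    have m: "m = n" using chart_dim[OF w(1) \<phi>0] .
    let ?\<phi> = "\<lambda>v. if v \<in> C then \<phi> v else {}"
    have "bij_betw ?\<phi> C (Pow {..<n}) \<longleftrightarrow> bij_betw \<phi> C (Pow {..<n})"
      by (rule bij_betw_cong) simp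
    moreover have "?\<phi> ` D = \<phi> ` D" if "D \<subseteq> C" for D
      using that by (intro image_cong) auto
    ultimately have "cube_chart K C n ?\<phi>"
      using w(1) unfolding m cube_chart_iff by simp
    then have "?\<phi> \<in> \<Phi>" by (simp add: \<Phi>_def)
    moreover have "(\<lambda>i. if i < n then t i else 0) \<in> T"
      using w(2) m by (auto simp: T_def)
    moreover have "w = cube_point C n ?\<phi> (\<lambda>i. if i < n then t i else 0)"
      unfolding w(3) m cube_point_def by (auto intro!: ext prod.cong)
    ultimately show "w \<in> (\<Union>\<phi>\<in>\<Phi>. cube_point C n \<phi> ` T)" by blast
  next
    fix w assume "w \<in> (\<Union>\<phi>\<in>\<Phi>. cube_point C n \<phi> ` T)"
    then obtain \<phi> t where w: "\<phi> \<in> \<Phi>" "t \<in> T" "w = cube_point C n \<phi> t" by blast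
    have "t i \<in> (if i < n then {0..1} else {0})" for i
      using w(2) unfolding T_def by blast
    then have "0 \<le> t i" "t i \<le> 1" if "i < n" for i
      using that by (metis atLeastAtMost_iff)+
    then show "w \<in> cell K C"
      using w by (auto simp: \<Phi>_def intro: cellI)
  qed
  moreover have "compact (cube_point C n \<phi> ` T)" for \<phi>
  proof (rule compact_continuous_image[OF _ T], unfold continuous_on_fun_iff, rule allI)
    fix v
    show "continuous_on T (\<lambda>t. cube_point C n \<phi> t v)"
    proof (cases "v \<in> C")
      case True
      have "continuous_on T (\<lambda>t. if i \<in> \<phi> v then t i else 1 - t i)" for i
        by (cases "i \<in> \<phi> v") (auto intro!: continuous_intros continuous_on_coordinate)
      then show ?thesis
        using True by (simp add: cube_point_def continuous_on_prod)
    qed (simp add: cube_point_def)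
  qed
  ultimately show ?thesis
    using fin by (simp add: compact_UN)
qed

text \<open>The space of all functions on the vertices need not be metrizable, but it is Hausdorff,
  so compact cells are closed in it.\<close>

lemma closed_cell: "C \<in> K \<Longrightarrow> closed (cell K C)"
  using compactin_imp_closedin[OF Hausdorff_space_fun] compact_cell by auto

lemma cell_subset_topspace: "C \<in> K \<Longrightarrow> cell K C \<subseteq> topspace (realization K)"
  by (auto simp: topspace_realization)

lemma topspace_cellE:
  assumes "w \<in> topspace (realization K)"
  obtains C where "C \<in> K" "w \<in> cell K C"
  using assms by (auto simp: topspace_realization)

lemma vertex_point_topspace: "v \<in> \<Union>K \<Longrightarrow> vertex_point v \<in> topspace (realization K)"
  using vertex_point_cell[OF cubical_axioms] by (auto simp: topspace_realization)

lemma continuous_map_from_realization: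
  fixes f :: "('v \<Rightarrow> real) \<Rightarrow> 'b::topological_space"
  assumes "\<And>C. C \<in> K \<Longrightarrow> continuous_on (cell K C) f"
  shows "continuous_map (realization K) euclidean f"
proof (unfold continuous_map_def, intro conjI allI impI)
  fix U :: "'b set" assume "openin euclidean U"
  then have U: "open U" by simp
  have "openin (top_of_set (cell K C)) ({w \<in> topspace (realization K). f w \<in> U} \<inter> cell K C)" if "C \<in> K" for C
  proof -
    have "{w \<in> topspace (realization K). f w \<in> U} \<inter> cell K C = cell K C \<inter> f -` U"
      using cell_subset_topspace[OF that] by auto
    then show ?thesis
      using continuous_openin_preimage_gen[OF assms[OF that] U] by simp
  qed
  then show "openin (realization K) {w \<in> topspace (realization K). f w \<in> U}"
    unfolding openin_realization by (auto simp: topspace_realization)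
qed simp

lemma continuous_map_coordinate: "continuous_map (realization K) euclideanreal (\<lambda>w. w v)"
  by (rule continuous_map_from_realization) (rule continuous_on_coordinate)

lemma closedin_realization_cell:
  assumes "closedin (realization K) S" "C \<in> K"
  shows "closed (S \<inter> cell K C)"
proof -
  have "openin (top_of_set (cell K C)) ((topspace (realization K) - S) \<inter> cell K C)"
    using assms unfolding closedin_def openin_realization by blast
  moreover have "(topspace (realization K) - S) \<inter> cell K C = cell K C - S \<inter> cell K C"
    using cell_subset_topspace[OF assms(2)] by auto
  ultimately have "closedin (top_of_set (cell K C)) (S \<inter> cell K C)"
    by (simp add: closedin_def)
  then show ?thesis
    using closed_cell[OF assms(2)] closedin_closed_trans by blast
qed

lemma closedin_realizationI:
  assumes "S \<subseteq> topspace (realization K)" "\<And>C. C \<in> K \<Longrightarrow> closed (S \<inter> cell K C)"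
  shows "closedin (realization K) S"
proof -
  have "openin (top_of_set (cell K C)) ((topspace (realization K) - S) \<inter> cell K C)" if "C \<in> K" for C
  proof -
    have "(topspace (realization K) - S) \<inter> cell K C = cell K C - S \<inter> cell K C"
      using cell_subset_topspace[OF that] by auto
    moreover have "closedin (top_of_set (cell K C)) (S \<inter> cell K C)"
      using assms(2)[OF that] by (simp add: closed_subset)
    ultimately show ?thesis
      by (simp add: closedin_def)
  qed
  then have "openin (realization K) (topspace (realization K) - S)"
    unfolding openin_realization by (auto simp: topspace_realization)
  then show ?thesis
    using assms(1) by (simp add: closedin_def)
qed

text \<open>Closedness in the weak topology is tested cell by cell. If finitely many cells receive
  the whole image, the preimage of a closed set is a finite union of closed preimages. Paths and
  homotopies in the realization are constructed through this criterion.\<close>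

lemma continuous_map_into_realization:
  assumes f: "continuous_map Z euclidean f"
    and \<F>: "finite \<F>" "\<F> \<subseteq> K" "\<And>x. x \<in> topspace Z \<Longrightarrow> \<exists>C\<in>\<F>. f x \<in> cell K C"
  shows "continuous_map Z (realization K) f"
  unfolding continuous_map_closedin
proof (intro conjI allI impI ballI)
  show "f \<in> topspace Z \<rightarrow> topspace (realization K)"
  proof (rule funcsetI)
    fix x assume "x \<in> topspace Z"
    then obtain C where "C \<in> \<F>" "f x \<in> cell K C"
      using \<F>(3) by blast
    then show "f x \<in> topspace (realization K)"
      using \<F>(2) cell_subset_topspace by blast
  qed
next
  fix S assume S: "closedin (realization K) S"
  have "{x \<in> topspace Z. f x \<in> S} = (\<Union>C\<in>\<F>. {x \<in> topspace Z. f x \<in> S \<inter> cell K C})"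
    using \<F>(3) by blast
  moreover have "closedin Z {x \<in> topspace Z. f x \<in> S \<inter> cell K C}" if "C \<in> \<F>" for C
  proof (rule closedin_continuous_map_preimage[OF f])
    show "closedin euclidean (S \<inter> cell K C)"
      using closedin_realization_cell[OF S] that \<F>(2) by auto
  qed
  ultimately show "closedin Z {x \<in> topspace Z. f x \<in> S}"
    using \<F>(1) by (auto intro!: closedin_Union)
qed

text \<open>A point has a finite support, so an infinite family of points in distinct open stars forms a
  closed discrete set.\<close>

lemma compactin_realization_support:
  assumes "compactin (realization K) S"
  shows "finite {v. \<exists>w\<in>S. 0 < w v}"
proof (rule ccontr)
  let ?V = "{v. \<exists>w\<in>S. 0 < w v}"
  assume inf: "infinite ?V"
  define g where "g v = (SOME w. w \<in> S \<and> 0 < w v)" for v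
  have g: "g v \<in> S \<and> 0 < g v v" if "v \<in> ?V" for v
  proof -
    have "\<exists>w. w \<in> S \<and> 0 < w v" using that by blast
    from someI_ex[OF this] show ?thesis unfolding g_def .
  qed
  have top: "S \<subseteq> topspace (realization K)"
    using assms by (rule compactin_subset_topspace)
  have supp: "finite {v. 0 < w v}" if w: "w \<in> S" for w
  proof -
    have "w \<in> topspace (realization K)"
      using w top by (rule rev_subsetD)
    then obtain C where "C \<in> K" "w \<in> cell K C"
      by (rule topspace_cellE)
    then have "{v. 0 < w v} \<subseteq> C"
      using cell_outside[of w K C] by force
    then show ?thesis
      using finite_cube[OF \<open>C \<in> K\<close>] finite_subset by blast
  qed
  \<comment> \<open>Each chosen point has finite support, so infinitely many vertices require
    infinitely many points.\<close>
  let ?Z = "g ` ?V"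
  have "?V \<subseteq> (\<Union>w\<in>?Z. {v. 0 < w v})"
    using g by blast
  moreover have "finite (\<Union>w\<in>?Z. {v. 0 < w v})" if "finite ?Z"
    using that g supp by (intro finite_UN_I) auto
  ultimately have "infinite ?Z"
    using inf finite_subset by blast
  moreover have "?Z \<subseteq> S" using g by blast
  ultimately have "S \<inter> realization K derived_set_of ?Z \<noteq> {}"
    using compactin_imp_Bolzano_Weierstrass[OF assms] by blast
  then obtain x where x: "x \<in> S" "x \<in> realization K derived_set_of ?Z" by blast
  have t1: "\<forall>S::('v \<Rightarrow> real) set. finite S \<longrightarrow> closedin euclidean S"
    using Hausdorff_imp_t1_space[OF Hausdorff_space_fun[where 'a = 'v]]
    unfolding t1_space_closedin_finite by simp
  \<comment> \<open>A point of \<open>?Z\<close> in a cell was chosen for a vertex of that cell, so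
    a cell meets \<open>?Z\<close> in a finite set. Hence \<open>x\<close> has a neighbourhood that
    avoids the rest of \<open>?Z\<close> and is not an accumulation point.\<close>
  have "closedin (realization K) (?Z - {x})"
  proof (rule closedin_realizationI)
    show "?Z - {x} \<subseteq> topspace (realization K)"
      using \<open>?Z \<subseteq> S\<close> top by blast
    fix C assume C: "C \<in> K"
    have "(?Z - {x}) \<inter> cell K C \<subseteq> g ` C"
    proof
      fix w assume "w \<in> (?Z - {x}) \<inter> cell K C"
      then obtain v where v: "v \<in> ?V" "w = g v" "w \<in> cell K C" by blast
      then have "v \<in> C"
        using g[OF v(1)] cell_outside[of w K C v] by force
      then show "w \<in> g ` C" using v by blast
    qed
    then have "finite ((?Z - {x}) \<inter> cell K C)"
      using finite_cube[OF C] finite_subset by blast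
    then have "closedin euclidean ((?Z - {x}) \<inter> cell K C)"
      using t1 by simp
    then show "closed ((?Z - {x}) \<inter> cell K C)" by simp
  qed
  then have op: "openin (realization K) (topspace (realization K) - (?Z - {x}))"
    by blast
  have xin: "x \<in> topspace (realization K) - (?Z - {x})"
    using x top by blast
  have "\<exists>y. y \<noteq> x \<and> y \<in> ?Z \<and> y \<in> topspace (realization K) - (?Z - {x})"
    by (rule x(2)[unfolded in_derived_set_of, THEN conjunct2, THEN spec, THEN mp, OF conjI[OF xin op]])
  then show False by blast
qed

lemma openin_star:
  "openin (realization K) {w \<in> topspace (realization K). \<exists>v\<in>Z. 0 < w v}"
proof -
  have "openin (realization K) {w \<in> topspace (realization K). w v \<in> {0<..}}" for v
    by (rule openin_continuous_map_preimage[OF continuous_map_coordinate]) simp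
  then have "openin (realization K) (\<Union>v\<in>Z. {w \<in> topspace (realization K). w v \<in> {0<..}})"
    by blast
  moreover have "(\<Union>v\<in>Z. {w \<in> topspace (realization K). w v \<in> {0<..}}) =
      {w \<in> topspace (realization K). \<exists>v\<in>Z. 0 < w v}"
    by auto
  ultimately show ?thesis by simp
qed

end

section \<open>Local systems on cube complexes\<close>

lemma cube_param_faceD:
  "cube_param K C n \<psi> \<Longrightarrow> D \<subseteq> C \<Longrightarrow> D \<in> K \<Longrightarrow> \<exists>L U. L \<subseteq> U \<and> U \<subseteq> {..<n} \<and> D = \<psi> ` {L..U}"
  by (simp add: cube_param_def)

text \<open>The edge is an interval with exactly two elements; inserting one missing element into
  its lower end must already give the upper end.\<close>

lemma cube_param_adjacentD:
  assumes \<psi>: "cube_param K C n \<psi>" and AB: "A \<subseteq> {..<n}" "B \<subseteq> {..<n}" "adjacent K (\<psi> A) (\<psi> B)"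
  shows "(\<exists>i<n. i \<notin> A \<and> B = insert i A) \<or> (\<exists>i<n. i \<notin> B \<and> A = insert i B)"
proof -
  have ne: "A \<noteq> B" and "{\<psi> A, \<psi> B} \<in> K"
    using AB(3) by (auto simp: adjacent_def)
  moreover have "{\<psi> A, \<psi> B} \<subseteq> C"
    using cube_param_in[OF \<psi>] AB by auto
  ultimately obtain L U where LU: "L \<subseteq> U" "U \<subseteq> {..<n}" "{\<psi> A, \<psi> B} = \<psi> ` {L..U}"
    using cube_param_faceD[OF \<psi>] by meson
  have inj: "inj_on \<psi> (Pow {..<n})"
    using \<psi> by (simp add: cube_param_def bij_betw_def)
  have sub: "{L..U} \<subseteq> Pow {..<n}"
    using LU(2) by (rule interval_subset_Pow)
  have "\<psi> ` {L..U} = \<psi> ` {A, B}"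
    using LU(3) by simp
  then have eq: "{L..U} = {A, B}"
    using inj_on_image_eq_iff[OF inj sub, of "{A, B}"] AB by simp
  have LU': "L \<in> {A, B}" "U \<in> {A, B}"
    using LU(1) unfolding eq[symmetric] by simp_all
  have *: "\<exists>i<n. i \<notin> P \<and> Q = insert i P" if PQ: "{P..Q} = {P, Q}" "P \<subseteq> Q" "P \<noteq> Q" "Q \<subseteq> {..<n}" for P Q
  proof -
    obtain i where i: "i \<in> Q" "i \<notin> P" using PQ(2,3) by blast
    have "insert i P \<in> {P..Q}" using i PQ(2) by (simp add: subset_insertI)
    then have "insert i P \<in> {P, Q}" unfolding PQ(1) .
    then have "insert i P = Q" using i by auto
    then show ?thesis using i PQ(4) by auto
  qed
  have "L \<noteq> U"
  proof
    assume "L = U"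
    then have "{A, B} = {L}" using eq by simp
    then show False using ne by (metis insertI1 insert_commute singletonD)
  qed
  then consider "L = A" "U = B" | "L = B" "U = A"
    using LU' by blast
  then show ?thesis
  proof cases
    case 1
    show ?thesis by (rule disjI1, rule *) (use 1 eq LU(1) AB ne in auto)
  next
    case 2
    show ?thesis by (rule disjI2, rule *) (use 2 eq LU(1) AB ne in auto)
  qed
qed

text \<open>The combinatorial data of a covering: fibres \<open>F\<close> over the vertices and
  transport \<open>T\<close> along edges. By \<open>T_sq\<close> transport commutes around squares,
  and this suffices for cubes of every dimension.\<close>

locale local_system = cubical K for K :: "'v set set" +
  fixes F :: "'v \<Rightarrow> 's set" and T :: "'v \<Rightarrow> 'v \<Rightarrow> 's \<Rightarrow> 's"
  assumes T_in: "\<And>u v s. adjacent K u v \<Longrightarrow> s \<in> F u \<Longrightarrow> T u v s \<in> F v"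
    and T_inv: "\<And>u v s. adjacent K u v \<Longrightarrow> s \<in> F u \<Longrightarrow> T v u (T u v s) = s"
    and T_sq: "\<And>a b c d s. square K a b c d \<Longrightarrow> s \<in> F a \<Longrightarrow> T b c (T a b s) = T d c (T a d s)"
begin

definition flat :: "'v set \<Rightarrow> ('v \<Rightarrow> 's) \<Rightarrow> bool" where
  "flat C \<sigma> \<longleftrightarrow> (\<forall>v\<in>C. \<sigma> v \<in> F v) \<and> (\<forall>v\<in>C. \<forall>w\<in>C. adjacent K v w \<longrightarrow> T v w (\<sigma> v) = \<sigma> w)"

lemma flat_subset: "flat C \<sigma> \<Longrightarrow> D \<subseteq> C \<Longrightarrow> flat D \<sigma>"
  unfolding flat_def by blast

text \<open>The section is built one direction at a time. On the new half of the cube it is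
  transported from the old half along direction \<open>k\<close>, and the squares spanned by
  \<open>k\<close> and an older direction make it flat there.\<close>

lemma flat_param:
  assumes \<psi>: "cube_param K C n \<psi>" and s: "s \<in> F (\<psi> {})" and "k \<le> n"
  shows "\<exists>\<tau>. \<tau> {} = s \<and> (\<forall>B\<subseteq>{..<k}. \<tau> B \<in> F (\<psi> B) \<and>
     (\<forall>i<k. i \<notin> B \<longrightarrow> T (\<psi> B) (\<psi> (insert i B)) (\<tau> B) = \<tau> (insert i B)))"
  using \<open>k \<le> n\<close>
proof (induction k)
  case 0
  show ?case
    using s by (intro exI[of _ "\<lambda>_. s"]) auto
next
  case (Suc k)
  then obtain \<tau> where \<tau>0: "\<tau> {} = s" and \<tau>F: "\<And>B. B \<subseteq> {..<k} \<Longrightarrow> \<tau> B \<in> F (\<psi> B)"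
    and \<tau>T: "\<And>B i. B \<subseteq> {..<k} \<Longrightarrow> i < k \<Longrightarrow> i \<notin> B \<Longrightarrow> T (\<psi> B) (\<psi> (insert i B)) (\<tau> B) = \<tau> (insert i B)"
    by auto
  define \<tau>' where "\<tau>' B = (if k \<in> B then T (\<psi> (B - {k})) (\<psi> B) (\<tau> (B - {k})) else \<tau> B)" for B
  have low: "B \<subseteq> {..<k}" if "B \<subseteq> {..<Suc k}" "k \<notin> B" for B
    using that less_Suc_eq by blast
  have low': "B - {k} \<subseteq> {..<k}" if "B \<subseteq> {..<Suc k}" for B
    using that less_Suc_eq by blast
  have sub: "B \<subseteq> {..<n}" if "B \<subseteq> {..<k}" for B
    using that Suc.prems by auto
  have kn: "k < n" using Suc.prems by simp
  show ?case
  proof (intro exI[of _ \<tau>'] conjI allI impI)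
    show "\<tau>' {} = s" by (simp add: \<tau>'_def \<tau>0)
    fix B assume B: "B \<subseteq> {..<Suc k}"
    show "\<tau>' B \<in> F (\<psi> B)"
    proof (cases "k \<in> B")
      case True
      then have "insert k (B - {k}) = B" by blast
      then have "adjacent K (\<psi> (B - {k})) (\<psi> B)"
        using cube_param_edge[OF \<psi> sub[OF low'[OF B]] kn] by simp
      then show ?thesis
        using T_in \<tau>F[OF low'[OF B]] True by (simp add: \<tau>'_def)
    qed (use \<tau>F[OF low[OF B]] in \<open>simp add: \<tau>'_def\<close>)
    fix i assume i: "i < Suc k" "i \<notin> B"
    show "T (\<psi> B) (\<psi> (insert i B)) (\<tau>' B) = \<tau>' (insert i B)"
    proof (cases "k \<in> B")
      case True
      define B0 where "B0 = B - {k}"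
      have B0: "B = insert k B0" "k \<notin> B0" "i \<notin> B0" "i < k" "B0 \<subseteq> {..<k}" "i \<noteq> k"
        using True i low'[OF B] less_Suc_eq[of i k] by (auto simp: B0_def)
      have "insert i B - {k} = insert i B0"
        using B0 by auto
      then have eq: "\<tau>' B = T (\<psi> B0) (\<psi> B) (\<tau> B0)"
          "\<tau>' (insert i B) = T (\<psi> (insert i B0)) (\<psi> (insert i B)) (\<tau> (insert i B0))"
        using True by (simp_all add: \<tau>'_def B0_def)
      have "square K (\<psi> B0) (\<psi> (insert i B0)) (\<psi> (insert i (insert k B0))) (\<psi> (insert k B0))"
        by (rule cube_param_square[OF \<psi> sub]) (use B0 kn in auto)
      then show ?thesis
        using T_sq[of "\<psi> B0" "\<psi> (insert i B0)" "\<psi> (insert i B)" "\<psi> B" "\<tau> B0"] \<tau>F[OF B0(5)]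
          \<tau>T[OF B0(5,4,3)] unfolding eq by (simp add: B0(1))
    next
      case False
      then show ?thesis
        using \<tau>T[OF low[OF B False], of i] i by (cases "i = k") (auto simp: \<tau>'_def)
    qed
  qed
qed

lemma flat_exists:
  assumes "C \<in> K" "u \<in> C" "s \<in> F u"
  obtains \<sigma> where "flat C \<sigma>" "\<sigma> u = s"
proof -
  obtain n \<psi> where \<psi>: "cube_param K C n \<psi>" "\<psi> {} = u"
    using rooted_param assms by metis
  obtain \<tau> where \<tau>0: "\<tau> {} = s" and \<tau>F: "\<And>B. B \<subseteq> {..<n} \<Longrightarrow> \<tau> B \<in> F (\<psi> B)"
    and \<tau>T: "\<And>B i. B \<subseteq> {..<n} \<Longrightarrow> i < n \<Longrightarrow> i \<notin> B \<Longrightarrow> T (\<psi> B) (\<psi> (insert i B)) (\<tau> B) = \<tau> (insert i B)"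
    using flat_param[OF \<psi>(1), of s n] assms \<psi>(2) by auto
  have bij: "bij_betw \<psi> (Pow {..<n}) C"
    using \<psi>(1) by (simp add: cube_param_def)
  define \<sigma> where "\<sigma> v = \<tau> (the_inv_into (Pow {..<n}) \<psi> v)" for v
  have \<sigma>: "\<sigma> (\<psi> B) = \<tau> B" if "B \<subseteq> {..<n}" for B
    using bij that by (simp add: \<sigma>_def bij_betw_def the_inv_into_f_f)
  have "\<sigma> v \<in> F v" if "v \<in> C" for v
    using that \<tau>F \<sigma> cube_param_image[OF \<psi>(1)] by auto
  moreover have "T v w (\<sigma> v) = \<sigma> w" if vw: "v \<in> C" "w \<in> C" "adjacent K v w" for v w
  proof -
    obtain A B where AB: "A \<subseteq> {..<n}" "B \<subseteq> {..<n}" "v = \<psi> A" "w = \<psi> B"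
      using vw cube_param_image[OF \<psi>(1)] by blast
    consider i where "i < n" "i \<notin> A" "B = insert i A" | i where "i < n" "i \<notin> B" "A = insert i B"
      using cube_param_adjacentD[OF \<psi>(1) AB(1,2)] vw(3) AB(3,4) by blast
    then show ?thesis
    proof cases
      case 1
      then show ?thesis using \<tau>T[OF AB(1)] \<sigma> AB by simp
    next
      case (2 i)
      have "adjacent K w v" using vw(3) adjacent_sym by metis
      then have "T v w (T w v (\<tau> B)) = \<tau> B"
        using T_inv \<tau>F[OF AB(2)] AB(4) by simp
      moreover have "T w v (\<tau> B) = \<tau> A"
        using \<tau>T[OF AB(2) 2(1,2)] 2(3) AB by simp
      ultimately show ?thesis using \<sigma> AB by simp
    qed
  qed
  ultimately have "flat C \<sigma>"
    by (simp add: flat_def)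
  moreover have "\<sigma> u = s"
    using \<sigma>[of "{}"] \<psi>(2) \<tau>0 by simp
  ultimately show ?thesis by (rule that)
qed

lemma flat_unique:
  assumes C: "C \<in> K" "u \<in> C" "v \<in> C" and "flat C \<sigma>" "flat C \<tau>" "\<sigma> u = \<tau> u"
  shows "\<sigma> v = \<tau> v"
proof -
  obtain n \<psi> where \<psi>: "cube_param K C n \<psi>" "\<psi> {} = u"
    using rooted_param C by metis
  have "\<sigma> (\<psi> B) = \<tau> (\<psi> B)" if "finite B" "B \<subseteq> {..<n}" for B
    using that
  proof (induction B)
    case empty
    then show ?case using \<psi>(2) assms(6) by simp
  next
    case (insert i B)
    have "adjacent K (\<psi> B) (\<psi> (insert i B))"
      using cube_param_edge[OF \<psi>(1)] insert by simp
    moreover have "\<psi> B \<in> C" "\<psi> (insert i B) \<in> C"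
      using cube_param_in[OF \<psi>(1)] insert by auto
    ultimately have "\<sigma> (\<psi> (insert i B)) = T (\<psi> B) (\<psi> (insert i B)) (\<sigma> (\<psi> B))"
        "\<tau> (\<psi> (insert i B)) = T (\<psi> B) (\<psi> (insert i B)) (\<tau> (\<psi> B))"
      using assms(4,5) unfolding flat_def by auto
    then show ?case using insert by simp
  qed
  then show ?thesis
    using C(3) cube_param_image[OF \<psi>(1)] finite_subset[OF _ finite_lessThan] by auto
qed

text \<open>Transport between any two vertices of a common cube, adjacent or not. The vertices that
  approximate a homotopy on a grid are known to share a cube but need not be adjacent.\<close>

definition tr :: "'v \<Rightarrow> 'v \<Rightarrow> 's \<Rightarrow> 's" where
  "tr u v s = (THE s'. \<exists>C \<sigma>. C \<in> K \<and> u \<in> C \<and> v \<in> C \<and> flat C \<sigma> \<and> \<sigma> u = s \<and> \<sigma> v = s')"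

text \<open>Two cubes that contain \<open>u\<close> and \<open>v\<close> meet in a cube containing
  both, and flat sections that agree at \<open>u\<close> agree on it. So the value depends neither
  on the cube nor on the section.\<close>

lemma tr_flat:
  assumes "C \<in> K" "flat C \<sigma>" "u \<in> C" "v \<in> C"
  shows "tr u v (\<sigma> u) = \<sigma> v"
  unfolding tr_def
proof (rule the_equality)
  show "\<exists>D \<tau>. D \<in> K \<and> u \<in> D \<and> v \<in> D \<and> flat D \<tau> \<and> \<tau> u = \<sigma> u \<and> \<tau> v = \<sigma> v"
    using assms by blast
  fix s' assume "\<exists>D \<tau>. D \<in> K \<and> u \<in> D \<and> v \<in> D \<and> flat D \<tau> \<and> \<tau> u = \<sigma> u \<and> \<tau> v = s'"
  then obtain D \<tau> where D: "D \<in> K" "u \<in> D" "v \<in> D" "flat D \<tau>" "\<tau> u = \<sigma> u" "\<tau> v = s'"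
    by blast
  have "C \<inter> D \<in> K"
    using inter_cube assms D by blast
  moreover have "flat (C \<inter> D) \<sigma>" "flat (C \<inter> D) \<tau>"
    using flat_subset[OF assms(2)] flat_subset[OF D(4)] by blast+
  ultimately have "\<tau> v = \<sigma> v"
    using flat_unique[of "C \<inter> D" u v \<tau> \<sigma>] assms D by blast
  then show "s' = \<sigma> v" using D by simp
qed

lemma tr_in:
  assumes "C \<in> K" "u \<in> C" "v \<in> C" "s \<in> F u"
  shows "tr u v s \<in> F v"
proof -
  obtain \<sigma> where "flat C \<sigma>" "\<sigma> u = s" using flat_exists assms by metis
  then show ?thesis using tr_flat[of C \<sigma> u v] assms by (auto simp: flat_def)
qed

lemma tr_comp:
  assumes "C \<in> K" "u \<in> C" "v \<in> C" "w \<in> C" "s \<in> F u"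
  shows "tr v w (tr u v s) = tr u w s"
proof -
  obtain \<sigma> where "flat C \<sigma>" "\<sigma> u = s" using flat_exists assms by metis
  then show ?thesis using tr_flat[of C \<sigma>] assms by metis
qed

lemma tr_refl:
  assumes "u \<in> \<Union>K" "s \<in> F u"
  shows "tr u u s = s"
proof -
  obtain \<sigma> where "flat {u} \<sigma>" "\<sigma> u = s" using flat_exists[of "{u}"] vertex_cube assms by blast
  then show ?thesis using tr_flat[of "{u}" \<sigma> u u] vertex_cube assms by simp
qed

lemma tr_adjacent:
  assumes "adjacent K u v" "s \<in> F u"
  shows "tr u v s = T u v s"
proof -
  have C: "{u, v} \<in> K" using assms by (simp add: adjacent_def)
  obtain \<sigma> where "flat {u, v} \<sigma>" "\<sigma> u = s" using flat_exists[OF C] assms by blast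
  then show ?thesis using tr_flat[of "{u, v}" \<sigma> u v] C assms by (auto simp: flat_def)
qed

primrec tp :: "(nat \<Rightarrow> 'v) \<Rightarrow> nat \<Rightarrow> 's \<Rightarrow> 's" where
  "tp V 0 s = s"
| "tp V (Suc n) s = tr (V n) (V (Suc n)) (tp V n s)"

lemma tp_in:
  assumes "\<And>i. i < n \<Longrightarrow> \<exists>C\<in>K. V i \<in> C \<and> V (Suc i) \<in> C" "s \<in> F (V 0)"
  shows "tp V n s \<in> F (V n)"
  using assms(1)
proof (induction n)
  case (Suc n)
  then have "tp V n s \<in> F (V n)" by simp
  moreover obtain C where "C \<in> K" "V n \<in> C" "V (Suc n) \<in> C" using Suc.prems by blast
  ultimately show ?case using tr_in by simp
qed (use assms in simp)

text \<open>Each rung and the next one lie in a common cube, inside which transport is independent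
  of the route.\<close>

lemma tp_ladder:
  assumes "\<And>i. i < n \<Longrightarrow> \<exists>C\<in>K. V i \<in> C \<and> V (Suc i) \<in> C \<and> W i \<in> C \<and> W (Suc i) \<in> C" "s \<in> F (V 0)"
  shows "tr (V n) (W n) (tp V n s) = tp W n (tr (V 0) (W 0) s)"
  using assms(1)
proof (induction n)
  case (Suc n)
  obtain C where C: "C \<in> K" "V n \<in> C" "V (Suc n) \<in> C" "W n \<in> C" "W (Suc n) \<in> C"
    using Suc.prems by blast
  have t: "tp V n s \<in> F (V n)"
    using tp_in[of n V s] Suc.prems assms(2) by (meson less_SucI)
  have "tr (V (Suc n)) (W (Suc n)) (tp V (Suc n) s) = tr (V n) (W (Suc n)) (tp V n s)"
    using tr_comp[of C "V n" "V (Suc n)" "W (Suc n)"] C t by simp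
  also have "\<dots> = tr (W n) (W (Suc n)) (tr (V n) (W n) (tp V n s))"
    using tr_comp[of C "V n" "W n" "W (Suc n)"] C t by simp
  finally show ?case using Suc by simp
qed simp

lemma tp_one_cube:
  assumes "C \<in> K" "\<And>i. i \<le> n \<Longrightarrow> V i \<in> C" "s \<in> F (V 0)"
  shows "tp V n s = tr (V 0) (V n) s"
  using assms(2)
proof (induction n)
  case 0
  then have "V 0 \<in> \<Union>K" using assms(1) by blast
  then show ?case using tr_refl assms(3) by simp
next
  case (Suc n)
  then show ?case using tr_comp[OF assms(1), of "V 0" "V n" "V (Suc n)" s] assms(3) by simp
qed

text \<open>In the block from \<open>k * M\<close> to \<open>Suc k * M\<close> the sequence
  \<open>V\<close> only moves between the ends of one edge, which is a cube. The block therefore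
  contributes the transport along that edge.\<close>

lemma tp_refinement:
  assumes x: "\<And>k. k < m \<Longrightarrow> adjacent K (x k) (x (Suc k))" "x 0 \<in> \<Union>K" and "0 < M"
    and V: "\<And>k. k \<le> m \<Longrightarrow> V (k * M) = x k"
    and V': "\<And>k i. k < m \<Longrightarrow> k * M \<le> i \<Longrightarrow> i \<le> Suc k * M \<Longrightarrow> V i \<in> {x k, x (Suc k)}"
    and s: "s \<in> F (x 0)" and "k \<le> m"
  shows "tp V (k * M) s = tp x k s"
  using \<open>k \<le> m\<close>
proof (induction k)
  case (Suc k)
  let ?C = "{x k, x (Suc k)}"
  have C: "?C \<in> K" using x(1)[of k] Suc.prems by (simp add: adjacent_def)
  have t: "tp x k s \<in> F (x k)"
  proof (rule tp_in)
    show "s \<in> F (x 0)" by (rule s)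
    fix i assume "i < k"
    then have "{x i, x (Suc i)} \<in> K" using x(1)[of i] Suc.prems by (simp add: adjacent_def)
    then show "\<exists>C\<in>K. x i \<in> C \<and> x (Suc i) \<in> C" by blast
  qed
  have "tp V (k * M + j) s = tr (x k) (V (k * M + j)) (tp x k s)" if "j \<le> M" for j
    using that
  proof (induction j)
    case 0
    have "x k \<in> \<Union>K" using C by blast
    then show ?case using Suc V[of k] t by (simp add: tr_refl)
  next
    case (Suc j)
    have "V (k * M + j) \<in> ?C" "V (Suc (k * M + j)) \<in> ?C"
      using V'[of k "k * M + j"] V'[of k "Suc (k * M + j)"] Suc.prems \<open>Suc k \<le> m\<close> by auto
    then show ?case
      using Suc tr_comp[OF C, of "x k" "V (k * M + j)" "V (Suc (k * M + j))"] t by simp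
  qed
  from this[of M] show ?case
    using V[of "Suc k"] Suc.prems by (simp add: add.commute)
qed simp

end

section \<open>Edge paths up to swaps across squares\<close>

text \<open>Edge paths are lists of vertices, read from the end of the path to its start.\<close>

primrec swap_eq :: "'v set set \<Rightarrow> nat \<Rightarrow> 'v list \<Rightarrow> 'v list \<Rightarrow> bool" where
  "swap_eq K 0 p q \<longleftrightarrow> (\<exists>z. p = [z] \<and> q = [z])"
| "swap_eq K (Suc n) p q \<longleftrightarrow> (\<exists>y x p' x' q'. p = y # x # p' \<and> q = y # x' # q' \<and>
     (x = x' \<and> swap_eq K n (x # p') (x' # q') \<or>
      (\<exists>w r. square K w x y x' \<and> swap_eq K n (x # p') (x # w # r) \<and> swap_eq K n (x' # q') (x' # w # r))))"

text \<open>The vertex \<open>y\<close> is appended to a path that ends at \<open>x\<close>. This is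
  a backtrack up to swaps if some path equivalent to \<open>x # p\<close> arrives at
  \<open>x\<close> from \<open>y\<close>, and that is excluded at every stage.\<close>

fun reduced_path :: "'v set set \<Rightarrow> 'v list \<Rightarrow> bool" where
  "reduced_path K [] \<longleftrightarrow> False"
| "reduced_path K [z] \<longleftrightarrow> True"
| "reduced_path K (y # x # p) \<longleftrightarrow> reduced_path K (x # p) \<and> \<not> (\<exists>q. swap_eq K (length p) (x # p) (x # y # q))"

lemma swap_eq_same:
  assumes "swap_eq K n (x # p) (x # q)" shows "swap_eq K (Suc n) (y # x # p) (y # x # q)"
  using assms by simp

lemma swap_eq_square:
  assumes "square K w x y x'" "swap_eq K n (x # p) (x # w # r)" "swap_eq K n (x' # q) (x' # w # r)"
  shows "swap_eq K (Suc n) (y # x # p) (y # x' # q)"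
  using assms by auto

lemma swap_eq_SucE:
  assumes "swap_eq K (Suc n) p q"
  obtains (same) y x p' q' where "p = y # x # p'" "q = y # x # q'" "swap_eq K n (x # p') (x # q')"
  | (swap) y x p' x' q' w r where "p = y # x # p'" "q = y # x' # q'" "square K w x y x'"
      "swap_eq K n (x # p') (x # w # r)" "swap_eq K n (x' # q') (x' # w # r)"
  using assms by auto

lemma swap_eq_length: "swap_eq K n p q \<Longrightarrow> length p = Suc n \<and> length q = Suc n"
proof (induction n arbitrary: p q)
  case (Suc n)
  from Suc.prems show ?case
    by (cases rule: swap_eq_SucE) (use Suc.IH in fastforce)+
qed auto

lemma swap_eq_hd: "swap_eq K n p q \<Longrightarrow> hd p = hd q"
  by (cases n) auto

lemma swap_eq_last: "swap_eq K n p q \<Longrightarrow> last p = last q"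
proof (induction n arbitrary: p q)
  case (Suc n)
  from Suc.prems show ?case
  proof (cases rule: swap_eq_SucE)
    case (same y x p' q')
    then show ?thesis using Suc.IH[OF same(3)] by simp
  next
    case (swap y x p' x' q' w r)
    then show ?thesis using Suc.IH[OF swap(4)] Suc.IH[OF swap(5)] by simp
  qed
qed auto

lemma swap_eq_refl: "length p = Suc n \<Longrightarrow> swap_eq K n p p"
proof (induction n arbitrary: p)
  case 0
  then show ?case by (cases p) auto
next
  case (Suc n)
  then obtain y x p' where p: "p = y # x # p'"
    by (metis length_Suc_conv)
  with Suc have "swap_eq K n (x # p') (x # p')" by simp
  then show ?case unfolding p by (rule swap_eq_same)
qed

lemma swap_eq_sym: "swap_eq K n p q \<Longrightarrow> swap_eq K n q p"
proof (induction n arbitrary: p q)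
  case (Suc n)
  from Suc.prems show ?case
  proof (cases rule: swap_eq_SucE)
    case (same y x p' q')
    then show ?thesis using Suc.IH[OF same(3)] swap_eq_same by metis
  next
    case (swap y x p' x' q' w r)
    show ?thesis unfolding swap(1,2)
      by (rule swap_eq_square[OF square_reflect[OF swap(3)] swap(5,4)])
  qed
qed auto

text \<open>The recursion in \<open>swap_eq\<close> compares the last edges: they agree, or they are
  sides of a square through whose fourth corner \<open>w\<close> both shortened paths can be routed.
  Equal last edges rule out the second case, so cancellation is immediate. The price of this form is
  that transitivity needs an argument.\<close>

lemma swap_eq_cancel:
  assumes "swap_eq K (Suc n) (y # x # p) (y # x # q)" shows "swap_eq K n (x # p) (x # q)"
  using assms by (cases rule: swap_eq_SucE) (auto simp: square_def)

lemma swap_eq_other: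
  assumes "swap_eq K n (y # x # p) (y # x' # q)" "x \<noteq> x'"
  obtains w r m where "n = Suc m" "square K w x y x'" "swap_eq K m (x # p) (x # w # r)"
    "swap_eq K m (x' # q) (x' # w # r)"
proof -
  have "n = Suc (length p)"
    using swap_eq_length[OF assms(1)] by simp
  with assms show ?thesis
    using that by auto
qed

locale flag_cubical = cubical K for K :: "'v set set" +
  assumes flags: "\<And>v. v \<in> \<Union>K \<Longrightarrow> flag (vertex_link K v)"
begin

text \<open>This is where the flag condition enters, in the form of the cube condition for squares at a
  vertex.\<close>

lemma swap_eq_trans:
  "swap_eq K n p q \<Longrightarrow> swap_eq K n q s \<Longrightarrow> swap_eq K n p s"
proof (induction n arbitrary: p q s)
  case 0
  then show ?case by auto
next
  case (Suc n)
  note IH = Suc.IH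
  from Suc.prems(1) show ?case
  proof (cases rule: swap_eq_SucE)
    case p: (same y x p' q')
    from Suc.prems(2) show ?thesis
    proof (cases rule: swap_eq_SucE)
      case q: (same y2 x2 q2 s')
      have "swap_eq K n (x # p') (x # s')"
        using IH p q by simp
      then have "swap_eq K (Suc n) (y # x # p') (y # x # s')"
        by (rule swap_eq_same)
      then show ?thesis using p q by simp
    next
      case q: (swap y2 x2 q2 x'' s' w r)
      have eq: "y2 = y" "x2 = x" "q2 = q'"
        using p(2) q(1) by simp_all
      have "swap_eq K n (x # p') (x # w # r)"
        using IH[OF p(3)] q(4) eq by simp
      then show ?thesis
        unfolding p(1) q(2) eq using q(3,5) eq by (intro swap_eq_square[of K w]) simp_all
    qed
  next
    case p: (swap y x p' x' q' w r)
    from Suc.prems(2) show ?thesis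
    proof (cases rule: swap_eq_SucE)
      case q: (same y2 x2 q2 s')
      have eq: "y2 = y" "x2 = x'" "q2 = q'"
        using p(2) q(1) by simp_all
      have "swap_eq K n (x' # s') (x' # w # r)"
        using IH[OF swap_eq_sym p(5)] q(3) eq by simp
      then show ?thesis
        unfolding p(1) q(2) eq using p(3,4) by (intro swap_eq_square[of K w]) simp_all
    next
      case q: (swap y2 x2 q2 x'' s' w' r')
      have eq: "y2 = y" "x2 = x'" "q2 = q'"
        using p(2) q(1) by simp_all
      note q' = q(2-)[unfolded eq]
      have mid: "swap_eq K n (x' # w # r) (x' # w' # r')"
        using IH[OF swap_eq_sym[OF p(5)] q'(3)] .
      then have n: "n = Suc (length r)"
        using swap_eq_length[OF mid] by simp
      define m where "m = length r"
      note m = n[folded m_def]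
      show ?thesis
      proof (cases "x = x''")
        case True
        \<comment> \<open>The two squares share the corners \<open>y\<close>, \<open>x\<close> and
          \<open>x'\<close>, hence they coincide.\<close>
        have "square K x' w x y" "square K x' w' x y"
          using p(3) q'(2) True by (metis square_rotate square_reflect)+
        then have "square K y x w x'" "square K y x w' x'"
          by (metis square_rotate square_reflect)+
        then have "w' = w"
          by (rule square_unique[symmetric])
        then have "swap_eq K m (w # r) (w # r')"
          using mid m swap_eq_cancel by metis
        then have "swap_eq K n (x # w # r) (x # w # r')"
          unfolding m by (rule swap_eq_same)
        then have "swap_eq K n (x # p') (x # s')"
          using IH[OF IH[OF p(4)] swap_eq_sym] q'(4) True \<open>w' = w\<close> by blast
        then have "swap_eq K (Suc n) (y # x # p') (y # x # s')"
          by (rule swap_eq_same)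
        then show ?thesis
          using p q' True by simp
      next
        case False
        have "w \<noteq> w'"
        proof
          assume "w = w'"
          then have "square K x' w x y" "square K x' w x'' y"
            using p(3) q'(2) by (metis square_rotate square_reflect)+
          then show False
            using square_unique False by blast
        qed
        with mid obtain t \<rho> m' where t: "n = Suc m'" "square K t w x' w'"
          "swap_eq K m' (w # r) (w # t # \<rho>)" "swap_eq K m' (w' # r') (w' # t # \<rho>)"
          by (rule swap_eq_other)
        have m': "m' = m" using m t(1) by simp
        have sq: "square K x' y x w" "square K x' w t w'" "square K x' y x'' w'"
          using p(3) q'(2) t(2) by (metis square_rotate square_reflect)+
        have "x' \<in> \<Union>K"
          using squareD(1)[OF sq(1)] by (rule adjacent_vertex)
        \<comment> \<open>The neighbours \<open>y\<close>, \<open>w\<close>, \<open>w'\<close> of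
          \<open>x'\<close> pairwise span squares. In the resulting 3-cube the corner
          \<open>T\<close> opposite to \<open>x'\<close> is adjacent to \<open>x\<close>,
          \<open>x''\<close> and \<open>t\<close>, so both outer paths can be routed through
          \<open>T\<close> and \<open>t\<close>.\<close>
        then obtain T where T: "square K y x T x''" "square K w x T t" "square K w' x'' T t"
          using flag_cube3[OF flags sq] by blast
        have "swap_eq K m (T # t # \<rho>) (T # t # \<rho>)"
          using swap_eq_length[OF t(3)] m' by (intro swap_eq_refl) simp
        then have "swap_eq K n (x # w # r) (x # T # t # \<rho>)" "swap_eq K n (x'' # w' # r') (x'' # T # t # \<rho>)"
          unfolding m using t(3,4) m' square_rotate[OF square_rotate[OF square_rotate[OF T(2)]]]
            square_rotate[OF square_rotate[OF square_rotate[OF T(3)]]] by (auto intro: swap_eq_square)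
        then have "swap_eq K n (x # p') (x # T # t # \<rho>)" "swap_eq K n (x'' # s') (x'' # T # t # \<rho>)"
          using IH p(4) q'(4) by blast+
        moreover have "square K T x y x''"
          using T(1) by (metis square_rotate square_reflect)
        ultimately show ?thesis
          unfolding p(1) q'(1) by (intro swap_eq_square)
      qed
    qed
  qed
qed

text \<open>Equivalent paths differ by swaps across squares, and a square carries a backtrack of one
  path to a backtrack of the other.\<close>

lemma swap_eq_reduced:
  "swap_eq K n p q \<Longrightarrow> reduced_path K p \<Longrightarrow> reduced_path K q"
proof (induction n arbitrary: p q)
  case 0
  then show ?case by auto
next
  case (Suc n)
  from Suc.prems(1) show ?case
  proof (cases rule: swap_eq_SucE)
    case (same y x p' q')
    have len: "length p' = n" "length q' = n"
      using swap_eq_length[OF same(3)] by simp_all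
    have p: "reduced_path K (x # p')" "\<not> (\<exists>r. swap_eq K n (x # p') (x # y # r))"
      using Suc.prems(2) same(1) len by auto
    have "\<not> (\<exists>r. swap_eq K n (x # q') (x # y # r))"
      using p(2) swap_eq_trans[OF same(3)] by blast
    then show ?thesis
      using Suc.IH[OF same(3) p(1)] same(2) len by simp
  next
    case (swap y x p' x' q' w r)
    have len: "length p' = n" "length q' = n" "n = Suc (length r)"
      using swap_eq_length[OF swap(4)] swap_eq_length[OF swap(5)] by simp_all
    have p: "reduced_path K (x # p')" "\<not> (\<exists>r. swap_eq K n (x # p') (x # y # r))"
      using Suc.prems(2) swap(1) len by auto
    have wr: "reduced_path K (w # r)" "\<not> (\<exists>s. swap_eq K (length r) (w # r) (w # x # s))"
      using Suc.IH[OF swap(4) p(1)] by auto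
    have sq: "square K x' w x y"
      using swap(3) by (metis square_rotate square_reflect)
    \<comment> \<open>If the path to \<open>w\<close> came from \<open>x'\<close>, replacing
      \<open>w\<close> by \<open>y\<close> in \<open>x # w # x' # s\<close> would make the path to
      \<open>x\<close> come from \<open>y\<close>, a backtrack of the given reduced path.\<close>
    have "\<not> swap_eq K (length r) (w # r) (w # x' # s)" for s
    proof
      assume a: "swap_eq K (length r) (w # r) (w # x' # s)"
      have "swap_eq K (length r) (y # x' # s) (y # x' # s)"
          "swap_eq K (length r) (w # x' # s) (w # x' # s)"
        using swap_eq_length[OF a] by (auto intro!: swap_eq_refl)
      then have "swap_eq K n (x # w # x' # s) (x # y # x' # s)"
        unfolding len(3) using sq by (intro swap_eq_square)
      moreover have "swap_eq K n (x # w # r) (x # w # x' # s)"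
        unfolding len(3) using a by (rule swap_eq_same)
      ultimately show False
        using p(2) swap(4) swap_eq_trans by blast
    qed
    then have "reduced_path K (x' # w # r)"
      using wr(1) by simp
    then have q: "reduced_path K (x' # q')"
      using Suc.IH swap_eq_sym[OF swap(5)] by blast
    \<comment> \<open>Arriving at \<open>x'\<close> both from \<open>w\<close> and from
      \<open>y\<close> gives a square at \<open>x'\<close> whose fourth corner is \<open>x\<close>
      by uniqueness. Then the path to \<open>w\<close> comes from \<open>x\<close>, although
      \<open>x # w # r\<close> is reduced.\<close>
    have "\<not> swap_eq K n (x' # q') (x' # y # s)" for s
    proof
      assume "swap_eq K n (x' # q') (x' # y # s)"
      then have "swap_eq K n (x' # w # r) (x' # y # s)"
        using swap_eq_trans swap_eq_sym[OF swap(5)] by blast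
      moreover have "w \<noteq> y"
        using squareD[OF swap(3)] by simp
      ultimately obtain u \<rho> m where u: "n = Suc m" "square K u w x' y"
        "swap_eq K m (w # r) (w # u # \<rho>)"
        by (rule swap_eq_other)
      have "square K x' w u y"
        using u(2) by (metis square_rotate square_reflect)
      then have "u = x"
        using sq square_unique by blast
      then show False
        using wr(2) u len by simp
    qed
    then show ?thesis
      using q swap(2) len by simp
  qed
qed

lemma swap_eq_walk:
  "swap_eq K n p q \<Longrightarrow> successively (adjacent K) p \<Longrightarrow> successively (adjacent K) q"
proof (induction n arbitrary: p q)
  case (Suc n)
  from Suc.prems(1) show ?case
  proof (cases rule: swap_eq_SucE)
    case (same y x p' q')
    then show ?thesis using Suc.IH[OF same(3)] Suc.prems(2) by simp
  next
    case (swap y x p' x' q' w r)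
    have "successively (adjacent K) (x # w # r)"
      using Suc.IH[OF swap(4)] Suc.prems(2) swap(1) by simp
    then have "successively (adjacent K) (x' # w # r)"
      using squareD[OF swap(3)] by simp
    then have "successively (adjacent K) (x' # q')"
      using Suc.IH[OF swap_eq_sym[OF swap(5)]] by simp
    then show ?thesis
      using squareD[OF swap(3)] swap(2) by simp
  qed
qed auto

end

text \<open>The coefficients are hat functions centred at the times \<open>k / m\<close>, so the
  path runs linearly from one vertex to the next. Written as a single sum it is continuous without
  any gluing.\<close>

definition edge_path :: "nat \<Rightarrow> (nat \<Rightarrow> 'v) \<Rightarrow> real \<Rightarrow> 'v \<Rightarrow> real" where
  "edge_path m x t = (\<lambda>u. \<Sum>k\<le>m. max 0 (1 - \<bar>t * real m - real k\<bar>) * vertex_point (x k) u)"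

lemma edge_path_segment:
  assumes "k < m" "real k \<le> t * real m" "t * real m \<le> real (Suc k)"
  shows "edge_path m x t =
    (\<lambda>u. (1 - (t * real m - real k)) * vertex_point (x k) u + (t * real m - real k) * vertex_point (x (Suc k)) u)"
proof
  fix u
  let ?f = "\<lambda>j. max 0 (1 - \<bar>t * real m - real j\<bar>) * vertex_point (x j) u"
  have "(\<Sum>j\<le>m. ?f j) = (\<Sum>j\<in>{k, Suc k}. ?f j)"
  proof (rule sum.mono_neutral_right)
    show "\<forall>i\<in>{..m} - {k, Suc k}. ?f i = 0"
    proof
      fix j assume "j \<in> {..m} - {k, Suc k}"
      then have "j < k \<or> Suc k < j" by auto
      then have "real j + 1 \<le> real k \<or> real (Suc k) + 1 \<le> real j" by linarith
      then have "\<bar>t * real m - real j\<bar> \<ge> 1" using assms by linarith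
      then show "?f j = 0" by simp
    qed
  qed (use assms in auto)
  then show "edge_path m x t u =
      (1 - (t * real m - real k)) * vertex_point (x k) u + (t * real m - real k) * vertex_point (x (Suc k)) u"
    using assms by (simp add: edge_path_def)
qed

lemma edge_path_vertex:
  assumes "k \<le> m" "t * real m = real k"
  shows "edge_path m x t = vertex_point (x k)"
proof
  fix u
  let ?f = "\<lambda>j. max 0 (1 - \<bar>t * real m - real j\<bar>) * vertex_point (x j) u"
  have "(\<Sum>j\<le>m. ?f j) = (\<Sum>j\<in>{k}. ?f j)"
  proof (rule sum.mono_neutral_right)
    show "\<forall>i\<in>{..m} - {k}. ?f i = 0"
    proof
      fix j assume "j \<in> {..m} - {k}"
      then have "j < k \<or> k < j" by auto
      then have "real j + 1 \<le> real k \<or> real k + 1 \<le> real j" by linarith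
      then have "\<bar>t * real m - real j\<bar> \<ge> 1" using assms by linarith
      then show "?f j = 0" by simp
    qed
  qed (use assms in auto)
  then show "edge_path m x t u = vertex_point (x k) u"
    using assms by (simp add: edge_path_def)
qed

lemma segment_exists:
  assumes "0 < m" "0 \<le> t" "t \<le> 1"
  obtains k where "k < m" "real k \<le> t * real m" "t * real m \<le> real (Suc k)"
proof (cases "t = 1")
  case True
  then show ?thesis using that[of "m - 1"] assms by simp
next
  case False
  define k where "k = nat \<lfloor>t * real m\<rfloor>"
  have "t * real m < 1 * real m"
    using False assms by (intro mult_strict_right_mono) auto
  moreover have "0 \<le> t * real m" using assms by simp
  ultimately have "real k \<le> t * real m" "t * real m < real k + 1" "real k < real m"
    unfolding k_def by linarith+
  then show ?thesis using that[of k] by simp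
qed

section \<open>From homotopies to grids of vertices\<close>

context cubical
begin

lemma edge_path_pathin:
  assumes "0 < m" "\<And>k. k < m \<Longrightarrow> adjacent K (x k) (x (Suc k))"
  shows "pathin (realization K) (edge_path m x)"
  unfolding pathin_def
proof (rule continuous_map_into_realization)
  show "continuous_map (top_of_set {0..1}) euclidean (edge_path m x)"
    by (simp add: continuous_on_fun_iff edge_path_def) (intro allI continuous_intros)
  show "finite ((\<lambda>k. {x k, x (Suc k)}) ` {..<m})" by simp
  show "(\<lambda>k. {x k, x (Suc k)}) ` {..<m} \<subseteq> K"
    using assms by (auto simp: adjacent_def)
  fix t :: real assume "t \<in> topspace (top_of_set {0..1})"
  then obtain k where k: "k < m" "real k \<le> t * real m" "t * real m \<le> real (Suc k)"
    using segment_exists[OF assms(1), of t] by auto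
  have "edge_path m x t \<in> cell K {x k, x (Suc k)}"
    unfolding edge_path_segment[OF k]
    by (rule edge_point_cell[OF cubical_axioms assms(2)[OF k(1)]]) (use k in auto)
  then show "\<exists>C\<in>(\<lambda>k. {x k, x (Suc k)}) ` {..<m}. edge_path m x t \<in> cell K C"
    using k(1) by blast
qed

text \<open>The preimages of the open stars of vertices cover the unit square, and a Lebesgue number
  of this cover determines how fine the grid has to be.\<close>

lemma uniform_stars:
  assumes h: "continuous_map (prod_topology (top_of_set {0..1::real}) (top_of_set {0..1::real})) (realization K) h"
  shows "\<exists>N0>0. \<forall>N\<ge>N0. \<forall>a\<in>{0..1}. \<forall>b\<in>{0..1}.
      \<exists>v. \<forall>a'\<in>{0..1}. \<forall>b'\<in>{0..1}. \<bar>a' - a\<bar> \<le> 1 / real N \<and> \<bar>b' - b\<bar> \<le> 1 / real N \<longrightarrow> 0 < h (a', b') v"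
proof -
  let ?S = "{0..1::real} \<times> {0..1::real}"
  have top: "prod_topology (top_of_set {0..1::real}) (top_of_set {0..1::real}) = top_of_set ?S"
    by (simp add: subtopology_Times[symmetric])
  have "\<exists>Q. open Q \<and> {z \<in> ?S. 0 < h z v} = ?S \<inter> Q" for v
  proof -
    have "openin (top_of_set ?S) {z \<in> topspace (top_of_set ?S). h z \<in> {w \<in> topspace (realization K). \<exists>u\<in>{v}. 0 < w u}}"
      using h unfolding top by (rule openin_continuous_map_preimage) (rule openin_star)
    moreover have "{z \<in> topspace (top_of_set ?S). h z \<in> {w \<in> topspace (realization K). \<exists>u\<in>{v}. 0 < w u}} =
        {z \<in> ?S. 0 < h z v}"
      using continuous_map_image_subset_topspace[OF h] unfolding top by auto
    ultimately show ?thesis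
      by (simp add: openin_open)
  qed
  then obtain Q where Q: "\<And>v. open (Q v)" "\<And>v. {z \<in> ?S. 0 < h z v} = ?S \<inter> Q v"
    by metis
  have cover: "?S \<subseteq> \<Union>(range Q)"
  proof
    fix z assume z: "z \<in> ?S"
    then have "h z \<in> topspace (realization K)"
      using continuous_map_image_subset_topspace[OF h] unfolding top by auto
    then obtain v where "0 < h z v"
      using topspace_cellE cell_positive by metis
    then have "z \<in> ?S \<inter> Q v"
      using z unfolding Q(2)[symmetric] by blast
    then show "z \<in> \<Union>(range Q)" by blast
  qed
  have "compact ?S" by (intro compact_Times compact_Icc)
  then obtain \<delta> where \<delta>: "0 < \<delta>" "\<And>T. T \<subseteq> ?S \<Longrightarrow> diameter T < \<delta> \<Longrightarrow> \<exists>B\<in>range Q. T \<subseteq> B"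
  proof (rule Lebesgue_number_lemma[OF _ _ cover])
    show "open B" if "B \<in> range Q" for B
      using that Q(1) by auto
  qed auto
  \<comment> \<open>Two points of \<open>?T\<close> below differ by at most \<open>2 / N\<close> in
    each coordinate, so the diameter is at most \<open>4 / N\<close>.\<close>
  obtain N0 :: nat where N0: "4 / \<delta> < real N0"
    using reals_Archimedean2 by blast
  have "0 < 4 / \<delta>" using \<delta>(1) by simp
  then have "0 < N0" using N0 by (metis less_trans of_nat_0_less_iff)
  then show ?thesis
  proof (intro exI[of _ N0] conjI allI impI ballI)
    fix N :: nat and a b :: real assume N: "N0 \<le> N" and "a \<in> {0..1}" "b \<in> {0..1}"
    let ?T = "{(a', b'). a' \<in> {0..1} \<and> b' \<in> {0..1} \<and> \<bar>a' - a\<bar> \<le> 1 / real N \<and> \<bar>b' - b\<bar> \<le> 1 / real N}"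
    have "4 / \<delta> < real N" using N N0 by linarith
    moreover have "0 < real N" using N \<open>0 < N0\<close> by simp
    ultimately have N4: "4 / real N < \<delta>"
      using \<delta>(1) \<open>0 < 4 / \<delta>\<close> by (simp add: field_simps)
    have "diameter ?T \<le> 4 / real N"
    proof (rule diameter_le)
      fix y z assume "y \<in> ?T" "z \<in> ?T"
      then obtain y1 y2 z1 z2 where yz: "y = (y1, y2)" "z = (z1, z2)"
        "\<bar>y1 - a\<bar> \<le> 1 / real N" "\<bar>y2 - b\<bar> \<le> 1 / real N" "\<bar>z1 - a\<bar> \<le> 1 / real N" "\<bar>z2 - b\<bar> \<le> 1 / real N"
        by auto
      have "norm (y - z) \<le> \<bar>y1 - z1\<bar> + \<bar>y2 - z2\<bar>"
        using norm_Pair_le[of "y1 - z1" "y2 - z2"] yz by simp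
      also have "\<dots> \<le> 4 * (1 / real N)" using yz by linarith
      finally show "norm (y - z) \<le> 4 / real N" by simp
    qed simp
    with N4 have "diameter ?T < \<delta>" by linarith
    moreover have "?T \<subseteq> ?S" by auto
    ultimately obtain v where v: "?T \<subseteq> Q v" using \<delta>(2) by blast
    have "0 < h (a', b') v" if "a' \<in> {0..1}" "b' \<in> {0..1}" "\<bar>a' - a\<bar> \<le> 1 / real N" "\<bar>b' - b\<bar> \<le> 1 / real N" for a' b'
    proof -
      have "(a', b') \<in> ?T" using that by simp
      then have "(a', b') \<in> ?S \<inter> Q v" using v that by blast
      then show ?thesis unfolding Q(2)[symmetric] by blast
    qed
    then show "\<exists>v. \<forall>a'\<in>{0..1}. \<forall>b'\<in>{0..1}. \<bar>a' - a\<bar> \<le> 1 / real N \<and> \<bar>b' - b\<bar> \<le> 1 / real N \<longrightarrow> 0 < h (a', b') v"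
      by blast
  qed
qed

lemma positive_common_cube:
  assumes "w \<in> topspace (realization K)"
  obtains C where "C \<in> K" "\<And>v. 0 < w v \<Longrightarrow> v \<in> C"
proof -
  obtain C where "C \<in> K" "w \<in> cell K C" using topspace_cellE[OF assms] .
  then show ?thesis using that[of C] cell_outside[of w K C] by force
qed

text \<open>A free homotopy between the constant loops at \<open>u\<close> and \<open>v\<close>
  traces a path from \<open>u\<close> to \<open>v\<close>. The stars of the vertices reachable from
  \<open>u\<close> and the stars of all others would disconnect its image, because vertices whose
  stars have a common point share a cube.\<close>

lemma vertices_connected:
  assumes sc: "simply_connected_space (realization K)" and uv: "u \<in> \<Union>K" "v \<in> \<Union>K"
  shows "(adjacent K)\<^sup>*\<^sup>* u v"
proof (rule ccontr)
  assume n: "\<not> (adjacent K)\<^sup>*\<^sup>* u v"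
  let ?Z = "{z. (adjacent K)\<^sup>*\<^sup>* u z}"
  let ?P = "\<lambda>_::real. vertex_point u" and ?Q = "\<lambda>_::real. vertex_point v"
  have "pathin (realization K) ?P" "pathin (realization K) ?Q"
    unfolding pathin_def using vertex_point_topspace uv by auto
  then have "homotopic_with (\<lambda>r. r 1 = r 0) (top_of_set {0..1}) (realization K) ?P ?Q"
    using sc unfolding simply_connected_space_def by blast
  then obtain h where h: "continuous_map (prod_topology (top_of_set {0..1::real}) (top_of_set {0..1::real})) (realization K) h"
    "\<And>t. h (0, t) = vertex_point u" "\<And>t. h (1, t) = vertex_point v"
    unfolding homotopic_with_def by auto
  have "continuous_map (top_of_set {0..1}) (prod_topology (top_of_set {0..1}) (top_of_set {0..1})) (\<lambda>a::real. (a, 0::real))"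
    by (intro continuous_map_pairedI) auto
  then have "continuous_map (top_of_set {0..1}) (realization K) (h \<circ> (\<lambda>a::real. (a, 0)))"
    using continuous_map_compose h(1) by blast
  then have "pathin (realization K) (\<lambda>a. h (a, 0))"
    by (simp add: pathin_def o_def)
  then have conn: "connectedin (realization K) ((\<lambda>a. h (a, 0)) ` {0..1})" (is "connectedin _ ?I")
    by (rule connectedin_path_image)
  let ?E = "\<lambda>Z. {w \<in> topspace (realization K). \<exists>v\<in>Z. 0 < w v}"
  have "?I \<subseteq> topspace (realization K)"
    using conn by (rule connectedin_subset_topspace)
  then have "?I \<subseteq> ?E ?Z \<union> ?E (- ?Z)"
    using topspace_cellE cell_positive by (smt (verit) ComplI UnI1 UnI2 mem_Collect_eq subset_iff)
  moreover have "?E ?Z \<inter> ?E (- ?Z) \<inter> ?I = {}"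
  proof (rule ccontr)
    assume "?E ?Z \<inter> ?E (- ?Z) \<inter> ?I \<noteq> {}"
    then obtain w a b where w: "w \<in> topspace (realization K)" "0 < w a" "0 < w b" "a \<in> ?Z" "b \<notin> ?Z"
      by blast
    obtain C where C: "C \<in> K" "a \<in> C" "b \<in> C"
      using positive_common_cube[OF w(1)] w by metis
    obtain n \<psi> where \<psi>: "cube_param K C n \<psi>" "\<psi> {} = a"
      using rooted_param C by metis
    have "(adjacent K)\<^sup>*\<^sup>* a (\<psi> B)" if "finite B" "B \<subseteq> {..<n}" for B
      using that
    proof (induction B)
      case (insert i B)
      then have "adjacent K (\<psi> B) (\<psi> (insert i B))"
        using cube_param_edge[OF \<psi>(1)] by simp
      then show ?case using insert by auto
    qed (use \<psi> in simp)
    then have "(adjacent K)\<^sup>*\<^sup>* a b"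
      using C(3) cube_param_image[OF \<psi>(1)] finite_subset[OF _ finite_lessThan] by auto
    then have "b \<in> ?Z" using w(4) by auto
    with w(5) show False by contradiction
  qed
  moreover have "vertex_point u \<in> ?I" "vertex_point v \<in> ?I"
    using h(2,3)[of 0, symmetric] by auto
  moreover have "vertex_point u \<in> ?E ?Z" "vertex_point v \<in> ?E (- ?Z)"
    using vertex_point_topspace uv n by (auto simp: vertex_point_def)
  ultimately show False
    using conn openin_star[of ?Z] openin_star[of "- ?Z"] unfolding connectedin by blast
qed

end

context local_system
begin

text \<open>The corners of a small square of the homotopy are sent to vertices whose open stars meet,
  so transport around the square is trivial.\<close>

theorem trivial_monodromy:
  assumes sc: "simply_connected_space (realization K)"
    and adj: "\<And>k. k < m \<Longrightarrow> adjacent K (x k) (x (Suc k))"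
    and closed: "x m = x 0" and x0: "x 0 \<in> \<Union>K" and s: "s \<in> F (x 0)"
  shows "tp x m s = s"
proof (cases "m = 0")
  case False
  then have m: "0 < m" by simp
  let ?p = "edge_path m x" and ?q = "\<lambda>_::real. vertex_point (x 0)"
  have p01: "?p 0 = vertex_point (x 0)" "?p 1 = vertex_point (x 0)"
    using edge_path_vertex[of 0 m 0 x] edge_path_vertex[of m m 1 x] closed by simp_all
  have "pathin (realization K) ?p" "pathin (realization K) ?q"
    using edge_path_pathin[of m x] m adj vertex_point_topspace[OF x0] by (auto simp: pathin_def)
  then have "homotopic_with (\<lambda>r. r 1 = r 0) (top_of_set {0..1}) (realization K) ?p ?q"
    using sc p01 unfolding simply_connected_space_def by simp
  then obtain h where h: "continuous_map (prod_topology (top_of_set {0..1::real}) (top_of_set {0..1::real})) (realization K) h"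
    "\<And>t. h (0, t) = ?p t" "\<And>t. h (1, t) = vertex_point (x 0)" "\<And>a. a \<in> {0..1} \<Longrightarrow> h (a, 1) = h (a, 0)"
    unfolding homotopic_with_def by auto
  have htop: "h (a, b) \<in> topspace (realization K)" if "a \<in> {0..1}" "b \<in> {0..1}" for a b
    using continuous_map_image_subset_topspace[OF h(1)] that by auto
  obtain M where M: "0 < M" "\<And>N a b. M \<le> N \<Longrightarrow> a \<in> {0..1} \<Longrightarrow> b \<in> {0..1} \<Longrightarrow>
      \<exists>v. \<forall>a'\<in>{0..1}. \<forall>b'\<in>{0..1}. \<bar>a' - a\<bar> \<le> 1 / real N \<and> \<bar>b' - b\<bar> \<le> 1 / real N \<longrightarrow> 0 < h (a', b') v"
    using uniform_stars[OF h(1)] by blast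
  \<comment> \<open>A multiple of \<open>m\<close>, so that the vertices \<open>x k\<close> of the
    loop sit at the grid points \<open>k * M\<close>; being at least \<open>M\<close>, it is fine
    enough for the stars.\<close>
  define N where "N = m * M"
  have N: "0 < N" "M \<le> N" using m M(1) by (auto simp: N_def)
  define c where "c i = real i / real N" for i
  have c01: "c i \<in> {0..1}" if "i \<le> N" for i
    using that N by (auto simp: c_def field_simps)
  have cc: "\<bar>c i - c i\<bar> \<le> 1 / real N" "\<bar>c i - c (Suc i)\<bar> \<le> 1 / real N" for i
    using N by (auto simp: c_def field_simps)
  have cN: "c N = 1" "c 0 = 0" using N by (auto simp: c_def)
  \<comment> \<open>The star of \<open>V j i\<close> contains the images of all points within one
    grid step of \<open>(c j, c i)\<close>. The stars of the vertices chosen at the corners of a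
    grid square thus have a common point.\<close>
  define V where "V j i = (SOME v. \<forall>a'\<in>{0..1}. \<forall>b'\<in>{0..1}.
      \<bar>a' - c j\<bar> \<le> 1 / real N \<and> \<bar>b' - c i\<bar> \<le> 1 / real N \<longrightarrow> 0 < h (a', b') v)" for j i
  have "\<forall>a'\<in>{0..1}. \<forall>b'\<in>{0..1}. \<bar>a' - c j\<bar> \<le> 1 / real N \<and> \<bar>b' - c i\<bar> \<le> 1 / real N \<longrightarrow> 0 < h (a', b') (V j i)"
    if "j \<le> N" "i \<le> N" for j i
    using someI_ex[OF M(2)[OF N(2) c01[OF that(1)] c01[OF that(2)]]] unfolding V_def .
  then have V: "0 < h (a', b') (V j i)"
    if "j \<le> N" "i \<le> N" "a' \<in> {0..1}" "b' \<in> {0..1}" "\<bar>a' - c j\<bar> \<le> 1 / real N" "\<bar>b' - c i\<bar> \<le> 1 / real N" for j i a' b'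
    using that by blast
  \<comment> \<open>The two ends of a row have the same image, but the vertices chosen there may
    differ. An extra step from \<open>V j N\<close> back to \<open>V j 0\<close> closes the
    row.\<close>
  define W where "W j i = (if i \<le> N then V j i else V j 0)" for j i
  have cube: "\<exists>C\<in>K. W j i \<in> C \<and> W j (Suc i) \<in> C \<and> W (Suc j) i \<in> C \<and> W (Suc j) (Suc i) \<in> C"
    if ji: "j < N" "i < Suc N" for j i
  proof (cases "i < N")
    case True
    let ?w = "h (c j, c i)"
    have "0 < ?w (V j i)" "0 < ?w (V j (Suc i))" "0 < ?w (V (Suc j) i)" "0 < ?w (V (Suc j) (Suc i))"
      using True ji(1) by (auto intro!: V c01 cc simp del: of_nat_Suc)
    moreover obtain C where "C \<in> K" "\<And>v. 0 < ?w v \<Longrightarrow> v \<in> C"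
      using positive_common_cube[OF htop[OF c01 c01]] True ji by (metis less_imp_le)
    ultimately show ?thesis using True by (auto simp: W_def)
  next
    case False
    then have i: "i = N" using ji by simp
    let ?w = "h (c j, 1)"
    have eq: "?w = h (c j, 0)" using h(4)[OF c01] ji by simp
    have "0 < ?w (V j N)" "0 < ?w (V (Suc j) N)"
      using ji(1) cN by (auto intro!: V c01 cc)
    moreover have "0 < ?w (V j 0)" "0 < ?w (V (Suc j) 0)"
      unfolding eq using ji(1) cN by (auto intro!: V c01 cc)
    moreover obtain C where "C \<in> K" "\<And>v. 0 < ?w v \<Longrightarrow> v \<in> C"
      using positive_common_cube[OF htop[of "c j" 1]] c01[of j] ji by auto
    ultimately show ?thesis using i by (auto simp: W_def)
  qed
  \<comment> \<open>Downward induction from the row \<open>N\<close>, where the homotopy has become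
    constant, to the row 0, which traverses the loop.\<close>
  have row: "tp (W j) (Suc N) r = r" if "j \<le> N" "r \<in> F (V j 0)" for j r
    using that
  proof (induction arbitrary: r rule: inc_induct)
    case base
    have "V N i = x 0" if "i \<le> N" for i
      using V[of N i 1 "c i"] that c01 cc cN h(3) by (auto simp: vertex_point_def split: if_splits)
    then have WN: "W N i = x 0" for i by (simp add: W_def)
    have "tp (W N) (Suc N) r = tr (W N 0) (W N (Suc N)) r"
      using WN x0 vertex_cube base by (intro tp_one_cube[of "{x 0}"]) (auto simp: W_def)
    also have "\<dots> = r"
      using WN[of 0] WN[of "Suc N"] x0 base tr_refl[OF x0] by (simp add: W_def)
    finally show ?case .
  next
    case (step j)
    obtain C where C: "C \<in> K" "V j 0 \<in> C" "V (Suc j) 0 \<in> C"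
      using cube[of j 0] step.hyps by (auto simp: W_def)
    let ?t = "tp (W j) (Suc N) r"
    have W0: "W j 0 = V j 0" "W j (Suc N) = V j 0" "W (Suc j) 0 = V (Suc j) 0" "W (Suc j) (Suc N) = V (Suc j) 0"
      by (simp_all add: W_def)
    have "tr (W j (Suc N)) (W (Suc j) (Suc N)) ?t = tp (W (Suc j)) (Suc N) (tr (W j 0) (W (Suc j) 0) r)"
      by (rule tp_ladder) (use cube step W0 in auto)
    also have "\<dots> = tr (W j 0) (W (Suc j) 0) r"
      unfolding W0 by (rule step.IH) (use tr_in[OF C step.prems] in simp)
    finally have eq: "tr (V j 0) (V (Suc j) 0) ?t = tr (V j 0) (V (Suc j) 0) r"
      unfolding W0 .
    have "\<exists>C\<in>K. W j i \<in> C \<and> W j (Suc i) \<in> C" if "i < Suc N" for i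
      using cube[of j i] that step.hyps by blast
    then have t: "?t \<in> F (V j 0)"
      using tp_in[of "Suc N" "W j" r] step.prems W0 by simp
    have "V j 0 \<in> \<Union>K" using C by blast
    then have "tr (V (Suc j) 0) (V j 0) (tr (V j 0) (V (Suc j) 0) u) = u" if "u \<in> F (V j 0)" for u
      using tr_comp[OF C(1,2,3,2) that] tr_refl that by simp
    then show ?case
      using eq t step.prems by metis
  qed
  have t: "c i * real m = real i / real M" for i
    using m M by (simp add: c_def N_def)
  have V0: "V 0 (k * M) = x k" if "k \<le> m" for k
  proof -
    have le: "k * M \<le> N" using that by (simp add: N_def)
    have "0 < h (0, c (k * M)) (V 0 (k * M))"
      using V[of 0 "k * M" 0 "c (k * M)"] le c01[OF le] cc cN by simp
    moreover have "h (0, c (k * M)) = vertex_point (x k)"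
      unfolding h(2) by (rule edge_path_vertex[OF that]) (use t[of "k * M"] M in simp)
    ultimately show ?thesis by (simp add: vertex_point_def split: if_splits)
  qed
  \<comment> \<open>On row 0 a chosen vertex has positive weight at a point of an edge of the loop,
    so it is an end of that edge, and it is \<open>x k\<close> at the grid point
    \<open>k * M\<close>.\<close>
  have "tp (W 0) (m * M) s = tp x m s"
  proof (rule tp_refinement[OF adj x0 M(1) _ _ s order_refl])
    show "W 0 (k * M) = x k" if "k \<le> m" for k
      using V0[OF that] that by (simp add: W_def N_def)
    fix k i assume k: "k < m" "k * M \<le> i" "i \<le> Suc k * M"
    have "Suc k * M \<le> m * M" using k(1) by (intro mult_right_mono) auto
    then have le: "i \<le> N" using k(3) by (simp add: N_def)
    have "0 < h (0, c i) (V 0 i)"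
      using V[of 0 i 0 "c i"] le c01[OF le] cc cN by simp
    moreover have "real k \<le> c i * real m" "c i * real m \<le> real (Suc k)"
    proof -
      have "real (k * M) \<le> real i" "real i \<le> real (Suc k * M)"
        using k(2,3) by (simp_all only: of_nat_le_iff)
      then show "real k \<le> c i * real m" "c i * real m \<le> real (Suc k)"
        unfolding t using M by (simp_all add: field_simps)
    qed
    ultimately have "V 0 i \<in> {x k, x (Suc k)}"
      unfolding h(2) by (subst (asm) edge_path_segment[OF k(1)]) (auto simp: vertex_point_def split: if_splits)
    then show "W 0 i \<in> {x k, x (Suc k)}"
      using le by (simp add: W_def)
  qed
  then have eq: "tp (W 0) N s = tp x m s" by (simp add: N_def)
  have V00: "V 0 0 = x 0" "V 0 N = x 0"
    using V0[of 0] V0[of m] closed by (simp_all add: N_def)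
  have "tp x m s \<in> F (x m)"
  proof (rule tp_in)
    show "\<exists>C\<in>K. x i \<in> C \<and> x (Suc i) \<in> C" if "i < m" for i
      using adj[OF that] unfolding adjacent_def by blast
  qed (rule s)
  then have "tp (W 0) (Suc N) s = tp x m s"
    using eq V00 closed x0 by (simp add: W_def tr_refl)
  then show ?thesis
    using row[of 0 s] s V00 by simp
qed simp

end

section \<open>The local system of reduced path classes\<close>

context flag_cubical
begin

definition path_class :: "'v list \<Rightarrow> 'v list set" where
  "path_class p = {q. swap_eq K (length p - 1) p q}"

definition states :: "'v \<Rightarrow> 'v \<Rightarrow> 'v list set set" where
  "states z v = path_class ` {p. successively (adjacent K) p \<and> reduced_path K p \<and> hd p = v \<and> last p = z}"

text \<open>The step from \<open>u\<close> to \<open>v\<close> cancels the last edge if some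
  representative of the class arrives at \<open>u\<close> from \<open>v\<close>, and appends an edge
  otherwise. By \<open>path_step_down\<close> and \<open>path_step_up\<close> the chosen
  representative does not matter.\<close>

definition path_step :: "'v \<Rightarrow> 'v \<Rightarrow> 'v list set \<Rightarrow> 'v list set" where
  "path_step u v c = (if \<exists>r. u # v # r \<in> c then path_class (v # (SOME r. u # v # r \<in> c))
     else path_class (v # (SOME p. p \<in> c)))"

lemma path_class_eq: "swap_eq K n p q \<Longrightarrow> path_class p = path_class q"
proof -
  assume e: "swap_eq K n p q"
  have "swap_eq K n p s \<longleftrightarrow> swap_eq K n q s" for s
    using swap_eq_trans[OF e] swap_eq_trans[OF swap_eq_sym[OF e]] by blast
  then show ?thesis
    using swap_eq_length[OF e] by (simp add: path_class_def)
qed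

lemma path_class_self: "p \<noteq> [] \<Longrightarrow> p \<in> path_class p"
  unfolding path_class_def by (cases p) (auto intro: swap_eq_refl)

lemma path_classD: "q \<in> path_class p \<Longrightarrow> swap_eq K (length p - 1) p q"
  by (simp add: path_class_def)

lemma path_step_down:
  assumes r: "u # v # r \<in> path_class p"
  shows "path_step u v (path_class p) = path_class (v # r)"
proof -
  define r' where "r' = (SOME r. u # v # r \<in> path_class p)"
  have r': "u # v # r' \<in> path_class p"
    unfolding r'_def using r by (rule someI)
  have "swap_eq K (length p - 1) (u # v # r) (u # v # r')"
    using swap_eq_trans[OF swap_eq_sym[OF path_classD[OF r]] path_classD[OF r']] .
  moreover from this have "length p - 1 = Suc (length r)"
    using swap_eq_length by fastforce
  ultimately have "swap_eq K (length r) (v # r) (v # r')"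
    using swap_eq_cancel by metis
  moreover have "path_step u v (path_class p) = path_class (v # r')"
    using r unfolding path_step_def r'_def by auto
  ultimately show ?thesis
    using path_class_eq by metis
qed

lemma path_step_up:
  assumes "\<And>r. u # v # r \<notin> path_class (u # p)"
  shows "path_step u v (path_class (u # p)) = path_class (v # u # p)"
proof -
  define q where "q = (SOME q. q \<in> path_class (u # p))"
  have "q \<in> path_class (u # p)"
    unfolding q_def using path_class_self[of "u # p"] by (intro someI) simp
  then have e: "swap_eq K (length p) (u # p) q"
    using path_classD by fastforce
  then obtain q' where "q = u # q'"
    using swap_eq_hd[OF e] swap_eq_length[OF e] by (cases q) auto
  then have "swap_eq K (Suc (length p)) (v # u # p) (v # q)"
    using e swap_eq_same by metis
  moreover have "path_step u v (path_class (u # p)) = path_class (v # q)"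
    using assms unfolding path_step_def q_def by auto
  ultimately show ?thesis
    using path_class_eq by metis
qed

lemma statesE:
  assumes "c \<in> states z u"
  obtains p where "c = path_class (u # p)" "successively (adjacent K) (u # p)" "reduced_path K (u # p)" "last (u # p) = z"
proof -
  obtain p where p: "c = path_class p" "successively (adjacent K) p" "reduced_path K p" "hd p = u" "last p = z"
    using assms by (auto simp: states_def)
  then obtain p' where "p = u # p'" by (cases p) auto
  then show ?thesis using that p by blast
qed

lemma statesI:
  "successively (adjacent K) (u # p) \<Longrightarrow> reduced_path K (u # p) \<Longrightarrow> last (u # p) = z \<Longrightarrow> path_class (u # p) \<in> states z u"
  unfolding states_def by (intro image_eqI[OF refl]) simp

lemma path_class_member:
  assumes "q \<in> path_class p"
  shows "path_class q = path_class p" "reduced_path K p \<Longrightarrow> reduced_path K q"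
    "successively (adjacent K) p \<Longrightarrow> successively (adjacent K) q" "last q = last p" "length q = length p"
proof -
  note e = path_classD[OF assms]
  show "path_class q = path_class p" using path_class_eq[OF e] by simp
  show "reduced_path K p \<Longrightarrow> reduced_path K q" using swap_eq_reduced[OF e] .
  show "successively (adjacent K) p \<Longrightarrow> successively (adjacent K) q" using swap_eq_walk[OF e] .
  show "last q = last p" using swap_eq_last[OF e] by simp
  show "length q = length p" using swap_eq_length[OF e] by simp
qed

lemma reduced_extend:
  "reduced_path K (v # u # p) \<longleftrightarrow> reduced_path K (u # p) \<and> (\<forall>r. u # v # r \<notin> path_class (u # p))"
  by (simp add: path_class_def)

lemma path_step_in:
  assumes "adjacent K u v" "c \<in> states z u"
  shows "path_step u v c \<in> states z v"
  using assms(2)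
proof (cases rule: statesE)
  case (1 p)
  show ?thesis
  proof (cases "\<exists>r. u # v # r \<in> path_class (u # p)")
    case True
    then obtain r where r: "u # v # r \<in> path_class (u # p)" by blast
    note m = path_class_member[OF r]
    have "path_class (v # r) \<in> states z v"
      using m(2-4) 1 by (intro statesI) auto
    then show ?thesis
      using path_step_down[OF r] 1 by simp
  next
    case False
    then have "reduced_path K (v # u # p)"
      using 1 by (intro reduced_extend[THEN iffD2]) blast
    then have "path_class (v # u # p) \<in> states z v"
      using 1 assms(1) by (intro statesI) (auto simp: adjacent_sym)
    then show ?thesis
      using path_step_up[of u v p] False 1 by simp
  qed
qed

text \<open>Cancelling and appending undo each other: if a reduced path arriving at \<open>u\<close>
  from \<open>v\<close> is shortened to \<open>v\<close>, reducedness prevents the shortened path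
  from being equivalent to one that arrives at \<open>v\<close> from \<open>u\<close>.\<close>

lemma path_step_inverse:
  assumes "c \<in> states z u"
  shows "path_step v u (path_step u v c) = c"
  using assms
proof (cases rule: statesE)
  case (1 p)
  show ?thesis
  proof (cases "\<exists>r. u # v # r \<in> path_class (u # p)")
    case True
    then obtain r where r: "u # v # r \<in> path_class (u # p)" by blast
    note m = path_class_member[OF r]
    have "reduced_path K (u # v # r)" using m(2) 1 by simp
    then have "path_step v u (path_class (v # r)) = path_class (u # v # r)"
      using reduced_extend by (intro path_step_up) blast
    then show ?thesis
      using path_step_down[OF r] m(1) 1 by simp
  next
    case False
    have "path_step v u (path_class (v # u # p)) = path_class (u # p)"
      by (rule path_step_down) (simp add: path_class_self)
    then show ?thesis
      using path_step_up[of u v p] False 1 by simp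
  qed
qed

text \<open>The step to \<open>b\<close> cancels and the step to \<open>d\<close> extends. Then the
  step from \<open>b\<close> to \<open>c\<close> extends, since otherwise a swap across the square
  would let the path arrive at \<open>a\<close> from \<open>d\<close>; and the step from
  \<open>d\<close> to \<open>c\<close> cancels after such a swap.\<close>

lemma path_step_square_mixed:
  assumes sq: "square K a b c d" and p: "c' = path_class (a # p)"
    and b: "a # b # r \<in> path_class (a # p)" and d: "\<And>r. a # d # r \<notin> path_class (a # p)"
  shows "path_step b c (path_step a b c') = path_step d c (path_step a d c')"
proof -
  note m = path_class_member[OF b]
  have len: "length p = Suc (length r)" using m(5) by simp
  have up: "path_step b c (path_class (b # r)) = path_class (c # b # r)"
  proof (rule path_step_up)
    fix \<rho>
    show "b # c # \<rho> \<notin> path_class (b # r)"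
    proof
      assume "b # c # \<rho> \<in> path_class (b # r)"
      then have e: "swap_eq K (length r) (b # r) (b # c # \<rho>)"
        using path_classD by fastforce
      have "square K c b a d" using sq by (metis square_rotate square_reflect)
      moreover have e': "swap_eq K (length r) (d # c # \<rho>) (d # c # \<rho>)"
        using swap_eq_length[OF e] by (intro swap_eq_refl) simp
      ultimately have "swap_eq K (Suc (length r)) (a # b # r) (a # d # c # \<rho>)"
        by (intro swap_eq_square[OF _ e e'])
      then have "a # d # c # \<rho> \<in> path_class (a # b # r)"
        by (simp add: path_class_def)
      then show False using d m(1) by blast
    qed
  qed
  have e: "swap_eq K (Suc (length r)) (a # p) (a # b # r)"
    using path_classD[OF b] len by simp
  have e': "swap_eq K (Suc (length r)) (c # b # r) (c # b # r)"
    by (rule swap_eq_refl) simp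
  have "square K b a d c" using sq by (metis square_rotate square_reflect)
  then have "swap_eq K (Suc (Suc (length r))) (d # a # p) (d # c # b # r)"
    by (rule swap_eq_square[OF _ e e'])
  then have "d # c # b # r \<in> path_class (d # a # p)"
    using len by (simp add: path_class_def)
  then have "path_step d c (path_class (d # a # p)) = path_class (c # b # r)"
    by (rule path_step_down)
  then show ?thesis
    unfolding p path_step_down[OF b] path_step_up[OF d] up by simp
qed

text \<open>Four cases, according to whether the steps to \<open>b\<close> and to \<open>d\<close>
  cancel or extend. If both cancel, the two representatives have different last edges and meet in
  \<open>c\<close> by uniqueness of squares; if both extend, the results differ by one swap across
  the given square.\<close>

lemma path_step_square:
  assumes sq: "square K a b c d" and c': "c' \<in> states z a"
  shows "path_step b c (path_step a b c') = path_step d c (path_step a d c')"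
  using c'
proof (cases rule: statesE)
  case (1 p)
  consider r r' where "a # b # r \<in> path_class (a # p)" "a # d # r' \<in> path_class (a # p)"
    | r where "a # b # r \<in> path_class (a # p)" "\<forall>r. a # d # r \<notin> path_class (a # p)"
    | r where "\<forall>r. a # b # r \<notin> path_class (a # p)" "a # d # r \<in> path_class (a # p)"
    | "\<forall>r. a # b # r \<notin> path_class (a # p)" "\<forall>r. a # d # r \<notin> path_class (a # p)"
    by blast
  then show ?thesis
  proof cases
    case (1 r r')
    have "swap_eq K (length p) (a # p) (a # b # r)" "swap_eq K (length p) (a # p) (a # d # r')"
      using path_classD[OF 1(1)] path_classD[OF 1(2)] by simp_all
    then have "swap_eq K (length p) (a # b # r) (a # d # r')"
      using swap_eq_trans[OF swap_eq_sym] by blast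
    then obtain w \<rho> m where w: "length p = Suc m" "square K w b a d"
       "swap_eq K m (b # r) (b # w # \<rho>)" "swap_eq K m (d # r') (d # w # \<rho>)"
      by (rule swap_eq_other) (use squareD[OF sq] in blast)
    have "square K a b w d" using w(2) by (metis square_rotate square_reflect)
    then have "w = c" using sq square_unique by metis
    then have "b # c # \<rho> \<in> path_class (b # r)" "d # c # \<rho> \<in> path_class (d # r')"
      using w swap_eq_length[OF w(3)] swap_eq_length[OF w(4)] by (simp_all add: path_class_def)
    then show ?thesis
      unfolding \<open>c' = _\<close> path_step_down[OF 1(1)] path_step_down[OF 1(2)] by (simp add: path_step_down)
  next
    case (2 r)
    show ?thesis
      by (rule path_step_square_mixed[OF sq \<open>c' = _\<close> 2(1)]) (use 2 in blast)
  next
    case (3 r)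
    show ?thesis
      by (rule path_step_square_mixed[OF square_reflect[OF sq] \<open>c' = _\<close> 3(2), symmetric]) (use 3 in blast)
  next
    case 4
    have up: "path_step b' c (path_class (b' # a # p)) = path_class (c # b' # a # p)"
      if sq': "square K a b' c d'" and no: "\<forall>r. a # d' # r \<notin> path_class (a # p)" for b' d'
    proof (rule path_step_up)
      fix \<rho>
      show "b' # c # \<rho> \<notin> path_class (b' # a # p)"
      proof
        assume "b' # c # \<rho> \<in> path_class (b' # a # p)"
        then have "swap_eq K (Suc (length p)) (b' # a # p) (b' # c # \<rho>)"
          using path_classD by fastforce
        then obtain w \<rho>' m where w: "Suc (length p) = Suc m" "square K w a b' c"
           "swap_eq K m (a # p) (a # w # \<rho>')"
          by (rule swap_eq_other) (use squareD[OF sq'] in blast)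
        have "square K b' a w c" "square K b' a d' c"
          using w(2) sq' by (metis square_rotate square_reflect)+
        then have "w = d'" by (rule square_unique)
        then show False using no w by (simp add: path_class_def)
      qed
    qed
    have e: "swap_eq K (Suc (length p)) (b # a # p) (b # a # p)" "swap_eq K (Suc (length p)) (d # a # p) (d # a # p)"
      by (rule swap_eq_refl; simp)+
    have "swap_eq K (Suc (Suc (length p))) (c # b # a # p) (c # d # a # p)"
      by (rule swap_eq_square[OF sq e])
    then have "path_class (c # b # a # p) = path_class (c # d # a # p)"
      by (rule path_class_eq)
    then show ?thesis
      unfolding \<open>c' = _\<close> using up[OF sq] up[OF square_reflect[OF sq]] 4 by (simp add: path_step_up)
  qed
qed

lemma local_system_states: "local_system K (states z) path_step"
  by unfold_locales (rule path_step_in path_step_inverse path_step_square; assumption)+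

end

section \<open>Combinatorial distance\<close>

lemma vdist_relpowp: "vdist K x y = (LEAST n. (adjacent K ^^ n) x y)"
  unfolding vdist_def relpowp_fun_conv ..

lemma vdist_le: "(adjacent K ^^ n) x y \<Longrightarrow> vdist K x y \<le> n"
  unfolding vdist_relpowp by (rule Least_le)

lemma relpowp_adjacent_sym: "(adjacent K ^^ n) x y \<Longrightarrow> (adjacent K ^^ n) y x"
proof (induction n arbitrary: y)
  case (Suc n)
  then obtain w where "(adjacent K ^^ n) x w" "adjacent K w y" by auto
  then have "adjacent K y w" "(adjacent K ^^ n) w x"
    using Suc.IH by (auto simp: adjacent_sym)
  then show ?case by (rule relpowp_Suc_I2)
qed auto

lemma vdist_sym: "vdist K x y = vdist K y x"
  unfolding vdist_relpowp by (rule arg_cong[where f = Least]) (auto intro: relpowp_adjacent_sym)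

lemma vdist_self [simp]: "vdist K x x = 0"
  using vdist_le[where n = 0 and x = x and y = x] by simp

lemma vdist_adjacent_le: "adjacent K x y \<Longrightarrow> vdist K x y \<le> 1"
proof -
  assume "adjacent K x y"
  then have "(adjacent K ^^ 1) x y" by (subst relpowp_1)
  then show ?thesis by (rule vdist_le)
qed

lemma walk_relpowp:
  "p \<noteq> [] \<Longrightarrow> successively (adjacent K) p \<Longrightarrow> (adjacent K ^^ (length p - 1)) (last p) (hd p)"
proof (induction p)
  case (Cons y p)
  show ?case
  proof (cases p)
    case (Cons x p')
    then have "(adjacent K ^^ length p') (last p) x" "adjacent K x y"
      using Cons.IH Cons.prems by (auto simp: adjacent_sym)
    then have "(adjacent K ^^ Suc (length p')) (last p) y"
      by auto
    then show ?thesis using Cons by simp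
  qed simp
qed simp

lemma relpowp_walk:
  "(adjacent K ^^ n) z v \<Longrightarrow> \<exists>p. successively (adjacent K) (v # p) \<and> last (v # p) = z \<and> length p = n"
proof (induction n arbitrary: v)
  case 0
  then show ?case by (intro exI[of _ "[]"]) simp
next
  case (Suc n)
  then obtain w where w: "(adjacent K ^^ n) z w" "adjacent K w v" by auto
  then obtain p where "successively (adjacent K) (w # p)" "last (w # p) = z" "length p = n"
    using Suc.IH by blast
  then show ?case using w(2) by (intro exI[of _ "w # p"]) (auto simp: adjacent_sym)
qed

context local_system
begin

lemma tp_cong: "(\<And>i. i \<le> n \<Longrightarrow> V i = W i) \<Longrightarrow> tp V n s = tp W n s"
  by (induction n) auto

lemma tp_append: "tp V (n + m) s = tp (\<lambda>i. V (n + i)) m (tp V n s)"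
  by (induction m) auto

lemma tp_reverse:
  assumes "\<And>i. i < n \<Longrightarrow> \<exists>C\<in>K. V i \<in> C \<and> V (Suc i) \<in> C" "V 0 \<in> \<Union>K" "s \<in> F (V 0)"
  shows "tp (\<lambda>i. V (n - i)) n (tp V n s) = s"
  using assms(1)
proof (induction n)
  case (Suc n)
  have t: "tp V n s \<in> F (V n)"
    using tp_in[of n V s] Suc.prems assms(3) by (meson less_SucI)
  obtain C where C: "C \<in> K" "V n \<in> C" "V (Suc n) \<in> C" using Suc.prems by blast
  have "V n \<in> \<Union>K" using C by blast
  have ret: "tr (V (Suc n)) (V n) (tp V (Suc n) s) = tp V n s"
    using tr_comp[OF C(1,2,3,2) t] tr_refl[OF \<open>V n \<in> \<Union>K\<close> t] by simp
  have "tp (\<lambda>i. V (Suc n - i)) (Suc n) (tp V (Suc n) s) =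
      tp (\<lambda>i. V (Suc n - (1 + i))) n (tp (\<lambda>i. V (Suc n - i)) 1 (tp V (Suc n) s))"
    using tp_append[of "\<lambda>i. V (Suc n - i)" 1 n] by simp
  also have "tp (\<lambda>i. V (Suc n - i)) 1 (tp V (Suc n) s) = tp V n s"
    using ret by simp
  finally show ?case using Suc by simp
qed simp

end

lemma walk_rev_nth:
  assumes "successively (adjacent K) p" "Suc k < length p"
  shows "adjacent K (rev p ! k) (rev p ! Suc k)"
proof -
  have "successively (adjacent K) (rev p)"
    using assms(1) by (simp add: successively_rev adjacent_sym)
  then show ?thesis
    using assms(2) by (simp add: successively_conv_nth)
qed

lemma rev_nth_last: "p \<noteq> [] \<Longrightarrow> rev p ! (length p - 1) = hd p" "p \<noteq> [] \<Longrightarrow> rev p ! 0 = last p"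
  by (simp_all add: rev_nth hd_conv_nth last_conv_nth)

locale cat0_complex = flag_cubical K for K :: "'v set set" +
  assumes sc: "simply_connected_space (realization K)"

lemma cat0_complexI: "cat0_cube_complex K \<Longrightarrow> cat0_complex K"
  by unfold_locales (auto simp: cat0_cube_complex_def)

context cat0_complex
begin

text \<open>Edge paths up to swaps are the states of a local system, whose monodromy is trivial.\<close>

lemma reduced_unique:
  assumes z: "z \<in> \<Union>K"
    and p: "successively (adjacent K) p" "reduced_path K p" "last p = z"
    and q: "successively (adjacent K) q" "reduced_path K q" "last q = z"
    and hd: "hd p = hd q"
  shows "swap_eq K (length p - 1) p q"
proof -
  interpret L: local_system K "states z" path_step
    by (rule local_system_states)
  have s: "path_class [z] \<in> states z z"
    by (intro statesI) auto
  \<comment> \<open>Every edge of a reduced path extends the state, so transport of the trivial path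
    along \<open>p\<close> reproduces the class of \<open>p\<close>. Lists run from end to start,
    whence \<open>rev p\<close>.\<close>
  have lift: "L.tp (\<lambda>i. rev p ! i) (length p - 1) (path_class [z]) = path_class p"
    if "successively (adjacent K) p" "reduced_path K p" "last p = z" for p
    using that
  proof (induction p rule: induct_list012)
    case (3 v u q)
    let ?n = "length q"
    have uq: "successively (adjacent K) (u # q)" "reduced_path K (u # q)" "last (u # q) = z" "adjacent K u v"
      using 3 by (auto simp: adjacent_sym)
    have IH: "L.tp (\<lambda>i. rev (u # q) ! i) ?n (path_class [z]) = path_class (u # q)"
      using "3.IH"(2)[OF uq(1-3)] by simp
    have c: "L.tp (\<lambda>i. rev (v # u # q) ! i) ?n (path_class [z]) = path_class (u # q)"
      unfolding IH[symmetric] by (rule L.tp_cong) (simp add: nth_append)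
    have "rev (v # u # q) ! ?n = u" "rev (v # u # q) ! Suc ?n = v"
      by (simp_all add: nth_append)
    then have "L.tp (\<lambda>i. rev (v # u # q) ! i) (Suc ?n) (path_class [z]) = L.tr u v (path_class (u # q))"
      using c by simp
    also have "\<dots> = path_step u v (path_class (u # q))"
      using uq by (intro L.tr_adjacent statesI)
    also have "\<dots> = path_class (v # u # q)"
      using 3(4) reduced_extend by (intro path_step_up) blast
    finally show ?case by simp
  qed auto
  let ?X = "\<lambda>i. rev p ! i" and ?Y = "\<lambda>i. rev q ! i"
  have ne: "p \<noteq> []" "q \<noteq> []" using p q by auto
  define n m where "n = length p - 1" and "m = length q - 1"
  have len: "length p = Suc n" "length q = Suc m" using ne by (auto simp: n_def m_def)
  have XY: "?X 0 = z" "?Y 0 = z" "?X n = ?Y m"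
    using rev_nth_last[OF ne(1)] rev_nth_last[OF ne(2)] hd p q by (simp_all add: n_def m_def)
  have adjX: "adjacent K (?X k) (?X (Suc k))" if "k < n" for k
    using walk_rev_nth[OF p(1)] that len by simp
  have adjY: "adjacent K (?Y k) (?Y (Suc k))" if "k < m" for k
    using walk_rev_nth[OF q(1)] that len by simp
  \<comment> \<open>The loop that follows \<open>p\<close> out and \<open>q\<close> back. Trivial
    monodromy along it makes the transports of the trivial path along \<open>p\<close> and along
    \<open>q\<close> agree.\<close>
  define Z where "Z i = (if i \<le> n then ?X i else ?Y (m - (i - n)))" for i
  have "L.tp Z (n + m) (path_class [z]) = path_class [z]"
  proof (rule L.trivial_monodromy[OF sc])
    show "adjacent K (Z k) (Z (Suc k))" if "k < n + m" for k
    proof (cases "k < n")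
      case True
      then show ?thesis using adjX by (simp add: Z_def)
    next
      case False
      define j where "j = m - Suc (k - n)"
      have j: "j < m" "m - (k - n) = Suc j" "m - (Suc k - n) = j"
        using False that by (auto simp: j_def)
      have "Z k = ?Y (Suc j)"
        using False j XY(3) by (cases "k = n") (auto simp: Z_def)
      moreover have "Z (Suc k) = ?Y j"
        using False j by (simp add: Z_def)
      ultimately show ?thesis using adjY[OF j(1)] by (simp add: adjacent_sym)
    qed
    show "Z (n + m) = Z 0" "Z 0 \<in> \<Union>K" "path_class [z] \<in> states z (Z 0)"
      using XY z s by (auto simp: Z_def)
  qed
  moreover have "L.tp Z n (path_class [z]) = L.tp ?X n (path_class [z])"
    by (rule L.tp_cong) (simp add: Z_def)
  moreover have "L.tp (\<lambda>i. Z (n + i)) m t = L.tp (\<lambda>i. ?Y (m - i)) m t" for t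
    by (rule L.tp_cong) (use XY(3) in \<open>auto simp: Z_def\<close>)
  ultimately have ret: "L.tp (\<lambda>i. ?Y (m - i)) m (path_class p) = path_class [z]"
    using L.tp_append[of Z n m "path_class [z]"] lift[OF p] by (simp add: n_def)
  have "L.tp (\<lambda>i. ?Y (m - (m - i))) m (L.tp (\<lambda>i. ?Y (m - i)) m (path_class p)) = path_class p"
  proof (rule L.tp_reverse)
    show "\<exists>C\<in>K. ?Y (m - i) \<in> C \<and> ?Y (m - Suc i) \<in> C" if "i < m" for i
    proof -
      have "adjacent K (?Y (m - Suc i)) (?Y (Suc (m - Suc i)))"
        using adjY[of "m - Suc i"] that by simp
      moreover have "Suc (m - Suc i) = m - i" using that by simp
      ultimately show ?thesis by (auto simp: adjacent_def)
    qed
    have "path_class p \<in> states z (hd p)"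
      using p unfolding states_def by blast
    moreover have Ym: "?Y (m - 0) = hd p"
      using rev_nth_last[OF ne(2)] hd by (simp add: m_def)
    ultimately show "path_class p \<in> states z (?Y (m - 0))"
      by simp
    show "?Y (m - 0) \<in> \<Union>K"
    proof (cases "m = 0")
      case True
      then show ?thesis using XY z by simp
    next
      case False
      then show ?thesis using adjacent_vertex(2)[OF adjY[of "m - 1"]] by simp
    qed
  qed
  moreover have "L.tp (\<lambda>i. ?Y (m - (m - i))) m (path_class [z]) = L.tp ?Y m (path_class [z])"
    by (rule L.tp_cong) simp
  ultimately have "path_class q = path_class p"
    using ret lift[OF q] by (simp add: m_def)
  then have "q \<in> path_class p" using path_class_self[OF ne(2)] by simp
  then show ?thesis by (rule path_classD)
qed

lemma vdist_reach:
  assumes "x \<in> \<Union>K" "y \<in> \<Union>K"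
  shows "(adjacent K ^^ vdist K x y) x y"
proof -
  have "\<exists>n. (adjacent K ^^ n) x y"
    using vertices_connected[OF sc assms] by (simp add: rtranclp_power)
  then show ?thesis
    unfolding vdist_relpowp by (rule LeastI_ex)
qed

lemma vdist_triangle:
  assumes "x \<in> \<Union>K" "y \<in> \<Union>K" "z \<in> \<Union>K"
  shows "vdist K x z \<le> vdist K x y + vdist K y z"
  by (rule vdist_le) (rule relpowp_trans[OF vdist_reach vdist_reach]; fact assms)

lemma vdist_eq_0: "x \<in> \<Union>K \<Longrightarrow> y \<in> \<Union>K \<Longrightarrow> vdist K x y = 0 \<longleftrightarrow> x = y"
  using vdist_reach[of x y] by auto

lemma vdist_adjacent_triangle:
  assumes "adjacent K x y" "z \<in> \<Union>K"
  shows "vdist K z y \<le> Suc (vdist K z x)" "vdist K z x \<le> Suc (vdist K z y)"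
  using vdist_triangle[OF assms(2) adjacent_vertex[OF assms(1)]]
    vdist_triangle[OF assms(2) adjacent_vertex(2,1)[OF assms(1)]]
    vdist_adjacent_le[OF assms(1)] vdist_sym[of K x y] by linarith+

lemma vdist_eq_1:
  assumes "x \<in> \<Union>K" "y \<in> \<Union>K"
  shows "vdist K x y = 1 \<longleftrightarrow> adjacent K x y"
proof
  assume "vdist K x y = 1"
  then have "(adjacent K ^^ 1) x y" using vdist_reach[OF assms] by simp
  then show "adjacent K x y" by (simp only: relpowp_1)
next
  assume a: "adjacent K x y"
  then have "vdist K x y \<noteq> 0" using vdist_eq_0[OF assms] by (auto simp: adjacent_def)
  then show "vdist K x y = 1" using vdist_adjacent_le[OF a] by linarith
qed

lemma geodesic:
  assumes "z \<in> \<Union>K" "v \<in> \<Union>K"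
  obtains p where "successively (adjacent K) (v # p)" "last (v # p) = z" "length p = vdist K z v"
  using relpowp_walk[OF vdist_reach[OF assms]] by blast

text \<open>A backtrack would put the last vertex at the end of a path that is two edges shorter,
  which contradicts the distance.\<close>

lemma geodesic_reduced:
  "z \<in> \<Union>K \<Longrightarrow> p \<noteq> [] \<Longrightarrow> successively (adjacent K) p \<Longrightarrow> last p = z \<Longrightarrow>
    length p = Suc (vdist K z (hd p)) \<Longrightarrow> reduced_path K p"
proof (induction p rule: induct_list012)
  case (3 y x p)
  have a: "adjacent K x y" using 3 by (simp add: adjacent_sym)
  have xp: "successively (adjacent K) (x # p)" "last (x # p) = z" using 3 by auto
  have le: "vdist K z x \<le> length p"
    using vdist_le[OF walk_relpowp[of "x # p" K]] xp by simp
  have d: "vdist K z y = Suc (length p)" using "3.prems"(5) by simp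
  then have "length p \<le> vdist K z x"
    using vdist_adjacent_triangle[OF a "3.prems"(1)] by simp
  then have "reduced_path K (x # p)"
    using "3.IH"(2) "3.prems"(1) xp le by simp
  moreover have "\<not> swap_eq K (length p) (x # p) (x # y # r)" for r
  proof
    assume e: "swap_eq K (length p) (x # p) (x # y # r)"
    have "successively (adjacent K) (y # r)" "last (y # r) = z"
      using swap_eq_walk[OF e xp(1)] swap_eq_last[OF e] xp(2) by auto
    then have "vdist K z y \<le> length r"
      using vdist_le[OF walk_relpowp[of "y # r" K]] by simp
    then show False using d swap_eq_length[OF e] by simp
  qed
  ultimately show ?case by simp
qed auto

text \<open>Geodesics to \<open>y\<close> through \<open>x\<close> and through \<open>x'\<close> are
  reduced with the same ends, hence equivalent up to swaps. Since their last edges differ,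
  \<open>swap_eq\<close> supplies the square together with its corner closer to
  \<open>z\<close>.\<close>

lemma quadrangle:
  assumes z: "z \<in> \<Union>K" and a: "adjacent K x y" "adjacent K x' y" "x \<noteq> x'"
    and d: "vdist K z y = Suc k" "vdist K z x = k" "vdist K z x' = k"
  obtains w where "square K w x y x'" "Suc (vdist K z w) = k" "w \<in> \<Union>K"
proof -
  have V: "x \<in> \<Union>K" "x' \<in> \<Union>K" "y \<in> \<Union>K"
    using adjacent_vertex[OF a(1)] adjacent_vertex[OF a(2)] by blast+
  obtain p where p: "successively (adjacent K) (x # p)" "last (x # p) = z" "length p = vdist K z x"
    using geodesic[OF z V(1)] .
  obtain q where q: "successively (adjacent K) (x' # q)" "last (x' # q) = z" "length q = vdist K z x'"
    using geodesic[OF z V(2)] .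
  have yp: "successively (adjacent K) (y # x # p)" "last (y # x # p) = z"
    using p a by (auto simp: adjacent_sym)
  have yq: "successively (adjacent K) (y # x' # q)" "last (y # x' # q) = z"
    using q a by (auto simp: adjacent_sym)
  have "reduced_path K (y # x # p)" "reduced_path K (y # x' # q)"
    by (rule geodesic_reduced[OF z]; use yp yq p q d in simp)+
  then have "swap_eq K (length (y # x # p) - 1) (y # x # p) (y # x' # q)"
    using reduced_unique[OF z yp(1) _ yp(2) yq(1) _ yq(2)] by simp
  then obtain w r m where w: "length (y # x # p) - 1 = Suc m" "square K w x y x'" "swap_eq K m (x # p) (x # w # r)"
    using a(3) by (rule swap_eq_other)
  have "successively (adjacent K) (w # r)" "last (w # r) = z"
    using swap_eq_walk[OF w(3) p(1)] swap_eq_last[OF w(3)] p(2) by auto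
  then have "vdist K z w \<le> length r"
    using vdist_le[OF walk_relpowp[of "w # r" K]] by simp
  moreover have "Suc (length r) = length p"
    using swap_eq_length[OF w(3)] by simp
  ultimately have "Suc (vdist K z w) = k"
    using vdist_adjacent_triangle(1)[OF squareD(1)[OF w(2)] z] p(3) d by simp
  then show ?thesis
    using that w(2) adjacent_vertex(1)[OF squareD(1)[OF w(2)]] by blast
qed

text \<open>Suppose both ends are equally far from \<open>z\<close>, and extend a geodesic to
  \<open>x\<close> by the edge. If the result is reduced, it is equivalent to a geodesic to
  \<open>y\<close> of different length, but swaps preserve length. If it is not reduced, an
  equivalent path passes through \<open>y\<close> too early.\<close>

lemma bipartite:
  assumes z: "z \<in> \<Union>K" and a: "adjacent K x y"
  shows "vdist K z y = Suc (vdist K z x) \<or> vdist K z x = Suc (vdist K z y)"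
proof -
  have V: "x \<in> \<Union>K" "y \<in> \<Union>K" using adjacent_vertex[OF a] .
  have "vdist K z x \<noteq> vdist K z y"
  proof
    assume eq: "vdist K z x = vdist K z y"
    obtain p where p: "successively (adjacent K) (x # p)" "last (x # p) = z" "length p = vdist K z x"
      using geodesic[OF z V(1)] .
    obtain q where q: "successively (adjacent K) (y # q)" "last (y # q) = z" "length q = vdist K z y"
      using geodesic[OF z V(2)] .
    have red: "reduced_path K (x # p)" "reduced_path K (y # q)"
      by (rule geodesic_reduced[OF z]; use p q in simp)+
    have walk: "successively (adjacent K) (y # x # p)" "last (y # x # p) = z"
      using p a by (auto simp: adjacent_sym)
    show False
    proof (cases "reduced_path K (y # x # p)")
      case True
      have "swap_eq K (length (y # x # p) - 1) (y # x # p) (y # q)"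
        using reduced_unique[OF z walk(1) True walk(2) q(1) red(2) q(2)] by simp
      then show False using swap_eq_length[of K _ "y # x # p" "y # q"] p q eq by fastforce
    next
      case False
      then obtain r where e: "swap_eq K (length p) (x # p) (x # y # r)"
        using red(1) by auto
      have "successively (adjacent K) (y # r)" "last (y # r) = z"
        using swap_eq_walk[OF e p(1)] swap_eq_last[OF e] p(2) by auto
      then have "vdist K z y \<le> length r"
        using vdist_le[OF walk_relpowp[of "y # r" K]] by simp
      then show False using swap_eq_length[OF e] eq p(3) by simp
    qed
  qed
  then show ?thesis
    using vdist_adjacent_triangle[OF a z] by linarith
qed

lemma vdist_predecessor:
  assumes "z \<in> \<Union>K" "y \<in> \<Union>K" "vdist K z y = Suc k"
  obtains x where "adjacent K x y" "vdist K z x = k"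
proof -
  have "(adjacent K ^^ Suc k) z y"
    using vdist_reach[OF assms(1,2)] assms(3) by simp
  then obtain x where x: "(adjacent K ^^ k) z x" "adjacent K x y" by auto
  then have "vdist K z x = k"
    using vdist_le[OF x(1)] vdist_adjacent_triangle(1)[OF x(2) assms(1)] assms(3) by simp
  then show ?thesis using that x by blast
qed

end

section \<open>Combinatorial half-spaces\<close>

text \<open>The side of the edge that contains \<open>x\<close>. The half-space dual to the oriented
  edge \<open>(x, y)\<close> accordingly corresponds to \<open>vhalf K y x\<close>.\<close>

definition vhalf :: "'v set set \<Rightarrow> 'v \<Rightarrow> 'v \<Rightarrow> 'v set" where
  "vhalf K x y = {z \<in> \<Union>K. vdist K z x < vdist K z y}"

definition vhalfs :: "'v set set \<Rightarrow> 'v set set" where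
  "vhalfs K = {vhalf K x y | x y. adjacent K x y}"

definition sep :: "'v set set \<Rightarrow> 'v \<Rightarrow> 'v \<Rightarrow> 'v set set" where
  "sep K x y = {H \<in> vhalfs K. x \<in> H \<and> y \<notin> H}"

context cat0_complex
begin

lemma vhalf_subset: "vhalf K x y \<subseteq> \<Union>K"
  by (auto simp: vhalf_def)

lemma vhalfsI: "adjacent K x y \<Longrightarrow> vhalf K x y \<in> vhalfs K"
  by (auto simp: vhalfs_def)

lemma vhalfsE:
  assumes "H \<in> vhalfs K"
  obtains x y where "adjacent K x y" "H = vhalf K x y"
  using assms by (auto simp: vhalfs_def)

lemma vhalfs_subset: "H \<in> vhalfs K \<Longrightarrow> H \<subseteq> \<Union>K"
  using vhalf_subset by (auto simp: vhalfs_def)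

lemma vhalf_iff:
  assumes "adjacent K x y" "z \<in> \<Union>K"
  shows "z \<in> vhalf K x y \<longleftrightarrow> vdist K z y = Suc (vdist K z x)"
    and "z \<notin> vhalf K x y \<longleftrightarrow> vdist K z x = Suc (vdist K z y)"
  using bipartite[OF assms(2,1)] assms(2) by (auto simp: vhalf_def)

lemma vhalf_compl:
  assumes "adjacent K x y" shows "\<Union>K - vhalf K x y = vhalf K y x"
proof (rule Set.set_eqI)
  fix z
  have "adjacent K y x" using assms by (simp add: adjacent_sym)
  then show "z \<in> \<Union>K - vhalf K x y \<longleftrightarrow> z \<in> vhalf K y x"
    using vhalf_iff[OF assms, of z] vhalf_iff[of y x z] vhalf_subset by (cases "z \<in> \<Union>K") auto
qed

lemma vhalf_ends:
  assumes "adjacent K x y"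
  shows "x \<in> vhalf K x y" "y \<notin> vhalf K x y"
  using vhalf_iff[OF assms, of x] vhalf_iff[OF assms, of y] adjacent_vertex[OF assms]
    vdist_eq_1[of x y] vdist_eq_1[of y x] assms by (simp_all add: adjacent_sym)

lemma vhalfs_compl: "H \<in> vhalfs K \<Longrightarrow> \<Union>K - H \<in> vhalfs K"
  by (metis adjacent_sym vhalf_compl vhalfsE vhalfsI)

lemma vhalfs_nonempty: "H \<in> vhalfs K \<Longrightarrow> H \<noteq> {}"
  by (metis empty_iff vhalfsE vhalf_ends(1))

text \<open>If \<open>z\<close> is closer to \<open>a\<close> than to \<open>b\<close> but closer to
  \<open>c\<close> than to \<open>d\<close>, then \<open>a\<close> and \<open>c\<close> are equally
  far from \<open>z\<close>. The quadrangle condition at \<open>b\<close> gives a fourth corner that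
  is still closer; uniqueness of squares identifies it with \<open>d\<close>, which is
  farther.\<close>

lemma vhalf_parallel_subset:
  assumes sq: "square K a b c d"
  shows "vhalf K a b \<subseteq> vhalf K d c"
proof
  fix z assume za: "z \<in> vhalf K a b"
  then have z: "z \<in> \<Union>K" using vhalf_subset by blast
  note e = squareD[OF sq]
  show "z \<in> vhalf K d c"
  proof (rule ccontr)
    assume "z \<notin> vhalf K d c"
    then have 1: "vdist K z d = Suc (vdist K z c)"
      using vhalf_iff(2)[OF e(9) z] by simp
    have 2: "vdist K z b = Suc (vdist K z a)"
      using za vhalf_iff(1)[OF e(1) z] by simp
    have 3: "vdist K z c = vdist K z a"
      using 1 2 bipartite[OF z e(2)] bipartite[OF z e(4)] by linarith
    obtain w where w: "square K w a b c" "Suc (vdist K z w) = vdist K z a"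
      by (rule quadrangle[OF z e(1) e(8) e(5) 2 refl 3])
    have "square K b a w c" "square K b a d c"
      using w(1) sq by (metis square_rotate square_reflect)+
    then have "w = d" by (rule square_unique)
    then show False using w(2) 1 3 by simp
  qed
qed

lemma vhalf_parallel:
  assumes "square K a b c d" shows "vhalf K a b = vhalf K d c"
proof
  show "vhalf K a b \<subseteq> vhalf K d c" by (rule vhalf_parallel_subset[OF assms])
  have "square K d c b a" using assms by (metis square_rotate square_reflect)
  then show "vhalf K d c \<subseteq> vhalf K a b" by (rule vhalf_parallel_subset)
qed

lemma square_opposite:
  assumes "square K a b c d" shows "opposite_edges K {a, b} {d, c}"
proof -
  note e = squareD[OF assms]
  have "{a, b} \<union> {d, c} = {a, b, c, d}" by auto
  then show ?thesis
    using assms e by (auto simp: opposite_edges_def square_def adjacent_def insert_commute)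
qed

text \<open>Induction on the distance from \<open>a\<close>. A predecessor \<open>x1\<close> of
  \<open>x\<close> and the vertex \<open>y\<close> are both one step closer to \<open>b\<close> than
  \<open>x\<close>, so the quadrangle condition gives a square that moves \<open>{x, y}\<close> to
  an edge \<open>{x1, w}\<close>, which crosses the same boundary closer to
  \<open>a\<close>.\<close>

lemma crossing_edge:
  assumes ab: "adjacent K a b"
  shows "adjacent K x y \<Longrightarrow> x \<in> vhalf K a b \<Longrightarrow> y \<notin> vhalf K a b \<Longrightarrow>
    vhalf K x y = vhalf K a b \<and> (opposite_edges K)\<^sup>*\<^sup>* {a, b} {x, y}"
proof (induction "vdist K a x" arbitrary: x y rule: less_induct)
  case less
  note xy = less.prems(1)
  have V: "x \<in> \<Union>K" "y \<in> \<Union>K" "a \<in> \<Union>K" "b \<in> \<Union>K"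
    using adjacent_vertex[OF xy] adjacent_vertex[OF ab] by auto
  note sym = vdist_sym[of K x] vdist_sym[of K y]
  have bx: "vdist K b x = Suc (vdist K a x)"
    using less.prems(2) vhalf_iff(1)[OF ab V(1)] sym by simp
  have ay: "vdist K a y = Suc (vdist K b y)"
    using less.prems(3) vhalf_iff(2)[OF ab V(2)] sym by simp
  have dby: "vdist K b y = vdist K a x"
    using bx ay bipartite[OF V(3) xy] bipartite[OF V(4) xy] by linarith
  show ?case
  proof (cases "vdist K a x")
    case 0
    then have "x = a" "y = b"
      using vdist_eq_0 V dby by auto
    then show ?thesis by simp
  next
    case (Suc k)
    obtain x1 where x1: "adjacent K x1 x" "vdist K a x1 = k"
      using vdist_predecessor[OF V(3,1) Suc] .
    have V1: "x1 \<in> \<Union>K" using adjacent_vertex(1)[OF x1(1)] .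
    have bx1: "vdist K b x1 = Suc k"
      using bipartite[OF V(4) x1(1)] bx Suc x1(2) vdist_triangle[OF V(4,3) V1]
        vdist_adjacent_le[OF ab] vdist_sym[of K a b] by linarith
    have ne: "x1 \<noteq> y" using x1(2) ay dby Suc by auto
    have yx: "adjacent K y x" using xy by (simp add: adjacent_sym)
    obtain w where w: "square K w x1 x y" "Suc (vdist K b w) = Suc k" "w \<in> \<Union>K"
      by (rule quadrangle[OF V(4) x1(1) yx ne, of "Suc k"]) (use bx Suc bx1 dby in auto)
    note e = squareD[OF w(1)]
    have aw: "vdist K a w = Suc k"
      using bipartite[OF V(3) e(1)] bipartite[OF V(3) e(4)] x1(2) ay dby Suc by linarith
    have "x1 \<in> vhalf K a b" "w \<notin> vhalf K a b"
      using vhalf_iff[OF ab V1] vhalf_iff[OF ab w(3)] x1(2) bx1 aw w(2)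
        vdist_sym[of K x1] vdist_sym[of K w] by simp_all
    then have IH: "vhalf K x1 w = vhalf K a b \<and> (opposite_edges K)\<^sup>*\<^sup>* {a, b} {x1, w}"
      using less.hyps[of x1 w] e(7) x1(2) Suc by simp
    have "square K x1 w y x" using w(1) by (metis square_rotate square_reflect)
    then have "vhalf K x1 w = vhalf K x y" "opposite_edges K {x1, w} {x, y}"
      by (rule vhalf_parallel, rule square_opposite)
    then show ?thesis using IH by auto
  qed
qed

lemma vhalfs_crossing:
  assumes "H \<in> vhalfs K" "adjacent K x y" "x \<in> H" "y \<notin> H"
  shows "H = vhalf K x y"
  using assms(1)
proof (cases rule: vhalfsE)
  case (1 a b)
  then show ?thesis using crossing_edge[OF 1(1) assms(2)] assms by simp
qed

text \<open>Two disjoint edges have four vertices, so their union is a two-dimensional cube and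
  \<open>g\<close> is the side opposite to \<open>{u, v}\<close>; it then has the same half-spaces
  by \<open>vhalf_parallel\<close>.\<close>

lemma opposite_edges_vhalf:
  assumes "opposite_edges K {u, v} g" "u \<noteq> v"
  obtains p q where "g = {p, q}" "adjacent K p q" "vhalf K p q = vhalf K u v"
proof -
  let ?C = "{u, v} \<union> g"
  have o: "{u, v} \<in> K" "card g = 2" "{u, v} \<inter> g = {}" "?C \<in> K"
    using assms by (auto simp: opposite_edges_def)
  obtain n \<psi> where \<psi>: "cube_param K ?C n \<psi>" "\<psi> {} = u"
    using rooted_param[OF o(4), of u] by blast
  have "card ?C = card {u, v} + card g"
    using o card_gt_0_iff[of g] by (intro card_Un_disjoint) auto
  then have "card ?C = 4" using o assms(2) by simp
  moreover have "card ?C = 2 ^ n"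
    using \<psi>(1) bij_betw_same_card[of \<psi> "Pow {..<n}" ?C] by (simp add: cube_param_def card_Pow)
  ultimately have "2 ^ n = (2::nat) ^ 2" by simp
  then have n: "n = 2" by (rule power_inject_exp[THEN iffD1, rotated]) simp
  have "v \<in> {w \<in> ?C. adjacent K (\<psi> {}) w}"
    using o assms(2) \<psi>(2) by (auto simp: adjacent_def)
  then obtain i where i: "i < n" "v = \<psi> {i}"
    unfolding cube_param_neighbours[OF \<psi>(1)] by blast
  define j where "j = 1 - i"
  have "i = 0 \<or> i = 1" using i n by auto
  then have j: "j < n" "i \<noteq> j" "{..<n} = {i, j}" using n by (auto simp: j_def)
  have sq: "square K u v (\<psi> {i, j}) (\<psi> {j})"
    using cube_param_square[OF \<psi>(1), of "{}" i j] i j \<psi>(2) by simp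
  have "Pow {..<n} = {{}, {i}, {j}, {i, j}}"
    unfolding j(3) by (auto simp: Pow_insert)
  then have "?C = {u, v, \<psi> {j}, \<psi> {i, j}}"
    using cube_param_image[OF \<psi>(1)] i \<psi>(2) by simp
  moreover have "\<psi> {j} \<notin> {u, v}" "\<psi> {i, j} \<notin> {u, v}"
    using squareD[OF sq] by (auto simp: adjacent_def)
  ultimately have "g = {\<psi> {j}, \<psi> {i, j}}" using o(3) by blast
  then show ?thesis
    using that squareD[OF sq] vhalf_parallel[OF sq] by metis
qed

lemma parallel_vhalf:
  assumes "(opposite_edges K)\<^sup>*\<^sup>* {x, y} f" "adjacent K x y"
  shows "\<exists>u v. f = {u, v} \<and> adjacent K u v \<and> vhalf K u v = vhalf K x y"
  using assms(1)
proof induction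
  case (step f g)
  then obtain u v where uv: "f = {u, v}" "adjacent K u v" "vhalf K u v = vhalf K x y" by blast
  show ?case
    by (rule opposite_edges_vhalf[of u v g]) (use step(2) uv in \<open>auto simp: adjacent_def\<close>)
qed (use assms(2) in blast)

section \<open>Distance as the number of separating half-spaces\<close>

lemma sep_step:
  assumes z: "z \<in> \<Union>K" and a: "adjacent K x y" and d: "vdist K z y = Suc (vdist K z x)"
  shows "sep K z y = insert (vhalf K x y) (sep K z x)" "vhalf K x y \<notin> sep K z x"
proof -
  note e = vhalf_ends[OF a]
  show "vhalf K x y \<notin> sep K z x" using e by (simp add: sep_def)
  have zin: "z \<in> vhalf K x y" using vhalf_iff(1)[OF a z] d by simp
  have ya: "adjacent K y x" using a by (simp add: adjacent_sym)
  show "sep K z y = insert (vhalf K x y) (sep K z x)"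
  proof (intro equalityI subsetI)
    fix H assume "H \<in> sep K z y"
    then show "H \<in> insert (vhalf K x y) (sep K z x)"
      using vhalfs_crossing[OF _ a] by (auto simp: sep_def)
  next
    fix H assume "H \<in> insert (vhalf K x y) (sep K z x)"
    then consider "H = vhalf K x y" | "H \<in> sep K z x" by blast
    then show "H \<in> sep K z y"
    proof cases
      case 1
      then show ?thesis using e zin vhalfsI[OF a] by (simp add: sep_def)
    next
      case 2
      have "y \<notin> H"
      proof
        assume "y \<in> H"
        then have "H = vhalf K y x"
          using 2 ya vhalfs_crossing by (auto simp: sep_def)
        then show False
          using 2 zin vhalf_compl[OF a] by (auto simp: sep_def)
      qed
      then show ?thesis using 2 by (simp add: sep_def)
    qed
  qed
qed

lemma sep_self: "sep K x x = {}"
  by (auto simp: sep_def)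

text \<open>Each edge of a geodesic that starts at \<open>x\<close> adds one new separating
  half-space and loses none of the earlier ones.\<close>

lemma sep_card:
  assumes "x \<in> \<Union>K" "y \<in> \<Union>K"
  shows "finite (sep K x y) \<and> card (sep K x y) = vdist K x y"
  using assms(2)
proof (induction "vdist K x y" arbitrary: y)
  case 0
  then show ?case using vdist_eq_0[OF assms(1)] by (simp add: sep_self)
next
  case (Suc k)
  obtain w where w: "adjacent K w y" "vdist K x w = k"
    using vdist_predecessor[OF assms(1) Suc.prems Suc.hyps(2)[symmetric]] .
  have "finite (sep K x w) \<and> card (sep K x w) = k"
    using Suc.hyps(1)[of w] w(2) adjacent_vertex(1)[OF w(1)] by simp
  moreover have "vdist K x y = Suc (vdist K x w)" using Suc w by simp
  ultimately show ?case
    using sep_step[OF assms(1) w(1)] w(2) by simp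
qed

lemma finite_sep: "x \<in> \<Union>K \<Longrightarrow> y \<in> \<Union>K \<Longrightarrow> finite (sep K x y)"
  and card_sep: "x \<in> \<Union>K \<Longrightarrow> y \<in> \<Union>K \<Longrightarrow> card (sep K x y) = vdist K x y"
  using sep_card by auto

lemma sep_adjacent: "adjacent K x y \<Longrightarrow> sep K x y = {vhalf K x y}"
  using sep_step[of x x y] adjacent_vertex[of K x y] vdist_eq_1[of x y] by (simp add: sep_self)

lemma sep_empty_iff: "x \<in> \<Union>K \<Longrightarrow> y \<in> \<Union>K \<Longrightarrow> sep K x y = {} \<longleftrightarrow> x = y"
  using sep_card[of x y] vdist_eq_0[of x y] by auto

lemma sep_via:
  assumes "v \<in> \<Union>K" "x \<in> \<Union>K" "y \<in> \<Union>K"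
  shows "sep K x y = (sep K v y - sep K v x) \<union> (\<lambda>H. \<Union>K - H) ` (sep K v x - sep K v y)"
proof (intro equalityI subsetI)
  fix H assume H: "H \<in> sep K x y"
  then have Hh: "H \<in> vhalfs K" "H \<subseteq> \<Union>K" using vhalfs_subset by (auto simp: sep_def)
  show "H \<in> (sep K v y - sep K v x) \<union> (\<lambda>H. \<Union>K - H) ` (sep K v x - sep K v y)"
  proof (cases "v \<in> H")
    case True
    then show ?thesis using H by (auto simp: sep_def)
  next
    case False
    then have "\<Union>K - H \<in> sep K v x - sep K v y"
      using H vhalfs_compl[OF Hh(1)] assms by (auto simp: sep_def)
    moreover have "H = \<Union>K - (\<Union>K - H)" using Hh by blast
    ultimately show ?thesis by blast
  qed
next
  fix H assume "H \<in> (sep K v y - sep K v x) \<union> (\<lambda>H. \<Union>K - H) ` (sep K v x - sep K v y)"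
  then show "H \<in> sep K x y"
    using vhalfs_compl assms by (auto simp: sep_def)
qed

text \<open>Seen from \<open>v\<close>, vertices become finite sets of half-spaces, and
  \<open>vdist\<close> is their Hamming distance. A half-space that separates \<open>x\<close> from
  \<open>y\<close> contains \<open>v\<close> or its complement does, which accounts for the two
  parts of the symmetric difference.\<close>

lemma vdist_via:
  assumes "v \<in> \<Union>K" "x \<in> \<Union>K" "y \<in> \<Union>K"
  shows "vdist K x y = card (sym_diff (sep K v x) (sep K v y))"
proof -
  let ?A = "sep K v x - sep K v y" and ?B = "sep K v y - sep K v x"
  have fin: "finite ?A" "finite ?B" using finite_sep assms by auto
  have "inj_on (\<lambda>H. \<Union>K - H) (vhalfs K)"
    using vhalfs_subset by (intro inj_onI) blast
  then have "inj_on (\<lambda>H. \<Union>K - H) ?A"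
    by (rule inj_on_subset) (auto simp: sep_def)
  then have c: "card ((\<lambda>H. \<Union>K - H) ` ?A) = card ?A" by (rule card_image)
  have "vdist K x y = card (?B \<union> (\<lambda>H. \<Union>K - H) ` ?A)"
    using card_sep[OF assms(2,3)] sep_via[OF assms] by simp
  also have "\<dots> = card ?B + card ?A"
    using fin c by (subst card_Un_disjoint) (auto simp: sep_def)
  also have "\<dots> = card (sym_diff (sep K v x) (sep K v y))"
    using fin by (subst card_Un_disjoint) auto
  finally show ?thesis .
qed

lemma sep_inj:
  assumes "v \<in> \<Union>K" "x \<in> \<Union>K" "y \<in> \<Union>K" "sep K v x = sep K v y"
  shows "x = y"
  using vdist_via[OF assms(1-3)] assms(4) vdist_eq_0[OF assms(2,3)] by simp

section \<open>Vertices from consistent orientations\<close>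

lemma consecutive_nested:
  assumes "adjacent K x y" "adjacent K y z" "x \<noteq> z" "\<not> (\<exists>w. square K w x y z)"
  shows "vhalf K x y \<subseteq> vhalf K y z"
proof
  fix p assume px: "p \<in> vhalf K x y"
  then have p: "p \<in> \<Union>K" using vhalf_subset by blast
  \<comment> \<open>Otherwise \<open>x\<close> and \<open>z\<close> are both closer to
    \<open>p\<close> than \<open>y\<close> is, and the quadrangle condition produces the excluded
    square.\<close>
  show "p \<in> vhalf K y z"
  proof (rule ccontr)
    assume "p \<notin> vhalf K y z"
    then have 1: "vdist K p y = Suc (vdist K p z)"
      using vhalf_iff(2)[OF assms(2) p] by simp
    have 2: "vdist K p y = Suc (vdist K p x)"
      using px vhalf_iff(1)[OF assms(1) p] by simp
    have 3: "vdist K p z = vdist K p x" using 1 2 by simp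
    have "adjacent K z y" using assms(2) by (simp add: adjacent_sym)
    then obtain w where "square K w x y z"
      using quadrangle[OF p assms(1) _ assms(3) 2 refl 3] by metis
    then show False using assms(4) by blast
  qed
qed

text \<open>Let \<open>y\<close> be a vertex outside \<open>H\<close> nearest to \<open>v\<close>,
  and \<open>x\<close> its predecessor. If \<open>x\<close> is not \<open>v\<close>, the preceding
  edge from \<open>w\<close> to \<open>x\<close> spans no square with the edge from \<open>x\<close>
  to \<open>y\<close>, since such a square would have a corner outside \<open>H\<close> too close to
  \<open>v\<close>. By \<open>consecutive_nested\<close> the half-space \<open>vhalf K w x\<close>
  contains \<open>v\<close> and is properly contained in \<open>H\<close>, against
  minimality.\<close>

lemma minimal_vhalf_adjacent:
  assumes v: "v \<in> \<Union>K" and H: "H \<in> vhalfs K" "v \<in> H"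
    and minimal: "\<And>H'. H' \<in> vhalfs K \<Longrightarrow> v \<in> H' \<Longrightarrow> H' \<subseteq> H \<Longrightarrow> H' = H"
  obtains u where "adjacent K v u" "H = vhalf K v u"
proof -
  have "\<exists>y. y \<in> \<Union>K - H"
    using vhalfs_nonempty[OF vhalfs_compl[OF H(1)]] by blast
  then obtain y where y: "y \<in> \<Union>K" "y \<notin> H"
    and least: "\<And>u. u \<in> \<Union>K \<Longrightarrow> u \<notin> H \<Longrightarrow> vdist K v y \<le> vdist K v u"
    using ex_has_least_nat[of "\<lambda>y. y \<in> \<Union>K - H" _ "vdist K v"] by (metis DiffD1 DiffD2 DiffI)
  have "vdist K v y \<noteq> 0" using vdist_eq_0[OF v y(1)] y H by auto
  then obtain n where n: "vdist K v y = Suc n" using not0_implies_Suc by blast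
  obtain x where x: "adjacent K x y" "vdist K v x = n"
    using vdist_predecessor[OF v y(1) n] .
  have xV: "x \<in> \<Union>K" using adjacent_vertex(1)[OF x(1)] .
  have xH: "x \<in> H" using least[OF xV] n x(2) by (cases "x \<in> H") auto
  have Hxy: "H = vhalf K x y" using vhalfs_crossing[OF H(1) x(1) xH y(2)] .
  show ?thesis
  proof (cases n)
    case 0
    then have "v = x" using vdist_eq_0[OF v xV] x(2) by simp
    then show ?thesis using that x(1) Hxy by simp
  next
    case (Suc k)
    obtain w where w: "adjacent K w x" "vdist K v w = k"
      using vdist_predecessor[OF v xV] x(2) Suc by metis
    have "w \<noteq> y" using w(2) n Suc by auto
    have "\<not> square K t w x y" for t
    proof
      assume sq: "square K t w x y"
      note e = squareD[OF sq]
      have "square K w t y x" using sq by (metis square_rotate square_reflect)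
      then have "H = vhalf K w t" unfolding Hxy by (rule vhalf_parallel[symmetric])
      then have "t \<notin> H" using vhalf_ends(2)[OF e(7)] by simp
      moreover have "t \<in> \<Union>K" using adjacent_vertex(1)[OF e(1)] .
      ultimately have "Suc n \<le> vdist K v t" using least n by simp
      then show False
        using vdist_adjacent_triangle(1)[OF e(7) v] w(2) Suc by simp
    qed
    then have "vhalf K w x \<subseteq> H"
      unfolding Hxy using consecutive_nested[OF w(1) x(1) \<open>w \<noteq> y\<close>] by blast
    moreover have "v \<in> vhalf K w x"
      using vhalf_iff(1)[OF w(1) v] w(2) x(2) Suc by simp
    ultimately have "vhalf K w x = H" using minimal vhalfsI[OF w(1)] by blast
    then show ?thesis using vhalf_ends(2)[OF w(1)] xH by simp
  qed
qed

lemma flip_adjacent: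
  assumes "adjacent K v u"
  shows "{H \<in> vhalfs K. u \<in> H} = ({H \<in> vhalfs K. v \<in> H} - {vhalf K v u}) \<union> {\<Union>K - vhalf K v u}"
proof -
  have "adjacent K u v" using assms by (simp add: adjacent_sym)
  then have "sep K v u = {vhalf K v u}" "sep K u v = {\<Union>K - vhalf K v u}"
    using sep_adjacent assms vhalf_compl by simp_all
  then have e: "H \<in> sep K v u \<longleftrightarrow> H = vhalf K v u" "H \<in> sep K u v \<longleftrightarrow> H = \<Union>K - vhalf K v u" for H
    by simp_all
  show ?thesis
  proof (rule Set.set_eqI)
    fix H
    show "H \<in> {H \<in> vhalfs K. u \<in> H} \<longleftrightarrow>
        H \<in> ({H \<in> vhalfs K. v \<in> H} - {vhalf K v u}) \<union> {\<Union>K - vhalf K v u}"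
      using e[of H] unfolding sep_def mem_Collect_eq Un_iff Diff_iff singleton_iff by argo
  qed
qed

text \<open>A consistent orientation at finite distance from a vertex is a vertex.\<close>

lemma flip_vertex:
  assumes "finite F" "v \<in> \<Union>K" "F \<subseteq> {H \<in> vhalfs K. v \<in> H}"
    and "\<And>A B. A \<in> ({H \<in> vhalfs K. v \<in> H} - F) \<union> (\<lambda>H. \<Union>K - H) ` F \<Longrightarrow>
      B \<in> ({H \<in> vhalfs K. v \<in> H} - F) \<union> (\<lambda>H. \<Union>K - H) ` F \<Longrightarrow> A \<inter> B \<noteq> {}"
  shows "\<exists>u\<in>\<Union>K. {H \<in> vhalfs K. u \<in> H} = ({H \<in> vhalfs K. v \<in> H} - F) \<union> (\<lambda>H. \<Union>K - H) ` F"
  using assms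
proof (induction "card F" arbitrary: F v)
  case 0
  then show ?case by auto
next
  case (Suc n)
  let ?S = "{H \<in> vhalfs K. v \<in> H}" and ?c = "\<lambda>H. \<Union>K - H"
  let ?\<sigma> = "(?S - F) \<union> ?c ` F"
  have "F \<noteq> {}" using Suc.hyps(2) by auto
  \<comment> \<open>A minimal member of \<open>F\<close> bounds an edge at \<open>v\<close> and can
    be flipped first: a smaller half-space around \<open>v\<close> outside \<open>F\<close> would be
    disjoint from the complement of \<open>H\<close>, although both belong to the consistent
    orientation.\<close>
  then obtain H where H: "H \<in> F" "\<And>H'. H' \<in> F \<Longrightarrow> H' \<subseteq> H \<Longrightarrow> H' = H"
    using finite_has_minimal[OF Suc.prems(1)] by metis
  have HS: "H \<in> vhalfs K" "v \<in> H" using H(1) Suc.prems(3) by auto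
  obtain u where u: "adjacent K v u" "H = vhalf K v u"
  proof (rule minimal_vhalf_adjacent[OF Suc.prems(2) HS])
    fix H' assume H': "H' \<in> vhalfs K" "v \<in> H'" "H' \<subseteq> H"
    show "H' = H"
    proof (cases "H' \<in> F")
      case False
      then have "H' \<in> ?\<sigma>" "?c H \<in> ?\<sigma>" using H' H(1) by auto
      then have "H' \<inter> ?c H \<noteq> {}" by (rule Suc.prems(4))
      then show ?thesis using H'(3) by blast
    qed (use H H' in blast)
  qed
  have uV: "u \<in> \<Union>K" using adjacent_vertex(2)[OF u(1)] .
  have Su: "{H \<in> vhalfs K. u \<in> H} = (?S - {H}) \<union> {?c H}"
    using flip_adjacent[OF u(1)] u(2) by simp
  have "?c H \<notin> F" using Suc.prems(3) HS by auto
  have "F = insert H (F - {H})" using H(1) by blast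
  then have im: "?c ` F = insert (?c H) (?c ` (F - {H}))" by (metis image_insert)
  have eq: "((?S - {H}) \<union> {?c H} - (F - {H})) \<union> ?c ` (F - {H}) = ?\<sigma>"
    unfolding im using \<open>?c H \<notin> F\<close> H(1) by blast
  have "\<exists>w\<in>\<Union>K. {H \<in> vhalfs K. w \<in> H} = ({H \<in> vhalfs K. u \<in> H} - (F - {H})) \<union> ?c ` (F - {H})"
  proof (rule Suc.hyps(1))
    show "n = card (F - {H})" using Suc.hyps(2) H(1) Suc.prems(1) by simp
    show "F - {H} \<subseteq> {H \<in> vhalfs K. u \<in> H}" unfolding Su using Suc.prems(3) by blast
    show "A \<inter> B \<noteq> {}" if "A \<in> {H \<in> vhalfs K. u \<in> H} - (F - {H}) \<union> ?c ` (F - {H})"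
      "B \<in> {H \<in> vhalfs K. u \<in> H} - (F - {H}) \<union> ?c ` (F - {H})" for A B
      using that unfolding Su eq by (rule Suc.prems(4))
  qed (use Suc.prems(1) uV in auto)
  then show ?case unfolding Su eq .
qed

section \<open>Cubes as families of independent flips\<close>

lemma cube_sep:
  assumes \<psi>: "cube_param K C n \<psi>"
  obtains \<pi> where "inj_on \<pi> {..<n}" "\<forall>B\<subseteq>{..<n}. sep K (\<psi> {}) (\<psi> B) = \<pi> ` B"
proof -
  have "{\<psi> {}} \<in> K" using cube_param_face[OF \<psi>, of "{}" "{}"] by simp
  then have v: "\<psi> {} \<in> \<Union>K" by blast
  have V: "\<psi> B \<in> \<Union>K" if "B \<subseteq> {..<n}" for B
    using cube_param_face[OF \<psi>, of B B] that by auto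
  obtain \<pi> where \<pi>: "inj_on \<pi> {..<n}" "\<And>B. B \<subseteq> {..<n} \<Longrightarrow>
      sep K (\<psi> {}) (\<psi> B) = sym_diff (sep K (\<psi> {}) (\<psi> {})) (\<pi> ` B)"
  proof (rule hypercube_coordinates[of "\<lambda>B. sep K (\<psi> {}) (\<psi> B)" n])
    show "inj_on (\<lambda>B. sep K (\<psi> {}) (\<psi> B)) (Pow {..<n})"
      using sep_inj[OF v V V] cube_param_inj[OF \<psi>] by (intro inj_onI) blast
    fix B i assume "B \<subseteq> {..<n}" "i < n" "i \<notin> B"
    then have a: "adjacent K (\<psi> B) (\<psi> (insert i B))" "\<psi> B \<in> \<Union>K" "\<psi> (insert i B) \<in> \<Union>K"
      using cube_param_edge[OF \<psi>] V by auto
    have "card (sym_diff (sep K (\<psi> {}) (\<psi> B)) (sep K (\<psi> {}) (\<psi> (insert i B)))) = 1"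
      using vdist_via[OF v a(2,3)] vdist_eq_1[OF a(2,3)] a(1) by simp
    then show "\<exists>a. sym_diff (sep K (\<psi> {}) (\<psi> B)) (sep K (\<psi> {}) (\<psi> (insert i B))) = {a}"
      by (rule card_1_singletonE) blast
  qed blast
  show ?thesis
    by (rule that[OF \<pi>(1)]) (use \<pi>(2) sep_self in auto)
qed

text \<open>The vertices \<open>u {H}\<close> are neighbours of \<open>v\<close>, and two of them
  span a square with \<open>v\<close> by the quadrangle condition seen from
  \<open>u {H, H'}\<close>. The flag condition gives a cube at \<open>v\<close> whose directions are
  the members of \<open>F\<close>; since \<open>sep\<close> from \<open>v\<close> determines a
  vertex, its vertices are the \<open>u S\<close>.\<close>

lemma cube_of_flips:
  assumes v: "v \<in> \<Union>K" and F: "finite F"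
    and u: "\<And>S. S \<subseteq> F \<Longrightarrow> u S \<in> \<Union>K" "\<And>S. S \<subseteq> F \<Longrightarrow> sep K v (u S) = S"
  shows "u ` Pow F \<in> K"
proof (cases "F = {}")
  case True
  then have "sep K v (u {}) = {}" "u {} \<in> \<Union>K" using u by auto
  then have "u {} = v" using sep_empty_iff[OF v] by metis
  then show ?thesis using True vertex_cube[OF v] by simp
next
  case False
  have adj: "adjacent K v (u {H})" if "H \<in> F" for H
    using card_sep[OF v u(1)[of "{H}"]] u(2)[of "{H}"] vdist_eq_1[OF v u(1)[of "{H}"]] that by simp
  obtain C where C: "C \<in> K" "v \<in> C" "{w \<in> C. adjacent K v w} = (\<lambda>H. u {H}) ` F"
  proof (rule flag_cube[OF flags[OF v], of "(\<lambda>H. u {H}) ` F"])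
    fix a b assume ab: "a \<in> (\<lambda>H. u {H}) ` F" "b \<in> (\<lambda>H. u {H}) ` F" "a \<noteq> b"
    then obtain H H' where H: "H \<in> F" "H' \<in> F" "a = u {H}" "b = u {H'}" "H \<noteq> H'" by blast
    let ?z = "u {H, H'}"
    have z: "?z \<in> \<Union>K" "sep K v ?z = {H, H'}" using u H by auto
    have S: "sep K v v = {}" "sep K v a = {H}" "sep K v b = {H'}" using u H sep_self by auto
    have aV: "a \<in> \<Union>K" "b \<in> \<Union>K" using u H by auto
    have d: "vdist K ?z v = Suc 1" "vdist K ?z a = 1" "vdist K ?z b = 1"
      using vdist_via[OF v z(1) v] vdist_via[OF v z(1) aV(1)] vdist_via[OF v z(1) aV(2)] H(5)
      unfolding z(2) S by (simp_all add: insert_Diff_if)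
    have e: "adjacent K a v" "adjacent K b v" using adj H by (auto simp: adjacent_sym)
    obtain w where w: "square K w a v b" "Suc (vdist K ?z w) = 1" "w \<in> \<Union>K"
      by (rule quadrangle[OF z(1) e ab(3) d])
    have "square K v a w b" using w(1) by (metis square_rotate square_reflect)
    then show "\<exists>d. square K v a d b" by blast
  next
    show "adjacent K v a" if "a \<in> (\<lambda>H. u {H}) ` F" for a
      using that adj by blast
    show "finite ((\<lambda>H. u {H}) ` F)" "(\<lambda>H. u {H}) ` F \<noteq> {}"
      using F False by simp_all
  qed
  obtain n \<psi> where \<psi>: "cube_param K C n \<psi>" "\<psi> {} = v"
    using rooted_param[OF C(1,2)] .
  obtain \<pi> where "inj_on \<pi> {..<n}" "\<forall>B\<subseteq>{..<n}. sep K (\<psi> {}) (\<psi> B) = \<pi> ` B"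
    by (rule cube_sep[OF \<psi>(1)])
  then have \<pi>: "inj_on \<pi> {..<n}" "\<And>B. B \<subseteq> {..<n} \<Longrightarrow> sep K v (\<psi> B) = \<pi> ` B"
    using \<psi>(2) by simp_all
  have nb: "(\<lambda>i. \<psi> {i}) ` {..<n} = (\<lambda>H. u {H}) ` F"
    using cube_param_neighbours[OF \<psi>(1)] C(3) \<psi>(2) by simp
  have "(\<lambda>x. sep K v x) ` (\<lambda>i. \<psi> {i}) ` {..<n} = (\<lambda>i. {\<pi> i}) ` {..<n}"
    unfolding image_image using \<pi>(2) by (intro image_cong) auto
  moreover have "(\<lambda>x. sep K v x) ` (\<lambda>H. u {H}) ` F = (\<lambda>H. {H}) ` F"
    unfolding image_image using u(2) by (intro image_cong) auto
  ultimately have "(\<lambda>i. {\<pi> i}) ` {..<n} = (\<lambda>H. {H}) ` F" using nb by simp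
  then have "\<Union>((\<lambda>i. {\<pi> i}) ` {..<n}) = \<Union>((\<lambda>H. {H}) ` F)" by simp
  then have F: "F = \<pi> ` {..<n}" by auto
  have CV: "\<psi> B \<in> \<Union>K" if "B \<subseteq> {..<n}" for B
    using cube_param_in[OF \<psi>(1) that] C(1) by blast
  have "u (\<pi> ` B) = \<psi> B" if "B \<subseteq> {..<n}" for B
  proof -
    have sub: "\<pi> ` B \<subseteq> F" unfolding F using that by (rule image_mono)
    show ?thesis
      by (rule sep_inj[OF v u(1)[OF sub] CV[OF that]]) (simp add: u(2)[OF sub] \<pi>(2)[OF that])
  qed
  then have "u ` (\<lambda>B. \<pi> ` B) ` Pow {..<n} = \<psi> ` Pow {..<n}"
    unfolding image_image by (intro image_cong) auto
  moreover have "(\<lambda>B. \<pi> ` B) ` Pow {..<n} = Pow F"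
    unfolding F by (simp add: image_Pow_surj)
  ultimately show ?thesis using cube_param_image[OF \<psi>(1)] C(1) by simp
qed

end

section \<open>Geometric half-spaces\<close>

text \<open>The mass that a point puts on \<open>W\<close>; restriction to the support keeps the sum
  finite for infinite \<open>W\<close>. For a half-space this is the coordinate transverse to its
  hyperplane in every cube that the hyperplane cuts.\<close>

definition weight :: "'v set \<Rightarrow> ('v \<Rightarrow> real) \<Rightarrow> real" where
  "weight W w = (\<Sum>v | v \<in> W \<and> w v \<noteq> 0. w v)"

definition geo_half :: "'v set set \<Rightarrow> 'v set \<Rightarrow> ('v \<Rightarrow> real) set" where
  "geo_half K W = {w \<in> topspace (realization K). 1 / 2 \<le> weight W w}"

lemma weight_vertex_point: "weight W (vertex_point v) = (if v \<in> W then 1 else 0)"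
proof -
  have "{u \<in> W. vertex_point v u \<noteq> (0::real)} = (if v \<in> W then {v} else {})"
    by (auto simp: vertex_point_def)
  then show ?thesis by (simp add: weight_def vertex_point_def)
qed

lemma cube_point_vertex:
  assumes \<phi>: "cube_chart K C n \<phi>" and a: "a \<in> C"
  shows "cube_point C n \<phi> (\<lambda>j. if j \<in> \<phi> a then 1 else 0) = vertex_point a"
proof
  fix u
  show "cube_point C n \<phi> (\<lambda>j. if j \<in> \<phi> a then 1 else 0) u = vertex_point a u"
  proof (cases "u \<in> C")
    case True
    have sub: "\<phi> u \<subseteq> {..<n}" "\<phi> a \<subseteq> {..<n}"
      using cube_param_chart(4)[OF \<phi>] True a by auto
    have "\<phi> u = \<phi> a \<longleftrightarrow> u = a"
      using \<phi> True a by (auto simp: cube_chart_def bij_betw_def inj_on_def)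
    moreover have "(\<Prod>i<n. if i \<in> \<phi> u then (if i \<in> \<phi> a then 1 else 0) else 1 - (if i \<in> \<phi> a then 1 else 0)) =
        (if \<phi> u = \<phi> a then 1 else 0 :: real)"
    proof (cases "\<phi> u = \<phi> a")
      case False
      then obtain i where "i < n" "i \<in> \<phi> u \<longleftrightarrow> i \<notin> \<phi> a" using sub by blast
      then have "(if i \<in> \<phi> u then (if i \<in> \<phi> a then 1 else 0) else 1 - (if i \<in> \<phi> a then 1 else 0)) = (0::real)"
        by auto
      then have "(\<Prod>i<n. if i \<in> \<phi> u then (if i \<in> \<phi> a then 1 else 0) else 1 - (if i \<in> \<phi> a then 1 else 0)) = (0::real)"
        using \<open>i < n\<close> by (intro prod_zero bexI[of _ i]) simp_all
      then show ?thesis using False by simp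
    qed (auto intro!: prod.neutral)
    ultimately show ?thesis using True by (simp add: cube_point_def vertex_point_def)
  qed (use a in \<open>auto simp: cube_point_def vertex_point_def\<close>)
qed

lemma continuous_cube_point:
  assumes "\<And>i. i < n \<Longrightarrow> continuous_on S (\<lambda>s. t s i)"
  shows "continuous_on S (\<lambda>s. cube_point C n \<phi> (t s))"
  unfolding continuous_on_fun_iff
proof
  fix v
  show "continuous_on S (\<lambda>s. cube_point C n \<phi> (t s) v)"
  proof (cases "v \<in> C")
    case True
    have "continuous_on S (\<lambda>s. if i \<in> \<phi> v then t s i else 1 - t s i)" if "i < n" for i
      using assms[OF that] by (cases "i \<in> \<phi> v") (auto intro!: continuous_intros)
    then have "continuous_on S (\<lambda>s. \<Prod>i<n. if i \<in> \<phi> v then t s i else 1 - t s i)"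
      by (intro continuous_on_prod) simp
    then show ?thesis using True by (simp add: cube_point_def)
  qed (simp add: cube_point_def)
qed

context cat0_complex
begin

lemma weight_cell:
  assumes "C \<in> K" "w \<in> cell K C" shows "weight W w = sum w (W \<inter> C)"
  unfolding weight_def
  by (rule sum.mono_neutral_left) (use finite_cube[OF assms(1)] cell_outside[OF assms(2)] in auto)

lemma weight_compl:
  assumes "w \<in> topspace (realization K)" shows "weight (\<Union>K - W) w = 1 - weight W w"
proof -
  obtain C where C: "C \<in> K" "w \<in> cell K C" using topspace_cellE[OF assms] .
  have "C = (W \<inter> C) \<union> ((\<Union>K - W) \<inter> C)" using C by blast
  then have "sum w C = sum w (W \<inter> C) + sum w ((\<Union>K - W) \<inter> C)"
    using finite_cube[OF C(1)] by (subst \<open>C = _\<close>, subst sum.union_disjoint) auto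
  then show ?thesis using cell_sum[OF C(2)] weight_cell[OF C] by simp
qed

lemma continuous_map_weight: "continuous_map (realization K) euclideanreal (weight W)"
proof (rule continuous_map_from_realization)
  fix C assume C: "C \<in> K"
  have "continuous_on (cell K C) (\<lambda>w. sum w (W \<inter> C))"
    by (intro continuous_on_sum continuous_on_coordinate)
  then show "continuous_on (cell K C) (weight W)"
    by (rule continuous_on_cong[THEN iffD1, rotated -1]) (use weight_cell[OF C] in auto)
qed

text \<open>The half-spaces that separate the origin \<open>?v\<close> from other vertices of the
  cube are indexed by the directions of the chart. Whichever of \<open>H\<close> and its complement
  contains \<open>?v\<close> is one of them or does not cut the cube.\<close>

lemma halfspace_in_chart:
  assumes H: "H \<in> vhalfs K" and \<phi>: "cube_chart K C n \<phi>" and C: "C \<in> K"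
  obtains (all) "C \<subseteq> H" | (none) "C \<inter> H = {}"
  | (pos) i where "i < n" "\<And>v. v \<in> C \<Longrightarrow> v \<in> H \<longleftrightarrow> i \<in> \<phi> v"
  | (neg) i where "i < n" "\<And>v. v \<in> C \<Longrightarrow> v \<in> H \<longleftrightarrow> i \<notin> \<phi> v"
proof -
  define \<psi> where "\<psi> = the_inv_into C \<phi>"
  note ch = cube_param_chart[OF \<phi>, folded \<psi>_def]
  let ?v = "\<psi> {}"
  have v: "?v \<in> C" using cube_param_in[OF ch(1)] by simp
  obtain \<pi> where "inj_on \<pi> {..<n}" "\<forall>B\<subseteq>{..<n}. sep K ?v (\<psi> B) = \<pi> ` B"
    by (rule cube_sep[OF ch(1)])
  then have \<pi>: "inj_on \<pi> {..<n}" "\<And>B. B \<subseteq> {..<n} \<Longrightarrow> sep K ?v (\<psi> B) = \<pi> ` B"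
    by simp_all
  have mem: "H' \<in> \<pi> ` \<phi> u \<longleftrightarrow> u \<notin> H'" if "u \<in> C" "H' \<in> vhalfs K" "?v \<in> H'" for u H'
    using \<pi>(2)[OF ch(4)[OF that(1)]] ch(2)[OF that(1)] that by (auto simp: sep_def)
  have idx: "i \<in> \<phi> u \<longleftrightarrow> \<pi> i \<in> \<pi> ` \<phi> u" if "i < n" "u \<in> C" for i u
    using inj_on_image_mem_iff[OF \<pi>(1), of i "\<phi> u"] ch(4)[OF that(2)] that(1) by simp
  have CV: "C \<subseteq> \<Union>K" using C by blast
  show ?thesis
  proof (cases "?v \<in> H")
    case True
    show ?thesis
    proof (cases "\<exists>i<n. H = \<pi> i")
      case True
      then obtain i where i: "i < n" "H = \<pi> i" by blast
      show ?thesis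
        using neg[OF i(1)] mem[OF _ H \<open>?v \<in> H\<close>] idx[OF i(1)] i(2) by blast
    next
      case False
      then have "H \<notin> \<pi> ` \<phi> u" if "u \<in> C" for u
        using ch(4)[OF that] by blast
      then show ?thesis using all mem[OF _ H True] by blast
    qed
  next
    case False
    let ?H = "\<Union>K - H"
    have H': "?H \<in> vhalfs K" "?v \<in> ?H" using vhalfs_compl[OF H] False v CV by auto
    have cm: "u \<notin> ?H \<longleftrightarrow> u \<in> H" if "u \<in> C" for u using that CV by blast
    show ?thesis
    proof (cases "\<exists>i<n. ?H = \<pi> i")
      case True
      then obtain i where i: "i < n" "?H = \<pi> i" by (elim exE conjE)
      have "u \<in> H \<longleftrightarrow> i \<in> \<phi> u" if "u \<in> C" for u
        using mem[OF that H'] idx[OF i(1) that] cm[OF that] unfolding i(2) by blast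
      then show ?thesis using pos[OF i(1)] by blast
    next
      case False
      have "u \<notin> H" if u: "u \<in> C" for u
      proof
        assume "u \<in> H"
        then have "?H \<in> \<pi> ` \<phi> u" using mem[OF u H'] cm[OF u] by simp
        then obtain i where "i \<in> \<phi> u" "?H = \<pi> i" by (rule imageE) simp
        then show False using False ch(4)[OF u] by (meson lessThan_iff subsetD)
      qed
      then have "C \<inter> H = {}" by blast
      then show ?thesis by (rule none)
    qed
  qed
qed

lemma weight_chart:
  assumes C: "C \<in> K" and \<phi>: "cube_chart K C n \<phi>" and t: "\<forall>i<n. 0 \<le> t i \<and> t i \<le> 1"
  shows "C \<subseteq> H \<Longrightarrow> weight H (cube_point C n \<phi> t) = 1"
    and "C \<inter> H = {} \<Longrightarrow> weight H (cube_point C n \<phi> t) = 0"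
    and "i < n \<Longrightarrow> (\<And>v. v \<in> C \<Longrightarrow> v \<in> H \<longleftrightarrow> i \<in> \<phi> v) \<Longrightarrow> weight H (cube_point C n \<phi> t) = t i"
    and "i < n \<Longrightarrow> (\<And>v. v \<in> C \<Longrightarrow> v \<in> H \<longleftrightarrow> i \<notin> \<phi> v) \<Longrightarrow> weight H (cube_point C n \<phi> t) = 1 - t i"
proof -
  let ?w = "cube_point C n \<phi> t"
  have w: "?w \<in> cell K C" using t by (intro cellI[OF \<phi>]) auto
  note wt = weight_cell[OF C w]
  show "C \<subseteq> H \<Longrightarrow> weight H ?w = 1"
    using cell_sum[OF w] wt by (simp add: Int_absorb1)
  show "C \<inter> H = {} \<Longrightarrow> weight H ?w = 0"
    using wt by (simp add: Int_commute)
  {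
    assume i: "i < n" and H: "\<And>v. v \<in> C \<Longrightarrow> v \<in> H \<longleftrightarrow> i \<in> \<phi> v"
    have "H \<inter> C = {v. v \<in> C \<and> i \<in> \<phi> v}" using H by blast
    then show "weight H ?w = t i"
      using wt cube_point_sum[OF \<phi>, where P = "\<lambda>A. i \<in> A" and t = t] sum_Pow_prod_mem[of "{..<n}" i t] i by simp
  next
    assume i: "i < n" and H: "\<And>v. v \<in> C \<Longrightarrow> v \<in> H \<longleftrightarrow> i \<notin> \<phi> v"
    have "H \<inter> C = {v. v \<in> C \<and> i \<notin> \<phi> v}" using H by blast
    then show "weight H ?w = 1 - t i"
      using wt cube_point_sum[OF \<phi>, where P = "\<lambda>A. i \<notin> A" and t = t] sum_Pow_prod_not_mem[of "{..<n}" i t] i by simp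
  }
qed

text \<open>In a cube the weight of the half-space is 0, 1, or, for a single direction
  \<open>i\<close>, the coordinate \<open>t i\<close> or \<open>1 - t i\<close>; its level 1/2 is
  the midcube in that direction. That the dual edges are the ones parallel to \<open>{x, y}\<close>
  is \<open>parallel_vhalf\<close> for one inclusion and \<open>crossing_edge\<close> for the
  other.\<close>

lemma hyperplane_eq:
  assumes xy: "adjacent K x y"
  shows "hyperplane K {x, y} = {w \<in> topspace (realization K). weight (vhalf K x y) w = 1 / 2}"
proof (intro equalityI subsetI)
  let ?H = "vhalf K x y"
  have H: "?H \<in> vhalfs K" using vhalfsI[OF xy] .
  fix w assume "w \<in> hyperplane K {x, y}"
  then obtain C f where C: "C \<in> K" "f \<subseteq> C" "(opposite_edges K)\<^sup>*\<^sup>* {x, y} f" "w \<in> midcube K C f"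
    unfolding hyperplane_def by blast
  obtain n \<phi> t i p q where m: "w = cube_point C n \<phi> t" "cube_chart K C n \<phi>" "\<forall>j<n. t j \<in> {0..1}" "i < n"
    "f = {p, q}" "i \<notin> \<phi> p" "\<phi> q = insert i (\<phi> p)" "t i = 1 / 2"
    using C(4) unfolding midcube_def by blast
  have t: "\<forall>j<n. 0 \<le> t j \<and> t j \<le> 1" using m(3) by simp
  obtain u v where uv: "f = {u, v}" "adjacent K u v" "vhalf K u v = ?H"
    using parallel_vhalf[OF C(3) xy] by blast
  have "u \<in> ?H" "v \<notin> ?H" using vhalf_ends[OF uv(2)] uv(3) by auto
  then have one: "p \<in> ?H \<longleftrightarrow> q \<notin> ?H" using uv(1) m(5) by (auto simp: doubleton_eq_iff)
  have pq: "p \<in> C" "q \<in> C" using C(2) m(5) by auto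
  have "w \<in> cell K C" unfolding m(1) using t by (intro cellI[OF m(2)]) auto
  then have top: "w \<in> topspace (realization K)" using cell_subset_topspace[OF C(1)] by blast
  have "weight ?H w = 1 / 2"
    using H m(2) C(1)
  proof (cases rule: halfspace_in_chart)
    case all
    then show ?thesis using one pq by blast
  next
    case none
    then show ?thesis using one pq by blast
  next
    case (pos j)
    have "j = i" using one pos(2)[OF pq(1)] pos(2)[OF pq(2)] m(7) by auto
    then show ?thesis
      using weight_chart(3)[OF C(1) m(2) t pos] m(1,8) by simp
  next
    case (neg j)
    have "j = i" using one neg(2)[OF pq(1)] neg(2)[OF pq(2)] m(7) by auto
    then show ?thesis
      using weight_chart(4)[OF C(1) m(2) t neg] m(1,8) by simp
  qed
  then show "w \<in> {w \<in> topspace (realization K). weight ?H w = 1 / 2}"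
    using top by simp
next
  let ?H = "vhalf K x y"
  have H: "?H \<in> vhalfs K" using vhalfsI[OF xy] .
  fix w assume "w \<in> {w \<in> topspace (realization K). weight ?H w = 1 / 2}"
  then have w: "w \<in> topspace (realization K)" "weight ?H w = 1 / 2" by auto
  obtain C where C: "C \<in> K" "w \<in> cell K C" using topspace_cellE[OF w(1)] .
  obtain n \<phi> t where m: "cube_chart K C n \<phi>" "\<forall>i<n. 0 \<le> t i \<and> t i \<le> 1" "w = cube_point C n \<phi> t"
    using C(2) by (rule cellE)
  define \<psi> where "\<psi> = the_inv_into C \<phi>"
  note ch = cube_param_chart[OF m(1), folded \<psi>_def]
  have mid: "w \<in> hyperplane K {x, y}"
    if i: "i < n" "t i = 1 / 2" and o: "(opposite_edges K)\<^sup>*\<^sup>* {x, y} {\<psi> {}, \<psi> {i}}" for i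
  proof -
    have "w \<in> midcube K C {\<psi> {}, \<psi> {i}}"
      unfolding midcube_def mem_Collect_eq
    proof (intro exI conjI)
      show "w = cube_point C n \<phi> t" "cube_chart K C n \<phi>" "i < n" "t i = 1 / 2" by fact+
      show "\<forall>j<n. t j \<in> {0..1}" using m(2) by simp
      show "{\<psi> {}, \<psi> {i}} = {\<psi> {}, \<psi> {i}}" ..
      show "i \<notin> \<phi> (\<psi> {})" "\<phi> (\<psi> {i}) = insert i (\<phi> (\<psi> {}))" using ch(3)[of "{}"] ch(3)[of "{i}"] i(1) by simp_all
    qed
    moreover have "{\<psi> {}, \<psi> {i}} \<subseteq> C" using cube_param_in[OF ch(1)] i(1) by simp
    ultimately show ?thesis unfolding hyperplane_def using C(1) o by blast
  qed
  have edge: "adjacent K (\<psi> {}) (\<psi> {i})" "adjacent K (\<psi> {i}) (\<psi> {})" if "i < n" for i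
    using cube_param_edge[OF ch(1), of "{}" i] that by (auto simp: adjacent_sym)
  have inC: "\<psi> {} \<in> C" "i < n \<Longrightarrow> \<psi> {i} \<in> C" for i
    using cube_param_in[OF ch(1)] by auto
  have \<phi>\<psi>: "\<phi> (\<psi> {}) = {}" "i < n \<Longrightarrow> \<phi> (\<psi> {i}) = {i}" for i using ch(3)[of "{}"] ch(3)[of "{i}"] by auto
  show "w \<in> hyperplane K {x, y}"
    using H m(1) C(1)
  proof (cases rule: halfspace_in_chart)
    case all
    then show ?thesis using weight_chart(1)[OF C(1) m(1,2) all] w(2) m(3) by simp
  next
    case none
    then show ?thesis using weight_chart(2)[OF C(1) m(1,2) none] w(2) m(3) by simp
  next
    case (pos i)
    have "t i = 1 / 2" using weight_chart(3)[OF C(1) m(1,2) pos] w(2) m(3) by simp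
    moreover have "\<psi> {i} \<in> ?H" "\<psi> {} \<notin> ?H" using pos(2)[OF inC(1)] pos(2)[OF inC(2)[OF pos(1)]] \<phi>\<psi> pos(1) by auto
    ultimately show ?thesis
      using mid[OF pos(1)] crossing_edge[OF xy edge(2)[OF pos(1)]] by (simp add: insert_commute)
  next
    case (neg i)
    have "t i = 1 / 2" using weight_chart(4)[OF C(1) m(1,2) neg] w(2) m(3) by simp
    moreover have "\<psi> {i} \<notin> ?H" "\<psi> {} \<in> ?H" using neg(2)[OF inC(1)] neg(2)[OF inC(2)[OF neg(1)]] \<phi>\<psi> neg(1) by auto
    ultimately show ?thesis
      using mid[OF neg(1)] crossing_edge[OF xy edge(1)[OF neg(1)]] by simp
  qed
qed

text \<open>Inside a cube of \<open>w\<close>, move straight in chart coordinates to a vertex of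
  \<open>H\<close>. The weight of \<open>H\<close> is constantly 1 or is an affine function of the
  transverse coordinate, so it exceeds 1/2 as soon as the motion starts. Both the closure and the
  connectedness of the open half rest on these paths.\<close>

lemma push_into_half:
  assumes H: "H \<in> vhalfs K" and w: "w \<in> topspace (realization K)" "1 / 2 \<le> weight H w"
  obtains p a where "pathin (realization K) p" "p 0 = w" "a \<in> H" "p 1 = vertex_point a"
    "\<forall>s. 0 < s \<longrightarrow> s \<le> 1 \<longrightarrow> 1 / 2 < weight H (p s)"
proof -
  obtain C where C: "C \<in> K" "w \<in> cell K C" using topspace_cellE[OF w(1)] .
  obtain n \<phi> t where m: "cube_chart K C n \<phi>" "\<forall>i<n. 0 \<le> t i \<and> t i \<le> 1" "w = cube_point C n \<phi> t"
    using C(2) by (rule cellE)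
  define \<psi> where "\<psi> = the_inv_into C \<phi>"
  note ch = cube_param_chart[OF m(1), folded \<psi>_def]
  define T where "T A s j = (1 - s) * t j + s * (if j \<in> A then 1 else 0)" for A s j
  have T01: "\<forall>j<n. 0 \<le> T A s j \<and> T A s j \<le> 1" if "0 \<le> s" "s \<le> 1" for A s
  proof (intro allI impI)
    fix j assume "j < n"
    then have "0 \<le> t j" "t j \<le> 1" using m(2) by auto
    then have "(1 - s) * t j \<le> (1 - s) * 1" using that by (intro mult_left_mono) auto
    then show "0 \<le> T A s j \<and> T A s j \<le> 1" using that \<open>0 \<le> t j\<close> by (auto simp: T_def)
  qed
  have path: "\<exists>p a. pathin (realization K) p \<and> p 0 = w \<and> a \<in> H \<and> p 1 = vertex_point a \<and>
     (\<forall>s. 0 < s \<longrightarrow> s \<le> 1 \<longrightarrow> 1 / 2 < weight H (p s))"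
    if a: "a \<in> C" "a \<in> H" and wt: "\<And>s. 0 < s \<Longrightarrow> s \<le> 1 \<Longrightarrow> 1 / 2 < weight H (cube_point C n \<phi> (T (\<phi> a) s))" for a
  proof (intro exI conjI allI impI)
    let ?p = "\<lambda>s. cube_point C n \<phi> (T (\<phi> a) s)"
    show "pathin (realization K) ?p"
      unfolding pathin_def
    proof (rule continuous_map_into_realization[of _ _ "{C}"])
      have "continuous_on {0..1} (\<lambda>s. T (\<phi> a) s i)" for i
        unfolding T_def by (intro continuous_intros)
      then show "continuous_map (top_of_set {0..1}) euclidean ?p"
        by (simp add: continuous_cube_point)
      show "\<exists>C\<in>{C}. ?p s \<in> cell K C" if "s \<in> topspace (top_of_set {0..1})" for s
        using T01[of s "\<phi> a"] that by (auto intro!: cellI[OF m(1)])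
    qed (use C(1) in auto)
    have "T (\<phi> a) 0 = t" by (simp add: T_def fun_eq_iff)
    then show "?p 0 = w" using m(3) by simp
    have "T (\<phi> a) 1 = (\<lambda>j. if j \<in> \<phi> a then 1 else 0)" by (simp add: T_def fun_eq_iff)
    then show "?p 1 = vertex_point a" using cube_point_vertex[OF m(1) a(1)] by simp
  qed (use a wt in auto)
  have "\<exists>p a. pathin (realization K) p \<and> p 0 = w \<and> a \<in> H \<and> p 1 = vertex_point a \<and>
     (\<forall>s. 0 < s \<longrightarrow> s \<le> 1 \<longrightarrow> 1 / 2 < weight H (p s))"
    using H m(1) C(1)
  proof (cases rule: halfspace_in_chart)
    case all
    show ?thesis
    proof (rule path[of "\<psi> {}"])
      show "\<psi> {} \<in> C" "\<psi> {} \<in> H" using cube_param_in[OF ch(1), of "{}"] all by auto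
      show "1 / 2 < weight H (cube_point C n \<phi> (T (\<phi> (\<psi> {})) s))" if "0 < s" "s \<le> 1" for s
        using weight_chart(1)[OF C(1) m(1) T01 all, of s] that by simp
    qed
  next
    case none
    then show ?thesis using weight_chart(2)[OF C(1) m(1,2) none] w(2) m(3) by simp
  next
    case (pos i)
    have ti: "1 / 2 \<le> t i" "t i \<le> 1" using weight_chart(3)[OF C(1) m(1,2) pos] w(2) m pos(1) by auto
    have i: "\<psi> {i} \<in> C" "\<phi> (\<psi> {i}) = {i}" using cube_param_in[OF ch(1), of "{i}"] ch(3)[of "{i}"] pos(1) by auto
    show ?thesis
    proof (rule path[of "\<psi> {i}"])
      show "\<psi> {i} \<in> C" "\<psi> {i} \<in> H" using i pos(2)[OF i(1)] by auto
      fix s :: real assume s: "0 < s" "s \<le> 1"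
      have "(1 - s) * (1 / 2) \<le> (1 - s) * t i" using s ti by (intro mult_left_mono) auto
      then have "1 / 2 < T (\<phi> (\<psi> {i})) s i" using s i(2) by (simp add: T_def field_simps)
      then show "1 / 2 < weight H (cube_point C n \<phi> (T (\<phi> (\<psi> {i})) s))"
        using weight_chart(3)[OF C(1) m(1) T01 pos, of s] s by simp
    qed
  next
    case (neg i)
    have ti: "t i \<le> 1 / 2" "0 \<le> t i" using weight_chart(4)[OF C(1) m(1,2) neg] w(2) m neg(1) by auto
    have i: "\<psi> {} \<in> C" "\<phi> (\<psi> {}) = {}" using cube_param_in[OF ch(1), of "{}"] ch(3)[of "{}"] by auto
    show ?thesis
    proof (rule path[of "\<psi> {}"])
      show "\<psi> {} \<in> C" "\<psi> {} \<in> H" using i neg(2)[OF i(1)] by auto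
      fix s :: real assume s: "0 < s" "s \<le> 1"
      have "(1 - s) * t i \<le> (1 - s) * (1 / 2)" using s ti by (intro mult_left_mono) auto
      then have "T (\<phi> (\<psi> {})) s i < 1 / 2" using s i(2) by (simp add: T_def field_simps)
      then show "1 / 2 < weight H (cube_point C n \<phi> (T (\<phi> (\<psi> {})) s))"
        using weight_chart(4)[OF C(1) m(1) T01 neg, of s] s by simp
    qed
  qed
  then show ?thesis using that by blast
qed

section \<open>The two components of the complement of a hyperplane\<close>

definition open_half :: "'v set \<Rightarrow> ('v \<Rightarrow> real) set" where
  "open_half H = {w \<in> topspace (realization K). 1 / 2 < weight H w}"

lemma openin_open_half: "openin (realization K) (open_half H)"
proof -
  have "openin (realization K) {w \<in> topspace (realization K). weight H w \<in> {1 / 2<..}}"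
    by (rule openin_continuous_map_preimage[OF continuous_map_weight]) simp
  then show ?thesis by (simp add: open_half_def)
qed

lemma closedin_geo_half: "closedin (realization K) (geo_half K H)"
proof -
  have "closedin (realization K) {w \<in> topspace (realization K). weight H w \<in> {1 / 2..}}"
    by (rule closedin_continuous_map_preimage[OF continuous_map_weight]) simp
  then show ?thesis by (simp add: geo_half_def)
qed

lemma closure_open_half:
  assumes H: "H \<in> vhalfs K"
  shows "realization K closure_of (open_half H) = geo_half K H"
proof
  show "realization K closure_of (open_half H) \<subseteq> geo_half K H"
    by (rule closure_of_minimal[OF _ closedin_geo_half]) (auto simp: open_half_def geo_half_def)
  show "geo_half K H \<subseteq> realization K closure_of (open_half H)"
  proof
    fix w assume "w \<in> geo_half K H"
    then have w: "w \<in> topspace (realization K)" "1 / 2 \<le> weight H w" by (auto simp: geo_half_def)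
    obtain p a where p: "pathin (realization K) p" "p 0 = w" "a \<in> H" "p 1 = vertex_point a"
      "\<forall>s. 0 < s \<longrightarrow> s \<le> 1 \<longrightarrow> 1 / 2 < weight H (p s)"
      by (rule push_into_half[OF H w])
    have c: "continuous_map (top_of_set {0..1}) (realization K) p" using p(1) by (simp add: pathin_def)
    have "(0::real) \<in> {0..1} \<inter> closure ({0..1} \<inter> {0<..1})"
    proof -
      have "{0..1} \<inter> {0<..1::real} = {0<..1}" by auto
      then show ?thesis by simp
    qed
    then have "0 \<in> top_of_set {0..1::real} closure_of {0<..1}"
      by (simp add: closure_of_subtopology)
    then have "w \<in> p ` (top_of_set {0..1::real} closure_of {0<..1})" using p(2) by blast
    then have "w \<in> realization K closure_of (p ` {0<..1})"
      using continuous_map_image_closure_subset[OF c] by blast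
    moreover have "p ` {0<..1} \<subseteq> open_half H"
      using p(5) continuous_map_image_subset_topspace[OF c] by (auto simp: open_half_def)
    ultimately show "w \<in> realization K closure_of (open_half H)"
      using closure_of_mono by blast
  qed
qed

text \<open>Points are pushed to vertices of \<open>H\<close>, and vertices of \<open>H\<close> are
  joined by geodesics inside \<open>H\<close>: if the predecessor \<open>w\<close> of
  \<open>v\<close> lay outside, \<open>H\<close> would be \<open>vhalf K v w\<close>, and
  \<open>u\<close> would be closer to \<open>v\<close> than to \<open>w\<close>.\<close>

lemma connectedin_open_half:
  assumes H: "H \<in> vhalfs K"
  shows "connectedin (realization K) (open_half H)"
proof -
  let ?S = "subtopology (realization K) (open_half H)"
  have sub: "open_half H \<subseteq> topspace (realization K)" by (auto simp: open_half_def)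
  have HV: "H \<subseteq> \<Union>K" using vhalfs_subset[OF H] .
  have vp: "vertex_point v \<in> open_half H" if "v \<in> H" for v
    using that HV vertex_point_topspace by (auto simp: open_half_def weight_vertex_point)
  have edge: "path_component_of ?S (vertex_point u) (vertex_point v)" if uv: "u \<in> H" "v \<in> H" "adjacent K u v" for u v
  proof -
    let ?p = "\<lambda>s. (\<lambda>z. (1 - s) * vertex_point u z + s * vertex_point v z)"
    have cellp: "?p s \<in> cell K {u, v}" if "0 \<le> s" "s \<le> 1" for s
      using edge_point_cell[OF cubical_axioms uv(3) that] .
    have C: "{u, v} \<in> K" using uv(3) by (simp add: adjacent_def)
    have "continuous_map (top_of_set {0..1}) (realization K) ?p"
    proof (rule continuous_map_into_realization[of _ _ "{{u, v}}"])
      show "continuous_map (top_of_set {0..1}) euclidean ?p"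
        by (simp add: continuous_on_fun_iff) (intro allI continuous_intros)
    qed (use C cellp in auto)
    moreover have "?p s \<in> open_half H" if "0 \<le> s" "s \<le> 1" for s
    proof -
      have "weight H (?p s) = sum (?p s) (H \<inter> {u, v})"
        using weight_cell[OF C cellp[OF that]] .
      also have "H \<inter> {u, v} = {u, v}" using uv by blast
      finally have "weight H (?p s) = 1" using cell_sum[OF cellp[OF that]] by simp
      then show ?thesis using cell_subset_topspace[OF C] cellp[OF that] by (auto simp: open_half_def)
    qed
    ultimately have "pathin ?S ?p"
      unfolding pathin_def by (intro continuous_map_into_subtopology) auto
    then show ?thesis
      unfolding path_component_of_def by (intro exI[of _ ?p]) simp
  qed
  obtain x y where xy: "adjacent K x y" "H = vhalf K x y" using H by (rule vhalfsE)
  have vertices: "path_component_of ?S (vertex_point u) (vertex_point v)" if u: "u \<in> H" and v: "v \<in> H" for u v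
    using v
  proof (induction "vdist K u v" arbitrary: v)
    case 0
    then have "u = v" using vdist_eq_0[OF subsetD[OF HV u] subsetD[OF HV 0(2)]] by simp
    then show ?case using vp[OF u] sub by (auto simp: path_component_of_refl)
  next
    case (Suc n)
    have V: "u \<in> \<Union>K" "v \<in> \<Union>K" using subsetD[OF HV] u Suc.prems by simp_all
    obtain w where w: "adjacent K w v" "vdist K u w = n"
      using vdist_predecessor[OF V Suc.hyps(2)[symmetric]] .
    have "w \<in> H"
    proof (rule ccontr)
      assume "w \<notin> H"
      then have "H = vhalf K v w"
        using vhalfs_crossing[OF H _ Suc.prems] w(1) by (simp add: adjacent_sym)
      then have "vdist K u v < vdist K u w" using u by (simp add: vhalf_def)
      then show False using Suc.hyps(2) w(2) by simp
    qed
    then have "path_component_of ?S (vertex_point u) (vertex_point w)"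
      using Suc.hyps(1)[of w] w(2) by simp
    then show ?case
      by (rule path_component_of_trans[OF _ edge[OF \<open>w \<in> H\<close> Suc.prems w(1)]])
  qed
  have pt: "\<exists>a\<in>H. path_component_of ?S w (vertex_point a)" if w: "w \<in> open_half H" for w
  proof -
    have w': "w \<in> topspace (realization K)" "1 / 2 \<le> weight H w" using w by (auto simp: open_half_def)
    obtain p a where p: "pathin (realization K) p" "p 0 = w" "a \<in> H" "p 1 = vertex_point a"
      "\<forall>s. 0 < s \<longrightarrow> s \<le> 1 \<longrightarrow> 1 / 2 < weight H (p s)"
      by (rule push_into_half[OF H w'])
    have c: "continuous_map (top_of_set {0..1}) (realization K) p" using p(1) by (simp add: pathin_def)
    have "p s \<in> open_half H" if "s \<in> {0..1}" for s
    proof (cases "s = 0")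
      case False
      then have "1 / 2 < weight H (p s)" using p(5) that by simp
      moreover have "p s \<in> topspace (realization K)"
        using continuous_map_image_subset_topspace[OF c] that by auto
      ultimately show ?thesis by (simp add: open_half_def)
    qed (use p w in simp)
    then have "pathin ?S p"
      using c unfolding pathin_def by (intro continuous_map_into_subtopology) auto
    then show ?thesis
      using p(2-4) unfolding path_component_of_def by blast
  qed
  have "path_connected_space ?S"
    unfolding path_connected_space_iff_path_component
  proof (intro ballI)
    fix w w' assume "w \<in> topspace ?S" "w' \<in> topspace ?S"
    then have "w \<in> open_half H" "w' \<in> open_half H" by auto
    then obtain a b where "a \<in> H" "b \<in> H" "path_component_of ?S w (vertex_point a)"
      "path_component_of ?S w' (vertex_point b)" using pt by meson
    then show "path_component_of ?S w w'"
      using vertices path_component_of_trans path_component_of_sym by metis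
  qed
  then have "connected_space ?S" by (rule path_connected_imp_connected_space)
  then show ?thesis using sub by (simp add: connectedin_def)
qed

lemma open_half_compl:
  "open_half (\<Union>K - H) = {w \<in> topspace (realization K). weight H w < 1 / 2}"
  using weight_compl by (auto simp: open_half_def)

text \<open>The two open halves are connected, open and disjoint, and they cover the complement of
  the hyperplane; hence they are its components.\<close>

lemma halfspaces_of_eq:
  assumes xy: "adjacent K x y"
  shows "halfspaces_of K (hyperplane K {x, y}) = {geo_half K (vhalf K x y), geo_half K (vhalf K y x)}"
proof -
  let ?H = "vhalf K x y" and ?H' = "vhalf K y x"
  let ?h = "hyperplane K {x, y}"
  let ?S = "subtopology (realization K) (topspace (realization K) - ?h)"
  have yx: "adjacent K y x" using xy by (simp add: adjacent_sym)
  have H: "?H \<in> vhalfs K" "?H' \<in> vhalfs K" using vhalfsI xy yx by auto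
  have top: "topspace ?S = topspace (realization K) - ?h" by auto
  have split: "topspace (realization K) - ?h = open_half ?H \<union> open_half ?H'"
    unfolding hyperplane_eq[OF xy] vhalf_compl[OF xy, symmetric] open_half_compl by (auto simp: open_half_def)
  have topS: "topspace ?S = open_half ?H \<union> open_half ?H'"
    unfolding top by (rule split)
  have disj: "open_half ?H \<inter> open_half ?H' = {}"
    unfolding vhalf_compl[OF xy, symmetric] open_half_compl by (auto simp: open_half_def)
  have comp: "connected_component_of_set ?S w = open_half A"
    if A: "A \<in> {?H, ?H'}" "w \<in> open_half A" for A w
  proof
    have sub: "open_half A \<subseteq> topspace (realization K) - ?h" unfolding split using A(1) by blast
    have "connectedin ?S (open_half A)"
      using connectedin_open_half H A(1) sub by (auto simp: connectedin_subtopology)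
    then show "open_half A \<subseteq> connected_component_of_set ?S w"
      using A(2) by (intro connected_component_of_maximal)
    have op: "openin ?S (open_half B)" if "B \<in> {?H, ?H'}" for B
    proof -
      have "open_half B \<subseteq> topspace (realization K) - ?h" unfolding split using that by blast
      then show ?thesis
        unfolding openin_subtopology using openin_open_half[of B] by (intro exI[of _ "open_half B"]) blast
    qed
    obtain B where B: "B \<in> {?H, ?H'}" "topspace ?S - open_half A = open_half B"
    proof (cases "A = ?H")
      case True
      have "(open_half ?H \<union> open_half ?H') - open_half ?H = open_half ?H'" using disj by blast
      then have "topspace ?S - open_half A = open_half ?H'"
        by (simp only: topS True)
      then show ?thesis using that by blast
    next
      case False
      then have "A = ?H'" using A(1) by blast
      moreover have "(open_half ?H \<union> open_half ?H') - open_half ?H' = open_half ?H" using disj by blast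
      ultimately have "topspace ?S - open_half A = open_half ?H"
        by (simp only: topS \<open>A = ?H'\<close>)
      then show ?thesis using that by blast
    qed
    have "closedin ?S (open_half A)"
      unfolding closedin_def using op[OF B(1)] B(2) A(1) topS by auto
    then have "connected_component_of_set ?S w \<subseteq> open_half A \<or> disjnt (connected_component_of_set ?S w) (open_half A)"
      using op[OF A(1)] connectedin_connected_component_of by (intro connectedin_clopen_cases)
    moreover have "w \<in> connected_component_of_set ?S w"
      using A(2) sub top by (auto simp: connected_component_of_refl)
    ultimately show "connected_component_of_set ?S w \<subseteq> open_half A"
      using A(2) by (auto simp: disjnt_iff)
  qed
  have ne: "open_half ?H \<noteq> {}" "open_half ?H' \<noteq> {}"
  proof -
    have "vertex_point x \<in> open_half ?H" "vertex_point y \<in> open_half ?H'"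
      using vhalf_ends[OF xy] vhalf_ends[OF yx] vertex_point_topspace adjacent_vertex[OF xy]
      by (auto simp: open_half_def weight_vertex_point)
    then show "open_half ?H \<noteq> {}" "open_half ?H' \<noteq> {}" by blast+
  qed
  have "connected_components_of ?S = {open_half ?H, open_half ?H'}"
    unfolding connected_components_of_def topS
  proof (intro equalityI subsetI)
    fix Q assume "Q \<in> connected_component_of_set ?S ` (open_half ?H \<union> open_half ?H')"
    then obtain w where "Q = connected_component_of_set ?S w" "w \<in> open_half ?H \<or> w \<in> open_half ?H'"
      by blast
    then show "Q \<in> {open_half ?H, open_half ?H'}"
      using comp[of ?H w] comp[of ?H' w] by auto
  next
    fix Q assume "Q \<in> {open_half ?H, open_half ?H'}"
    then obtain A w where A: "A \<in> {?H, ?H'}" "Q = open_half A" "w \<in> open_half A" using ne by blast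
    then have "Q = connected_component_of_set ?S w"
      using comp[OF A(1,3)] by simp
    moreover have "w \<in> open_half ?H \<union> open_half ?H'" using A by blast
    ultimately show "Q \<in> connected_component_of_set ?S ` (open_half ?H \<union> open_half ?H')"
      by blast
  qed
  then have "halfspaces_of K ?h = (\<lambda>U. realization K closure_of U) ` {open_half ?H, open_half ?H'}"
    unfolding halfspaces_of_def by blast
  then show ?thesis using closure_open_half H by simp
qed

lemma halfspaces_eq: "halfspaces K = geo_half K ` vhalfs K"
proof (intro equalityI subsetI)
  fix P assume "P \<in> halfspaces K"
  then obtain x y where xy: "adjacent K x y" "P \<in> halfspaces_of K (hyperplane K {x, y})"
    unfolding halfspaces_def by blast
  moreover have "adjacent K y x" using xy(1) by (simp add: adjacent_sym)
  ultimately show "P \<in> geo_half K ` vhalfs K"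
    using halfspaces_of_eq[OF xy(1)] vhalfsI by auto
next
  fix P assume "P \<in> geo_half K ` vhalfs K"
  then obtain x y where xy: "adjacent K x y" "P = geo_half K (vhalf K x y)"
    by (auto simp: vhalfs_def)
  then have "P \<in> halfspaces_of K (hyperplane K {x, y})"
    using halfspaces_of_eq[OF xy(1)] by simp
  then show "P \<in> halfspaces K"
    unfolding halfspaces_def using xy(1) by blast
qed

lemma vertex_in_geo_half: "v \<in> \<Union>K \<Longrightarrow> vertex_point v \<in> geo_half K H \<longleftrightarrow> v \<in> H"
  using vertex_point_topspace by (auto simp: geo_half_def weight_vertex_point)

lemma geo_half_subset_iff:
  assumes "H \<in> vhalfs K" "geo_half K H \<subseteq> geo_half K H'"
  shows "H \<subseteq> H'"
  using assms vhalfs_subset vertex_in_geo_half by blast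

lemma geo_half_inj: "inj_on (geo_half K) (vhalfs K)"
proof (rule inj_onI)
  fix A B assume AB: "A \<in> vhalfs K" "B \<in> vhalfs K" "geo_half K A = geo_half K B"
  show "A = B"
    by (rule subset_antisym) (use geo_half_subset_iff[of A B] geo_half_subset_iff[of B A] AB in auto)
qed

lemma opp_geo_half:
  assumes "H \<in> vhalfs K"
  shows "opp K (geo_half K H) = geo_half K (\<Union>K - H)"
proof -
  have "topspace (realization K) - geo_half K H = open_half (\<Union>K - H)"
    unfolding open_half_compl by (auto simp: geo_half_def)
  then show ?thesis
    unfolding opp_def using closure_open_half[OF vhalfs_compl[OF assms]] by simp
qed

lemma halfspaces_dual_eq:
  assumes "adjacent K x y"
  shows "halfspaces_dual K x y = {geo_half K (vhalf K y x)}"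
proof -
  have yx: "adjacent K y x" using assms by (simp add: adjacent_sym)
  show ?thesis
    unfolding halfspaces_dual_def halfspaces_of_eq[OF assms]
    using vertex_in_geo_half adjacent_vertex[OF assms] vhalf_ends[OF assms] vhalf_ends[OF yx] by auto
qed

end

section \<open>Cube complexes of rings of sets\<close>

text \<open>The vertices are the elements of \<open>W\<close>, encoded by the members \<open>c v\<close> of a ring of sets; the
  cubes are the finite Boolean intervals of the ring.\<close>

locale set_ring_complex =
  fixes W :: "'a set" and c :: "'a \<Rightarrow> 'p set"
  assumes inj: "inj_on c W"
    and un: "\<And>S T. S \<in> c ` W \<Longrightarrow> T \<in> c ` W \<Longrightarrow> S \<union> T \<in> c ` W"
    and int: "\<And>S T. S \<in> c ` W \<Longrightarrow> T \<in> c ` W \<Longrightarrow> S \<inter> T \<in> c ` W"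
    and fin: "\<And>S T. S \<in> c ` W \<Longrightarrow> T \<in> c ` W \<Longrightarrow> finite (T - S)"
    and step: "\<And>S T. S \<in> c ` W \<Longrightarrow> T \<in> c ` W \<Longrightarrow> S \<subset> T \<Longrightarrow> \<exists>a\<in>T - S. insert a S \<in> c ` W"
    and nonempty: "W \<noteq> {}"
begin

definition cubes :: "'a set set" where
  "cubes = {D. D \<subseteq> W \<and> (\<exists>A B. A \<subseteq> B \<and> finite (B - A) \<and> c ` D = {A..B})}"

lemma cubesE:
  assumes "D \<in> cubes"
  obtains A B where "D \<subseteq> W" "A \<subseteq> B" "finite (B - A)" "c ` D = {A..B}"
  using assms by (auto simp: cubes_def)

lemma cubesI: "D \<subseteq> W \<Longrightarrow> A \<subseteq> B \<Longrightarrow> finite (B - A) \<Longrightarrow> c ` D = {A..B} \<Longrightarrow> D \<in> cubes"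
  by (auto simp: cubes_def)

lemma cubes_subset: "D \<in> cubes \<Longrightarrow> D \<subseteq> W"
  by (auto simp: cubes_def)

lemma interval_cube:
  assumes "A \<subseteq> B" "finite (B - A)" "{A..B} \<subseteq> c ` W"
  shows "{v \<in> W. c v \<in> {A..B}} \<in> cubes" "c ` {v \<in> W. c v \<in> {A..B}} = {A..B}"
proof -
  show eq: "c ` {v \<in> W. c v \<in> {A..B}} = {A..B}"
    using assms(3) by blast
  show "{v \<in> W. c v \<in> {A..B}} \<in> cubes"
    by (rule cubesI[OF _ assms(1,2) eq]) blast
qed

lemma singleton_cube: "v \<in> W \<Longrightarrow> {v} \<in> cubes"
  by (rule cubesI[of _ "c v" "c v"]) auto

lemma Union_cubes: "\<Union>cubes = W"
  using singleton_cube cubes_subset by blast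

text \<open>Removing \<open>A\<close> and renaming by \<open>e\<close> is an order isomorphism from
  \<open>{A..B}\<close> onto the subsets of \<open>{..<n}\<close>. It matches intervals with
  intervals, that is, the cubes inside \<open>D\<close> with the faces.\<close>

lemma chart:
  assumes D: "D \<subseteq> W" "A \<subseteq> B" "c ` D = {A..B}" and e: "bij_betw e (B - A) {..<n}"
  shows "cube_chart cubes D n (\<lambda>v. e ` (c v - A))"
proof -
  define f where "f S = e ` (S - A)" for S
  have einj: "inj_on e (B - A)" and eim: "e ` (B - A) = {..<n}"
    using e by (auto simp: bij_betw_def)
  have finBA: "finite (B - A)" using e bij_betw_finite by blast
  have mono: "f S \<subseteq> f S' \<longleftrightarrow> S \<subseteq> S'" if S: "A \<subseteq> S" "S \<subseteq> B" "A \<subseteq> S'" "S' \<subseteq> B" for S S'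
  proof -
    have "f S \<subseteq> f S' \<longleftrightarrow> S - A \<subseteq> S' - A"
      unfolding f_def by (rule inj_on_image_subset_iff[OF einj]) (use S in auto)
    then show ?thesis using S by blast
  qed
  have finj: "inj_on f {A..B}"
    by (rule inj_onI) (metis mono atLeastAtMost_iff order_refl subset_antisym)
  have surj: "\<exists>S. A \<subseteq> S \<and> S \<subseteq> B \<and> f S = X" if X: "X \<subseteq> {..<n}" for X
  proof (intro exI conjI)
    let ?S = "A \<union> {p \<in> B - A. e p \<in> X}"
    show "A \<subseteq> ?S" "?S \<subseteq> B" using D(2) by auto
    have "?S - A = {p \<in> B - A. e p \<in> X}" by blast
    moreover have "X \<subseteq> e ` (B - A)" using X eim by simp
    then have "e ` {p \<in> B - A. e p \<in> X} = X" by blast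
    ultimately show "f ?S = X" by (simp add: f_def)
  qed
  have fB: "f S \<subseteq> {..<n}" if "S \<subseteq> B" for S
    unfolding f_def eim[symmetric] using that by blast
  have interval: "f ` {A'..B'} = {f A'..f B'}" if A': "A \<subseteq> A'" "A' \<subseteq> B" "A \<subseteq> B'" "B' \<subseteq> B" for A' B'
  proof (intro equalityI subsetI)
    fix X assume "X \<in> f ` {A'..B'}"
    then obtain S where "A' \<subseteq> S" "S \<subseteq> B'" "X = f S" by auto
    then show "X \<in> {f A'..f B'}" unfolding f_def by auto
  next
    fix X assume X: "X \<in> {f A'..f B'}"
    then have "X \<subseteq> {..<n}" using fB[OF A'(4)] by (meson atLeastAtMost_iff order_trans)
    then obtain S where S: "A \<subseteq> S" "S \<subseteq> B" "f S = X" using surj by meson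
    then have "A' \<subseteq> S" "S \<subseteq> B'"
      using mono[OF A'(1,2) S(1,2)] mono[OF S(1,2) A'(3,4)] X by auto
    then show "X \<in> f ` {A'..B'}" using S(3) by auto
  qed
  have cD: "inj_on c D" using inj D(1) by (rule inj_on_subset)
  have "bij_betw f {A..B} (Pow {..<n})"
    unfolding bij_betw_def
  proof (intro conjI finj equalityI subsetI)
    fix X assume "X \<in> f ` {A..B}"
    then obtain S where "X = f S" "S \<in> {A..B}" by (rule imageE)
    then show "X \<in> Pow {..<n}" using fB[of S] by simp
  next
    fix X assume "X \<in> Pow {..<n}"
    then have "X \<subseteq> {..<n}" by simp
    then obtain S where S: "A \<subseteq> S" "S \<subseteq> B" "f S = X" using surj by meson
    then have "S \<in> {A..B}" by simp
    then show "X \<in> f ` {A..B}" unfolding S(3)[symmetric] by (rule imageI)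
  qed
  moreover have "bij_betw c D {A..B}" using cD D(3) by (simp add: bij_betw_def)
  ultimately have "bij_betw (f \<circ> c) D (Pow {..<n})" by (rule bij_betw_trans[rotated])
  moreover have "D' \<in> cubes \<longleftrightarrow> (\<exists>L U. L \<subseteq> U \<and> U \<subseteq> {..<n} \<and> (f \<circ> c) ` D' = {L..U})" if D': "D' \<subseteq> D" for D'
  proof
    assume "D' \<in> cubes"
    then obtain A' B' where AB: "A' \<subseteq> B'" "c ` D' = {A'..B'}" by (elim cubesE) blast
    have "{A'..B'} \<subseteq> {A..B}" using AB(2) D(3) image_mono[OF D'] by metis
    then have "A' \<in> {A..B}" "B' \<in> {A..B}" using AB(1) by (meson atLeastAtMost_iff order_refl subsetD)+
    then have i: "A \<subseteq> A'" "A' \<subseteq> B" "A \<subseteq> B'" "B' \<subseteq> B" by simp_all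
    have "(f \<circ> c) ` D' = {f A'..f B'}"
      unfolding image_comp[symmetric] AB(2) by (rule interval[OF i])
    then show "\<exists>L U. L \<subseteq> U \<and> U \<subseteq> {..<n} \<and> (f \<circ> c) ` D' = {L..U}"
      using mono[OF i] AB(1) fB[OF i(4)] by (intro exI[of _ "f A'"] exI[of _ "f B'"]) simp
  next
    assume "\<exists>L U. L \<subseteq> U \<and> U \<subseteq> {..<n} \<and> (f \<circ> c) ` D' = {L..U}"
    then obtain L U where LU: "L \<subseteq> U" "U \<subseteq> {..<n}" "(f \<circ> c) ` D' = {L..U}" by meson
    have "L \<subseteq> {..<n}" using LU(1,2) by (rule subset_trans)
    then obtain A' where A': "A \<subseteq> A'" "A' \<subseteq> B" "f A' = L" using surj[OF \<open>L \<subseteq> {..<n}\<close>] by (elim exE conjE) (rule that)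
    obtain B' where B': "A \<subseteq> B'" "B' \<subseteq> B" "f B' = U" using surj[OF LU(2)] by (elim exE conjE) (rule that)
    have "f ` (c ` D') = f ` {A'..B'}"
      by (simp only: image_comp LU(3) interval[OF A'(1,2) B'(1,2)] A'(3) B'(3))
    moreover have "c ` D' \<subseteq> {A..B}" using image_mono[OF D', of c] D(3) by simp
    moreover have "{A'..B'} \<subseteq> {A..B}" using A' B' by (simp add: atLeastatMost_subset_iff)
    ultimately have eq: "c ` D' = {A'..B'}"
      by (simp add: inj_on_image_eq_iff[OF finj])
    have "A' \<subseteq> B'" using mono[OF A'(1,2) B'(1,2)] LU(1) A'(3) B'(3) by simp
    moreover have "finite (B' - A')"
      by (rule finite_subset[OF _ finBA]) (use A' B' in blast)
    moreover have "D' \<subseteq> W" using D' D(1) by (rule subset_trans)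
    ultimately show "D' \<in> cubes" using eq by (intro cubesI)
  qed
  ultimately show ?thesis
    unfolding cube_chart_iff f_def o_def by simp
qed

lemma chart_ex:
  assumes "D \<subseteq> W" "A \<subseteq> B" "finite (B - A)" "c ` D = {A..B}"
  obtains n e where "bij_betw e (B - A) {..<n::nat}" "cube_chart cubes D n (\<lambda>v. e ` (c v - A))"
proof -
  obtain e where "bij_betw e (B - A) {0..<card (B - A)}"
    using ex_bij_betw_finite_nat[OF assms(3)] by blast
  then have "bij_betw e (B - A) {..<card (B - A)}" by (simp add: atLeast0LessThan)
  then show ?thesis using that chart[OF assms(1,2,4)] by blast
qed

lemma cube_complex_cubes: "cube_complex cubes"
  unfolding cube_complex_def
proof (intro conjI ballI impI)
  fix C assume "C \<in> cubes"
  then show "\<exists>n \<phi>. cube_chart cubes C n \<phi>"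
    by (elim cubesE) (metis chart_ex)
next
  fix C D assume CD: "C \<in> cubes" "D \<in> cubes" "C \<inter> D \<noteq> {}"
  obtain A B where AB: "C \<subseteq> W" "A \<subseteq> B" "finite (B - A)" "c ` C = {A..B}" using CD(1) by (rule cubesE)
  obtain A' B' where AB': "D \<subseteq> W" "A' \<subseteq> B'" "finite (B' - A')" "c ` D = {A'..B'}" using CD(2) by (rule cubesE)
  have "c ` (C \<inter> D) = {A..B} \<inter> {A'..B'}"
    using inj_on_image_Int[OF inj AB(1) AB'(1)] AB(4) AB'(4) by simp
  also have "\<dots> = {A \<union> A'..B \<inter> B'}" by auto
  finally have eq: "c ` (C \<inter> D) = {A \<union> A'..B \<inter> B'}" .
  obtain x where "x \<in> C \<inter> D" using CD(3) by blast
  then have "c x \<in> {A \<union> A'..B \<inter> B'}" unfolding eq[symmetric] by blast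
  then have "A \<union> A' \<subseteq> B \<inter> B'" unfolding atLeastAtMost_iff by (elim conjE) (rule order_trans)
  moreover have "finite (B \<inter> B' - (A \<union> A'))"
    by (rule finite_subset[OF _ AB(3)]) blast
  ultimately show "C \<inter> D \<in> cubes"
    using eq AB(1) by (intro cubesI) auto
qed

sublocale cubical cubes
  by unfold_locales (rule cube_complex_cubes)

lemma adjacent_cubes:
  "adjacent cubes x y \<longleftrightarrow> x \<in> W \<and> y \<in> W \<and>
     (\<exists>p. p \<notin> c x \<and> c y = insert p (c x) \<or> p \<notin> c y \<and> c x = insert p (c y))"
proof
  assume "adjacent cubes x y"
  then have xy: "x \<noteq> y" "{x, y} \<in> cubes" by (auto simp: adjacent_def)
  then obtain A B where AB: "{x, y} \<subseteq> W" "A \<subseteq> B" "c ` {x, y} = {A..B}" by (elim cubesE) blast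
  have cne: "c x \<noteq> c y" using inj xy(1) AB(1) by (auto dest: inj_onD)
  have eq: "{c x, c y} = {A..B}" using AB(3) by simp
  have A: "A \<in> {c x, c y}" using AB(2) unfolding eq by simp
  have flip: "\<exists>p. p \<notin> P \<and> R = insert p P"
    if PR: "{P, R} = {A..B}" "P \<noteq> R" "P \<subseteq> R" for P R
  proof -
    obtain p where p: "p \<in> R" "p \<notin> P" using PR by blast
    have "P \<in> {A..B}" "R \<in> {A..B}" unfolding PR(1)[symmetric] by auto
    then have "insert p P \<in> {A..B}" using p PR(3) by auto
    then have "insert p P \<in> {P, R}" unfolding PR(1) .
    then show ?thesis using p by auto
  qed
  have "c x \<in> {A..B}" "c y \<in> {A..B}" unfolding eq[symmetric] by simp_all
  then have "A \<subseteq> c x" "A \<subseteq> c y" by simp_all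
  with A consider "c x \<subseteq> c y" | "c y \<subseteq> c x" by blast
  then have "\<exists>p. p \<notin> c x \<and> c y = insert p (c x) \<or> p \<notin> c y \<and> c x = insert p (c y)"
  proof cases
    case 1
    show ?thesis using flip[OF eq cne 1] by blast
  next
    case 2
    have "{c y, c x} = {A..B}" using eq by (simp add: insert_commute)
    then show ?thesis using flip[OF _ cne[symmetric] 2] by blast
  qed
  then show "x \<in> W \<and> y \<in> W \<and> (\<exists>p. p \<notin> c x \<and> c y = insert p (c x) \<or> p \<notin> c y \<and> c x = insert p (c y))"
    using AB(1) by blast
next
  assume r: "x \<in> W \<and> y \<in> W \<and> (\<exists>p. p \<notin> c x \<and> c y = insert p (c x) \<or> p \<notin> c y \<and> c x = insert p (c y))"
  have *: "{x, y} \<in> cubes \<and> x \<noteq> y" if xy: "x \<in> W" "y \<in> W" "p \<notin> c x" "c y = insert p (c x)" for x y p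
  proof
    have "{S..insert p S} = {S, insert p S}" for S by auto
    then have "c ` {x, y} = {c x..insert p (c x)}" using xy(4) by simp
    moreover have "finite (insert p (c x) - c x)" by (rule finite_subset[of _ "{p}"]) auto
    ultimately show "{x, y} \<in> cubes" using xy(1,2) by (intro cubesI[of _ "c x" "insert p (c x)"]) auto
    show "x \<noteq> y" using xy by auto
  qed
  from r obtain p where "p \<notin> c x \<and> c y = insert p (c x) \<or> p \<notin> c y \<and> c x = insert p (c y)" by blast
  then show "adjacent cubes x y"
    using *[of x y p] *[of y x p] r unfolding adjacent_def by (auto simp: insert_commute)
qed

lemma finite_Union_ring: "finite \<F> \<Longrightarrow> \<F> \<noteq> {} \<Longrightarrow> \<F> \<subseteq> c ` W \<Longrightarrow> \<Union>\<F> \<in> c ` W"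
  by (induction rule: finite_ne_induct) (auto intro: un simp del: image_iff)

lemma finite_Inter_ring: "finite \<F> \<Longrightarrow> \<F> \<noteq> {} \<Longrightarrow> \<F> \<subseteq> c ` W \<Longrightarrow> \<Inter>\<F> \<in> c ` W"
  by (induction rule: finite_ne_induct) (auto intro: int simp del: image_iff)

text \<open>A neighbour of \<open>v\<close> adds an element to \<open>c v\<close> or removes one;
  \<open>U\<close> and \<open>N\<close> collect these elements. Additions combine by unions and
  removals by intersections, while an addition and a removal combine because the two neighbours are
  joined in the link. So all sets between \<open>c v - N\<close> and \<open>c v \<union> U\<close>
  belong to the ring.\<close>

lemma flag_link:
  assumes v: "v \<in> W"
  shows "flag (vertex_link cubes v)"
  unfolding flag_def
proof (intro allI impI, elim conjE)
  fix \<sigma> assume \<sigma>: "finite \<sigma>" "\<sigma> \<noteq> {}" "\<sigma> \<subseteq> \<Union>(vertex_link cubes v)"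
    "\<forall>a\<in>\<sigma>. \<forall>b\<in>\<sigma>. a \<noteq> b \<longrightarrow> {a, b} \<in> vertex_link cubes v"
  have adj: "adjacent cubes v a" if "a \<in> \<sigma>" for a
    using that \<sigma>(3) unfolding vertex_link_def by blast
  define U where "U = {p. p \<notin> c v \<and> insert p (c v) \<in> c ` \<sigma>}"
  define N where "N = {p. p \<in> c v \<and> c v - {p} \<in> c ` \<sigma>}"
  have \<sigma>W: "\<sigma> \<subseteq> W" using adj adjacent_cubes by blast
  have \<sigma>UN: "(\<exists>p\<in>U. c a = insert p (c v)) \<or> (\<exists>p\<in>N. c a = c v - {p})" if a: "a \<in> \<sigma>" for a
  proof -
    obtain p where "p \<notin> c v \<and> c a = insert p (c v) \<or> p \<notin> c a \<and> c v = insert p (c a)"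
      using adj[OF a] adjacent_cubes by blast
    then consider "p \<notin> c v" "c a = insert p (c v)" | "p \<in> c v" "c a = c v - {p}" by blast
    then show ?thesis
    proof cases
      case 1
      then have "p \<in> U" using a unfolding U_def by (metis image_eqI mem_Collect_eq)
      then show ?thesis using 1 by blast
    next
      case 2
      then have "p \<in> N" using a unfolding N_def by (metis image_eqI mem_Collect_eq)
      then show ?thesis using 2 by blast
    qed
  qed
  have finU: "finite U"
  proof (rule inj_on_finite[of "\<lambda>p. insert p (c v)" U "c ` \<sigma>"])
    show "inj_on (\<lambda>p. insert p (c v)) U" by (rule inj_onI) (auto simp: U_def)
  qed (use \<sigma>(1) in \<open>auto simp: U_def\<close>)
  have finN: "finite N"
  proof (rule inj_on_finite[of "\<lambda>p. c v - {p}" N "c ` \<sigma>"])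
    show "inj_on (\<lambda>p. c v - {p}) N" by (rule inj_onI) (auto simp: N_def)
  qed (use \<sigma>(1) in \<open>auto simp: N_def\<close>)
  have cv: "c v \<in> c ` W" using v by blast
  have up: "insert p (c v) \<in> c ` W" if "p \<in> U" for p
    using that \<sigma>W unfolding U_def by blast
  have down: "c v - {p} \<in> c ` W" if "p \<in> N" for p
    using that \<sigma>W unfolding N_def by blast
  have mixed: "insert p (c v) - {q} \<in> c ` W" if pq: "p \<in> U" "q \<in> N" for p q
  proof -
    have "insert p (c v) \<in> c ` \<sigma>" "c v - {q} \<in> c ` \<sigma>"
      using pq by (simp_all add: U_def N_def)
    then obtain a b where ab: "a \<in> \<sigma>" "c a = insert p (c v)" "b \<in> \<sigma>" "c b = c v - {q}"
      by (elim imageE) simp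
    have "a \<noteq> b" using ab pq by (auto simp: U_def)
    then have "{a, b} \<in> vertex_link cubes v" using \<sigma>(4) ab by blast
    then obtain C where C: "C \<in> cubes" "a \<in> C" "b \<in> C" unfolding vertex_link_def by blast
    then obtain A B where AB: "C \<subseteq> W" "c ` C = {A..B}" by (elim cubesE) blast
    have "c a \<in> {A..B}" "c b \<in> {A..B}" using C AB(2) by blast+
    then have "insert p (c v) - {q} \<in> {A..B}" using ab by auto
    then show ?thesis using AB by blast
  qed
  let ?A = "c v - N" and ?B = "c v \<union> U"
  \<comment> \<open>\<open>S\<close> is the union, over its added elements \<open>p\<close>, of the
    sets \<open>insert p (c v) - N'\<close>, and each of these is an intersection of mixed sets over
    the removed elements.\<close>
  have all: "S \<in> c ` W" if S: "?A \<subseteq> S" "S \<subseteq> ?B" for S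
  proof -
    define U' N' where "U' = S - c v" and "N' = c v - S"
    have sub: "U' \<subseteq> U" "N' \<subseteq> N" using S by (auto simp: U'_def N'_def)
    have fin': "finite U'" "finite N'" using sub finU finN finite_subset by blast+
    have Seq: "S = (c v - N') \<union> U'" by (auto simp: U'_def N'_def)
    have NU: "N' \<inter> U' = {}" by (auto simp: U'_def N'_def)
    have minus: "c v - N' \<in> c ` W"
    proof (cases "N' = {}")
      case False
      have "\<Inter>((\<lambda>q. c v - {q}) ` N') \<in> c ` W"
        by (rule finite_Inter_ring) (use fin' False down sub in auto)
      also have "\<Inter>((\<lambda>q. c v - {q}) ` N') = c v - N'" using False by blast
      finally show ?thesis .
    qed (use cv in simp)
    have one: "insert p (c v) - N' \<in> c ` W" if p: "p \<in> U'" for p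
    proof (cases "N' = {}")
      case True
      then show ?thesis using up[of p] p sub by auto
    next
      case False
      have "\<Inter>((\<lambda>q. insert p (c v) - {q}) ` N') \<in> c ` W"
        by (rule finite_Inter_ring) (use fin' False mixed sub p in blast)+
      also have "\<Inter>((\<lambda>q. insert p (c v) - {q}) ` N') = insert p (c v) - N'" using False by blast
      finally show ?thesis .
    qed
    show ?thesis
    proof (cases "U' = {}")
      case True
      then show ?thesis using minus Seq by simp
    next
      case False
      have "\<Union>((\<lambda>p. insert p (c v) - N') ` U') \<in> c ` W"
        by (rule finite_Union_ring) (use fin' False one in auto)
      also have "\<Union>((\<lambda>p. insert p (c v) - N') ` U') = S" unfolding Seq using False NU by blast
      finally show ?thesis .
    qed
  qed
  have AB: "?A \<subseteq> ?B" "finite (?B - ?A)" "{?A..?B} \<subseteq> c ` W"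
    using all by (auto intro: finite_subset[of _ "U \<union> N"] finU finN)
  let ?C = "{w \<in> W. c w \<in> {?A..?B}}"
  have C: "?C \<in> cubes" using interval_cube(1)[OF AB] .
  have vC: "v \<in> ?C" using v by auto
  have "{u \<in> ?C. adjacent cubes v u} = \<sigma>"
  proof (intro equalityI subsetI)
    fix a assume a: "a \<in> \<sigma>"
    have "c a \<in> {?A..?B}" using \<sigma>UN[OF a] by auto
    then show "a \<in> {u \<in> ?C. adjacent cubes v u}" using a adj \<sigma>W by blast
  next
    fix u assume "u \<in> {u \<in> ?C. adjacent cubes v u}"
    then have u: "u \<in> W" "?A \<subseteq> c u" "c u \<subseteq> ?B" "adjacent cubes v u" by auto
    obtain p where "p \<notin> c v \<and> c u = insert p (c v) \<or> p \<notin> c u \<and> c v = insert p (c u)"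
      using u(4) adjacent_cubes by blast
    then have "c u \<in> c ` \<sigma>"
    proof (elim disjE conjE)
      assume "p \<notin> c v" "c u = insert p (c v)"
      then show ?thesis using u(3) unfolding U_def by auto
    next
      assume p: "p \<notin> c u" "c v = insert p (c u)"
      then have "p \<in> N" using u(2) by auto
      moreover have "c u = c v - {p}" using p by auto
      ultimately show ?thesis unfolding N_def by auto
    qed
    then obtain a where "a \<in> \<sigma>" "c u = c a" by blast
    then show "u \<in> \<sigma>" using inj u(1) \<sigma>W by (auto dest: inj_onD)
  qed
  moreover have "?C \<noteq> {v}"
  proof
    assume eq: "?C = {v}"
    obtain a where a: "a \<in> \<sigma>" using \<sigma>(2) by blast
    have "c a \<in> {?A..?B}" using \<sigma>UN[OF a] by auto
    then have "a \<in> ?C" using a \<sigma>W by blast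
    then have "a = v" unfolding eq by simp
    then show False using adj[OF a] by (simp add: adjacent_def)
  qed
  ultimately show "\<sigma> \<in> vertex_link cubes v"
    unfolding vertex_link_def mem_Collect_eq using C vC by (intro exI[of _ ?C]) auto
qed

end

section \<open>Coordinates on a finite interval of the ring\<close>

locale set_ring_window = set_ring_complex W c for W :: "'a set" and c :: "'a \<Rightarrow> 'p set" +
  fixes m M :: "'p set"
  assumes mV: "m \<in> c ` W" and MV: "M \<in> c ` W" and mM: "m \<subseteq> M"
begin

definition Q :: "'p set" where "Q = M - m"

definition window :: "'a set" where "window = {v \<in> W. m \<subseteq> c v \<and> c v \<subseteq> M}"

text \<open>The mass of the vertices whose set contains \<open>a\<close>, which is the coordinate in
  direction \<open>a\<close> for points supported in the window. The function \<open>point\<close>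
  is the way back, by product weights.\<close>

definition coord :: "('a \<Rightarrow> real) \<Rightarrow> 'p \<Rightarrow> real" where
  "coord w a = (\<Sum>v | v \<in> window \<and> a \<in> c v. w v)"

definition point :: "('p \<Rightarrow> real) \<Rightarrow> 'a \<Rightarrow> real" where
  "point y v = (if v \<in> window then \<Prod>a\<in>Q. if a \<in> c v then y a else 1 - y a else 0)"

definition low :: "('p \<Rightarrow> real) \<Rightarrow> 'p set" where "low y = m \<union> {a \<in> Q. y a = 1}"

definition high :: "('p \<Rightarrow> real) \<Rightarrow> 'p set" where "high y = m \<union> {a \<in> Q. 0 < y a}"

text \<open>The coordinate vectors of points: the interval from \<open>low y\<close> to
  \<open>high y\<close> is the smallest face of the cube over \<open>Q\<close> that contains
  \<open>y\<close>, and it has to be a cube of the complex.\<close>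

definition admissible :: "('p \<Rightarrow> real) set" where
  "admissible = {y. (\<forall>a\<in>Q. 0 \<le> y a \<and> y a \<le> 1) \<and> {low y..high y} \<subseteq> c ` W}"

lemma finite_Q: "finite Q"
  unfolding Q_def by (rule fin[OF mV MV])

lemma finite_window: "finite window"
proof (rule inj_on_finite[of c window "(\<lambda>X. m \<union> X) ` Pow Q"])
  show "inj_on c window" by (rule inj_on_subset[OF inj]) (auto simp: window_def)
  show "c ` window \<subseteq> (\<lambda>X. m \<union> X) ` Pow Q"
  proof
    fix S assume "S \<in> c ` window"
    then have "m \<subseteq> S" "S \<subseteq> M" by (auto simp: window_def)
    then have "S = m \<union> (S - m)" "S - m \<in> Pow Q" by (auto simp: Q_def)
    then show "S \<in> (\<lambda>X. m \<union> X) ` Pow Q" by (rule image_eqI)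
  qed
qed (use finite_Q in simp)

lemma low_le_high: "low y \<subseteq> high y"
  by (auto simp: low_def high_def)

lemma high_le: "high y \<subseteq> M"
  using mM by (auto simp: high_def Q_def)

text \<open>At a vertex outside the interval from \<open>low y\<close> to \<open>high y\<close> some
  factor is 0. At a vertex inside, the coordinates equal to 0 or 1 contribute the factor 1, and what
  remains is a cube point.\<close>

lemma point_cell:
  assumes y: "y \<in> admissible"
  shows "\<exists>D\<in>cubes. D \<subseteq> window \<and> point y \<in> cell cubes D"
proof -
  let ?A = "low y" and ?B = "high y"
  have y01: "\<And>a. a \<in> Q \<Longrightarrow> 0 \<le> y a" "\<And>a. a \<in> Q \<Longrightarrow> y a \<le> 1" and sub: "{?A..?B} \<subseteq> c ` W"
    using y by (auto simp: admissible_def)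
  have BA: "?B - ?A \<subseteq> Q" "finite (?B - ?A)"
    using finite_subset[OF _ finite_Q, of "?B - ?A"] by (auto simp: low_def high_def)
  let ?D = "{v \<in> W. c v \<in> {?A..?B}}"
  note D = interval_cube[OF low_le_high BA(2) sub]
  have DW: "?D \<subseteq> W" by blast
  have Dw: "?D \<subseteq> window"
    using high_le[of y] by (auto simp: window_def low_def)
  obtain n e where e: "bij_betw e (?B - ?A) {..<n::nat}" "cube_chart cubes ?D n (\<lambda>v. e ` (c v - ?A))"
    using chart_ex[OF DW low_le_high BA(2) D(2)] .
  define t where "t i = y (inv_into (?B - ?A) e i)" for i
  have te: "t (e a) = y a" if "a \<in> ?B - ?A" for a
    using e(1) that by (simp add: t_def bij_betw_def inv_into_f_f)
  have t01: "\<forall>i<n. 0 \<le> t i \<and> t i \<le> 1"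
  proof (intro allI impI)
    fix i assume "i < n"
    then have "i \<in> e ` (?B - ?A)" using e(1) by (simp add: bij_betw_def)
    then obtain a where "a \<in> ?B - ?A" "i = e a" by blast
    then show "0 \<le> t i \<and> t i \<le> 1" using te[of a] y01 BA(1) by auto
  qed
  have "point y = cube_point ?D n (\<lambda>v. e ` (c v - ?A)) t"
  proof
    fix v
    let ?f = "\<lambda>a. if a \<in> c v then y a else 1 - y a"
    show "point y v = cube_point ?D n (\<lambda>v. e ` (c v - ?A)) t v"
    proof (cases "v \<in> ?D")
      case True
      then have cv: "?A \<subseteq> c v" "c v \<subseteq> ?B" by auto
      have "(\<Prod>i<n. if i \<in> e ` (c v - ?A) then t i else 1 - t i) =
          (\<Prod>a\<in>?B - ?A. if e a \<in> e ` (c v - ?A) then t (e a) else 1 - t (e a))"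
        by (rule prod.reindex_bij_betw[OF e(1), symmetric])
      also have "\<dots> = (\<Prod>a\<in>?B - ?A. ?f a)"
      proof (rule prod.cong[OF refl])
        fix a assume a: "a \<in> ?B - ?A"
        have "inj_on e (?B - ?A)" using e(1) by (simp add: bij_betw_def)
        then have "e a \<in> e ` (c v - ?A) \<longleftrightarrow> a \<in> c v - ?A"
          by (rule inj_on_image_mem_iff) (use a cv in auto)
        then show "(if e a \<in> e ` (c v - ?A) then t (e a) else 1 - t (e a)) = ?f a"
          using te[OF a] a by simp
      qed
      also have "\<dots> = (\<Prod>a\<in>Q. ?f a)"
      proof (rule prod.mono_neutral_left[OF finite_Q BA(1)], rule ballI)
        fix a assume a: "a \<in> Q - (?B - ?A)"
        then consider "y a = 1" | "y a = 0" "a \<notin> ?B"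
          using y01[of a] by (force simp: low_def high_def Q_def)
        then show "?f a = 1"
        proof cases
          case 1
          then have "a \<in> ?A" using a by (auto simp: low_def)
          then show ?thesis using 1 cv by auto
        next
          case 2
          then have "a \<notin> c v" using cv by auto
          then show ?thesis using 2 by simp
        qed
      qed
      finally show ?thesis using True Dw by (auto simp: point_def cube_point_def)
    next
      case False
      have "point y v = 0"
      proof (cases "v \<in> window")
        case True
        then have vW: "v \<in> W" "m \<subseteq> c v" "c v \<subseteq> M" by (auto simp: window_def)
        then have "\<not> ?A \<subseteq> c v \<or> \<not> c v \<subseteq> ?B" using False by auto
        then obtain a where a: "a \<in> ?A \<and> a \<notin> c v \<or> a \<in> c v \<and> a \<notin> ?B" by blast
        then have "a \<in> Q" "?f a = 0"
          using vW y01[of a] by (auto simp: low_def high_def Q_def)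
        then have "(\<Prod>a\<in>Q. ?f a) = 0"
          using finite_Q by (intro prod_zero) blast+
        then show ?thesis by (simp add: point_def)
      qed (simp add: point_def)
      moreover have "cube_point ?D n (\<lambda>v. e ` (c v - ?A)) t v = 0"
        using False unfolding cube_point_def by (rule if_not_P)
      ultimately show ?thesis by simp
    qed
  qed
  also have "\<dots> \<in> cell cubes ?D"
    using t01 by (intro cellI[OF e(2)]) auto
  finally show ?thesis using D(1) Dw by blast
qed

lemma point_cong: "(\<And>a. a \<in> Q \<Longrightarrow> y a = z a) \<Longrightarrow> point y = point z"
  unfolding point_def by (rule ext) (auto intro!: prod.cong)

text \<open>By \<open>hypercube_coordinates\<close> each direction of the chart changes a single
  element \<open>\<pi> i\<close>, whose coordinate is \<open>t i\<close> or \<open>1 - t i\<close>;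
  every other element has the constant coordinate 0 or 1 on the cube. The product over
  \<open>Q\<close> thus reduces to the one that defines the cube point.\<close>

lemma coord_point:
  assumes C: "C \<in> cubes" "w \<in> cell cubes C" and supp: "\<And>v. 0 < w v \<Longrightarrow> v \<in> window"
  shows "coord w \<in> admissible" "point (coord w) = w"
proof -
  obtain A B where AB: "C \<subseteq> W" "A \<subseteq> B" "c ` C = {A..B}" using C(1) by (elim cubesE) blast
  obtain n \<phi> t where \<phi>: "cube_chart cubes C n \<phi>" "\<forall>i<n. 0 \<le> t i \<and> t i \<le> 1" "w = cube_point C n \<phi> t"
    using C(2) by (rule cellE)
  define \<psi> where "\<psi> = the_inv_into C \<phi>"
  note ch = cube_param_chart[OF \<phi>(1), folded \<psi>_def]
  have \<psi>W: "\<psi> B \<in> W" if "B \<subseteq> {..<n}" for B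
    using cube_param_in[OF ch(1) that] AB(1) by blast
  let ?c0 = "c (\<psi> {})"
  obtain \<pi> where \<pi>: "inj_on \<pi> {..<n}" "\<And>B. B \<subseteq> {..<n} \<Longrightarrow> c (\<psi> B) = sym_diff ?c0 (\<pi> ` B)"
  proof (rule hypercube_coordinates[of "\<lambda>B. c (\<psi> B)" n])
    show "inj_on (\<lambda>B. c (\<psi> B)) (Pow {..<n})"
    proof (rule inj_onI)
      fix B B' assume B: "B \<in> Pow {..<n}" "B' \<in> Pow {..<n}" "c (\<psi> B) = c (\<psi> B')"
      then have "\<psi> B = \<psi> B'" using inj \<psi>W by (auto dest: inj_onD)
      then show "B = B'" using cube_param_inj[OF ch(1)] B by auto
    qed
    fix B i assume "B \<subseteq> {..<n}" "i < n" "i \<notin> B"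
    then have "adjacent cubes (\<psi> B) (\<psi> (insert i B))" using cube_param_edge[OF ch(1)] by blast
    then obtain p where "p \<notin> c (\<psi> B) \<and> c (\<psi> (insert i B)) = insert p (c (\<psi> B)) \<or>
        p \<notin> c (\<psi> (insert i B)) \<and> c (\<psi> B) = insert p (c (\<psi> (insert i B)))"
      using adjacent_cubes by blast
    then have "sym_diff (c (\<psi> B)) (c (\<psi> (insert i B))) = {p}" by auto
    then show "\<exists>a. sym_diff (c (\<psi> B)) (c (\<psi> (insert i B))) = {a}" by blast
  qed blast
  have cv: "c v = sym_diff ?c0 (\<pi> ` \<phi> v)" "\<phi> v \<subseteq> {..<n}" if "v \<in> C" for v
    using \<pi>(2)[OF ch(4)[OF that]] ch(2)[OF that] ch(4)[OF that] by simp_all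
  have mem: "i \<in> \<phi> v \<longleftrightarrow> (\<pi> i \<in> c v \<longleftrightarrow> \<pi> i \<notin> ?c0)" if "v \<in> C" "i < n" for v i
  proof -
    have "\<pi> i \<in> \<pi> ` \<phi> v \<longleftrightarrow> i \<in> \<phi> v"
      by (rule inj_on_image_mem_iff[OF \<pi>(1)]) (use that cv in auto)
    then show ?thesis unfolding cv(1)[OF that(1)] by blast
  qed
  have w0: "0 \<le> w v" for v using cell_nonneg[OF C(2)] .
  have finC: "finite C" using finite_cube[OF C(1)] .
  have wC: "w v = 0" if "v \<notin> C" for v using cell_outside[OF C(2) that] .
  \<comment> \<open>\<open>C\<close> may reach beyond the window. Its vertices outside have weight
    0, so the coordinates can be computed on \<open>C\<close>.\<close>
  define g where "g a = (\<Sum>v | v \<in> C \<and> a \<in> c v. w v)" for a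
  have coord_g: "coord w a = g a" for a
  proof -
    have "g a = (\<Sum>v | v \<in> window \<and> v \<in> C \<and> a \<in> c v. w v)"
      unfolding g_def
    proof (rule sum.mono_neutral_right)
      show "\<forall>i\<in>{v \<in> C. a \<in> c v} - {v \<in> window. v \<in> C \<and> a \<in> c v}. w i = 0"
        using supp w0 by (smt (verit, best) DiffD1 DiffD2 mem_Collect_eq)
    qed (use finC in auto)
    also have "\<dots> = coord w a"
      unfolding coord_def by (rule sum.mono_neutral_left) (use finite_window wC in auto)
    finally show ?thesis by simp
  qed
  have total: "sum w C = 1" using cell_sum[OF C(2)] .
  have g_all: "g a = 1" if "\<And>v. v \<in> C \<Longrightarrow> a \<in> c v" for a
  proof -
    have "{v \<in> C. a \<in> c v} = C" using that by blast
    then show ?thesis using total by (simp add: g_def)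
  qed
  have g_none: "g a = 0" if "\<And>v. v \<in> C \<Longrightarrow> a \<notin> c v" for a
  proof -
    have "{v \<in> C. a \<in> c v} = {}" using that by blast
    then show ?thesis unfolding g_def by (simp only: sum.empty)
  qed
  have g01: "0 \<le> g a" "g a \<le> 1" for a
  proof -
    show "0 \<le> g a" unfolding g_def by (intro sum_nonneg w0)
    have "g a \<le> sum w C" unfolding g_def by (intro sum_mono2 finC) (use w0 in auto)
    then show "g a \<le> 1" using total by simp
  qed
  have g\<pi>: "g (\<pi> i) = (if \<pi> i \<in> ?c0 then 1 - t i else t i)" if i: "i < n" for i
  proof (cases "\<pi> i \<in> ?c0")
    case True
    have "{v. v \<in> C \<and> \<pi> i \<in> c v} = {v. v \<in> C \<and> i \<notin> \<phi> v}" using mem[OF _ i] True by blast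
    then show ?thesis
      using cube_point_sum[OF \<phi>(1), where P = "\<lambda>A. i \<notin> A" and t = t] sum_Pow_prod_not_mem[of "{..<n}" i t] i True
      by (simp add: g_def \<phi>(3))
  next
    case False
    have "{v. v \<in> C \<and> \<pi> i \<in> c v} = {v. v \<in> C \<and> i \<in> \<phi> v}" using mem[OF _ i] False by blast
    then show ?thesis
      using cube_point_sum[OF \<phi>(1), where P = "\<lambda>A. i \<in> A" and t = t] sum_Pow_prod_mem[of "{..<n}" i t] i False
      by (simp add: g_def \<phi>(3))
  qed
  obtain u where u: "u \<in> C" "0 < w u" using cell_positive[OF C(2)] by blast
  then have uw: "m \<subseteq> c u" "c u \<subseteq> M" using supp by (auto simp: window_def)
  have inAB: "A \<subseteq> c v" "c v \<subseteq> B" if "v \<in> C" for v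
  proof -
    have "c v \<in> {A..B}" unfolding AB(3)[symmetric] using that by (rule imageI)
    then show "A \<subseteq> c v" "c v \<subseteq> B" by simp_all
  qed
  have gA: "g a = 1" if "a \<in> A" for a using that inAB by (intro g_all) blast
  have gB: "g a = 0" if "a \<notin> B" for a using that inAB by (intro g_none) blast
  have gm: "g a = 1" if "a \<in> m" for a
  proof -
    have "g a = (\<Sum>v\<in>C. w v)"
      unfolding g_def
    proof (rule sum.mono_neutral_left[OF finC])
      show "\<forall>i\<in>C - {v \<in> C. a \<in> c v}. w i = 0"
      proof
        fix v assume "v \<in> C - {v \<in> C. a \<in> c v}"
        then have "v \<notin> window" using that by (auto simp: window_def)
        then show "w v = 0" using supp[of v] w0[of v] by linarith
      qed
    qed auto
    then show ?thesis using total by simp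
  qed
  have gM: "g a = 0" if "a \<notin> M" for a
    unfolding g_def
  proof (rule sum.neutral, rule ballI)
    fix v assume "v \<in> {v \<in> C. a \<in> c v}"
    then have "v \<notin> window" using that by (auto simp: window_def)
    then show "w v = 0" using supp[of v] w0[of v] by linarith
  qed
  have AM: "A \<subseteq> M" using inAB(1)[OF u(1)] uw(2) by (rule subset_trans)
  have mB: "m \<subseteq> B" using uw(1) inAB(2)[OF u(1)] by (rule subset_trans)
  have "A \<subseteq> low (coord w)"
  proof
    fix a assume a: "a \<in> A"
    then show "a \<in> low (coord w)"
      using gA[OF a] AM unfolding low_def Q_def coord_g by blast
  qed
  moreover have "high (coord w) \<subseteq> B"
  proof
    fix a assume "a \<in> high (coord w)"
    then have "a \<in> m \<or> 0 < g a" unfolding high_def coord_g by blast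
    then show "a \<in> B" using mB gB[of a] by fastforce
  qed
  ultimately have "{low (coord w)..high (coord w)} \<subseteq> {A..B}"
    by (simp add: atLeastatMost_subset_iff)
  also have "{A..B} \<subseteq> c ` W" unfolding AB(3)[symmetric] using AB(1) by (rule image_mono)
  finally show "coord w \<in> admissible"
    unfolding admissible_def mem_Collect_eq coord_g using g01 by blast
  show "point (coord w) = w"
  proof
    fix v
    let ?f = "\<lambda>a. if a \<in> c v then g a else 1 - g a"
    show "point (coord w) v = w v"
    proof (cases "v \<in> window")
      case False
      then have "w v = 0" using supp[of v] w0[of v] by linarith
      then show ?thesis using False by (simp add: point_def)
    next
      case True
      then have vw: "v \<in> W" "m \<subseteq> c v" "c v \<subseteq> M" by (auto simp: window_def)
      show ?thesis
      proof (cases "v \<in> C")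
        case vC: True
        have outside: "?f a = 1" if "a \<notin> Q" for a
        proof (cases "a \<in> m")
          case True
          then show ?thesis using gm[OF True] vw by auto
        next
          case False
          then have "a \<notin> M" using that by (simp add: Q_def)
          then show ?thesis using gM[of a] vw by auto
        qed
        have const: "?f a = 1" if "a \<notin> \<pi> ` {..<n}" for a
        proof -
          have same: "a \<in> c v' \<longleftrightarrow> a \<in> ?c0" if "v' \<in> C" for v'
          proof -
            have "a \<notin> \<pi> ` \<phi> v'" using \<open>a \<notin> \<pi> ` {..<n}\<close> cv(2)[OF that] by blast
            then show ?thesis unfolding cv(1)[OF that] by blast
          qed
          show ?thesis
          proof (cases "a \<in> ?c0")
            case True
            then show ?thesis using g_all[of a] same vC by simp
          next
            case False
            then show ?thesis using g_none[of a] same vC by simp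
          qed
        qed
        have "w v = (\<Prod>i<n. if i \<in> \<phi> v then t i else 1 - t i)"
          using vC by (simp add: \<phi>(3) cube_point_def)
        also have "\<dots> = (\<Prod>i<n. ?f (\<pi> i))"
          by (rule prod.cong[OF refl]) (use mem[OF vC] g\<pi> in auto)
        also have "\<dots> = (\<Prod>a\<in>\<pi> ` {..<n}. ?f a)"
          using prod.reindex[OF \<pi>(1), of ?f] by (simp add: o_def)
        \<comment> \<open>Both changes of the index set are harmless: factors of elements that the
          cube does not change are 1, and so are factors of elements outside
          \<open>Q\<close>.\<close>
        also have "\<dots> = (\<Prod>a\<in>Q \<union> \<pi> ` {..<n}. ?f a)"
          by (rule prod.mono_neutral_left) (use finite_Q const in auto)
        also have "\<dots> = (\<Prod>a\<in>Q. ?f a)"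
          by (rule prod.mono_neutral_right) (use finite_Q outside in auto)
        finally show ?thesis unfolding point_def coord_g using True by simp
      next
        case vC: False
        have "c v \<notin> {A..B}"
        proof
          assume "c v \<in> {A..B}"
          then have "c v \<in> c ` C" unfolding AB(3) .
          then obtain v' where "v' \<in> C" "c v = c v'" by blast
          then have "v = v'" using inj vw(1) AB(1) by (auto dest: inj_onD)
          then show False using vC \<open>v' \<in> C\<close> by simp
        qed
        then have "\<not> A \<subseteq> c v \<or> \<not> c v \<subseteq> B" by simp
        then obtain a where a: "a \<in> A \<and> a \<notin> c v \<or> a \<in> c v \<and> a \<notin> B" by blast
        then have "a \<in> Q" using AM mB vw by (auto simp: Q_def)
        moreover have "?f a = 0" using a gA[of a] gB[of a] by auto
        ultimately have "(\<Prod>a\<in>Q. ?f a) = 0" using finite_Q by (intro prod_zero) blast+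
        then show ?thesis unfolding point_def coord_g using True wC[OF vC] by simp
      qed
    qed
  qed
qed

text \<open>Both \<open>low\<close> and \<open>high\<close> of the maximum are unions. A set
  \<open>S\<close> between them is the union of its traces on \<open>high y\<close> and
  \<open>high z\<close>, which lie in the two given intervals and hence in the ring.\<close>

lemma admissible_max:
  assumes y: "y \<in> admissible" and z: "z \<in> admissible"
  shows "(\<lambda>a. max (y a) (z a)) \<in> admissible"
proof -
  let ?x = "\<lambda>a. max (y a) (z a)"
  have b: "\<And>a. a \<in> Q \<Longrightarrow> 0 \<le> y a \<and> y a \<le> 1" "\<And>a. a \<in> Q \<Longrightarrow> 0 \<le> z a \<and> z a \<le> 1"
    and ring: "{low y..high y} \<subseteq> c ` W" "{low z..high z} \<subseteq> c ` W"
    using y z by (auto simp: admissible_def)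
  have lo: "low ?x = low y \<union> low z"
    using b unfolding low_def by (force simp: max_def)
  have hi: "high ?x = high y \<union> high z"
    unfolding high_def by (auto simp: less_max_iff_disj)
  have "S \<in> c ` W" if S: "S \<in> {low ?x..high ?x}" for S
  proof -
    have S': "low y \<subseteq> S" "low z \<subseteq> S" "S \<subseteq> high y \<union> high z" using S by (auto simp: lo hi)
    have "S \<inter> high y \<in> {low y..high y}" "S \<inter> high z \<in> {low z..high z}"
      using S' low_le_high by (simp_all add: low_le_high)
    then have "S \<inter> high y \<in> c ` W" "S \<inter> high z \<in> c ` W" using ring by (meson subsetD)+
    then have "(S \<inter> high y) \<union> (S \<inter> high z) \<in> c ` W" by (rule un)
    moreover have "(S \<inter> high y) \<union> (S \<inter> high z) = S" using S'(3) by blast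
    ultimately show ?thesis by simp
  qed
  moreover have "\<forall>a\<in>Q. 0 \<le> ?x a \<and> ?x a \<le> 1"
    using b by (auto simp: le_max_iff_disj)
  ultimately show ?thesis unfolding admissible_def by blast
qed

text \<open>The coordinates of the point at time \<open>s\<close> on the edge from \<open>S\<close>
  to \<open>insert a S\<close>.\<close>

definition edge_coord :: "'p set \<Rightarrow> 'p \<Rightarrow> real \<Rightarrow> 'p \<Rightarrow> real" where
  "edge_coord S a s = (\<lambda>b. if b \<in> S then 1 else if b = a then s else 0)"

lemma edge_coord_admissible:
  assumes S: "S \<in> c ` W" "insert a S \<in> c ` W" "m \<subseteq> S" "insert a S \<subseteq> M" and s: "0 \<le> s" "s \<le> 1"
  shows "edge_coord S a s \<in> admissible"
proof -
  have "S \<subseteq> low (edge_coord S a s)"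
    using S(4) by (auto simp: low_def edge_coord_def Q_def)
  moreover have "high (edge_coord S a s) \<subseteq> insert a S"
    using S(3) by (auto simp: high_def edge_coord_def split: if_splits)
  ultimately have "X \<in> {S, insert a S}" if "X \<in> {low (edge_coord S a s)..high (edge_coord S a s)}" for X
    using that by auto
  then have "{low (edge_coord S a s)..high (edge_coord S a s)} \<subseteq> c ` W"
    using S(1,2) by blast
  then show ?thesis
    using s by (auto simp: admissible_def edge_coord_def)
qed

lemma continuous_point:
  assumes "\<And>a. a \<in> Q \<Longrightarrow> continuous_on T (\<lambda>z. g z a)" and "\<And>z. z \<in> T \<Longrightarrow> g z \<in> admissible"
  shows "continuous_map (top_of_set T) (realization cubes) (\<lambda>z. point (g z))"
proof (rule continuous_map_into_realization)
  have "continuous_on T (\<lambda>z. point (g z) v)" for v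
  proof (cases "v \<in> window")
    case True
    have "continuous_on T (\<lambda>z. if a \<in> c v then g z a else 1 - g z a)" if "a \<in> Q" for a
      using assms(1)[OF that] by (cases "a \<in> c v") (auto intro!: continuous_intros)
    then have "continuous_on T (\<lambda>z. \<Prod>a\<in>Q. if a \<in> c v then g z a else 1 - g z a)"
      by (intro continuous_on_prod)
    then show ?thesis using True by (simp add: point_def)
  qed (simp add: point_def)
  then show "continuous_map (top_of_set T) euclidean (\<lambda>z. point (g z))"
    by (simp add: continuous_on_fun_iff)
  show "finite {D \<in> cubes. D \<subseteq> window}"
    by (rule finite_subset[of _ "Pow window"]) (use finite_window in auto)
  show "\<exists>C\<in>{D \<in> cubes. D \<subseteq> window}. point (g z) \<in> cell cubes C" if "z \<in> topspace (top_of_set T)" for z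
    using point_cell[OF assms(2)] that by auto
qed blast

text \<open>Raising the coordinates one at a time contracts a loop.\<close>

lemma homotopic_raise:
  assumes f: "\<And>a. a \<in> Q \<Longrightarrow> continuous_on {0..1} (\<lambda>t. f t a)" "\<And>t. t \<in> {0..1} \<Longrightarrow> f t \<in> admissible"
      "\<And>a. f 1 a = f 0 a"
    and S: "S \<in> c ` W" "insert a S \<in> c ` W" "m \<subseteq> S" "insert a S \<subseteq> M" "a \<notin> S"
  shows "homotopic_with (\<lambda>r. r 1 = r 0) (top_of_set {0..1::real}) (realization cubes)
      (\<lambda>t. point (\<lambda>b. max (f t b) (if b \<in> S then 1 else 0)))
      (\<lambda>t. point (\<lambda>b. max (f t b) (if b \<in> insert a S then 1 else 0)))"
proof -
  \<comment> \<open>At time \<open>fst z\<close> of the homotopy the loop, with parameter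
    \<open>snd z\<close>, is joined with a point that moves along the edge from \<open>S\<close> to
    \<open>insert a S\<close>.\<close>
  define h where "h = (\<lambda>z. point (\<lambda>b. max (f (snd z) b) (edge_coord S a (fst z) b)))"
  have "continuous_map (top_of_set ({0..1} \<times> {0..1})) (realization cubes) h"
    unfolding h_def
  proof (rule continuous_point)
    fix b assume b: "b \<in> Q"
    have "continuous_on ({0..1} \<times> {0..1}) (\<lambda>z. f (snd z) b)"
      by (rule continuous_on_compose2[OF f(1)[OF b]]) (auto intro!: continuous_intros)
    moreover have "continuous_on ({0..1} \<times> {0..1}) (\<lambda>z. edge_coord S a (fst z) b)"
      unfolding edge_coord_def by (cases "b \<in> S"; cases "b = a") (auto intro!: continuous_intros)
    ultimately show "continuous_on ({0..1} \<times> {0..1}) (\<lambda>z. max (f (snd z) b) (edge_coord S a (fst z) b))"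
      by (rule continuous_on_max)
  next
    fix z :: "real \<times> real" assume z: "z \<in> {0..1} \<times> {0..1}"
    then have "snd z \<in> {0..1}" "0 \<le> fst z" "fst z \<le> 1" by auto
    then show "(\<lambda>b. max (f (snd z) b) (edge_coord S a (fst z) b)) \<in> admissible"
      using edge_coord_admissible[OF S(1-4), of "fst z"] f(2) by (intro admissible_max) auto
  qed
  moreover have "prod_topology (top_of_set {0..1::real}) (top_of_set {0..1::real}) = top_of_set ({0..1} \<times> {0..1})"
    by (simp add: subtopology_Times[symmetric])
  ultimately have "continuous_map (prod_topology (top_of_set {0..1}) (top_of_set {0..1})) (realization cubes) h"
    by simp
  moreover have "h (0, t) = point (\<lambda>b. max (f t b) (if b \<in> S then 1 else 0))"
    "h (1, t) = point (\<lambda>b. max (f t b) (if b \<in> insert a S then 1 else 0))" for t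
    unfolding h_def edge_coord_def by (auto intro!: arg_cong[where f = point])
  moreover have "h (s, 1) = h (s, 0)" for s
    by (simp add: h_def f(3))
  ultimately show ?thesis
    unfolding homotopic_with_def by (intro exI[of _ h]) auto
qed

text \<open>The elements of \<open>M - m\<close> are raised in an order provided by
  \<open>step\<close>, which keeps every intermediate set in the ring. At \<open>m\<close> nothing
  has been raised yet; at \<open>M\<close> every coordinate in \<open>Q\<close> is 1, and the loop
  has become constant at the top of the window.\<close>

lemma loop_contracts:
  assumes p: "pathin (realization cubes) p" "p 1 = p 0"
    and supp: "\<And>t v. t \<in> {0..1} \<Longrightarrow> 0 < p t v \<Longrightarrow> v \<in> window"
  shows "homotopic_with (\<lambda>r. r 1 = r 0) (top_of_set {0..1::real}) (realization cubes) p
      (\<lambda>t. point (\<lambda>a. 1))"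
proof -
  have pc: "continuous_map (top_of_set {0..1}) (realization cubes) p" using p(1) by (simp add: pathin_def)
  define f where "f t = coord (p t)" for t
  have adm: "f t \<in> admissible" and pt: "point (f t) = p t" if t: "t \<in> {0..1}" for t
  proof -
    have "p t \<in> topspace (realization cubes)"
      using continuous_map_image_subset_topspace[OF pc] t by auto
    then obtain C where "C \<in> cubes" "p t \<in> cell cubes C" by (rule topspace_cellE)
    then show "f t \<in> admissible" "point (f t) = p t"
      unfolding f_def using coord_point supp[OF t] by blast+
  qed
  have fc: "continuous_on {0..1} (\<lambda>t. f t a)" for a
  proof -
    have "continuous_on {0..1} (\<lambda>t. p t v)" for v
      using continuous_map_compose[OF pc continuous_map_coordinate[of v]] by (simp add: o_def)
    then show ?thesis unfolding f_def coord_def by (intro continuous_on_sum)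
  qed
  have f1: "f 1 a = f 0 a" for a using p(2) by (simp add: f_def)
  let ?p = "\<lambda>S t. point (\<lambda>b. max (f t b) (if b \<in> S then 1 else 0))"
  have raise: "homotopic_with (\<lambda>r. r 1 = r 0) (top_of_set {0..1::real}) (realization cubes) (?p S) (?p M)"
    if S: "S \<in> c ` W" "m \<subseteq> S" "S \<subseteq> M" for S
    using S
  proof (induction "card (M - S)" arbitrary: S rule: less_induct)
    case less
    show ?case
    proof (cases "S = M")
      case True
      have "continuous_map (top_of_set {0..1}) (realization cubes) (?p M)"
      proof (rule continuous_point)
        show "continuous_on {0..1} (\<lambda>t. max (f t b) (if b \<in> M then 1 else 0))" for b
          by (intro continuous_on_max fc continuous_on_const)
        have "edge_coord M undefined 0 = (\<lambda>b. if b \<in> M then 1 else 0)"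
          by (auto simp: edge_coord_def)
        moreover have "(\<lambda>b. if b \<in> M then 1 else 0::real) \<in> admissible"
        proof -
          have "M \<subseteq> low (\<lambda>b. if b \<in> M then 1 else 0)" using mM by (auto simp: low_def Q_def)
          then have "X = M" if "X \<in> {low (\<lambda>b. if b \<in> M then 1 else 0)..high (\<lambda>b. if b \<in> M then 1 else 0)}" for X
            using high_le[of "\<lambda>b. if b \<in> M then 1 else 0"] that
            by (meson atLeastAtMost_iff order_trans subset_antisym)
          then have "{low (\<lambda>b. if b \<in> M then 1 else 0)..high (\<lambda>b. if b \<in> M then 1 else 0)} \<subseteq> {M}"
            by blast
          then show ?thesis unfolding admissible_def using MV by auto
        qed
        ultimately show "(\<lambda>b. max (f t b) (if b \<in> M then 1 else 0)) \<in> admissible" if "t \<in> {0..1}" for t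
          using adm[OF that] by (intro admissible_max) auto
      qed
      then show ?thesis unfolding True by (auto simp: homotopic_with_refl f1)
    next
      case False
      then have "S \<subset> M" using less.prems(3) by blast
      then obtain a where a: "a \<in> M - S" "insert a S \<in> c ` W" using step[OF less.prems(1) MV] by blast
      have sub: "m \<subseteq> insert a S" "insert a S \<subseteq> M" using a(1) less.prems by auto
      have "finite (M - S)" using fin[OF less.prems(1) MV] .
      then have "card (M - insert a S) < card (M - S)"
        by (rule psubset_card_mono) (use a(1) in auto)
      then have "homotopic_with (\<lambda>r. r 1 = r 0) (top_of_set {0..1::real}) (realization cubes) (?p (insert a S)) (?p M)"
        using less.hyps a(2) sub by blast
      moreover have "homotopic_with (\<lambda>r. r 1 = r 0) (top_of_set {0..1::real}) (realization cubes) (?p S) (?p (insert a S))"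
        by (rule homotopic_raise) (use fc adm f1 less.prems a sub in auto)
      ultimately show ?thesis using homotopic_with_trans by blast
    qed
  qed
  have "homotopic_with (\<lambda>r. r 1 = r 0) (top_of_set {0..1::real}) (realization cubes) p (?p m)"
  proof (rule homotopic_with_equal)
    show "p 1 = p 0" "?p m 1 = ?p m 0" using p(2) f1 by simp_all
    show "continuous_map (top_of_set {0..1}) (realization cubes) p" by (rule pc)
    fix t :: real assume "t \<in> topspace (top_of_set {0..1})"
    then have t: "t \<in> {0..1}" by simp
    have "?p m t = point (f t)"
    proof (rule point_cong)
      fix a assume a: "a \<in> Q"
      then have "a \<notin> m" "0 \<le> f t a" using adm[OF t] by (auto simp: Q_def admissible_def)
      then show "max (f t a) (if a \<in> m then 1 else 0) = f t a" by simp
    qed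
    then show "p t = ?p m t" using pt[OF t] by simp
  qed
  moreover have "homotopic_with (\<lambda>r. r 1 = r 0) (top_of_set {0..1::real}) (realization cubes) (?p m) (?p M)"
    by (rule raise[OF mV order_refl mM])
  moreover have "homotopic_with (\<lambda>r. r 1 = r 0) (top_of_set {0..1::real}) (realization cubes) (?p M) (\<lambda>t. point (\<lambda>a. 1))"
  proof (rule homotopic_with_equal)
    show "?p M 1 = ?p M 0" by (simp add: f1)
    show "continuous_map (top_of_set {0..1}) (realization cubes) (?p M)"
      using homotopic_with_imp_continuous_maps[OF raise[OF mV order_refl mM]] by blast
    fix t :: real assume "t \<in> topspace (top_of_set {0..1})"
    then have t: "t \<in> {0..1}" by simp
    show "?p M t = point (\<lambda>a. 1)"
    proof (rule point_cong)
      fix a assume a: "a \<in> Q"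
      then have "a \<in> M" "f t a \<le> 1" using adm[OF t] by (auto simp: Q_def admissible_def)
      then show "max (f t a) (if a \<in> M then 1 else 0) = 1" by simp
    qed
  qed simp
  ultimately show ?thesis by (meson homotopic_with_trans)
qed

end

context set_ring_complex
begin

text \<open>Two loops have compact images and meet the open stars of finitely many vertices. A
  window with the intersection and the union of their sets as ends contains both supports, and both
  loops contract to its top.\<close>

lemma simply_connected_cubes: "simply_connected_space (realization cubes)"
  unfolding simply_connected_space_def
proof (intro allI impI, elim conjE)
  fix p q assume p: "pathin (realization cubes) p" "p 1 = p 0" and q: "pathin (realization cubes) q" "q 1 = q 0"
  let ?supp = "\<lambda>p. {v. \<exists>w\<in>p ` {0..1::real}. 0 < w v}"
  have finsupp: "finite (?supp p)" and suppW: "?supp p \<subseteq> W" if "pathin (realization cubes) p" for p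
  proof -
    have c: "continuous_map (top_of_set {0..1}) (realization cubes) p" using that by (simp add: pathin_def)
    have "compactin (realization cubes) (p ` {0..1})"
      by (rule image_compactin[OF _ c]) (simp add: compactin_subtopology)
    then show "finite (?supp p)" by (rule compactin_realization_support)
    show "?supp p \<subseteq> W"
    proof
      fix v assume "v \<in> ?supp p"
      then obtain t where t: "t \<in> {0..1}" "0 < p t v" by blast
      have "p t \<in> topspace (realization cubes)"
        using continuous_map_image_subset_topspace[OF c] t(1) by auto
      then obtain C where C: "C \<in> cubes" "\<And>v. 0 < p t v \<Longrightarrow> v \<in> C" by (rule topspace_cellE) (metis cell_outside less_irrefl)
      then show "v \<in> W" using t(2) cubes_subset by blast
    qed
  qed
  obtain v0 where "v0 \<in> W" using nonempty by blast
  \<comment> \<open>\<open>v0\<close> keeps the family nonempty, so that the intersection and the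
    union of its sets are members of the ring.\<close>
  define V where "V = insert v0 (?supp p \<union> ?supp q)"
  have V: "finite V" "V \<noteq> {}" "V \<subseteq> W"
    using finsupp[OF p(1)] finsupp[OF q(1)] suppW[OF p(1)] suppW[OF q(1)] \<open>v0 \<in> W\<close> by (auto simp: V_def)
  interpret set_ring_window W c "\<Inter>(c ` V)" "\<Union>(c ` V)"
  proof unfold_locales
    show "\<Inter>(c ` V) \<in> c ` W" by (rule finite_Inter_ring) (use V in auto)
    show "\<Union>(c ` V) \<in> c ` W" by (rule finite_Union_ring) (use V in auto)
    show "\<Inter>(c ` V) \<subseteq> \<Union>(c ` V)" using V(2) by blast
  qed
  have "V \<subseteq> window" using V(3) by (auto simp: window_def)
  then have "v \<in> window" if "t \<in> {0..1}" "0 < p t v \<or> 0 < q t v" for t v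
    using that unfolding V_def by blast
  then have "homotopic_with (\<lambda>r. r 1 = r 0) (top_of_set {0..1::real}) (realization cubes) p (\<lambda>t. point (\<lambda>a. 1))"
    "homotopic_with (\<lambda>r. r 1 = r 0) (top_of_set {0..1::real}) (realization cubes) q (\<lambda>t. point (\<lambda>a. 1))"
    using loop_contracts[OF p] loop_contracts[OF q] by blast+
  then show "homotopic_with (\<lambda>r. r 1 = r 0) (top_of_set {0..1}) (realization cubes) p q"
    by (meson homotopic_with_sym homotopic_with_trans)
qed

theorem cat0_cubes: "cat0_cube_complex cubes"
  unfolding cat0_cube_complex_def
  using cube_complex_cubes simply_connected_cubes flag_link Union_cubes nonempty by auto

end

section \<open>The essential minimal set\<close>

lemma discrete_change:
  fixes P :: "int \<Rightarrow> bool"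
  assumes "P a" "\<not> P b" "a \<le> b"
  shows "\<exists>n. P n \<and> \<not> P (n + 1)"
proof (rule ccontr)
  assume "\<nexists>n. P n \<and> \<not> P (n + 1)"
  with assms(3,1) have "P b"
    by (induction rule: int_ge_induct) blast+
  then show False using assms(2) by simp
qed

section \<open>The minimal set of a hyperbolic automorphism\<close>

locale hyperbolic_automorphism = cat0_complex K for K :: "'v set set" +
  fixes f f' :: "'v \<Rightarrow> 'v"
  assumes f_in: "\<And>v. v \<in> \<Union>K \<Longrightarrow> f v \<in> \<Union>K" and f'_in: "\<And>v. v \<in> \<Union>K \<Longrightarrow> f' v \<in> \<Union>K"
    and f'_f: "\<And>v. v \<in> \<Union>K \<Longrightarrow> f' (f v) = v" and f_f': "\<And>v. v \<in> \<Union>K \<Longrightarrow> f (f' v) = v"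
    and f_cube: "\<And>C. C \<in> K \<Longrightarrow> f ` C \<in> K" and f'_cube: "\<And>C. C \<in> K \<Longrightarrow> f' ` C \<in> K"
    and nonempty: "K \<noteq> {}" and hyperbolic: "hyperbolic K f"
begin

definition L :: int where "L = int (translation_length K f)"

lemma L_pos: "0 < L"
  using hyperbolic by (simp add: hyperbolic_def L_def)

lemma adjacent_f: "adjacent K x y \<Longrightarrow> adjacent K (f x) (f y)"
  using f_cube[of "{x, y}"] f'_f adjacent_vertex[of K x y] unfolding adjacent_def by auto metis

lemma adjacent_f': "adjacent K x y \<Longrightarrow> adjacent K (f' x) (f' y)"
  using f'_cube[of "{x, y}"] f_f' adjacent_vertex[of K x y] unfolding adjacent_def by auto metis

lemma relpowp_image:
  assumes "\<And>x y. adjacent K x y \<Longrightarrow> adjacent K (h x) (h y)"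
  shows "(adjacent K ^^ n) x y \<Longrightarrow> (adjacent K ^^ n) (h x) (h y)"
  by (induction n arbitrary: y) (auto dest: assms)

lemma vdist_f:
  assumes "x \<in> \<Union>K" "y \<in> \<Union>K" shows "vdist K (f x) (f y) = vdist K x y"
proof (rule antisym)
  show "vdist K (f x) (f y) \<le> vdist K x y"
    by (rule vdist_le, rule relpowp_image[OF adjacent_f], assumption, rule vdist_reach[OF assms])
  have "(adjacent K ^^ vdist K (f x) (f y)) (f' (f x)) (f' (f y))"
    by (rule relpowp_image[OF adjacent_f'], assumption, rule vdist_reach[OF f_in f_in]) (rule assms)+
  then show "vdist K x y \<le> vdist K (f x) (f y)"
    using vdist_le f'_f assms by simp
qed

lemma vhalf_f:
  assumes "x \<in> \<Union>K" "y \<in> \<Union>K" "z \<in> \<Union>K"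
  shows "f z \<in> vhalf K (f x) (f y) \<longleftrightarrow> z \<in> vhalf K x y"
  using assms f_in vdist_f by (simp add: vhalf_def del: Union_iff)

lemma vhalfs_preimage:
  assumes "H \<in> vhalfs K" shows "{z \<in> \<Union>K. f z \<in> H} \<in> vhalfs K"
proof -
  obtain x y where xy: "adjacent K x y" "H = vhalf K x y" using assms by (rule vhalfsE)
  note a = adjacent_f'[OF xy(1)]
  have V: "x \<in> \<Union>K" "y \<in> \<Union>K" using adjacent_vertex[OF xy(1)] .
  have "f z \<in> H \<longleftrightarrow> z \<in> vhalf K (f' x) (f' y)" if "z \<in> \<Union>K" for z
    using vhalf_f[OF adjacent_vertex[OF a] that] f_f' V xy(2) by simp
  then have "{z \<in> \<Union>K. f z \<in> H} = vhalf K (f' x) (f' y)"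
    using vhalf_subset by blast
  then show ?thesis using vhalfsI[OF a] by simp
qed

lemma translation_le: "v \<in> \<Union>K \<Longrightarrow> translation_length K f \<le> vdist K v (f v)"
  unfolding translation_length_def by (rule cINF_lower) auto

definition minv :: "'v set" where
  "minv = {v \<in> \<Union>K. vdist K v (f v) = translation_length K f}"

lemma minv_nonempty: "minv \<noteq> {}"
proof -
  have "(\<lambda>v. vdist K v (f v)) ` \<Union>K \<noteq> {}"
    using nonempty cube_nonempty by auto
  then have "Inf ((\<lambda>v. vdist K v (f v)) ` \<Union>K) \<in> (\<lambda>v. vdist K v (f v)) ` \<Union>K"
    by (rule Inf_nat_def1)
  then show ?thesis
    unfolding minv_def translation_length_def by auto
qed

lemma min_set_eq: "min_set K f = {C \<in> K. C \<subseteq> minv}"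
  unfolding min_set_def minv_def by auto

lemma minv_f: "v \<in> minv \<Longrightarrow> f v \<in> minv"
  using f_in vdist_f by (simp add: minv_def del: Union_iff)

lemma minv_f': "v \<in> minv \<Longrightarrow> f' v \<in> minv"
  using f'_in vdist_f[of "f' v" v] f_f' by (simp add: minv_def del: Union_iff)

lemma char_set_no_axis:
  assumes "\<And>\<gamma>. \<not> combinatorial_axis K f \<gamma>" shows "char_set K f = {}"
  using assms by (simp add: char_set_def positive_char_set_def)

text \<open>Then the characteristic set is empty, every vertex projects to \<open>{}\<close>, and
  the complex is a point, treated as the ring with one member.\<close>

lemma cat0_no_axis:
  assumes no: "\<And>\<gamma>. \<not> combinatorial_axis K f \<gamma>"
  shows "cat0_cube_complex (ess_min_set K f)"
proof -
  let ?W = "{{}} :: ('v \<Rightarrow> real) set set set"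
  interpret S: set_ring_complex ?W "\<lambda>_. {} :: int set"
    by unfold_locales (simp_all add: inj_on_def)
  have ch: "char_set K f = {}" using char_set_no_axis[OF no] .
  have proj: "ess_proj K f v = {}" for v by (simp add: ess_proj_def ch)
  have image: "ess_proj K f ` C = ?W" if "C \<noteq> {}" for C
    using that proj by auto
  have W: "?W \<in> ess_char_complex K f"
  proof -
    have "?W \<subseteq> sageev_vertices K {}" by (simp add: sageev_vertices_def)
    moreover have "bij_betw (\<lambda>_. {}) ?W (Pow {..<0::nat})" by (auto simp: bij_betw_def)
    ultimately show ?thesis
      unfolding ess_char_complex_def ch sageev_complex_def mem_Collect_eq
      by (intro conjI exI[of _ 0] exI[of _ "\<lambda>_. {}"]) auto
  qed
  obtain v where v: "v \<in> minv" using minv_nonempty by blast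
  then have "{v} \<in> min_set K f" using vertex_cube by (auto simp: min_set_eq minv_def)
  then have "?W \<in> ess_min_set K f" using W image[of "{v}"] unfolding ess_min_set_def by blast
  moreover have "D = ?W" if D: "D \<in> ess_min_set K f" for D
  proof -
    obtain C where "C \<in> min_set K f" "D = ess_proj K f ` C" using D unfolding ess_min_set_def by blast
    then show ?thesis using image[OF cube_nonempty] by (simp add: min_set_def)
  qed
  ultimately have "ess_min_set K f = {?W}" by blast
  also have "\<dots> = S.cubes"
  proof (intro equalityI subsetI)
    fix D assume "D \<in> {?W}"
    then show "D \<in> S.cubes" using S.singleton_cube[of "{}"] by simp
  next
    fix D assume "D \<in> S.cubes"
    then have "D \<subseteq> ?W" "D \<noteq> {}" using S.cubes_subset S.cube_nonempty by blast+
    then show "D \<in> {?W}" by blast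
  qed
  finally show ?thesis using S.cat0_cubes by simp
qed

end

section \<open>Index sets of half-spaces along an axis\<close>

locale hyperbolic_axis = hyperbolic_automorphism K f f' for K :: "'v set set" and f f' :: "'v \<Rightarrow> 'v" +
  fixes \<gamma> :: "int \<Rightarrow> 'v"
  assumes axis: "combinatorial_axis K f \<gamma>"
begin

text \<open>The half-space dual to the oriented edge from \<open>\<gamma> m\<close> to
  \<open>\<gamma> (m + 1)\<close>. With this orientation \<open>c (\<gamma> k)\<close> consists of
  the integers below \<open>k\<close>.\<close>

definition H :: "int \<Rightarrow> 'v set" where "H m = vhalf K (\<gamma> (m + 1)) (\<gamma> m)"

definition c :: "'v \<Rightarrow> int set" where "c v = {m. v \<in> H m}"

text \<open>The characteristic set as a set of combinatorial half-spaces; \<open>char_set_eq\<close>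
  translates.\<close>

definition A :: "'v set set" where "A = range H \<union> range (\<lambda>m. \<Union>K - H m)"

lemma \<gamma>_in: "\<gamma> m \<in> \<Union>K"
  using axis unfolding combinatorial_axis_def by (meson rangeI subsetD)

lemma vdist_\<gamma>: "int (vdist K (\<gamma> m) (\<gamma> n)) = \<bar>m - n\<bar>"
  using axis by (simp add: combinatorial_axis_def)

lemma f_\<gamma>: "f (\<gamma> m) = \<gamma> (m + L)"
  using axis by (simp add: combinatorial_axis_def L_def)

lemma adjacent_\<gamma>: "adjacent K (\<gamma> (m + 1)) (\<gamma> m)"
proof -
  have "int (vdist K (\<gamma> (m + 1)) (\<gamma> m)) = 1" using vdist_\<gamma>[of "m + 1" m] by simp
  then have "vdist K (\<gamma> (m + 1)) (\<gamma> m) = 1" by simp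
  then show ?thesis using vdist_eq_1[OF \<gamma>_in \<gamma>_in] by simp
qed

lemma H_vhalfs: "H m \<in> vhalfs K"
  unfolding H_def by (rule vhalfsI[OF adjacent_\<gamma>])

lemma H_subset: "H m \<subseteq> \<Union>K"
  using vhalfs_subset[OF H_vhalfs] .

lemma \<gamma>_H: "\<gamma> k \<in> H m \<longleftrightarrow> m < k"
proof -
  have "\<gamma> k \<in> H m \<longleftrightarrow> int (vdist K (\<gamma> k) (\<gamma> (m + 1))) < int (vdist K (\<gamma> k) (\<gamma> m))"
    using \<gamma>_in[of k] by (simp add: H_def vhalf_def)
  then show ?thesis unfolding vdist_\<gamma> by auto
qed

lemma inj_H: "inj H"
proof (rule injI)
  fix m n assume "H m = H n"
  then have "m < k \<longleftrightarrow> n < k" for k using \<gamma>_H by metis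
  then show "m = n" by (metis less_irrefl linorder_neqE)
qed

lemma H_ne_compl: "H m \<noteq> \<Union>K - H n"
proof
  assume "H m = \<Union>K - H n"
  moreover have "\<gamma> (max m n + 1) \<in> H m" "\<gamma> (max m n + 1) \<in> H n" by (simp_all add: \<gamma>_H)
  ultimately show False by blast
qed

lemma compl_H_inj: "\<Union>K - H m = \<Union>K - H n \<longleftrightarrow> m = n"
proof
  assume "\<Union>K - H m = \<Union>K - H n"
  then have "H m = H n" using H_subset by blast
  then show "m = n" using inj_H by (auto dest: injD)
qed simp

lemma f_H: "v \<in> \<Union>K \<Longrightarrow> f v \<in> H (m + L) \<longleftrightarrow> v \<in> H m"
  using vhalf_f[OF \<gamma>_in \<gamma>_in, of v "m + 1" m] f_\<gamma>[of "m + 1"] f_\<gamma>[of m]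
  by (simp add: H_def algebra_simps)

lemma f_H': "v \<in> \<Union>K \<Longrightarrow> f v \<in> H m \<longleftrightarrow> v \<in> H (m - L)"
  using f_H[of v "m - L"] by simp

lemma funpow_f: "v \<in> \<Union>K \<Longrightarrow> (f ^^ n) v \<in> \<Union>K \<and> ((f ^^ n) v \<in> H m \<longleftrightarrow> v \<in> H (m - int n * L))"
proof (induction n arbitrary: m)
  case (Suc n)
  then show ?case using f_in f_H'[of "(f ^^ n) v" m] by (simp add: algebra_simps del: Union_iff)
qed simp

lemma funpow_f': "v \<in> \<Union>K \<Longrightarrow> (f' ^^ n) v \<in> \<Union>K \<and> ((f' ^^ n) v \<in> H m \<longleftrightarrow> v \<in> H (m + int n * L))"
proof (induction n arbitrary: m)
  case (Suc n)
  let ?u = "(f' ^^ n) v"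
  have u: "?u \<in> \<Union>K" using Suc by simp
  have "f' ?u \<in> H m \<longleftrightarrow> ?u \<in> H (m + L)"
    using f_H[OF f'_in[OF u], of m] f_f'[OF u] by simp
  also have "\<dots> \<longleftrightarrow> v \<in> H (m + L + int n * L)" using Suc by blast
  finally show ?case using f'_in[OF u] by (simp add: algebra_simps del: Union_iff)
qed simp

text \<open>Only finitely many half-spaces separate \<open>v\<close> from \<open>\<gamma> 0\<close>,
  whose index set is the set of negative integers.\<close>

lemma c_bounded:
  assumes v: "v \<in> \<Union>K"
  shows "finite {m. m < 0 \<and> m \<notin> c v}" "finite {m. 0 \<le> m \<and> m \<in> c v}"
proof -
  have i: "inj_on H X" for X using inj_H by (rule inj_on_subset) simp
  have "H ` {m. m < 0 \<and> m \<notin> c v} \<subseteq> sep K (\<gamma> 0) v"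
    using H_vhalfs \<gamma>_H[of 0] by (auto simp: sep_def c_def)
  then show "finite {m. m < 0 \<and> m \<notin> c v}"
    using finite_sep[OF \<gamma>_in v] finite_subset finite_imageD[OF _ i] by blast
  have "H ` {m. 0 \<le> m \<and> m \<in> c v} \<subseteq> sep K v (\<gamma> 0)"
    using H_vhalfs \<gamma>_H[of 0] by (auto simp: sep_def c_def)
  then show "finite {m. 0 \<le> m \<and> m \<in> c v}"
    using finite_sep[OF v \<gamma>_in] finite_subset finite_imageD[OF _ i] by blast
qed

lemma eventually_in:
  assumes "finite {m::int. m < 0 \<and> m \<notin> S}"
  shows "\<exists>n. \<forall>k\<ge>n. m - int k * L \<in> S"
proof -
  obtain b where b: "\<And>x. x \<in> {m. m < 0 \<and> m \<notin> S} \<Longrightarrow> b \<le> x"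
    using bdd_below_finite[OF assms] by (auto simp: bdd_below_def)
  have "m - int k * L \<in> S" if k: "nat (\<bar>m\<bar> + \<bar>b\<bar> + 1) \<le> k" for k
  proof -
    have "int k * 1 \<le> int k * L" using L_pos by (intro mult_left_mono) auto
    then have "m - int k * L < 0" "m - int k * L < b" using k by linarith+
    then show ?thesis using b[of "m - int k * L"] by fastforce
  qed
  then show ?thesis by blast
qed

lemma eventually_out:
  assumes "finite {m::int. 0 \<le> m \<and> m \<in> S}"
  shows "\<exists>n. \<forall>k\<ge>n. m + int k * L \<notin> S"
proof -
  obtain b where b: "\<And>x. x \<in> {m. 0 \<le> m \<and> m \<in> S} \<Longrightarrow> x \<le> b"
    using bdd_above_finite[OF assms] by (auto simp: bdd_above_def)
  have "m + int k * L \<notin> S" if k: "nat (\<bar>m\<bar> + \<bar>b\<bar> + 1) \<le> k" for k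
  proof -
    have "int k * 1 \<le> int k * L" using L_pos by (intro mult_left_mono) auto
    then have "0 \<le> m + int k * L" "b < m + int k * L" using k by linarith+
    then show ?thesis using b[of "m + int k * L"] by fastforce
  qed
  then show ?thesis by blast
qed

lemma A_vhalfs: "Z \<in> A \<Longrightarrow> Z \<in> vhalfs K"
  using H_vhalfs vhalfs_compl by (auto simp: A_def)

lemma A_compl: "Z \<in> A \<Longrightarrow> \<Union>K - Z \<in> A"
  using H_subset by (auto simp: A_def double_diff)

lemma A_preimage:
  assumes Z: "Z \<in> vhalfs K" "Z \<notin> A" shows "{z \<in> \<Union>K. f z \<in> Z} \<notin> A"
proof
  assume "{z \<in> \<Union>K. f z \<in> Z} \<in> A"
  then consider m where "{z \<in> \<Union>K. f z \<in> Z} = H m" | m where "{z \<in> \<Union>K. f z \<in> Z} = \<Union>K - H m"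
    by (auto simp: A_def)
  then show False
  proof cases
    case (1 m)
    have "z \<in> Z \<longleftrightarrow> z \<in> H (m + L)" if z: "z \<in> \<Union>K" for z
    proof -
      have "f' z \<in> H m \<longleftrightarrow> z \<in> Z" unfolding 1[symmetric] using f'_in[OF z] f_f'[OF z] by simp
      then show ?thesis using f_H[OF f'_in[OF z], of m] f_f'[OF z] by simp
    qed
    then have "Z = H (m + L)" using vhalfs_subset[OF Z(1)] H_subset by blast
    then show False using Z(2) by (simp add: A_def)
  next
    case (2 m)
    have "z \<in> Z \<longleftrightarrow> z \<notin> H (m + L)" if z: "z \<in> \<Union>K" for z
    proof -
      have "f' z \<in> \<Union>K - H m \<longleftrightarrow> z \<in> Z" unfolding 2[symmetric] using f'_in[OF z] f_f'[OF z] by simp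
      then show ?thesis using f_H[OF f'_in[OF z], of m] f_f'[OF z] f'_in[OF z] by simp
    qed
    then have "Z = \<Union>K - H (m + L)" using vhalfs_subset[OF Z(1)] by blast
    then show False using Z(2) by (simp add: A_def)
  qed
qed

text \<open>In each residue class modulo \<open>L\<close> the index set of \<open>v\<close> contains
  all very negative and no very large integers, so it somewhere contains \<open>m - L\<close> but
  not \<open>m\<close>; then \<open>H m\<close> contains \<open>f v\<close> but not
  \<open>v\<close>. The \<open>L\<close> half-spaces found in this way already exhaust the distance
  from \<open>v\<close> to \<open>f v\<close>.\<close>

lemma sep_minv:
  assumes v: "v \<in> minv" shows "sep K (f v) v \<subseteq> range H"
proof -
  have V: "v \<in> \<Union>K" "vdist K v (f v) = translation_length K f" using v by (auto simp: minv_def)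
  have "\<exists>m. m mod L = r \<and> m \<notin> c v \<and> m - L \<in> c v" if r: "r \<in> {0..<L}" for r
  proof -
    obtain a where a: "\<forall>k\<ge>a. r - int k * L \<in> c v" using eventually_in[OF c_bounded(1)[OF V(1)]] by blast
    obtain b where b: "\<forall>k\<ge>b. r + int k * L \<notin> c v" using eventually_out[OF c_bounded(2)[OF V(1)]] by blast
    have "\<exists>n. r + n * L \<in> c v \<and> \<not> r + (n + 1) * L \<in> c v"
      by (rule discrete_change[of _ "- int a" "int b"]) (use a b in auto)
    then obtain n where "r + n * L \<in> c v" "r + (n + 1) * L \<notin> c v" by blast
    moreover have "(r + (n + 1) * L) mod L = r"
      unfolding mod_mult_self1 using r by simp
    moreover have "r + (n + 1) * L - L = r + n * L" by (simp add: algebra_simps)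
    ultimately show ?thesis by metis
  qed
  then obtain g where g: "\<And>r. r \<in> {0..<L} \<Longrightarrow> g r mod L = r \<and> g r \<notin> c v \<and> g r - L \<in> c v"
    by metis
  have sub: "(\<lambda>r. H (g r)) ` {0..<L} \<subseteq> sep K (f v) v"
  proof
    fix Z assume "Z \<in> (\<lambda>r. H (g r)) ` {0..<L}"
    then obtain r where "r \<in> {0..<L}" "Z = H (g r)" by blast
    then show "Z \<in> sep K (f v) v"
      using g[of r] f_H'[OF V(1), of "g r"] H_vhalfs by (simp add: sep_def c_def)
  qed
  have "inj_on (\<lambda>r. H (g r)) {0..<L}"
  proof (rule inj_onI)
    fix r s assume rs: "r \<in> {0..<L}" "s \<in> {0..<L}" "H (g r) = H (g s)"
    then have "g r = g s" using inj_H by (auto dest: injD)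
    then show "r = s" using g[OF rs(1)] g[OF rs(2)] by metis
  qed
  then have "card ((\<lambda>r. H (g r)) ` {0..<L}) = card {0..<L}" by (rule card_image)
  also have "\<dots> = translation_length K f" by (simp add: L_def)
  also have "\<dots> = card (sep K (f v) v)"
    using card_sep[OF f_in[OF V(1)] V(1)] V(2) vdist_sym[of K v] by simp
  finally have "(\<lambda>r. H (g r)) ` {0..<L} = sep K (f v) v"
    using card_subset_eq[OF finite_sep[OF f_in[OF V(1)] V(1)] sub] by simp
  then have "sep K (f v) v = (\<lambda>r. H (g r)) ` {0..<L}" by (rule sym)
  then show ?thesis by auto
qed

lemma minv_monotone:
  assumes v: "v \<in> minv" "m \<in> c v" shows "m - L \<in> c v"
proof (rule ccontr)
  assume "m - L \<notin> c v"
  have V: "v \<in> \<Union>K" using v by (simp add: minv_def)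
  have "f v \<notin> H m" using f_H'[OF V, of m] \<open>m - L \<notin> c v\<close> by (simp add: c_def)
  then have "\<Union>K - H m \<in> sep K (f v) v"
    using v(2) f_in[OF V] vhalfs_compl[OF H_vhalfs] by (simp add: sep_def c_def del: Union_iff)
  then have "\<Union>K - H m \<in> range H" using sep_minv[OF v(1)] by blast
  then show False using H_ne_compl by auto
qed

lemma minv_invariant:
  assumes v: "v \<in> minv" and Z: "Z \<in> vhalfs K" "Z \<notin> A"
  shows "f v \<in> Z \<longleftrightarrow> v \<in> Z"
proof (rule ccontr)
  assume ne: "\<not> (f v \<in> Z \<longleftrightarrow> v \<in> Z)"
  have V: "v \<in> \<Union>K" using v by (simp add: minv_def)
  have "Z \<in> sep K (f v) v \<or> \<Union>K - Z \<in> sep K (f v) v"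
    using ne V f_in[OF V] vhalfs_compl[OF Z(1)] Z(1) by (auto simp: sep_def simp del: Union_iff)
  then have "Z \<in> A \<or> \<Union>K - Z \<in> A" using sep_minv[OF v] by (auto simp: A_def)
  then have "Z \<in> A" using A_compl[of "\<Union>K - Z"] vhalfs_subset[OF Z(1)] by (auto simp: double_diff)
  then show False using Z(2) by simp
qed

lemma monotone_iterate:
  assumes "\<And>m. m \<in> S \<Longrightarrow> m - L \<in> S" "m \<in> S" shows "m - int n * L \<in> S"
proof (induction n)
  case (Suc n)
  then show ?case using assms(1)[OF Suc] by (simp add: algebra_simps)
qed (use assms in simp)

text \<open>Every half-space separating \<open>f v\<close> from \<open>v\<close> is some
  \<open>H m\<close> with \<open>m - L\<close> in the index set and \<open>m\<close> outside. A set
  closed under subtraction of \<open>L\<close> has at most one such \<open>m\<close> in each residue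
  class, so the displacement is at most \<open>L\<close>.\<close>

lemma minvI:
  assumes v: "v \<in> \<Union>K" and mono: "\<And>m. m \<in> c v \<Longrightarrow> m - L \<in> c v"
    and inv: "\<And>Z. Z \<in> vhalfs K \<Longrightarrow> Z \<notin> A \<Longrightarrow> f v \<in> Z \<longleftrightarrow> v \<in> Z"
  shows "v \<in> minv"
proof -
  let ?J = "{m. m \<notin> c v \<and> m - L \<in> c v}"
  have sub: "sep K (f v) v \<subseteq> H ` ?J"
  proof
    fix Z assume Z: "Z \<in> sep K (f v) v"
    then have "Z \<in> A" using inv[of Z] by (auto simp: sep_def)
    then consider m where "Z = H m" | m where "Z = \<Union>K - H m" by (auto simp: A_def)
    then show "Z \<in> H ` ?J"
    proof cases
      case (1 m)
      then show ?thesis using Z f_H'[OF v, of m] by (auto simp: sep_def c_def)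
    next
      case (2 m)
      then have "m \<in> c v" "m - L \<notin> c v" using Z f_H'[OF v, of m] v by (auto simp: sep_def c_def)
      then show ?thesis using mono by blast
    qed
  qed
  have inj: "inj_on (\<lambda>m. m mod L) ?J"
  proof -
    have False if mn: "m \<notin> c v" "n - L \<in> c v" "m mod L = n mod L" "m < n" for m n
    proof -
      have "L dvd n - m" using mn(3) by (metis mod_eq_dvd_iff)
      then obtain k where k: "n - m = L * k" by (elim dvdE)
      have "0 < L * k" using k mn(4) by simp
      then have "0 < k" using L_pos by (simp add: zero_less_mult_iff)
      then have "m = n - L - int (nat (k - 1)) * L" using k by (simp add: algebra_simps)
      then have "m \<in> c v" using monotone_iterate[OF mono mn(2)] by metis
      then show False using mn(1) by simp
    qed
    then show ?thesis by (intro inj_onI) (metis (no_types, lifting) linorder_neqE mem_Collect_eq)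
  qed
  have img: "(\<lambda>m. m mod L) ` ?J \<subseteq> {0..<L}" using L_pos by auto
  have finJ: "finite ?J" using inj_on_finite[OF inj img] by simp
  have "card (sep K (f v) v) \<le> card (H ` ?J)" using finJ sub by (intro card_mono) auto
  also have "\<dots> \<le> card ?J" using finJ by (rule card_image_le)
  also have "\<dots> \<le> card {0..<L}" by (rule card_inj_on_le[OF inj img]) simp
  also have "\<dots> = translation_length K f" by (simp add: L_def)
  finally have "vdist K v (f v) \<le> translation_length K f"
    using card_sep[OF f_in[OF v] v] vdist_sym[of K v] by simp
  then show ?thesis using translation_le[OF v] v by (simp add: minv_def)
qed

text \<open>The first condition is consistency: no chosen \<open>H m\<close> lies inside an
  \<open>H n\<close> whose complement is chosen. The second one singles out the minimal set. The
  last two say that \<open>S\<close> differs from the negative integers, and so from the index set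
  of any vertex, by finitely many elements.\<close>

definition ring :: "int set set" where
  "ring = {S. (\<forall>m n. m \<in> S \<longrightarrow> H m \<subseteq> H n \<longrightarrow> n \<in> S) \<and> (\<forall>m\<in>S. m - L \<in> S) \<and>
     finite {m. m < 0 \<and> m \<notin> S} \<and> finite {m. 0 \<le> m \<and> m \<in> S}}"

lemma c_ring: "v \<in> minv \<Longrightarrow> c v \<in> ring"
  using minv_monotone c_bounded[of v] by (auto simp: ring_def c_def minv_def)

text \<open>Hyperplanes off the axis do not separate the points of the orbit of \<open>v\<close>, which meets
  every half-space of \<open>A\<close>.\<close>

lemma off_axis_meets:
  assumes v: "v \<in> minv" and Z: "Z \<in> vhalfs K" "Z \<notin> A" "v \<in> Z"
  shows "Z \<inter> H m \<noteq> {}" "Z \<inter> (\<Union>K - H m) \<noteq> {}"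
proof -
  have V: "v \<in> \<Union>K" using v by (simp add: minv_def)
  have 1: "(f ^^ n) v \<in> minv \<and> (f ^^ n) v \<in> Z" for n
    by (induction n) (use v Z minv_f minv_invariant[OF _ Z(1,2)] in auto)
  have 2: "(f' ^^ n) v \<in> minv \<and> (f' ^^ n) v \<in> Z" for n
  proof (induction n)
    case (Suc n)
    let ?u = "(f' ^^ n) v"
    have "?u \<in> \<Union>K" using Suc by (simp add: minv_def)
    then show ?case using Suc minv_f'[of ?u] minv_invariant[OF minv_f' Z(1,2), of ?u] f_f'[of ?u] by simp
  qed (use v Z in simp)
  obtain a where "\<forall>k\<ge>a. m - int k * L \<in> c v" using eventually_in[OF c_bounded(1)[OF V]] by blast
  then have "(f ^^ a) v \<in> H m" using funpow_f[OF V, of a m] by (simp add: c_def)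
  then show "Z \<inter> H m \<noteq> {}" using 1 by blast
  obtain b where "\<forall>k\<ge>b. m + int k * L \<notin> c v" using eventually_out[OF c_bounded(2)[OF V]] by blast
  then have "(f' ^^ b) v \<in> \<Union>K - H m" using funpow_f'[OF V, of b m] by (simp add: c_def del: Union_iff)
  then show "Z \<inter> (\<Union>K - H m) \<noteq> {}" using 2 by blast
qed

text \<open>Keep the side of \<open>v\<close> for all half-spaces outside \<open>A\<close> and
  prescribe \<open>S\<close> along the axis. This orientation is consistent and differs from that of
  \<open>v\<close> in finitely many places, so \<open>flip_vertex\<close> makes it a vertex, and
  \<open>minvI\<close> places the vertex in the minimal set.\<close>

lemma realize:
  assumes v: "v \<in> minv" and S: "S \<in> ring"
  shows "\<exists>u\<in>minv. c u = S \<and> (\<forall>Z. Z \<in> vhalfs K \<longrightarrow> Z \<notin> A \<longrightarrow> (u \<in> Z \<longleftrightarrow> v \<in> Z))"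
proof -
  have V: "v \<in> \<Union>K" using v by (simp add: minv_def)
  have S': "\<And>m n. m \<in> S \<Longrightarrow> H m \<subseteq> H n \<Longrightarrow> n \<in> S" "\<And>m. m \<in> S \<Longrightarrow> m - L \<in> S"
    "finite {m. m < 0 \<and> m \<notin> S}" "finite {m. 0 \<le> m \<and> m \<in> S}"
    using S by (auto simp: ring_def)
  let ?c = "\<lambda>Z. \<Union>K - Z"
  define F where "F = H ` (c v - S) \<union> (\<lambda>m. ?c (H m)) ` (S - c v)"
  define \<sigma> where "\<sigma> = H ` S \<union> (\<lambda>m. ?c (H m)) ` (- S) \<union> {Z \<in> vhalfs K. Z \<notin> A \<and> v \<in> Z}"
  have "finite (c v - S)"
    by (rule finite_subset[of _ "{m. m < 0 \<and> m \<notin> S} \<union> {m. 0 \<le> m \<and> m \<in> c v}"])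
      (use S'(3) c_bounded(2)[OF V] in auto)
  moreover have "finite (S - c v)"
    by (rule finite_subset[of _ "{m. m < 0 \<and> m \<notin> c v} \<union> {m. 0 \<le> m \<and> m \<in> S}"])
      (use S'(4) c_bounded(1)[OF V] in auto)
  ultimately have finF: "finite F" by (simp add: F_def)
  have FS: "F \<subseteq> {Z \<in> vhalfs K. v \<in> Z}"
    using H_vhalfs vhalfs_compl[OF H_vhalfs] V by (auto simp: F_def c_def)
  have Hm: "H m \<in> F \<longleftrightarrow> m \<in> c v - S" "?c (H m) \<in> F \<longleftrightarrow> m \<in> S - c v" for m
  proof -
    have 1: "H m \<notin> (\<lambda>m. ?c (H m)) ` (S - c v)" "?c (H m) \<notin> H ` (c v - S)"
      using H_ne_compl H_ne_compl[symmetric] by (simp_all add: image_iff)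
    have 2: "H m \<in> H ` (c v - S) \<longleftrightarrow> m \<in> c v - S" by (rule inj_image_mem_iff[OF inj_H])
    have 3: "?c (H m) \<in> (\<lambda>m. ?c (H m)) ` (S - c v) \<longleftrightarrow> m \<in> S - c v"
      using compl_H_inj by (auto simp: image_iff)
    show "H m \<in> F \<longleftrightarrow> m \<in> c v - S" unfolding F_def Un_iff 2 using 1(1) by argo
    show "?c (H m) \<in> F \<longleftrightarrow> m \<in> S - c v" unfolding F_def Un_iff 3 using 1(2) by argo
  qed
  have cc: "?c (?c (H m)) = H m" for m using H_subset by blast
  have cF: "?c ` F = (\<lambda>m. ?c (H m)) ` (c v - S) \<union> H ` (S - c v)"
    by (simp add: F_def image_Un image_image cc)
  have in\<sigma>: "m \<in> S \<Longrightarrow> H m \<in> \<sigma>" "m \<notin> S \<Longrightarrow> ?c (H m) \<in> \<sigma>" for m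
    by (simp_all add: \<sigma>_def)
  have incF: "m \<in> c v - S \<Longrightarrow> ?c (H m) \<in> ?c ` F" "m \<in> S - c v \<Longrightarrow> H m \<in> ?c ` F" for m
    unfolding cF Un_iff by (rule disjI1, erule imageI) (rule disjI2, erule imageI)
  have \<sigma>: "({Z \<in> vhalfs K. v \<in> Z} - F) \<union> ?c ` F = \<sigma>"
  proof (intro equalityI subsetI)
    fix Z assume "Z \<in> ({Z \<in> vhalfs K. v \<in> Z} - F) \<union> ?c ` F"
    then consider "Z \<in> vhalfs K" "v \<in> Z" "Z \<notin> F" | "Z \<in> ?c ` F" by blast
    then show "Z \<in> \<sigma>"
    proof cases
      case 1
      consider "Z \<notin> A" | m where "Z = H m" | m where "Z = ?c (H m)" by (auto simp: A_def)
      then show ?thesis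
      proof cases
        case (2 m)
        then have "m \<in> S" using 1 Hm(1)[of m] by (simp add: c_def)
        then show ?thesis using 2 by (simp add: \<sigma>_def)
      next
        case (3 m)
        then have "m \<notin> S" using 1 Hm(2)[of m] by (simp add: c_def)
        then show ?thesis using 3 by (auto simp: \<sigma>_def)
      qed (use 1 in \<open>simp add: \<sigma>_def\<close>)
    next
      case 2
      then have "Z \<in> (\<lambda>m. ?c (H m)) ` (c v - S) \<or> Z \<in> H ` (S - c v)" unfolding cF Un_iff .
      then show ?thesis using in\<sigma> by (elim disjE imageE) simp_all
    qed
  next
    fix Z assume "Z \<in> \<sigma>"
    then consider m where "m \<in> S" "Z = H m" | m where "m \<notin> S" "Z = ?c (H m)" | "Z \<in> vhalfs K" "Z \<notin> A" "v \<in> Z"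
      by (auto simp: \<sigma>_def)
    then show "Z \<in> ({Z \<in> vhalfs K. v \<in> Z} - F) \<union> ?c ` F"
    proof cases
      case (1 m)
      show ?thesis
      proof (cases "m \<in> c v")
        case True
        then have "v \<in> H m" "H m \<notin> F" using Hm(1)[of m] 1 by (simp_all add: c_def)
        then show ?thesis using H_vhalfs 1 by simp
      next
        case False
        then show ?thesis using incF(2)[of m] 1 by simp
      qed
    next
      case (2 m)
      show ?thesis
      proof (cases "m \<in> c v")
        case False
        then have "v \<in> ?c (H m)" "?c (H m) \<notin> F" using Hm(2)[of m] 2 V by (simp_all add: c_def)
        then show ?thesis using vhalfs_compl[OF H_vhalfs, of m] unfolding 2(2) by blast
      next
        case True
        then show ?thesis using incF(1)[of m] 2 by simp
      qed
    next
      case 3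
      have "F \<subseteq> A" by (auto simp: F_def A_def)
      then show ?thesis using 3 by blast
    qed
  qed
  \<comment> \<open>Two sets \<open>H m\<close> meet far out on the axis, and two complements meet
    at its other end; \<open>H m\<close> and a complement of \<open>H n\<close> meet by the first
    condition in \<open>ring\<close>. Pairs with one member outside \<open>A\<close> are covered by
    \<open>off_axis_meets\<close>, and two members outside \<open>A\<close> share
    \<open>v\<close>.\<close>
  have meet: "P \<inter> R \<noteq> {}" if PR: "P \<in> \<sigma>" "R \<in> \<sigma>" for P R
  proof -
    have HH: "H m \<inter> H n \<noteq> {}" for m n
    proof -
      have "\<gamma> (max m n + 1) \<in> H m \<inter> H n" by (simp add: \<gamma>_H)
      then show ?thesis by blast
    qed
    have CC: "?c (H m) \<inter> ?c (H n) \<noteq> {}" for m n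
    proof -
      have "\<gamma> (min m n) \<in> ?c (H m) \<inter> ?c (H n)" using \<gamma>_in[of "min m n"] by (simp add: \<gamma>_H)
      then show ?thesis by blast
    qed
    have HC: "H m \<inter> ?c (H n) \<noteq> {}" if "m \<in> S" "n \<notin> S" for m n
      using S'(1)[OF that(1), of n] that(2) H_subset by blast
    have sym: "P \<inter> R \<noteq> {} \<longleftrightarrow> R \<inter> P \<noteq> {}" by (simp add: Int_commute)
    consider (P1) m where "m \<in> S" "P = H m" | (P2) m where "m \<notin> S" "P = ?c (H m)" | (P3) "P \<in> vhalfs K" "P \<notin> A" "v \<in> P"
      using PR(1) by (auto simp: \<sigma>_def)
    then show ?thesis
    proof cases
      case (P1 m)
      consider n where "R = H n" | n where "n \<notin> S" "R = ?c (H n)" | "R \<in> vhalfs K" "R \<notin> A" "v \<in> R"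
        using PR(2) by (auto simp: \<sigma>_def)
      then show ?thesis
      proof cases
        case (1 n)
        then show ?thesis using HH P1 by simp
      next
        case (2 n)
        then show ?thesis using HC[OF P1(1) 2(1)] P1 by simp
      next
        case 3
        then show ?thesis using off_axis_meets(1)[OF v 3] P1 sym by simp
      qed
    next
      case (P2 m)
      consider n where "n \<in> S" "R = H n" | n where "R = ?c (H n)" | "R \<in> vhalfs K" "R \<notin> A" "v \<in> R"
        using PR(2) by (auto simp: \<sigma>_def)
      then show ?thesis
      proof cases
        case (1 n)
        then show ?thesis using HC[OF 1(1) P2(1)] P2 sym by simp
      next
        case (2 n)
        then show ?thesis using CC P2 by simp
      next
        case 3
        then show ?thesis using off_axis_meets(2)[OF v 3] P2 sym by simp
      qed
    next
      case P3
      consider n where "R = H n" | n where "R = ?c (H n)" | "v \<in> R"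
        using PR(2) by (auto simp: \<sigma>_def)
      then show ?thesis
      proof cases
        case (1 n)
        then show ?thesis using off_axis_meets(1)[OF v P3] by simp
      next
        case (2 n)
        then show ?thesis using off_axis_meets(2)[OF v P3] by simp
      next
        case 3
        then show ?thesis using P3 by blast
      qed
    qed
  qed
  have "\<exists>u\<in>\<Union>K. {Z \<in> vhalfs K. u \<in> Z} = ({Z \<in> vhalfs K. v \<in> Z} - F) \<union> ?c ` F"
  proof (rule flip_vertex[OF finF V FS])
    fix P R assume "P \<in> ({Z \<in> vhalfs K. v \<in> Z} - F) \<union> ?c ` F" "R \<in> ({Z \<in> vhalfs K. v \<in> Z} - F) \<union> ?c ` F"
    then show "P \<inter> R \<noteq> {}" unfolding \<sigma> by (rule meet)
  qed
  then obtain u where u: "u \<in> \<Union>K" "{Z \<in> vhalfs K. u \<in> Z} = \<sigma>" unfolding \<sigma> by (rule bexE)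
  have uZ: "u \<in> Z \<longleftrightarrow> Z \<in> \<sigma>" if "Z \<in> vhalfs K" for Z using u(2) that by blast
  have "H m \<in> \<sigma> \<longleftrightarrow> m \<in> S" for m
  proof -
    have 1: "H m \<notin> (\<lambda>m. ?c (H m)) ` (- S)" using H_ne_compl by (simp add: image_iff)
    have 2: "H m \<notin> {Z \<in> vhalfs K. Z \<notin> A \<and> v \<in> Z}" by (simp add: A_def)
    show ?thesis unfolding \<sigma>_def Un_iff inj_image_mem_iff[OF inj_H] using 1 2 by argo
  qed
  then have cu: "c u = S" using uZ[OF H_vhalfs] by (simp add: c_def)
  have off: "u \<in> Z \<longleftrightarrow> v \<in> Z" if Z: "Z \<in> vhalfs K" "Z \<notin> A" for Z
    using uZ[OF Z(1)] Z by (auto simp: \<sigma>_def A_def)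
  have "u \<in> minv"
  proof (rule minvI[OF u(1)])
    show "m - L \<in> c u" if "m \<in> c u" for m using S'(2) that cu by simp
    fix Z assume Z: "Z \<in> vhalfs K" "Z \<notin> A"
    \<comment> \<open>The preimage of \<open>Z\<close> under \<open>f\<close> is again a half-space
      outside \<open>A\<close>, where \<open>u\<close> and \<open>v\<close> are on the same
      side.\<close>
    have "f u \<in> Z \<longleftrightarrow> u \<in> {z \<in> \<Union>K. f z \<in> Z}" using u(1) by simp
    also have "\<dots> \<longleftrightarrow> v \<in> {z \<in> \<Union>K. f z \<in> Z}"
      by (rule off[OF vhalfs_preimage[OF Z(1)] A_preimage[OF Z]])
    also have "\<dots> \<longleftrightarrow> f v \<in> Z" using V by simp
    also have "\<dots> \<longleftrightarrow> u \<in> Z" using minv_invariant[OF v Z] off[OF Z] by simp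
    finally show "f u \<in> Z \<longleftrightarrow> u \<in> Z" .
  qed
  then show ?thesis using cu off by blast
qed

lemma ring_eq: "c ` minv = ring"
proof
  show "c ` minv \<subseteq> ring" using c_ring by blast
  show "ring \<subseteq> c ` minv"
  proof
    fix S assume S: "S \<in> ring"
    obtain v where "v \<in> minv" using minv_nonempty by blast
    then show "S \<in> c ` minv" using realize[OF _ S] by blast
  qed
qed

lemma ring_Un: "S \<in> ring \<Longrightarrow> T \<in> ring \<Longrightarrow> S \<union> T \<in> ring"
proof -
  assume S: "S \<in> ring" and T: "T \<in> ring"
  have "finite {m. m < 0 \<and> m \<notin> S \<union> T}"
    by (rule finite_subset[of _ "{m. m < 0 \<and> m \<notin> S}"]) (use S in \<open>auto simp: ring_def\<close>)
  moreover have "finite {m. 0 \<le> m \<and> m \<in> S \<union> T}"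
    by (rule finite_subset[of _ "{m. 0 \<le> m \<and> m \<in> S} \<union> {m. 0 \<le> m \<and> m \<in> T}"]) (use S T in \<open>auto simp: ring_def\<close>)
  ultimately show ?thesis using S T unfolding ring_def by blast
qed

lemma ring_Int: "S \<in> ring \<Longrightarrow> T \<in> ring \<Longrightarrow> S \<inter> T \<in> ring"
proof -
  assume S: "S \<in> ring" and T: "T \<in> ring"
  have "finite {m. m < 0 \<and> m \<notin> S \<inter> T}"
    by (rule finite_subset[of _ "{m. m < 0 \<and> m \<notin> S} \<union> {m. m < 0 \<and> m \<notin> T}"]) (use S T in \<open>auto simp: ring_def\<close>)
  moreover have "finite {m. 0 \<le> m \<and> m \<in> S \<inter> T}"
    by (rule finite_subset[of _ "{m. 0 \<le> m \<and> m \<in> S}"]) (use S in \<open>auto simp: ring_def\<close>)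
  ultimately show ?thesis using S T unfolding ring_def by blast
qed

lemma ring_finite: "S \<in> ring \<Longrightarrow> T \<in> ring \<Longrightarrow> finite (T - S)"
  by (rule finite_subset[of _ "{m. m < 0 \<and> m \<notin> S} \<union> {m. 0 \<le> m \<and> m \<in> T}"]) (auto simp: ring_def)

text \<open>Add the least missing element. An inclusion \<open>H m \<subseteq> H n\<close> forces
  \<open>n \<le> m\<close>, and subtraction of \<open>L\<close> decreases, so whatever else the new
  element demands is a smaller member of \<open>T\<close> and hence already in
  \<open>S\<close>.\<close>

lemma ring_step:
  assumes S: "S \<in> ring" and T: "T \<in> ring" and ST: "S \<subset> T"
  shows "\<exists>a\<in>T - S. insert a S \<in> ring"
proof
  have fin: "finite (T - S)" using ring_finite[OF S T] .
  let ?a = "Min (T - S)"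
  show a: "?a \<in> T - S" using fin ST by (intro Min_in) auto
  have less: "m \<in> S" if "m \<in> T" "m < ?a" for m
    using Min_le[OF fin, of m] that by force
  have up: "n \<in> insert ?a S" if m: "m \<in> insert ?a S" "H m \<subseteq> H n" for m n
  proof (cases "m = ?a")
    case True
    have "\<gamma> (m + 1) \<in> H m" by (simp add: \<gamma>_H)
    then have "\<gamma> (m + 1) \<in> H n" using m(2) by blast
    then have "n \<le> m" by (simp add: \<gamma>_H)
    moreover have "n \<in> T" using T a m(2) True unfolding ring_def by blast
    ultimately show ?thesis using less[of n] True by (cases "n = ?a") auto
  next
    case False
    then show ?thesis using S m unfolding ring_def by blast
  qed
  have down: "m - L \<in> insert ?a S" if "m \<in> insert ?a S" for m
  proof (cases "m = ?a")
    case True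
    have "m - L \<in> T" using T a True unfolding ring_def by blast
    then show ?thesis using less[of "m - L"] True L_pos by simp
  next
    case False
    then show ?thesis using S that unfolding ring_def by blast
  qed
  have "finite {m. m < 0 \<and> m \<notin> insert ?a S}"
    by (rule finite_subset[of _ "{m. m < 0 \<and> m \<notin> S}"]) (use S in \<open>auto simp: ring_def\<close>)
  moreover have "finite {m. 0 \<le> m \<and> m \<in> insert ?a S}"
    by (rule finite_subset[of _ "insert ?a {m. 0 \<le> m \<and> m \<in> S}"]) (use S in \<open>auto simp: ring_def\<close>)
  ultimately show "insert ?a S \<in> ring" using up down unfolding ring_def by blast
qed

end

section \<open>Comparison with the geometric definitions\<close>

context hyperbolic_axis
begin

lemma funpow_f_\<gamma>: "(f ^^ n) (\<gamma> m) = \<gamma> (m + int n * L)"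
  by (induction n) (auto simp: f_\<gamma> algebra_simps)

lemma funpow_f'_\<gamma>: "(f' ^^ n) (\<gamma> m) = \<gamma> (m - int n * L)"
proof (induction n)
  case (Suc n)
  have "f' (\<gamma> k) = \<gamma> (k - L)" for k
    using f_\<gamma>[of "k - L"] f'_f[OF \<gamma>_in[of "k - L"]] by simp
  then show ?case using Suc by (simp add: algebra_simps)
qed simp

text \<open>Some forward iterate of \<open>\<gamma> 0\<close> lies inside a given half-space of
  \<open>\<delta>\<close> and some backward iterate outside. So an edge of \<open>\<gamma>\<close>
  enters it, and an edge that crosses its boundary determines a half-space.\<close>

lemma axis_independent:
  assumes \<delta>: "combinatorial_axis K f \<delta>"
  shows "vhalf K (\<delta> (k + 1)) (\<delta> k) \<in> range H"
proof -
  interpret D: hyperbolic_axis K f f' \<delta> by unfold_locales (rule \<delta>)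
  have DH: "vhalf K (\<delta> (k + 1)) (\<delta> k) = D.H k" by (simp add: D.H_def)
  obtain a where "\<forall>j\<ge>a. k - int j * L \<in> D.c (\<gamma> 0)"
    using eventually_in[OF D.c_bounded(1)[OF \<gamma>_in]] by blast
  then have a: "\<gamma> (int a * L) \<in> D.H k"
    using D.funpow_f[OF \<gamma>_in[of 0], of a k] by (simp add: D.c_def funpow_f_\<gamma>)
  obtain b where "\<forall>j\<ge>b. k + int j * L \<notin> D.c (\<gamma> 0)"
    using eventually_out[OF D.c_bounded(2)[OF \<gamma>_in]] by blast
  then have b: "\<gamma> (- int b * L) \<notin> D.H k"
    using D.funpow_f'[OF \<gamma>_in[of 0], of b k] by (simp add: D.c_def funpow_f'_\<gamma>)
  have "- int b * L \<le> 0" "0 \<le> int a * L" using L_pos by simp_all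
  then have "\<exists>n. \<gamma> n \<notin> D.H k \<and> \<not> \<gamma> (n + 1) \<notin> D.H k"
    using a b by (intro discrete_change[of _ "- int b * L" "int a * L"]) auto
  then obtain n where n: "\<gamma> n \<notin> D.H k" "\<gamma> (n + 1) \<in> D.H k" by blast
  have "D.H k = H n"
    unfolding H_def by (rule vhalfs_crossing[OF D.H_vhalfs adjacent_\<gamma> n(2,1)])
  then show ?thesis unfolding DH by blast
qed

lemma positive_char_set_eq: "positive_char_set K f = geo_half K ` range H"
proof -
  have dual: "halfspaces_dual K (\<delta> m) (\<delta> (m + 1)) = {geo_half K (vhalf K (\<delta> (m + 1)) (\<delta> m))}"
    if \<delta>: "combinatorial_axis K f \<delta>" for \<delta> m
  proof -
    interpret D: hyperbolic_axis K f f' \<delta> by unfold_locales (rule \<delta>)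
    have "adjacent K (\<delta> m) (\<delta> (m + 1))" using D.adjacent_\<gamma>[of m] by (simp add: adjacent_sym)
    then show ?thesis by (rule halfspaces_dual_eq)
  qed
  show ?thesis
  proof (intro equalityI subsetI)
    fix P assume "P \<in> positive_char_set K f"
    then obtain \<delta> m where \<delta>: "combinatorial_axis K f \<delta>" "P \<in> halfspaces_dual K (\<delta> m) (\<delta> (m + 1))"
      unfolding positive_char_set_def by blast
    then have "P = geo_half K (vhalf K (\<delta> (m + 1)) (\<delta> m))" using dual by simp
    then show "P \<in> geo_half K ` range H" using axis_independent[OF \<delta>(1)] by blast
  next
    fix P assume "P \<in> geo_half K ` range H"
    then obtain m where "P = geo_half K (H m)" by blast
    then have "P \<in> halfspaces_dual K (\<gamma> m) (\<gamma> (m + 1))" using dual[OF axis] by (simp add: H_def)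
    then show "P \<in> positive_char_set K f" unfolding positive_char_set_def using axis by blast
  qed
qed

lemma char_set_eq: "char_set K f = geo_half K ` A"
proof -
  have "opp K ` geo_half K ` range H = geo_half K ` range (\<lambda>m. \<Union>K - H m)"
    unfolding image_image using opp_geo_half[OF H_vhalfs] by (intro image_cong) auto
  then show ?thesis unfolding char_set_def positive_char_set_eq A_def image_Un by simp
qed

lemma ess_proj_eq:
  assumes v: "v \<in> \<Union>K" shows "ess_proj K f v = geo_half K ` {Z \<in> A. v \<in> Z}"
proof (intro equalityI subsetI)
  fix P assume "P \<in> ess_proj K f v"
  then obtain Z where "Z \<in> A" "P = geo_half K Z" "vertex_point v \<in> P"
    unfolding ess_proj_def char_set_eq by blast
  then show "P \<in> geo_half K ` {Z \<in> A. v \<in> Z}" using vertex_in_geo_half[OF v] by simp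
next
  fix P assume "P \<in> geo_half K ` {Z \<in> A. v \<in> Z}"
  then obtain Z where Z: "Z \<in> A" "v \<in> Z" "P = geo_half K Z" by blast
  then have "P \<in> halfspaces K" using A_vhalfs halfspaces_eq by simp
  then show "P \<in> ess_proj K f v"
    unfolding ess_proj_def char_set_eq using Z vertex_in_geo_half[OF v] by simp
qed

lemma geo_half_in_proj:
  assumes v: "v \<in> \<Union>K" and Z: "Z \<in> A" shows "geo_half K Z \<in> ess_proj K f v \<longleftrightarrow> v \<in> Z"
proof
  assume "geo_half K Z \<in> ess_proj K f v"
  then obtain Z' where "Z' \<in> A" "v \<in> Z'" "geo_half K Z = geo_half K Z'"
    unfolding ess_proj_eq[OF v] by blast
  then show "v \<in> Z" using geo_half_inj A_vhalfs Z by (metis inj_onD)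
next
  assume "v \<in> Z"
  then show "geo_half K Z \<in> ess_proj K f v" unfolding ess_proj_eq[OF v] using Z by blast
qed

text \<open>Reads the index set off a vertex of the Sageev construction; \<open>ess_proj\<close>
  followed by \<open>ce\<close> is \<open>c\<close>.\<close>

definition ce :: "('v \<Rightarrow> real) set set \<Rightarrow> int set" where "ce e = {m. geo_half K (H m) \<in> e}"

lemma ce_proj: "v \<in> \<Union>K \<Longrightarrow> ce (ess_proj K f v) = c v"
  using geo_half_in_proj[of v "H _"] by (simp add: ce_def c_def A_def)

lemma mem_A_cong:
  assumes "u \<in> \<Union>K" "v \<in> \<Union>K" "c u = c v" "Z \<in> A" shows "u \<in> Z \<longleftrightarrow> v \<in> Z"
proof -
  have H: "u \<in> H m \<longleftrightarrow> v \<in> H m" for m using assms(3) unfolding c_def by blast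
  consider m where "Z = H m" | m where "Z = \<Union>K - H m" using assms(4) by (auto simp: A_def)
  then show ?thesis by cases (use H assms(1,2) in simp_all)
qed

lemma ess_proj_cong:
  assumes "u \<in> \<Union>K" "v \<in> \<Union>K" "c u = c v" shows "ess_proj K f u = ess_proj K f v"
proof -
  have "{Z \<in> A. u \<in> Z} = {Z \<in> A. v \<in> Z}" using mem_A_cong[OF assms] by blast
  then show ?thesis unfolding ess_proj_eq[OF assms(1)] ess_proj_eq[OF assms(2)] by simp
qed

lemma minv_in: "v \<in> minv \<Longrightarrow> v \<in> \<Union>K"
  by (simp add: minv_def)

lemma ce_image: "X \<subseteq> minv \<Longrightarrow> ce ` ess_proj K f ` X = c ` X"
  unfolding image_image by (intro image_cong refl ce_proj minv_in) blast

sublocale E: set_ring_complex "ess_proj K f ` minv" ce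
proof unfold_locales
  have im: "ce ` ess_proj K f ` minv = ring" using ce_image[OF order_refl] ring_eq by simp
  show "inj_on ce (ess_proj K f ` minv)"
  proof (rule inj_onI)
    fix x y assume "x \<in> ess_proj K f ` minv" "y \<in> ess_proj K f ` minv" "ce x = ce y"
    obtain u where u: "x = ess_proj K f u" "u \<in> minv" using \<open>x \<in> _\<close> by (rule imageE)
    obtain v where v: "y = ess_proj K f v" "v \<in> minv" using \<open>y \<in> _\<close> by (rule imageE)
    have "c u = c v" using \<open>ce x = ce y\<close> unfolding u(1) v(1) ce_proj[OF minv_in[OF u(2)]] ce_proj[OF minv_in[OF v(2)]] .
    then show "x = y" unfolding u(1) v(1) by (rule ess_proj_cong[OF minv_in[OF u(2)] minv_in[OF v(2)]])
  qed
  show "ess_proj K f ` minv \<noteq> {}" by (simp only: image_is_empty minv_nonempty not_False_eq_True)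
  fix S T assume ST: "S \<in> ce ` ess_proj K f ` minv" "T \<in> ce ` ess_proj K f ` minv"
  then have R: "S \<in> ring" "T \<in> ring" unfolding im by simp_all
  show "S \<union> T \<in> ce ` ess_proj K f ` minv" unfolding im using R by (rule ring_Un)
  show "S \<inter> T \<in> ce ` ess_proj K f ` minv" unfolding im using R by (rule ring_Int)
  show "finite (T - S)" using R by (rule ring_finite)
  show "\<exists>a\<in>T - S. insert a S \<in> ce ` ess_proj K f ` minv" if "S \<subset> T"
    unfolding im by (rule ring_step[OF R \<open>S \<subset> T\<close>])
qed

text \<open>The chain condition is finiteness of distance: a vertex outside the first member of a
  descending chain is outside all of them, and only finitely many half-spaces separate
  \<open>v\<close> from it.\<close>

lemma proj_sageev_vertex:
  assumes v: "v \<in> \<Union>K" shows "ess_proj K f v \<in> sageev_vertices K (char_set K f)"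
  unfolding sageev_vertices_def mem_Collect_eq
proof (intro conjI ballI)
  show "ess_proj K f v \<subseteq> char_set K f" by (simp add: ess_proj_def)
  fix P assume "P \<in> char_set K f"
  then obtain Z where Z: "Z \<in> A" "P = geo_half K Z" unfolding char_set_eq by blast
  show "P \<in> ess_proj K f v \<longleftrightarrow> opp K P \<notin> ess_proj K f v"
    unfolding Z(2) opp_geo_half[OF A_vhalfs[OF Z(1)]] geo_half_in_proj[OF v Z(1)]
      geo_half_in_proj[OF v A_compl[OF Z(1)]] using v by simp
next
  fix P R assume "P \<in> ess_proj K f v" "R \<in> ess_proj K f v"
  then have "vertex_point v \<in> P \<inter> R" by (simp add: ess_proj_def)
  then show "P \<inter> R \<noteq> {}" by blast
next
  show "\<nexists>h. \<forall>i::nat. h i \<in> ess_proj K f v \<and> h (Suc i) \<subset> h i"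
  proof
    assume "\<exists>h. \<forall>i::nat. h i \<in> ess_proj K f v \<and> h (Suc i) \<subset> h i"
    then obtain h where "\<forall>i::nat. h i \<in> ess_proj K f v \<and> h (Suc i) \<subset> h i" ..
    then have h: "h i \<in> ess_proj K f v" "h (Suc i) \<subset> h i" for i by simp_all
    have less: "h j \<subset> h i" if "i < j" for i j
      using that
    proof (induction j)
      case (Suc j)
      then consider "i < j" | "i = j" by linarith
      then show ?case
      proof cases
        case 1
        show ?thesis by (rule psubset_trans[OF h(2) Suc.IH[OF 1]])
      qed (use h(2) in simp)
    qed simp
    have "\<exists>Z. Z \<in> vhalfs K \<and> v \<in> Z \<and> h i = geo_half K Z" for i
    proof -
      obtain Z where "Z \<in> A" "v \<in> Z" "h i = geo_half K Z"
        using h(1)[of i] unfolding ess_proj_eq[OF v] by blast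
      then show ?thesis using A_vhalfs by blast
    qed
    then have "\<forall>i. \<exists>Z. Z \<in> vhalfs K \<and> v \<in> Z \<and> h i = geo_half K Z" ..
    from choice[OF this] obtain Z where "\<forall>i. Z i \<in> vhalfs K \<and> v \<in> Z i \<and> h i = geo_half K (Z i)" ..
    then have Z: "Z i \<in> vhalfs K" "v \<in> Z i" "h i = geo_half K (Z i)" for i by auto
    obtain u where u: "u \<in> \<Union>K" "u \<notin> Z 0"
      using vhalfs_nonempty[OF vhalfs_compl[OF Z(1)[of 0]]] by blast
    have "u \<notin> Z i" for i
    proof (cases "i = 0")
      case False
      then have "geo_half K (Z i) \<subseteq> geo_half K (Z 0)" using less[of 0 i] by (simp add: Z(3)[symmetric] psubset_imp_subset)
      then have "Z i \<subseteq> Z 0" using geo_half_subset_iff[OF Z(1)] by blast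
      then show ?thesis using u(2) by blast
    qed (use u in simp)
    then have "range Z \<subseteq> sep K v u" using Z(1,2) by (auto simp: sep_def)
    then have "finite (range Z)" by (rule finite_subset[OF _ finite_sep[OF v u(1)]])
    moreover have "inj Z"
    proof (rule injI)
      fix i j assume "Z i = Z j"
      then have "h i = h j" using Z(3) by simp
      then show "i = j" using less[of i j] less[of j i] by (cases i j rule: linorder_cases) auto
    qed
    ultimately show False using finite_imageD infinite_UNIV_nat by blast
  qed
qed

lemma proj_diff:
  assumes u: "u \<in> \<Union>K" and w: "w \<in> \<Union>K" and c: "p \<notin> c u" "c w = insert p (c u)"
  shows "ess_proj K f u - ess_proj K f w = {geo_half K (\<Union>K - H p)}"
    and "ess_proj K f w - ess_proj K f u = {geo_half K (H p)}"
proof -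
  have HA: "H m \<in> A" "\<Union>K - H m \<in> A" for m by (auto simp: A_def)
  have m: "u \<in> H m \<longleftrightarrow> m \<in> c u" "w \<in> H m \<longleftrightarrow> m \<in> c u \<or> m = p" for m
    using c(2) unfolding c_def by blast+
  have sep: "P \<in> ess_proj K f x - ess_proj K f y \<longleftrightarrow> (\<exists>Z\<in>A. P = geo_half K Z \<and> x \<in> Z \<and> y \<notin> Z)"
    if "x \<in> \<Union>K" "y \<in> \<Union>K" for P x y
    using geo_half_in_proj[OF that(2)] unfolding ess_proj_eq[OF that(1)] by blast
  have uw: "Z \<in> A \<and> u \<in> Z \<and> w \<notin> Z \<longleftrightarrow> Z = \<Union>K - H p" for Z
  proof
    assume Z: "Z \<in> A \<and> u \<in> Z \<and> w \<notin> Z"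
    then consider n where "Z = H n" | n where "Z = \<Union>K - H n" by (auto simp: A_def)
    then show "Z = \<Union>K - H p" by cases (use Z m w in auto)
  qed (use HA m u c(1) in auto)
  have wu: "Z \<in> A \<and> w \<in> Z \<and> u \<notin> Z \<longleftrightarrow> Z = H p" for Z
  proof
    assume Z: "Z \<in> A \<and> w \<in> Z \<and> u \<notin> Z"
    then consider n where "Z = H n" | n where "Z = \<Union>K - H n" by (auto simp: A_def)
    then show "Z = H p" by cases (use Z m u in auto)
  qed (use HA m c(1) in auto)
  show "ess_proj K f u - ess_proj K f w = {geo_half K (\<Union>K - H p)}"
  proof (rule Set.set_eqI)
    fix P
    show "P \<in> ess_proj K f u - ess_proj K f w \<longleftrightarrow> P \<in> {geo_half K (\<Union>K - H p)}"
      unfolding sep[OF u w] singleton_iff using uw by metis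
  qed
  show "ess_proj K f w - ess_proj K f u = {geo_half K (H p)}"
  proof (rule Set.set_eqI)
    fix P
    show "P \<in> ess_proj K f w - ess_proj K f u \<longleftrightarrow> P \<in> {geo_half K (H p)}"
      unfolding sep[OF w u] singleton_iff using wu by metis
  qed
qed

lemma adjacent_sageev:
  assumes "adjacent E.cubes \<sigma> \<tau>" shows "sageev_adjacent K \<sigma> \<tau>"
proof -
  have im: "\<sigma> \<in> ess_proj K f ` minv" "\<tau> \<in> ess_proj K f ` minv"
    and "\<exists>p. p \<notin> ce \<sigma> \<and> ce \<tau> = insert p (ce \<sigma>) \<or> p \<notin> ce \<tau> \<and> ce \<sigma> = insert p (ce \<tau>)"
    using iffD1[OF E.adjacent_cubes assms] by simp_all
  then obtain p where p: "p \<notin> ce \<sigma> \<and> ce \<tau> = insert p (ce \<sigma>) \<or> p \<notin> ce \<tau> \<and> ce \<sigma> = insert p (ce \<tau>)"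
    by (elim exE)
  obtain u where u: "\<sigma> = ess_proj K f u" "u \<in> minv" using im(1) by (rule imageE)
  obtain w where w: "\<tau> = ess_proj K f w" "w \<in> minv" using im(2) by (rule imageE)
  note uK = minv_in[OF u(2)] and wK = minv_in[OF w(2)]
  have "\<Union>K - (\<Union>K - H p) = H p" using H_subset by blast
  then have o: "opp K (geo_half K (H p)) = geo_half K (\<Union>K - H p)"
      "opp K (geo_half K (\<Union>K - H p)) = geo_half K (H p)"
    using opp_geo_half[OF H_vhalfs, of p] opp_geo_half[OF vhalfs_compl[OF H_vhalfs], of p] by (simp_all only:)
  from p have "p \<notin> c u \<and> c w = insert p (c u) \<or> p \<notin> c w \<and> c u = insert p (c w)"
    unfolding u(1) w(1) ce_proj[OF uK] ce_proj[OF wK] .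
  then show ?thesis
  proof (elim disjE conjE)
    assume "p \<notin> c u" "c w = insert p (c u)"
    note d = proj_diff[OF uK wK this]
    show ?thesis unfolding sageev_adjacent_def u(1) w(1) d
      by (rule exI[of _ "geo_half K (\<Union>K - H p)"]) (simp only: o simp_thms)
  next
    assume "p \<notin> c w" "c u = insert p (c w)"
    note d = proj_diff[OF wK uK this]
    show ?thesis unfolding sageev_adjacent_def u(1) w(1) d
      by (rule exI[of _ "geo_half K (H p)"]) (simp only: o simp_thms)
  qed
qed

lemma cubes_sageev:
  assumes D: "D \<in> E.cubes" shows "D \<in> ess_char_complex K f"
proof -
  obtain n \<phi> where \<phi>: "cube_chart E.cubes D n \<phi>" using E.chart_exists[OF D] .
  define \<psi> where "\<psi> = the_inv_into D \<phi>"
  note ch = cube_param_chart[OF \<phi>, folded \<psi>_def]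
  have "D \<subseteq> sageev_vertices K (char_set K f)"
    using E.cubes_subset[OF D] proj_sageev_vertex minv_in by blast
  moreover have "bij_betw \<phi> D (Pow {..<n})" using \<phi> by (simp add: cube_chart_def)
  moreover have "sageev_adjacent K \<sigma> \<tau>"
    if st: "\<sigma> \<in> D" "\<tau> \<in> D" "card (sym_diff (\<phi> \<sigma>) (\<phi> \<tau>)) = 1" for \<sigma> \<tau>
  proof -
    obtain i where i: "sym_diff (\<phi> \<sigma>) (\<phi> \<tau>) = {i}" using st(3) by (rule card_1_singletonE)
    have sub: "\<phi> \<sigma> \<subseteq> {..<n}" "\<phi> \<tau> \<subseteq> {..<n}" using ch(4) st by blast+
    have "i < n" using i sub by blast
    have "adjacent E.cubes \<sigma> \<tau>"
    proof (cases "i \<in> \<phi> \<sigma>")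
      case True
      then have "\<phi> \<sigma> = insert i (\<phi> \<tau>)" "i \<notin> \<phi> \<tau>" using i by blast+
      then have "adjacent E.cubes (\<psi> (\<phi> \<tau>)) (\<psi> (\<phi> \<sigma>))"
        using cube_param_edge[OF ch(1) sub(2) \<open>i < n\<close>] by simp
      then show ?thesis using ch(2)[OF st(1)] ch(2)[OF st(2)] by (simp add: adjacent_sym)
    next
      case False
      have "x \<in> \<phi> \<tau> \<longleftrightarrow> x \<in> insert i (\<phi> \<sigma>)" for x
      proof -
        have "x \<in> sym_diff (\<phi> \<sigma>) (\<phi> \<tau>) \<longleftrightarrow> x = i" unfolding i by simp
        then show ?thesis using False by auto
      qed
      then have "\<phi> \<tau> = insert i (\<phi> \<sigma>)" by (rule Set.set_eqI)
      then have "adjacent E.cubes (\<psi> (\<phi> \<sigma>)) (\<psi> (\<phi> \<tau>))"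
        using cube_param_edge[OF ch(1) sub(1) \<open>i < n\<close> False] by simp
      then show ?thesis using ch(2)[OF st(1)] ch(2)[OF st(2)] by simp
    qed
    then show ?thesis by (rule adjacent_sageev)
  qed
  ultimately show ?thesis
    unfolding ess_char_complex_def sageev_complex_def mem_Collect_eq by blast
qed

lemma proj_min_cube:
  assumes C: "C \<in> min_set K f" shows "ess_proj K f ` C \<in> E.cubes"
proof -
  have CK: "C \<in> K" "C \<subseteq> minv" using C by (auto simp: min_set_eq)
  obtain v where v: "v \<in> C" using cube_nonempty[OF CK(1)] by blast
  have V: "v \<in> \<Union>K" using v CK(1) by blast
  obtain n \<psi> where \<psi>: "cube_param K C n \<psi>" "\<psi> {} = v" using rooted_param[OF CK(1) v] .
  obtain \<pi> where "inj_on \<pi> {..<n}" "\<forall>B\<subseteq>{..<n}. sep K (\<psi> {}) (\<psi> B) = \<pi> ` B"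
    by (rule cube_sep[OF \<psi>(1)])
  then have \<pi>: "\<And>B. B \<subseteq> {..<n} \<Longrightarrow> sep K v (\<psi> B) = \<pi> ` B" using \<psi>(2) by simp
  define d where "d m = \<Union>K - H m" for m
  have d_inj: "m = n" if "d m = d n" for m n using that unfolding d_def by (rule iffD1[OF compl_H_inj])
  have d_ne: "H m \<noteq> d n" for m n unfolding d_def by (rule H_ne_compl)
  have flip: "m \<in> c (\<psi> B) \<longleftrightarrow> (if m \<in> c v then H m \<notin> \<pi> ` B else d m \<in> \<pi> ` B)" if B: "B \<subseteq> {..<n}" for m B
  proof -
    have "\<psi> B \<in> \<Union>K" using cube_param_in[OF \<psi>(1) B] CK(1) by blast
    then show ?thesis
      unfolding \<pi>[OF B, symmetric] using V H_vhalfs[of m] vhalfs_compl[OF H_vhalfs[of m]]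
      by (auto simp: sep_def c_def d_def simp del: Union_iff)
  qed
  define R where "R = {m \<in> c v. H m \<in> \<pi> ` {..<n}}"
  define R' where "R' = {m. m \<notin> c v \<and> d m \<in> \<pi> ` {..<n}}"
  have fin\<pi>: "finite (\<pi> ` {..<n})" by simp
  have "H ` R \<subseteq> \<pi> ` {..<n}" by (rule image_subsetI) (simp only: R_def mem_Collect_eq)
  then have "finite (H ` R)" using fin\<pi> by (rule finite_subset)
  then have finR: "finite R" by (rule finite_imageD) (rule inj_on_subset[OF inj_H subset_UNIV])
  have "d ` R' \<subseteq> \<pi> ` {..<n}" by (rule image_subsetI) (simp only: R'_def mem_Collect_eq)
  then have "finite (d ` R')" using fin\<pi> by (rule finite_subset)
  then have finR': "finite R'" by (rule finite_imageD) (rule inj_onI, rule d_inj)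
  have "(c v \<union> R') - (c v - R) \<subseteq> R \<union> R'" by blast
  then have fin: "finite ((c v \<union> R') - (c v - R))" by (rule finite_subset) (simp only: finR finR' finite_Un)
  have "c ` C = {c v - R..c v \<union> R'}"
  proof (intro equalityI subsetI)
    fix S assume "S \<in> c ` C"
    then obtain B where B: "B \<subseteq> {..<n}" "S = c (\<psi> B)" unfolding cube_param_image[OF \<psi>(1)] by blast
    have "\<pi> ` B \<subseteq> \<pi> ` {..<n}" using B(1) by (rule image_mono)
    then have "c v - R \<subseteq> S" "S \<subseteq> c v \<union> R'"
    proof -
      show "c v - R \<subseteq> S"
      proof
        fix m assume "m \<in> c v - R"
        then have "m \<in> c v" "H m \<notin> \<pi> ` {..<n}" by (simp_all add: R_def)
        then show "m \<in> S" using flip[OF B(1), of m] \<open>\<pi> ` B \<subseteq> _\<close> unfolding B(2) by (simp only: if_True) blast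
      qed
      show "S \<subseteq> c v \<union> R'"
      proof
        fix m assume m: "m \<in> S"
        show "m \<in> c v \<union> R'"
        proof (cases "m \<in> c v")
          case False
          then have "d m \<in> \<pi> ` B" using flip[OF B(1), of m] m unfolding B(2) by simp
          then show ?thesis using False \<open>\<pi> ` B \<subseteq> _\<close> unfolding R'_def by blast
        qed simp
      qed
    qed
    then show "S \<in> {c v - R..c v \<union> R'}" by (simp only: atLeastAtMost_iff simp_thms)
  next
    fix S assume "S \<in> {c v - R..c v \<union> R'}"
    then have S: "c v - R \<subseteq> S" "S \<subseteq> c v \<union> R'" by (simp_all only: atLeastAtMost_iff)
    \<comment> \<open>To reach the index set \<open>S\<close>, flip exactly the axis directions in
      which \<open>S\<close> differs from \<open>c v\<close>.\<close>
    define B where "B = {i. i < n \<and> ((\<exists>m\<in>c v - S. \<pi> i = H m) \<or> (\<exists>m\<in>S - c v. \<pi> i = d m))}"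
    have B: "B \<subseteq> {..<n}" by (auto simp: B_def)
    have 1: "H m \<in> \<pi> ` B \<longleftrightarrow> m \<notin> S" if m: "m \<in> c v" for m
    proof
      assume "H m \<in> \<pi> ` B"
      then obtain i where i: "H m = \<pi> i" "i \<in> B" by (rule imageE)
      then consider k where "k \<in> c v - S" "\<pi> i = H k" | k where "k \<in> S - c v" "\<pi> i = d k"
        unfolding B_def by blast
      then show "m \<notin> S"
      proof cases
        case (1 k)
        then have "m = k" using i(1) injD[OF inj_H, of m k] by simp
        then show ?thesis using 1 by simp
      next
        case (2 k)
        then show ?thesis using i(1) d_ne[of m k] by simp
      qed
    next
      assume "m \<notin> S"
      then have "m \<in> R" using S(1) m by blast
      then obtain i where "i < n" "\<pi> i = H m" unfolding R_def by auto
      then have "i \<in> B" unfolding B_def using m \<open>m \<notin> S\<close> by blast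
      then show "H m \<in> \<pi> ` B" using \<open>\<pi> i = H m\<close> by (metis imageI)
    qed
    have 2: "d m \<in> \<pi> ` B \<longleftrightarrow> m \<in> S" if m: "m \<notin> c v" for m
    proof
      assume "d m \<in> \<pi> ` B"
      then obtain i where i: "d m = \<pi> i" "i \<in> B" by (rule imageE)
      then consider k where "k \<in> c v - S" "\<pi> i = H k" | k where "k \<in> S - c v" "\<pi> i = d k"
        unfolding B_def by blast
      then show "m \<in> S"
      proof cases
        case (1 k)
        then show ?thesis using i(1) d_ne[of k m] by simp
      next
        case (2 k)
        then have "m = k" using i(1) by (intro d_inj) simp
        then show ?thesis using 2 by simp
      qed
    next
      assume "m \<in> S"
      then have "m \<in> R'" using S(2) m by blast
      then obtain i where "i < n" "\<pi> i = d m" unfolding R'_def by auto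
      then have "i \<in> B" unfolding B_def using m \<open>m \<in> S\<close> by blast
      then show "d m \<in> \<pi> ` B" using \<open>\<pi> i = d m\<close> by (metis imageI)
    qed
    have "m \<in> c (\<psi> B) \<longleftrightarrow> m \<in> S" for m
      using flip[OF B, of m] 1[of m] 2[of m] by (cases "m \<in> c v") simp_all
    then have "S = c (\<psi> B)" by (intro Set.set_eqI) simp
    then show "S \<in> c ` C" using cube_param_in[OF \<psi>(1) B] by (simp only: imageI)
  qed
  then have "ce ` ess_proj K f ` C = {c v - R..c v \<union> R'}" using ce_image[OF CK(2)] by simp
  then show ?thesis
    using CK(2) by (intro E.cubesI[OF _ _ fin]) auto
qed

text \<open>Over a vertex \<open>v\<close> with the least index set \<open>A0\<close>,
  \<open>realize\<close> gives for each set of the interval a vertex of the minimal set with the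
  sides of \<open>v\<close> off the axis. These vertices differ from \<open>v\<close> exactly by the
  prescribed flips, so \<open>cube_of_flips\<close> assembles them to a cube of
  \<open>K\<close>.\<close>

lemma cube_lift:
  assumes D: "D \<in> E.cubes" obtains C where "C \<in> min_set K f" "D = ess_proj K f ` C"
proof -
  obtain A0 B0 where AB: "D \<subseteq> ess_proj K f ` minv" "A0 \<subseteq> B0" "finite (B0 - A0)" "ce ` D = {A0..B0}"
    using D by (rule E.cubesE)
  let ?c = "\<lambda>m. \<Union>K - H m"
  have "{A0..B0} \<subseteq> ce ` ess_proj K f ` minv" unfolding AB(4)[symmetric] using AB(1) by (rule image_mono)
  then have sub: "S \<in> ring" if "A0 \<subseteq> S" "S \<subseteq> B0" for S
    using that ce_image[OF order_refl] ring_eq by auto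
  obtain v where v: "v \<in> minv" "c v = A0"
    using sub[OF order_refl AB(2)] ring_eq by (metis imageE)
  have V: "v \<in> \<Union>K" using minv_in[OF v(1)] .
  \<comment> \<open>As \<open>A0\<close> is the least set, \<open>v\<close> lies outside each
    \<open>H m\<close> with \<open>m\<close> in \<open>B0 - A0\<close>. The half-spaces to be
    flipped are the complements.\<close>
  define F where "F = ?c ` (B0 - A0)"
  have finF: "finite F" using AB(3) by (simp add: F_def)
  define S where "S Z = A0 \<union> {m \<in> B0 - A0. ?c m \<in> Z}" for Z
  have Sring: "S Z \<in> ring" for Z by (rule sub) (use AB(2) in \<open>auto simp: S_def\<close>)
  have "\<exists>u. u \<in> minv \<and> c u = S Z \<and> (\<forall>Y. Y \<in> vhalfs K \<longrightarrow> Y \<notin> A \<longrightarrow> (u \<in> Y \<longleftrightarrow> v \<in> Y))" for Z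
    using realize[OF v(1) Sring[of Z]] by blast
  then obtain u where u: "\<And>Z. u Z \<in> minv" "\<And>Z. c (u Z) = S Z"
    "\<And>Z Y. Y \<in> vhalfs K \<Longrightarrow> Y \<notin> A \<Longrightarrow> u Z \<in> Y \<longleftrightarrow> v \<in> Y" by metis
  have mem: "v \<in> H m \<longleftrightarrow> m \<in> A0" "u Z \<in> H m \<longleftrightarrow> m \<in> S Z" for m Z
    using v(2) u(2)[of Z] unfolding c_def by blast+
  have sepu: "sep K v (u Z) = Z" if Z: "Z \<subseteq> F" for Z
  proof (intro equalityI subsetI)
    fix Y assume "Y \<in> sep K v (u Z)"
    then have Y: "Y \<in> vhalfs K" "v \<in> Y" "u Z \<notin> Y" by (auto simp: sep_def)
    then have "Y \<in> A" using u(3)[of Y Z] by blast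
    then consider m where "Y = H m" | m where "Y = ?c m" by (auto simp: A_def)
    then show "Y \<in> Z"
    proof cases
      case (1 m)
      then show ?thesis using Y mem by (simp add: S_def)
    next
      case (2 m)
      then have "m \<notin> A0" "m \<in> S Z" using Y mem minv_in[OF u(1)[of Z]] by auto
      then show ?thesis using 2 by (simp add: S_def)
    qed
  next
    fix Y assume Y: "Y \<in> Z"
    then obtain m where m: "m \<in> B0 - A0" "Y = ?c m" using Z by (auto simp: F_def)
    then have "m \<in> S Z" using Y by (simp add: S_def)
    then have "v \<in> Y" "u Z \<notin> Y" using m mem V by auto
    then show "Y \<in> sep K v (u Z)" using m vhalfs_compl[OF H_vhalfs] by (simp add: sep_def)
  qed
  have "u ` Pow F \<in> K"
    by (rule cube_of_flips[OF V finF]) (use minv_in[OF u(1)] sepu in auto)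
  moreover have uM: "u ` Pow F \<subseteq> minv" using u(1) by blast
  ultimately have C: "u ` Pow F \<in> min_set K f" by (simp add: min_set_eq)
  have "c ` u ` Pow F = {A0..B0}"
  proof (intro equalityI subsetI)
    fix X assume "X \<in> c ` u ` Pow F"
    then obtain Z where "X = S Z" using u(2) by auto
    then show "X \<in> {A0..B0}" using AB(2) by (auto simp: S_def)
  next
    fix X assume "X \<in> {A0..B0}"
    then have X: "A0 \<subseteq> X" "X \<subseteq> B0" by auto
    let ?Z = "?c ` (X - A0)"
    have "?Z \<in> Pow F" using X unfolding F_def by blast
    have Zm: "?c m \<in> ?Z \<longleftrightarrow> m \<in> X - A0" for m
      by (rule inj_image_mem_iff) (rule inj_onI, rule iffD1[OF compl_H_inj])
    have "S ?Z = A0 \<union> {m \<in> B0 - A0. m \<in> X - A0}" unfolding S_def Zm ..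
    also have "\<dots> = X" using X by auto
    finally have "X = c (u ?Z)" unfolding u(2) by (rule sym)
    then show "X \<in> c ` u ` Pow F" unfolding image_image using \<open>?Z \<in> Pow F\<close> by (rule image_eqI)
  qed
  then have "ce ` ess_proj K f ` u ` Pow F = ce ` D" using ce_image[OF uM] AB(4) by simp
  then have "D = ess_proj K f ` u ` Pow F"
    using inj_on_image_eq_iff[OF E.inj image_mono[OF uM] AB(1)] by simp
  with C show ?thesis by (rule that)
qed

theorem ess_min_set_eq: "ess_min_set K f = E.cubes"
proof (intro equalityI subsetI)
  fix D assume "D \<in> ess_min_set K f"
  then show "D \<in> E.cubes" unfolding ess_min_set_def using proj_min_cube by blast
next
  fix D assume D: "D \<in> E.cubes"
  obtain C where "C \<in> min_set K f" "D = ess_proj K f ` C" by (rule cube_lift[OF D])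
  then show "D \<in> ess_min_set K f" unfolding ess_min_set_def using cubes_sageev[OF D] by blast
qed

end

context hyperbolic_automorphism
begin

theorem cat0_ess_min_set: "cat0_cube_complex (ess_min_set K f)"
proof (cases "\<exists>\<gamma>. combinatorial_axis K f \<gamma>")
  case True
  then obtain \<gamma> where "combinatorial_axis K f \<gamma>" by blast
  then interpret hyperbolic_axis K f f' \<gamma> by unfold_locales
  show ?thesis using ess_min_set_eq E.cat0_cubes by simp
next
  case False
  then show ?thesis using cat0_no_axis by blast
qed

end

theorem proposition3p20:
  fixes G :: "('g, 'm) monoid_scheme"
    and X :: "'v set set"
    and act :: "'g \<Rightarrow> 'v \<Rightarrow> 'v"
    and g :: 'g
  assumes "cat0_cube_complex X"
    and "cube_complex_action G X act"
    and "without_inversion G X act"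
    and "g \<in> carrier G"
    and "hyperbolic X (act g)"
  shows "cat0_cube_complex (ess_min_set X (act g))"
proof -
  interpret cat0_complex X by (rule cat0_complexI[OF assms(1)])
  interpret group_action G "\<Union>X" act using assms(2) by (simp add: cube_complex_action_def)
  let ?i = "inv\<^bsub>G\<^esub> g"
  have G: "group G" using group_hom unfolding group_hom_def by blast
  have i: "?i \<in> carrier G" using group.inv_closed[OF G assms(4)] .
  have ii: "inv\<^bsub>G\<^esub> ?i = g" using group.inv_inv[OF G assms(4)] .
  have "hyperbolic_automorphism X (act g) (act ?i)"
  proof unfold_locales
    show "act g v \<in> \<Union>X" if "v \<in> \<Union>X" for v using element_image[OF assms(4) that refl] .
    show "act ?i v \<in> \<Union>X" if "v \<in> \<Union>X" for v using element_image[OF i that refl] .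
    show "act ?i (act g v) = v" if "v \<in> \<Union>X" for v using orbit_sym_aux[OF assms(4) that refl] .
    show "act g (act ?i v) = v" if "v \<in> \<Union>X" for v using orbit_sym_aux[OF i that refl] ii by simp
    show "act g ` C \<in> X" "act ?i ` C \<in> X" if "C \<in> X" for C
      using assms(2,4) i that by (auto simp: cube_complex_action_def)
    show "X \<noteq> {}" using assms(1) by (simp add: cat0_cube_complex_def)
    show "hyperbolic X (act g)" by (rule assms(5))
  qed
  then show ?thesis by (rule hyperbolic_automorphism.cat0_ess_min_set)
qed

end
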